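(* Consider the Beta model with parameter $\nu>0$ or the spherical model (in which case put $\nu=0$) with $r=n$: let $X_1,\ldots,X_{n+1}$ be i.i.d. points in $\mathbb{R}^n$ from the model, let $\mathcal V_{n,n}$ be the $n$-dimensional volume of the simplex with these vertices, $\mathcal L_{n,n}=\log(n!\,\mathcal V_{n,n})$, and let $\widetilde m_n=\frac12\big(\frac12\log n-n+1-\nu+\log(2^{3/2}\pi)\big)$. Then, as $n\to\infty$, $\mathcal L_{n,n}-\widetilde m_n$ converges in the mod-Gaussian sense (meaning mod-$\phi$ convergence with $\eta(t)=\frac12t^2$) with parameters $w_n=\frac12\log\frac n2-\frac12$, namely $$\lim_{n\to\infty}\frac{\mathbb{E}e^{t(\mathcal L_{n,n}-\widetilde m_n)}}{e^{\frac14t^2(\log\frac n2-1)}}=\frac{G\left(\frac12\right)}{G\left(\frac12+\frac t2\right)G\left(1+\frac t2\right)}.$$ The convergence is uniform as long as $t$ stays in any compact subset of $\mathbb{C}\setminus\{-1,-2,\ldots\}$.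
   Context: Beta model with parameter $\nu>0$: density $\pi^{-n/2}\frac{\Gamma((n+\nu)/2)}{\Gamma(\nu/2)}(1-|x|^2)^{(\nu-2)/2}$ on $\{x\in\mathbb{R}^n:|x|<1\}$. Spherical model: uniform distribution on the unit sphere of $\mathbb{R}^n$ ($n\ge2$). $G$ is the Barnes $G$-function, the entire function $G(z+1)=(2\pi)^{z/2}e^{-\frac12(z+(1+\gamma)z^2)}\prod_{k=1}^\infty(1+\frac zk)^ke^{\frac{z^2}{2k}-z}$ ($\gamma$ the Euler constant), satisfying $G(z+1)=\Gamma(z)G(z)$ and $G(1)=1$. Mod-$\phi$ convergence: real random variables $Y_n$ converge in the mod-$\phi$ sense with $\eta$ and parameters $w_n\to+\infty$ if $\phi$ is an infinitely divisible distribution with $\int e^{tx}\phi(dx)=e^{\eta(t)}$ on an open strip $S=\{c_-<\operatorname{Re}t<c_+\}$ of the complex plane, and $\mathbb{E}e^{tY_n}/e^{w_n\eta(t)}$ converges, locally uniformly on $S$, to an analytic limit function. For complex $t$ at which the expectation does not converge absolutely, $\mathbb{E}e^{tY_n}$ is understood as the meromorphic continuation in $t$ of the moment generating function. *)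

theory Defs
  imports "HOL-Probability.Probability" "HOL-Complex_Analysis.Complex_Analysis"
begin

text \<open>
  The dimension \<open>n\<close> tends to infinity, so \<open>\<real>\<^sup>n\<close> is modelled by the extensional functions
  \<open>{..<n} \<rightarrow>\<^sub>E \<real>\<close>, the space of the product measure below. The Euclidean norm of \<open>x\<close> is
  \<open>L2_set x {..<n}\<close>.
\<close>

abbreviation lebesgue_n :: "nat \<Rightarrow> (nat \<Rightarrow> real) measure" where
  "lebesgue_n n \<equiv> PiM {..<n} (\<lambda>_. lborel)"

definition beta_distribution :: "nat \<Rightarrow> real \<Rightarrow> (nat \<Rightarrow> real) measure" where
  "beta_distribution n \<nu> =
     density (lebesgue_n n) (\<lambda>x. ennreal (
       if L2_set x {..<n} < 1
       then pi powr (- real n / 2) * Gamma ((real n + \<nu>) / 2) / Gamma (\<nu> / 2)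
            * (1 - (L2_set x {..<n})\<^sup>2) powr ((\<nu> - 2) / 2)
       else 0))"

text \<open>
  The uniform distribution on the unit sphere is the normalized cone (= surface) measure: the
  mass of \<open>A\<close> is the proportion of the unit ball covered by the segments from the origin to the
  points of \<open>A\<close>.
\<close>

definition sphere_distribution :: "nat \<Rightarrow> (nat \<Rightarrow> real) measure" where
  "sphere_distribution n =
     distr (uniform_measure (lebesgue_n n) {x \<in> space (lebesgue_n n). L2_set x {..<n} \<le> 1})
       (lebesgue_n n) (\<lambda>x. \<lambda>k\<in>{..<n}. x k / L2_set x {..<n})"

text \<open>The parameter value \<open>\<nu> = 0\<close> encodes the spherical model.\<close>

definition model_distribution :: "nat \<Rightarrow> real \<Rightarrow> (nat \<Rightarrow> real) measure" where
  "model_distribution n \<nu> = (if \<nu> = 0 then sphere_distribution n else beta_distribution n \<nu>)"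

definition simplex_of :: "nat \<Rightarrow> (nat \<Rightarrow> nat \<Rightarrow> real) \<Rightarrow> (nat \<Rightarrow> real) set" where
  "simplex_of n x =
     {(\<lambda>k\<in>{..<n}. \<Sum>i\<le>n. c i * x i k) | c. (\<forall>i\<le>n. 0 \<le> c i) \<and> (\<Sum>i\<le>n. c i) = (1 :: real)}"

definition simplex_volume :: "nat \<Rightarrow> (nat \<Rightarrow> nat \<Rightarrow> real) \<Rightarrow> real" where
  "simplex_volume n x = measure (lebesgue_n n) (simplex_of n x)"

definition log_volume :: "nat \<Rightarrow> (nat \<Rightarrow> 'a \<Rightarrow> nat \<Rightarrow> real) \<Rightarrow> 'a \<Rightarrow> real" where
  "log_volume n X \<omega> = ln (fact n * simplex_volume n (\<lambda>i. X i \<omega>))"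

definition centering :: "real \<Rightarrow> nat \<Rightarrow> real" where
  "centering \<nu> n = 1 / 2 * (1 / 2 * ln (real n) - real n + 1 - \<nu> + ln (2 powr (3 / 2) * pi))"

definition barnes_G :: "complex \<Rightarrow> complex" where
  "barnes_G u = (let z = u - 1 in
     of_real (2 * pi) powr (z / 2) * exp (- (z + (1 + euler_mascheroni) * z\<^sup>2) / 2)
     * (\<Prod>k. (1 + z / of_nat (Suc k)) ^ Suc k * exp (z\<^sup>2 / (2 * of_nat (Suc k)) - z)))"

definition mgf_domain :: "'a measure \<Rightarrow> ('a \<Rightarrow> real) \<Rightarrow> complex set" where
  "mgf_domain M Y = {t. integrable M (\<lambda>\<omega>. exp (t * of_real (Y \<omega>)))}"

text \<open>
  \<open>F\<close> is the meromorphic continuation to \<open>D\<close> of the moment generating function of \<open>Y\<close>.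
  The domain of absolute convergence is a vertical strip. Since \<open>D\<close> is convex and meets the
  interior of that strip, \<open>F\<close> is determined on \<open>D\<close>; being nicely meromorphic, it has no removable
  singularities and is \<open>0\<close> at its poles.
\<close>

definition mgf_continuation ::
    "'a measure \<Rightarrow> ('a \<Rightarrow> real) \<Rightarrow> complex set \<Rightarrow> (complex \<Rightarrow> complex) \<Rightarrow> bool" where
  "mgf_continuation M Y D F \<longleftrightarrow>
     open D \<and> convex D \<and> D \<inter> interior (mgf_domain M Y) \<noteq> {} \<and>
     F nicely_meromorphic_on D \<and>
     (\<forall>t \<in> D \<inter> mgf_domain M Y. F t = (\<integral>\<omega>. exp (t * of_real (Y \<omega>)) \<partial>M))"

definition infinitely_divisible :: "real measure \<Rightarrow> bool" where
  "infinitely_divisible \<phi> \<longleftrightarrow> real_distribution \<phi> \<and>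
     (\<forall>k::nat. k \<ge> 1 \<longrightarrow> (\<exists>\<mu>. real_distribution \<mu> \<and>
        distr (PiM {..<k} (\<lambda>_. \<mu>)) borel (\<lambda>x. \<Sum>i<k. x i) = \<phi>))"

definition vertical_strip :: "ereal \<Rightarrow> ereal \<Rightarrow> complex set" where
  "vertical_strip a b = {t. a < ereal (Re t) \<and> ereal (Re t) < b}"

text \<open>
  Mod-\<open>\<phi>\<close> convergence of \<open>Y\<^sub>n\<close> (defined on \<open>M\<^sub>n\<close>) with \<open>\<eta>\<close>, parameters \<open>w\<^sub>n\<close> and limit
  function \<open>\<Psi>\<close> on the strip \<open>a < Re t < b\<close>. Only large \<open>n\<close> matter.
\<close>

definition mod_phi_convergence ::
    "(nat \<Rightarrow> 'a measure) \<Rightarrow> (nat \<Rightarrow> 'a \<Rightarrow> real) \<Rightarrow> real measure \<Rightarrow> (complex \<Rightarrow> complex) \<Rightarrow>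
     (nat \<Rightarrow> real) \<Rightarrow> ereal \<Rightarrow> ereal \<Rightarrow> (complex \<Rightarrow> complex) \<Rightarrow> bool" where
  "mod_phi_convergence M Y \<phi> \<eta> w a b \<Psi> \<longleftrightarrow>
     filterlim w at_top sequentially \<and> infinitely_divisible \<phi> \<and> a < b \<and>
     (\<forall>t \<in> vertical_strip a b. t \<in> mgf_domain \<phi> (\<lambda>x. x) \<and>
        (\<integral>x. exp (t * of_real x) \<partial>\<phi>) = exp (\<eta> t)) \<and>
     \<Psi> analytic_on vertical_strip a b \<and>
     (\<exists>F. (\<forall>\<^sub>F n in sequentially. prob_space (M n) \<and> Y n \<in> borel_measurable (M n) \<and>
              (\<exists>D. vertical_strip a b \<subseteq> D \<and> mgf_continuation (M n) (Y n) D (F n))) \<and>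
          (\<forall>z \<in> vertical_strip a b. \<exists>r>0. cball z r \<subseteq> vertical_strip a b \<and>
              uniform_limit (cball z r) (\<lambda>n t. F n t / exp (of_real (w n) * \<eta> t)) \<Psi> sequentially))"

end

theory Submission
  imports Defs "Jordan_Normal_Form.Determinant" "HOL-Real_Asymp.Real_Asymp"
begin

text \<open>
  Up to sign, \<open>n!\<close> times the volume of the simplex is the determinant of the bordered matrix of its
  vertices. Its moments are explicit products of Gamma quotients: in polar coordinates the moments
  of a determinant with beta distributed rows follow from those of a Gaussian one, an affine
  Blaschke--Petkantschin argument passes from determinants to simplices, and the spherical model is
  the limit \<open>\<nu> \<rightarrow> 0\<close>. The meromorphic function extending these moments is the continuation of the
  moment generating function of the logarithm.

  Separating even from odd \<open>j\<close>, the product of the \<open>\<Gamma>((j + t)/2) / \<Gamma>(j/2)\<close> is expressed by products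
  \<open>\<Prod>i\<le>m. \<Gamma>(i + w) / \<Gamma>(i) = (\<Gamma>(m + w) / \<Gamma>(m))\<^sup>m / (\<Prod>k<m. (1 + w/k)\<^sup>k)\<close> with \<open>w = t/2\<close> and
  \<open>w = (t - 1)/2\<close>, whose denominators are, up to exponential factors, partial products of the
  Weierstrass product of \<open>G(1 + w)\<close>. The remaining Gamma quotients are expanded by Taylor's theorem
  for \<open>ln \<Gamma>\<close>, with an error that vanishes locally uniformly in \<open>t\<close>.
\<close>

subsection \<open>Determinants and linear substitution\<close>

text \<open>Determinants come first because, under Gaussian rows, they are rotation invariant and
  satisfy a recursion in the dimension; homogeneity in each row then trades Gaussian rows for beta
  rows at the price of a radial factor. Slicing by the hyperplane through \<open>n + 1\<close>
  points turns a determinant moment of order \<open>s - 1\<close> in dimension \<open>n + 1\<close>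
  into a simplex moment of order \<open>s\<close> in dimension \<open>n\<close>, and the integral
  over all hyperplanes factors completely. This shift, and the Lipschitz bound on
  \<open>x powr s\<close> behind the spherical limit, are why moments are computed for
  \<open>s \<ge> 1\<close> only; the identity theorem supplies the other exponents.

  Since \<open>ln 0 = 0\<close>, a degenerate simplex would contribute spuriously to the moment
  generating function. That it has probability zero is read off from the moments as the exponent
  tends to \<open>0\<close>.

  In the asymptotics, Gamma quotients occur to powers of order \<open>n\<close>, and one factor has
  a shift of order \<open>n\<close> at an argument of order \<open>n^2\<close>. The logarithms are
  therefore expanded up to an error cubic in the shift and of order \<open>x^(-2)\<close> in the
  argument.\<close>

no_notation Matrix.vec_index (infixl \<open>$\<close> 100)

text \<open>The entries are a function on all index pairs, so that a leading minor is the same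
  function with a smaller size and replacing a row is a function update.\<close>

definition mdet :: "nat \<Rightarrow> (nat \<Rightarrow> nat \<Rightarrow> real) \<Rightarrow> real" where
  "mdet n A = Determinant.det (Matrix.mat n n (\<lambda>(i, j). A i j))"

lemma mdet_cong: "(\<And>i j. i < n \<Longrightarrow> j < n \<Longrightarrow> A i j = B i j) \<Longrightarrow> mdet n A = mdet n B"
  unfolding mdet_def by (rule arg_cong[where f = Determinant.det]) (auto intro!: eq_matI)

lemma mdet_leibniz:
  "mdet n A = (\<Sum>p | p permutes {0..<n}. of_int (sign p) * (\<Prod>i = 0..<n. A i (p i)))"
  unfolding mdet_def Determinant.det_def
  by (auto intro!: sum.cong prod.cong simp: permutes_in_image)

lemma mdet_mult: "mdet n (\<lambda>i j. \<Sum>k<n. A i k * B k j) = mdet n A * mdet n B"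
proof -
  have "Matrix.mat n n (\<lambda>(i, j). \<Sum>k<n. A i k * B k j) =
      Matrix.mat n n (\<lambda>(i, j). A i j) * Matrix.mat n n (\<lambda>(i, j). B i j)"
    by (auto intro!: eq_matI sum.cong simp: scalar_prod_def atLeast0LessThan)
  then show ?thesis
    unfolding mdet_def by (simp add: Determinant.det_mult[of _ n])
qed

lemma mdet_transpose: "mdet n (\<lambda>i j. A j i) = mdet n A"
proof -
  have "Matrix.mat n n (\<lambda>(i, j). A j i) = transpose_mat (Matrix.mat n n (\<lambda>(i, j). A i j))"
    by (auto intro!: eq_matI)
  then show ?thesis
    unfolding mdet_def by (simp add: Determinant.det_transpose[of _ n])
qed

lemma mdet_last_row:
  assumes "\<And>j. j < n \<Longrightarrow> A n j = 0"
  shows "mdet (Suc n) A = A n n * mdet n A"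
proof -
  let ?M = "Matrix.mat (Suc n) (Suc n) (\<lambda>(i, j). A i j)"
  have "mat_delete ?M n n = Matrix.mat n n (\<lambda>(i, j). A i j)"
    by (auto intro!: eq_matI simp: mat_delete_def)
  then have "cofactor ?M n n = mdet n A"
    by (simp add: cofactor_def mdet_def power_add[symmetric] mult_2[symmetric])
  moreover have "mdet (Suc n) A = (\<Sum>j<Suc n. ?M $$ (n, j) * cofactor ?M n j)"
    unfolding mdet_def by (rule laplace_expansion_row) auto
  ultimately show ?thesis
    using assms by simp
qed

lemma mdet_last_col:
  assumes "\<And>i. i < n \<Longrightarrow> A i n = 0"
  shows "mdet (Suc n) A = A n n * mdet n A"
  using mdet_last_row[of n "\<lambda>i j. A j i"] assms mdet_transpose[of _ A] by simp

lemma mdet_one: "mdet n (\<lambda>i j. if i = j then 1 else 0) = 1"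
  by (induction n) (simp_all add: mdet_last_row, simp add: mdet_def)

text \<open>Column operations with pivot \<open>A n n\<close> clear the rest of the last row;
  expansion along that row leaves the Schur complement.\<close>

lemma mdet_schur:
  assumes "A n n \<noteq> 0"
  shows "mdet (Suc n) A = A n n * mdet n (\<lambda>i j. A i j - A i n * A n j / A n n)"
proof -
  \<comment> \<open>Right multiplication by the unipotent matrix \<open>E\<close> subtracts
    \<open>A n j / A n n\<close> times column \<open>n\<close> from each column
    \<open>j < n\<close>.\<close>
  define E where "E = (\<lambda>k j. if k = n \<and> j < n then - A n j / A n n else if k = j then 1 else (0::real))"
  have "mdet (Suc n) E = 1"
    using mdet_cong[of n E "\<lambda>i j. if i = j then 1 else 0"]
    by (subst mdet_last_col) (auto simp: E_def mdet_one)
  then have "mdet (Suc n) A = mdet (Suc n) (\<lambda>i j. \<Sum>k<Suc n. A i k * E k j)"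
    by (simp only: mdet_mult)
  also have "\<dots> = A n n * mdet n (\<lambda>i j. \<Sum>k<Suc n. A i k * E k j)"
  proof (subst mdet_last_row)
    show "(\<Sum>k<Suc n. A n k * E k j) = 0" if "j < n" for j
    proof -
      have "(\<Sum>k<n. A n k * E k j) = (\<Sum>k<n. if k = j then A n k else 0)"
        by (rule sum.cong) (auto simp: E_def)
      then show ?thesis
        using that assms by (simp add: E_def)
    qed
    have "(\<Sum>k<n. A n k * E k n) = 0"
      by (rule sum.neutral) (auto simp: E_def)
    then show "(\<Sum>k<Suc n. A n k * E k n) * mdet n (\<lambda>i j. \<Sum>k<Suc n. A i k * E k j) =
       A n n * mdet n (\<lambda>i j. \<Sum>k<Suc n. A i k * E k j)"
      by (simp add: E_def)
  qed
  also have "mdet n (\<lambda>i j. \<Sum>k<Suc n. A i k * E k j) = mdet n (\<lambda>i j. A i j - A i n * A n j / A n n)"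
  proof (rule mdet_cong)
    fix i j assume "i < n" "j < n"
    then have "(\<Sum>k<n. A i k * E k j) = (\<Sum>k<n. if k = j then A i k else 0)"
      by (intro sum.cong) (auto simp: E_def)
    then show "(\<Sum>k<Suc n. A i k * E k j) = A i j - A i n * A n j / A n n"
      using \<open>j < n\<close> by (simp add: E_def)
  qed
  finally show ?thesis .
qed

text \<open>The Schur complement of \<open>I - \<theta> a a^T\<close> has the same shape with
  \<open>\<theta> / p\<close>, hence the induction over arbitrary \<open>\<theta>\<close>. The bound
  on \<open>\<theta>\<close> keeps every pivot \<open>p\<close> positive.\<close>

lemma mdet_rank_one:
  assumes "0 \<le> \<theta>" "\<theta> * (\<Sum>k<n. (a k)\<^sup>2) < 1"
  shows "mdet n (\<lambda>i j. (if i = j then 1 else 0) - \<theta> * a i * a j) = 1 - \<theta> * (\<Sum>k<n. (a k)\<^sup>2)"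
  using assms
proof (induction n arbitrary: \<theta>)
  case 0
  then show ?case by (simp add: mdet_def)
next
  case (Suc n)
  define p where "p = 1 - \<theta> * (a n)\<^sup>2"
  have le: "\<theta> * (\<Sum>k<n. (a k)\<^sup>2) \<ge> 0"
    using Suc.prems by (simp add: sum_nonneg)
  have lt: "\<theta> * (\<Sum>k<n. (a k)\<^sup>2) < p"
    using Suc.prems by (simp add: p_def algebra_simps)
  have p: "p > 0"
    using le lt by linarith
  have "mdet (Suc n) (\<lambda>i j. (if i = j then 1 else 0) - \<theta> * a i * a j) =
      p * mdet n (\<lambda>i j. (if i = j then 1 else 0) - \<theta> / p * a i * a j)"
    (is "mdet _ ?A = _")
  proof -
    have An: "?A n n = p"
      by (simp add: p_def power2_eq_square)
    have "mdet (Suc n) ?A = ?A n n * mdet n (\<lambda>i j. ?A i j - ?A i n * ?A n j / ?A n n)"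
      by (rule mdet_schur) (use An p in simp)
    also have "mdet n (\<lambda>i j. ?A i j - ?A i n * ?A n j / ?A n n) =
        mdet n (\<lambda>i j. (if i = j then 1 else 0) - \<theta> / p * a i * a j)"
    proof (rule mdet_cong)
      fix i j assume "i < n" "j < n"
      then have "?A i j - ?A i n * ?A n j / ?A n n =
          (if i = j then 1 else 0) - (\<theta> * a i * a j + \<theta> * a i * a n * (\<theta> * a n * a j) / p)"
        unfolding An by simp
      also have "\<theta> * a i * a j + \<theta> * a i * a n * (\<theta> * a n * a j) / p = \<theta> / p * a i * a j"
        using p unfolding p_def by (simp add: field_simps power2_eq_square)
      finally show "?A i j - ?A i n * ?A n j / ?A n n = (if i = j then 1 else 0) - \<theta> / p * a i * a j" .
    qed
    finally show ?thesis
      unfolding An .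
  qed
  also have "\<dots> = p * (1 - \<theta> / p * (\<Sum>k<n. (a k)\<^sup>2))"
    using Suc.prems p lt by (subst Suc.IH) (auto simp: field_simps)
  also have "\<dots> = 1 - \<theta> * (\<Sum>k<Suc n. (a k)\<^sup>2)"
    using p by (simp add: field_simps p_def)
  finally show ?case .
qed

lemma borel_measurable_mdet [measurable]:
  assumes "\<And>i j. i < n \<Longrightarrow> j < n \<Longrightarrow> (\<lambda>x. A x i j) \<in> borel_measurable M"
  shows "(\<lambda>x. mdet n (A x)) \<in> borel_measurable M"
  unfolding mdet_leibniz
  by (intro borel_measurable_sum borel_measurable_times borel_measurable_const borel_measurable_prod)
     (auto intro!: assms simp: permutes_in_image)

text \<open>The left kernel is the useful one: \<open>w\<close> becomes the normal vector of a
  hyperplane that contains all columns of \<open>A\<close>.\<close>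

lemma mdet_eq_0_imp_kernel:
  assumes "mdet n A = 0"
  obtains w where "\<exists>k<n. w k \<noteq> 0" "\<And>j. j < n \<Longrightarrow> (\<Sum>i<n. w i * A i j) = 0"
proof -
  let ?M = "Matrix.mat n n (\<lambda>(i, j). A j i)"
  have "Determinant.det ?M = 0"
    using assms mdet_transpose[of n A] by (simp add: mdet_def)
  then obtain v where v: "v \<in> carrier_vec n" "v \<noteq> 0\<^sub>v n" "?M *\<^sub>v v = 0\<^sub>v n"
    using det_0_iff_vec_prod_zero[of ?M n] by auto
  show ?thesis
  proof
    show "\<exists>k<n. vec_index v k \<noteq> 0"
      using v(1,2) by (metis carrier_vecD eq_vecI index_zero_vec(1) index_zero_vec(2))
    show "(\<Sum>i<n. vec_index v i * A i j) = 0" if "j < n" for j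
    proof -
      have "vec_index (?M *\<^sub>v v) j = 0"
        using v(3) that by simp
      then show ?thesis
        using that v(1) by (simp add: scalar_prod_def atLeast0LessThan mult.commute)
    qed
  qed
qed

text \<open>Any bound depending on \<open>n\<close> alone would serve: it makes the log volume
  bounded above and keeps the powers of the determinant in a range where they are Lipschitz.\<close>

lemma abs_mdet_le:
  assumes "\<And>i j. i < n \<Longrightarrow> j < n \<Longrightarrow> \<bar>A i j\<bar> \<le> 1"
  shows "\<bar>mdet n A\<bar> \<le> fact n"
proof -
  have "\<bar>mdet n A\<bar> \<le> (\<Sum>p | p permutes {0..<n}. \<bar>of_int (sign p) * (\<Prod>i = 0..<n. A i (p i))\<bar>)"
    unfolding mdet_leibniz by (rule sum_abs)
  also have "\<dots> \<le> (\<Sum>p | p permutes {0..<n}. 1)"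
  proof (rule sum_mono)
    fix p assume "p \<in> {p. p permutes {0..<n}}"
    then have "(\<Prod>i = 0..<n. \<bar>A i (p i)\<bar>) \<le> 1"
      by (intro prod_le_1) (auto intro!: assms simp: permutes_in_image)
    then show "\<bar>of_int (sign p) * (\<Prod>i = 0..<n. A i (p i))\<bar> \<le> 1"
      by (simp add: abs_mult abs_prod sign_def)
  qed
  also have "\<dots> = fact n"
    by (simp add: card_permutations[of _ n])
  finally show ?thesis .
qed

lemma mdet_row_affine:
  assumes "k < n"
  shows "mdet n (A(k := \<lambda>j. (1 - r) * u j + r * v j)) =
    (1 - r) * mdet n (A(k := u)) + r * mdet n (A(k := v))"
proof -
  have k: "(\<Prod>i = 0..<n. (A(k := w)) i (p i)) = w (p k) * (\<Prod>i\<in>{0..<n} - {k}. A i (p i))" for w p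
    using assms by (subst prod.remove[of _ k]) auto
  show ?thesis
    unfolding mdet_leibniz k sum_distrib_left sum.distrib[symmetric]
    by (rule sum.cong) (auto simp: algebra_simps)
qed

section \<open>Affine substitution in product Lebesgue measure\<close>

lemma sets_lebesgue_n [measurable_cong]: "sets (PiM I (\<lambda>_. lborel :: real measure)) = sets (PiM I (\<lambda>_. borel))"
  by (rule sets_PiM_cong) auto

interpretation lborel_product: product_sigma_finite "\<lambda>_. lborel :: real measure" ..

lemma nn_integral_lebesgue_n_Suc:
  assumes "f \<in> borel_measurable (lebesgue_n (Suc n))"
  shows "(\<integral>\<^sup>+x. f x \<partial>lebesgue_n (Suc n)) = (\<integral>\<^sup>+x. \<integral>\<^sup>+t. f (x(n := t)) \<partial>lborel \<partial>lebesgue_n n)"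
  using assms unfolding lessThan_Suc
  by (intro lborel_product.product_nn_integral_insert) auto

lemma nn_integral_lebesgue_n_Suc_rev:
  assumes "f \<in> borel_measurable (lebesgue_n (Suc n))"
  shows "(\<integral>\<^sup>+x. f x \<partial>lebesgue_n (Suc n)) = (\<integral>\<^sup>+t. \<integral>\<^sup>+x. f (x(n := t)) \<partial>lebesgue_n n \<partial>lborel)"
  using assms unfolding lessThan_Suc
  by (intro lborel_product.product_nn_integral_insert_rev) auto

text \<open>The restriction keeps images inside the extensional functions, the carrier of
  \<open>lebesgue_n n\<close>.\<close>

definition affine_n :: "nat \<Rightarrow> (nat \<Rightarrow> nat \<Rightarrow> real) \<Rightarrow> (nat \<Rightarrow> real) \<Rightarrow> (nat \<Rightarrow> real) \<Rightarrow> nat \<Rightarrow> real" where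
  "affine_n n A b x = (\<lambda>i\<in>{..<n}. b i + (\<Sum>j<n. A i j * x j))"

lemma measurable_affine_n [measurable]: "affine_n n A b \<in> lebesgue_n n \<rightarrow>\<^sub>M lebesgue_n n"
  unfolding affine_n_def by (intro measurable_restrict) measurable

lemma upd_lebesgue_n [measurable]: 
  "(\<lambda>p. (fst p)(n := snd p)) \<in> lebesgue_n n \<Otimes>\<^sub>M lborel \<rightarrow>\<^sub>M lebesgue_n (Suc n)"
  using measurable_add_dim[of n "{..<n}" "\<lambda>_. lborel :: real measure"] 
  by (simp add: lessThan_Suc split_def)

lemma affine_n_Suc_upd:
  "affine_n (Suc n) A b (x(n := t)) =
    (\<lambda>i\<in>{..<n}. b i + A i n * t + (\<Sum>j<n. A i j * x j))(n := b n + A n n * t + (\<Sum>j<n. A n j * x j))"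
  by (rule ext) (simp add: affine_n_def restrict_def less_Suc_eq ac_simps)

text \<open>
  The linear change of variables formula, by induction on the dimension: after the last
  coordinate has been substituted, the remaining ones are transformed by the Schur complement.
\<close>

lemma nn_integral_affine_n_pivot:
  assumes IH: "\<And>A b f. mdet n A \<noteq> 0 \<Longrightarrow> f \<in> borel_measurable (lebesgue_n n) \<Longrightarrow>
      (\<integral>\<^sup>+x. f x \<partial>lebesgue_n n) = ennreal \<bar>mdet n A\<bar> * (\<integral>\<^sup>+x. f (affine_n n A b x) \<partial>lebesgue_n n)"
    and pivot: "A n n \<noteq> 0" and det: "mdet (Suc n) A \<noteq> 0"
    and f [measurable]: "f \<in> borel_measurable (lebesgue_n (Suc n))"
  shows "(\<integral>\<^sup>+x. f x \<partial>lebesgue_n (Suc n)) =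
    ennreal \<bar>mdet (Suc n) A\<bar> * (\<integral>\<^sup>+x. f (affine_n (Suc n) A b x) \<partial>lebesgue_n (Suc n))"
proof -
  define S where "S = (\<lambda>i j. A i j - A i n * A n j / A n n)"
  have det_eq: "mdet (Suc n) A = A n n * mdet n S"
    unfolding S_def by (rule mdet_schur) (rule pivot)
  then have S: "mdet n S \<noteq> 0"
    using det by auto
  \<comment> \<open>\<open>b' u\<close> is the offset seen by the first \<open>n\<close> image
    coordinates when the last one equals \<open>u\<close>: the last input coordinate has been solved
    for and eliminated, which is also what turns \<open>A\<close> into its Schur complement
    \<open>S\<close>.\<close>
  define b' where "b' = (\<lambda>u i. b i + A i n * (u - b n) / A n n)"
  have b'_meas [measurable]: "(\<lambda>p. affine_n n S (b' (snd p)) (fst p)) \<in> lebesgue_n n \<Otimes>\<^sub>M lborel \<rightarrow>\<^sub>M lebesgue_n n"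
    unfolding affine_n_def b'_def by (intro measurable_restrict) measurable
  have upd': "(\<lambda>p. (affine_n n S (b' (snd p)) (fst p))(n := snd p)) \<in> lebesgue_n n \<Otimes>\<^sub>M lborel \<rightarrow>\<^sub>M lebesgue_n (Suc n)"
    using measurable_compose[OF measurable_Pair[OF b'_meas measurable_snd] upd_lebesgue_n] by simp
  have upd_split: "(\<lambda>(x, u). f ((affine_n n S (b' u) x)(n := u))) \<in> borel_measurable (lebesgue_n n \<Otimes>\<^sub>M lborel)"
    unfolding split_def by (rule measurable_compose[OF upd' f])
  have [measurable]: "(\<lambda>x. f (affine_n (Suc n) A b x)) \<in> borel_measurable (lebesgue_n (Suc n))"
    by (rule measurable_compose[OF measurable_affine_n f])
  have fsec: "(\<lambda>u. f (x(n := u))) \<in> borel_measurable lborel" if "x \<in> space (lebesgue_n n)" for x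
    using measurable_compose[OF measurable_Pair1'[OF that] measurable_compose[OF upd_lebesgue_n f]] by simp
  have inner: "ennreal \<bar>A n n\<bar> * (\<integral>\<^sup>+t. f (affine_n (Suc n) A b (x(n := t))) \<partial>lborel) =
      (\<integral>\<^sup>+u. f ((affine_n n S (b' u) x)(n := u)) \<partial>lborel)" if x: "x \<in> space (lebesgue_n n)" for x
  proof -
    define c where "c = b n + (\<Sum>j<n. A n j * x j)"
    have [measurable]: "(\<lambda>u. f ((affine_n n S (b' u) x)(n := u))) \<in> borel_measurable lborel"
      using measurable_compose[OF measurable_Pair1'[OF x] measurable_compose[OF upd' f]] by simp
    have eq: "affine_n (Suc n) A b (x(n := t)) = (affine_n n S (b' (c + A n n * t)) x)(n := c + A n n * t)" for t
    proof -
      have "b i + A i n * t + (\<Sum>j<n. A i j * x j) = b' (c + A n n * t) i + (\<Sum>j<n. S i j * x j)" for i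
      proof -
        have "(\<Sum>j<n. S i j * x j) = (\<Sum>j<n. A i j * x j) - A i n / A n n * (\<Sum>j<n. A n j * x j)"
          by (simp add: S_def left_diff_distrib sum_subtractf sum_distrib_left mult.assoc)
        then show ?thesis
          using pivot by (simp add: b'_def c_def field_simps)
      qed
      then have "(\<lambda>i\<in>{..<n}. b i + A i n * t + (\<Sum>j<n. A i j * x j)) = affine_n n S (b' (c + A n n * t)) x"
        unfolding affine_n_def by (intro restrict_ext)
      moreover have "b n + A n n * t + (\<Sum>j<n. A n j * x j) = c + A n n * t"
        by (simp add: c_def)
      ultimately show ?thesis
        unfolding affine_n_Suc_upd by (rule arg_cong2)
    qed
    have "(\<integral>\<^sup>+u. f ((affine_n n S (b' u) x)(n := u)) \<partial>lborel) =
        ennreal \<bar>A n n\<bar> * (\<integral>\<^sup>+t. f ((affine_n n S (b' (c + A n n * t)) x)(n := c + A n n * t)) \<partial>lborel)"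
      by (rule nn_integral_real_affine) (use pivot in auto)
    then show ?thesis
      unfolding eq by simp
  qed
  have "(\<integral>\<^sup>+x. f x \<partial>lebesgue_n (Suc n)) = (\<integral>\<^sup>+u. \<integral>\<^sup>+x. f (x(n := u)) \<partial>lebesgue_n n \<partial>lborel)"
    by (rule nn_integral_lebesgue_n_Suc_rev) fact
  also have "\<dots> = (\<integral>\<^sup>+u. ennreal \<bar>mdet n S\<bar> * (\<integral>\<^sup>+x. f ((affine_n n S (b' u) x)(n := u)) \<partial>lebesgue_n n) \<partial>lborel)"
  proof (rule nn_integral_cong)
    fix u :: real
    have "(\<lambda>x. f (x(n := u))) \<in> borel_measurable (lebesgue_n n)"
      using measurable_compose[OF measurable_Pair2'[of u] measurable_compose[OF upd_lebesgue_n f]] by simp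
    from IH[OF S this, of "b' u"]
    show "(\<integral>\<^sup>+x. f (x(n := u)) \<partial>lebesgue_n n) =
      ennreal \<bar>mdet n S\<bar> * (\<integral>\<^sup>+x. f ((affine_n n S (b' u) x)(n := u)) \<partial>lebesgue_n n)" .
  qed
  also have "\<dots> = ennreal \<bar>mdet n S\<bar> * (\<integral>\<^sup>+u. \<integral>\<^sup>+x. f ((affine_n n S (b' u) x)(n := u)) \<partial>lebesgue_n n \<partial>lborel)"
  proof (rule nn_integral_cmult)
    interpret sigma_finite_measure "lebesgue_n n" by (rule lborel_product.sigma_finite) auto
    show "(\<lambda>u. \<integral>\<^sup>+x. f ((affine_n n S (b' u) x)(n := u)) \<partial>lebesgue_n n) \<in> borel_measurable lborel"
      using measurable_pair_swap[OF upd_split] by (intro borel_measurable_nn_integral) (simp only: split_conv)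
  qed
  also have "(\<integral>\<^sup>+u. \<integral>\<^sup>+x. f ((affine_n n S (b' u) x)(n := u)) \<partial>lebesgue_n n \<partial>lborel) =
      (\<integral>\<^sup>+x. \<integral>\<^sup>+u. f ((affine_n n S (b' u) x)(n := u)) \<partial>lborel \<partial>lebesgue_n n)"
  proof -
    interpret sigma_finite_measure "lebesgue_n n" by (rule lborel_product.sigma_finite) auto
    interpret pair_sigma_finite "lebesgue_n n" lborel ..
    show ?thesis
      using upd_split by (rule Fubini')
  qed
  also have "\<dots> = (\<integral>\<^sup>+x. ennreal \<bar>A n n\<bar> * (\<integral>\<^sup>+t. f (affine_n (Suc n) A b (x(n := t))) \<partial>lborel) \<partial>lebesgue_n n)"
    by (rule nn_integral_cong) (simp add: inner)
  also have "\<dots> = ennreal \<bar>A n n\<bar> * (\<integral>\<^sup>+x. f (affine_n (Suc n) A b x) \<partial>lebesgue_n (Suc n))"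
  proof (subst nn_integral_cmult)
    have "(\<lambda>p. f (affine_n (Suc n) A b ((fst p)(n := snd p)))) \<in> borel_measurable (lebesgue_n n \<Otimes>\<^sub>M lborel)"
      by measurable
    then show "(\<lambda>x. \<integral>\<^sup>+t. f (affine_n (Suc n) A b (x(n := t))) \<partial>lborel) \<in> borel_measurable (lebesgue_n n)"
      by (intro lborel.borel_measurable_nn_integral) (simp add: split_def)
  qed (simp add: nn_integral_lebesgue_n_Suc)
  finally show ?thesis
    by (simp add: det_eq abs_mult ennreal_mult mult_ac)
qed

lemma nn_integral_affine_n:
  assumes "mdet n A \<noteq> 0" "f \<in> borel_measurable (lebesgue_n n)"
  shows "(\<integral>\<^sup>+x. f x \<partial>lebesgue_n n) = ennreal \<bar>mdet n A\<bar> * (\<integral>\<^sup>+x. f (affine_n n A b x) \<partial>lebesgue_n n)"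
  using assms
proof (induction n arbitrary: A b f)
  case 0
  have "affine_n 0 A b x = x" if "x \<in> space (lebesgue_n 0)" for x
    using that by (auto simp: affine_n_def space_PiM)
  then show ?case
    by (simp add: mdet_def cong: nn_integral_cong_simp)
next
  case (Suc n)
  show ?case
  proof (cases "A n n = 0")
    case False
    then show ?thesis
      by (intro nn_integral_affine_n_pivot Suc.IH Suc.prems)
  next
    case True
    \<comment> \<open>If the whole last column above the zero pivot vanished as well, the
      determinant would be zero.\<close>
    obtain k where k: "k < n" "A k n \<noteq> 0"
      using mdet_last_col[of n A] True Suc.prems(1) by fastforce
    \<comment> \<open>Adding row \<open>k\<close> to the last row creates a nonzero pivot and leaves
      the determinant unchanged.\<close>
    define A' where "A' = A(n := \<lambda>j. A n j + A k j)"
    define b' where "b' = b(n := b n + b k)"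
    have det: "mdet (Suc n) A' = mdet (Suc n) A"
    proof -
      define L where "L = (\<lambda>i j. if i = n \<and> j = k then 1 else if i = j then 1 else (0::real))"
      have "mdet (Suc n) (\<lambda>i j. \<Sum>l<Suc n. L i l * A l j) = mdet (Suc n) A'"
      proof (rule mdet_cong)
        fix i j assume "i < Suc n" "j < Suc n"
        have "(\<Sum>l<Suc n. L i l * A l j) =
            (\<Sum>l<Suc n. (if l = i then A l j else 0) + (if l = k then (if i = n then A l j else 0) else 0))"
          using k by (intro sum.cong) (auto simp: L_def)
        also have "\<dots> = A' i j"
          using k \<open>i < Suc n\<close> unfolding sum.distrib by (auto simp: A'_def)
        finally show "(\<Sum>l<Suc n. L i l * A l j) = A' i j" .
      qed
      moreover have "mdet (Suc n) L = 1"
        using k mdet_cong[of n L "\<lambda>i j. if i = j then 1 else 0"]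
        by (subst mdet_last_col) (auto simp: L_def mdet_one)
      ultimately show ?thesis
        using mdet_mult[of "Suc n" L A] by simp
    qed
    \<comment> \<open>This shear undoes the row addition on the image side. It translates the last
      coordinate by an amount depending on the others only, so it preserves the measure.\<close>
    define g where "g = (\<lambda>y :: nat \<Rightarrow> real. y(n := y n - y k))"
    have g_meas [measurable]: "g \<in> lebesgue_n (Suc n) \<rightarrow>\<^sub>M lebesgue_n (Suc n)"
    proof -
      have "(\<lambda>y. \<lambda>i\<in>{..<Suc n}. if i = n then y n - y k else y i) \<in> lebesgue_n (Suc n) \<rightarrow>\<^sub>M lebesgue_n (Suc n)"
        using k by (intro measurable_restrict) auto
      then show ?thesis
        by (rule measurable_cong[THEN iffD1, rotated])
           (auto simp: g_def space_PiM PiE_def extensional_def fun_eq_iff restrict_def)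
    qed
    have g_affine: "g (affine_n (Suc n) A' b' x) = affine_n (Suc n) A b x" for x
      using k by (auto simp: g_def affine_n_def A'_def b'_def fun_eq_iff restrict_def sum.distrib algebra_simps)
    have f [measurable]: "f \<in> borel_measurable (lebesgue_n (Suc n))" by fact
    have "(\<integral>\<^sup>+x. f x \<partial>lebesgue_n (Suc n)) = (\<integral>\<^sup>+x. f (g x) \<partial>lebesgue_n (Suc n))"
    proof -
      have "(\<integral>\<^sup>+x. f (g x) \<partial>lebesgue_n (Suc n)) = (\<integral>\<^sup>+x. \<integral>\<^sup>+t. f (g (x(n := t))) \<partial>lborel \<partial>lebesgue_n n)"
        by (rule nn_integral_lebesgue_n_Suc) measurable
      also have "\<dots> = (\<integral>\<^sup>+x. \<integral>\<^sup>+t. f (x(n := t)) \<partial>lborel \<partial>lebesgue_n n)"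
      proof (rule nn_integral_cong)
        fix x assume x: "x \<in> space (lebesgue_n n)"
        have fsec: "(\<lambda>u. f (x(n := u))) \<in> borel_measurable borel"
          using measurable_compose[OF measurable_Pair1'[OF x] measurable_compose[OF upd_lebesgue_n f]] by simp
        have "g (x(n := t)) = x(n := - x k + 1 * t)" for t
          using k by (auto simp: g_def)
        then show "(\<integral>\<^sup>+t. f (g (x(n := t))) \<partial>lborel) = (\<integral>\<^sup>+t. f (x(n := t)) \<partial>lborel)"
          using nn_integral_real_affine[OF fsec, of 1 "- x k"] by simp
      qed
      finally show ?thesis
        by (simp add: nn_integral_lebesgue_n_Suc)
    qed
    also have "\<dots> = ennreal \<bar>mdet (Suc n) A'\<bar> * (\<integral>\<^sup>+x. f (g (affine_n (Suc n) A' b' x)) \<partial>lebesgue_n (Suc n))"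
    proof (rule nn_integral_affine_n_pivot)
      show "A' n n \<noteq> 0" using k True by (simp add: A'_def)
      show "mdet (Suc n) A' \<noteq> 0" using det Suc.prems by simp
    qed (use Suc.IH in auto)
    finally show ?thesis
      unfolding det g_affine .
  qed
qed

lemma sets_hyperplane:
  "{x \<in> space (lebesgue_n n). (\<Sum>i<n. w i * x i) = d} \<in> sets (lebesgue_n n)"
  by measurable

text \<open>Every line parallel to an axis \<open>k\<close> with \<open>w k \<noteq> 0\<close> meets
  the hyperplane in a single point, so Fubini gives measure zero.\<close>

lemma emeasure_hyperplane:
  assumes "\<exists>k<n. w k \<noteq> 0"
  shows "emeasure (lebesgue_n n) {x \<in> space (lebesgue_n n). (\<Sum>i<n. w i * x i) = d} = 0"
proof -
  obtain k where k: "k < n" "w k \<noteq> 0" using assms by auto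
  let ?H = "{x \<in> space (lebesgue_n n). (\<Sum>i<n. w i * x i) = d}"
  have H: "?H \<in> sets (lebesgue_n n)" by measurable
  have ins: "{..<n} = insert k ({..<n} - {k})" using k by auto
  have "emeasure (lebesgue_n n) ?H = (\<integral>\<^sup>+x. indicator ?H x \<partial>PiM (insert k ({..<n} - {k})) (\<lambda>_. lborel))"
    using H ins by simp
  also have "\<dots> = (\<integral>\<^sup>+x. \<integral>\<^sup>+t. indicator ?H (x(k := t)) \<partial>lborel \<partial>PiM ({..<n} - {k}) (\<lambda>_. lborel))"
    using H ins by (intro lborel_product.product_nn_integral_insert) auto
  also have "\<dots> = (\<integral>\<^sup>+x. 0 \<partial>PiM ({..<n} - {k}) (\<lambda>_. lborel :: real measure))"
  proof (rule nn_integral_cong)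
    fix x :: "nat \<Rightarrow> real"
    define c where "c = (d - (\<Sum>i\<in>{..<n} - {k}. w i * x i)) / w k"
    have "(\<Sum>i<n. w i * (x(k := t)) i) = w k * t + (\<Sum>i\<in>{..<n} - {k}. w i * x i)" for t
      using k by (subst sum.remove[of _ k]) auto
    then have "indicator ?H (x(k := t)) \<le> (indicator {c} t :: ennreal)" for t
      using k by (auto simp: c_def field_simps split: split_indicator)
    then have "(\<integral>\<^sup>+t. indicator ?H (x(k := t)) \<partial>lborel) \<le> (\<integral>\<^sup>+t. indicator {c} t \<partial>lborel)"
      by (intro nn_integral_mono) auto
    then show "(\<integral>\<^sup>+t. indicator ?H (x(k := t)) \<partial>lborel) = 0"
      by simp
  qed
  finally show ?thesis by simp
qed

lemma mdet_inverse:
  assumes "mdet n A \<noteq> 0"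
  shows "\<exists>B. \<forall>i<n. \<forall>j<n. (\<Sum>k<n. B i k * A k j) = (if i = j then 1 else 0) \<and>
    (\<Sum>k<n. A i k * B k j) = (if i = j then 1 else 0)"
proof -
  let ?A = "Matrix.mat n n (\<lambda>(i, j). A i j)"
  have "?A \<in> carrier_mat n n" by simp
  note adj = adj_mat[OF this]
  define B where "B = (\<lambda>i j. adj_mat ?A $$ (i, j) / mdet n A)"
  show ?thesis
  proof (intro exI[of _ B] allI impI conjI)
    fix i j assume ij: "i < n" "j < n"
    have "(adj_mat ?A * ?A) $$ (i, j) = (\<Sum>k<n. adj_mat ?A $$ (i, k) * A k j)"
      using ij adj(1) by (simp add: scalar_prod_def atLeast0LessThan)
    moreover have "(adj_mat ?A * ?A) $$ (i, j) = mdet n A * (if i = j then 1 else 0)"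
      using ij unfolding adj(3) by (simp add: mdet_def)
    ultimately show "(\<Sum>k<n. B i k * A k j) = (if i = j then 1 else 0)"
      using assms by (auto simp: B_def sum_divide_distrib[symmetric] split: if_splits)
    have "(?A * adj_mat ?A) $$ (i, j) = (\<Sum>k<n. A i k * adj_mat ?A $$ (k, j))"
      using ij adj(1) by (simp add: scalar_prod_def atLeast0LessThan)
    moreover have "(?A * adj_mat ?A) $$ (i, j) = mdet n A * (if i = j then 1 else 0)"
      using ij unfolding adj(2) by (simp add: mdet_def)
    ultimately show "(\<Sum>k<n. A i k * B k j) = (if i = j then 1 else 0)"
      using assms by (auto simp: B_def sum_divide_distrib[symmetric] split: if_splits)
  qed
qed

lemma sum_inverse_matrix:
  fixes A B :: "nat \<Rightarrow> nat \<Rightarrow> real"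
  assumes "\<And>i j. i < n \<Longrightarrow> j < n \<Longrightarrow> (\<Sum>k<n. B i k * A k j) = (if i = j then 1 else 0)" "i < n"
  shows "(\<Sum>k<n. B i k * (\<Sum>j<n. A k j * c j)) = c i"
proof -
  have "(\<Sum>k<n. B i k * (\<Sum>j<n. A k j * c j)) = (\<Sum>k<n. \<Sum>j<n. B i k * A k j * c j)"
    by (simp add: sum_distrib_left mult.assoc)
  also have "\<dots> = (\<Sum>j<n. (\<Sum>k<n. B i k * A k j) * c j)"
    by (subst sum.swap) (simp add: sum_distrib_right)
  also have "\<dots> = (\<Sum>j<n. if i = j then c j else 0)"
    by (rule sum.cong) (use assms in auto)
  finally show ?thesis
    using assms(2) by simp
qed

subsection \<open>The volume of a simplex\<close>

text \<open>Bordering by a column of ones treats the \<open>n + 1\<close> vertices alike and makes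
  the determinant affine in each of them, as the row-by-row arguments require. The edge form below
  serves for volume and measurability.\<close>

definition simplex_det :: "nat \<Rightarrow> (nat \<Rightarrow> nat \<Rightarrow> real) \<Rightarrow> real" where
  "simplex_det n x = mdet (Suc n) (\<lambda>i j. if j < n then x i j else 1)"

text \<open>The Schur complement of the corner entry \<open>1\<close> subtracts the last vertex from
  all others.\<close>

lemma simplex_det_eq_edges: "simplex_det n x = mdet n (\<lambda>i j. x i j - x n j)"
  unfolding simplex_det_def by (subst mdet_schur) (auto intro: mdet_cong)

text \<open>Eliminating the last barycentric coordinate exhibits the simplex as an affine image of
  the standard simplex, which has volume \<open>1 / fact n\<close>. Dependent edges put the image
  into a hyperplane.\<close>

lemma simplex_volume_eq: "fact n * simplex_volume n x = \<bar>simplex_det n x\<bar>"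
proof -
  \<comment> \<open>The edges are the columns of \<open>T\<close>, hence the transposition.\<close>
  define T where "T = (\<lambda>k i. x i k - x n k)"
  have det: "mdet n T = simplex_det n x"
    unfolding simplex_det_eq_edges T_def by (rule mdet_transpose)
  define \<Delta> where "\<Delta> = {c. (\<forall>i\<in>{..<n}. 0 \<le> c i) \<and> sum c {..<n} \<le> (1::real)} \<inter> space (lebesgue_n n)"
  have \<Delta>: "emeasure (lebesgue_n n) \<Delta> = ennreal (1 / fact n)"
    using emeasure_std_simplex_aux[of "{..<n}" 1] unfolding \<Delta>_def by simp
  have comb: "(\<Sum>i\<le>n. c i * x i k) = x n k + (\<Sum>i<n. T k i * c i)" if "(\<Sum>i\<le>n. c i) = 1" for c k
  proof -
    have "c n = 1 - (\<Sum>i<n. c i)"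
      using that by (simp add: lessThan_Suc_atMost[symmetric])
    moreover have "(\<Sum>i<n. T k i * c i) = (\<Sum>i<n. c i * x i k) - (\<Sum>i<n. c i) * x n k"
      by (simp add: T_def algebra_simps sum_subtractf sum_distrib_left)
    moreover have "c n * x n k = x n k - (\<Sum>i<n. c i) * x n k"
      unfolding calculation(1) by (simp add: left_diff_distrib)
    ultimately show ?thesis
      by (simp add: lessThan_Suc_atMost[symmetric])
  qed
  have simplex: "simplex_of n x = affine_n n T (x n) ` \<Delta>"
  proof (intro equalityI subsetI)
    fix y assume "y \<in> simplex_of n x"
    then obtain c where c: "\<forall>i\<le>n. 0 \<le> c i" "(\<Sum>i\<le>n. c i) = 1" "y = (\<lambda>k\<in>{..<n}. \<Sum>i\<le>n. c i * x i k)"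
      by (auto simp: simplex_of_def)
    have "restrict c {..<n} \<in> \<Delta>"
      using c(1,2) by (auto simp: \<Delta>_def space_PiM lessThan_Suc_atMost[symmetric])
    moreover have "y = affine_n n T (x n) (restrict c {..<n})"
      using comb[OF c(2)] by (auto simp: c(3) affine_n_def fun_eq_iff restrict_def)
    ultimately show "y \<in> affine_n n T (x n) ` \<Delta>" by blast
  next
    fix y assume "y \<in> affine_n n T (x n) ` \<Delta>"
    then obtain c where c: "c \<in> \<Delta>" "y = affine_n n T (x n) c" by auto
    define c' where "c' = c(n := 1 - (\<Sum>i<n. c i))"
    have c': "(\<forall>i\<le>n. 0 \<le> c' i)" "(\<Sum>i\<le>n. c' i) = 1"
      using c(1) by (auto simp: c'_def \<Delta>_def lessThan_Suc_atMost[symmetric])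
    have "y = (\<lambda>k\<in>{..<n}. \<Sum>i\<le>n. c' i * x i k)"
      unfolding comb[OF c'(2)] by (auto simp: c(2) affine_n_def c'_def fun_eq_iff restrict_def)
    then show "y \<in> simplex_of n x"
      using c' by (auto simp: simplex_of_def)
  qed
  show ?thesis
  proof (cases "simplex_det n x = 0")
    case True
    \<comment> \<open>\<open>w\<close> is orthogonal to all edges, so the functional
      \<open>w\<close> is constant on the simplex, with its value \<open>d\<close> at the last
      vertex.\<close>
    then obtain w where w: "\<exists>k<n. w k \<noteq> 0" "\<And>j. j < n \<Longrightarrow> (\<Sum>k<n. w k * T k j) = 0"
      using mdet_eq_0_imp_kernel[of n T] det by metis
    define d where "d = (\<Sum>k<n. w k * x n k)"
    let ?H = "{y \<in> space (lebesgue_n n). (\<Sum>k<n. w k * y k) = d}"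
    have "simplex_of n x \<subseteq> ?H"
    proof
      fix y assume "y \<in> simplex_of n x"
      then obtain c where y: "y = affine_n n T (x n) c" by (auto simp: simplex)
      have "(\<Sum>k<n. w k * (\<Sum>j<n. T k j * c j)) = (\<Sum>k<n. \<Sum>j<n. w k * T k j * c j)"
        by (simp add: sum_distrib_left mult.assoc)
      also have "\<dots> = (\<Sum>j<n. (\<Sum>k<n. w k * T k j) * c j)"
        by (subst sum.swap) (simp add: sum_distrib_right)
      finally have "(\<Sum>k<n. w k * (\<Sum>j<n. T k j * c j)) = 0"
        using w(2) by simp
      then show "y \<in> ?H"
        by (simp add: y affine_n_def space_PiM distrib_left sum.distrib d_def)
    qed
    from emeasure_eq_0[OF sets_hyperplane emeasure_hyperplane[OF w(1)] this]
    have "emeasure (lebesgue_n n) (simplex_of n x) = 0" .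
    then show ?thesis
      using True by (simp add: simplex_volume_def measure_def)
  next
    case False
    then have dT: "mdet n T \<noteq> 0" by (simp add: det)
    obtain B where "\<forall>i<n. \<forall>j<n. (\<Sum>k<n. B i k * T k j) = (if i = j then 1 else 0) \<and>
        (\<Sum>k<n. T i k * B k j) = (if i = j then 1 else 0)"
      using mdet_inverse[OF dT] by (rule exE)
    then have B: "(\<Sum>k<n. B i k * T k j) = (if i = j then 1 else 0)"
      "(\<Sum>k<n. T i k * B k j) = (if i = j then 1 else 0)" if "i < n" "j < n" for i j
      using that by simp_all
    \<comment> \<open>The inverse affine map: it presents the simplex as a preimage of the standard
      simplex and thereby shows that it is measurable.\<close>
    define \<psi> where "\<psi> = affine_n n B (\<lambda>i. - (\<Sum>k<n. B i k * x n k))"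
    have \<psi>T: "\<psi> (affine_n n T (x n) c) = c" if "c \<in> space (lebesgue_n n)" for c
      using sum_inverse_matrix[of n B T _ c, OF B(1)] that
      by (auto simp: \<psi>_def affine_n_def fun_eq_iff restrict_def space_PiM PiE_def extensional_def distrib_left sum.distrib)
    have T\<psi>: "affine_n n T (x n) (\<psi> y) = y" if "y \<in> space (lebesgue_n n)" for y
    proof -
      have "- (\<Sum>k<n. B i k * x n k) + (\<Sum>k<n. B i k * y k) = (\<Sum>k<n. B i k * (y k - x n k))" for i
        by (simp add: algebra_simps sum_subtractf)
      then have "(\<Sum>i<n. T j i * (- (\<Sum>k<n. B i k * x n k) + (\<Sum>k<n. B i k * y k))) = y j - x n j" if "j < n" for j
        using sum_inverse_matrix[of n T B j "\<lambda>k. y k - x n k", OF B(2)] that by simp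
      then show ?thesis
        using that
        by (auto simp: \<psi>_def affine_n_def fun_eq_iff restrict_def space_PiM PiE_def extensional_def)
    qed
    have \<Delta>_sets: "\<Delta> \<in> sets (lebesgue_n n)"
      unfolding \<Delta>_def by measurable
    have \<Delta>_space: "\<Delta> \<subseteq> space (lebesgue_n n)"
      unfolding \<Delta>_def by (rule Int_lower2)
    have aff_space: "affine_n n A b y \<in> space (lebesgue_n n)" for A b y
      by (auto simp: affine_n_def space_PiM)
    have "simplex_of n x = \<psi> -` \<Delta> \<inter> space (lebesgue_n n)"
      unfolding simplex
    proof (intro equalityI subsetI)
      fix y assume "y \<in> affine_n n T (x n) ` \<Delta>"
      then obtain c where c: "c \<in> \<Delta>" "y = affine_n n T (x n) c" by blast
      then show "y \<in> \<psi> -` \<Delta> \<inter> space (lebesgue_n n)"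
        using \<psi>T[of c] aff_space[of T "x n" c] \<Delta>_space by auto
    next
      fix y assume "y \<in> \<psi> -` \<Delta> \<inter> space (lebesgue_n n)"
      then show "y \<in> affine_n n T (x n) ` \<Delta>"
        using T\<psi>[of y] by (intro image_eqI[of _ _ "\<psi> y"]) auto
    qed
    also have "\<dots> \<in> sets (lebesgue_n n)"
      unfolding \<psi>_def by (rule measurable_sets[OF measurable_affine_n \<Delta>_sets])
    finally have S: "simplex_of n x \<in> sets (lebesgue_n n)" .
    have "emeasure (lebesgue_n n) (simplex_of n x) = (\<integral>\<^sup>+y. indicator (simplex_of n x) y \<partial>lebesgue_n n)"
      using S by simp
    also have "\<dots> = ennreal \<bar>mdet n T\<bar> * (\<integral>\<^sup>+c. indicator (simplex_of n x) (affine_n n T (x n) c) \<partial>lebesgue_n n)"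
      by (rule nn_integral_affine_n[OF dT]) (use S in simp)
    also have "(\<integral>\<^sup>+c. indicator (simplex_of n x) (affine_n n T (x n) c) \<partial>lebesgue_n n) = (\<integral>\<^sup>+c. indicator \<Delta> c \<partial>lebesgue_n n)"
    proof (rule nn_integral_cong)
      fix c assume c: "c \<in> space (lebesgue_n n)"
      have "affine_n n T (x n) c \<in> simplex_of n x \<longleftrightarrow> c \<in> \<Delta>"
        unfolding simplex
      proof
        assume "affine_n n T (x n) c \<in> affine_n n T (x n) ` \<Delta>"
        then obtain c' where c': "c' \<in> \<Delta>" "affine_n n T (x n) c = affine_n n T (x n) c'" by blast
        have "c = c'"
          using \<psi>T[OF c] \<psi>T[OF subsetD[OF \<Delta>_space c'(1)]] unfolding c'(2) by simp
        then show "c \<in> \<Delta>" using c'(1) by simp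
      qed (rule imageI)
      then show "indicator (simplex_of n x) (affine_n n T (x n) c) = (indicator \<Delta> c :: ennreal)"
        by (simp split: split_indicator)
    qed
    also have "\<dots> = ennreal (1 / fact n)"
      using \<Delta> \<Delta>_sets by simp
    finally have "emeasure (lebesgue_n n) (simplex_of n x) = ennreal (\<bar>mdet n T\<bar> * (1 / fact n))"
      by (subst ennreal_mult) simp_all
    then have "measure (lebesgue_n n) (simplex_of n x) = \<bar>mdet n T\<bar> * (1 / fact n)"
      by (intro measure_eq_emeasure_eq_ennreal) simp_all
    then show ?thesis
      unfolding simplex_volume_def det by simp
  qed
qed

section \<open>Integration row by row\<close>

lemma product_sigma_finite_lebesgue_n: "product_sigma_finite (\<lambda>_. lebesgue_n n)"
  unfolding product_sigma_finite_def by (auto intro: lborel_product.sigma_finite)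

text \<open>Lifts an identity between integrals over one row to all rows at once. The identity may
  hold only for a class of integrands, such as functions homogeneous in the row; \<open>Q\<close>
  describes this class and is required of every row section of \<open>H\<close>.\<close>

lemma nn_integral_PiM_rowwise:
  fixes \<mu> \<sigma> N :: "'b measure" and C :: ennreal and I :: "nat set"
  assumes "sigma_finite_measure \<mu>" "sigma_finite_measure \<sigma>"
    and sets_\<mu> [measurable_cong]: "sets \<mu> = sets N" and sets_\<sigma> [measurable_cong]: "sets \<sigma> = sets N"
    and \<tau> [measurable]: "\<tau> \<in> N \<rightarrow>\<^sub>M N"
    and row: "\<And>h. h \<in> borel_measurable N \<Longrightarrow> Q h \<Longrightarrow> (\<integral>\<^sup>+y. h y \<partial>\<mu>) = C * (\<integral>\<^sup>+y. h (\<tau> y) \<partial>\<sigma>)"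
    and "finite I" "H \<in> borel_measurable (PiM I (\<lambda>_. N))"
    and "\<And>i x. i \<in> I \<Longrightarrow> x \<in> space (PiM (I - {i}) (\<lambda>_. N)) \<Longrightarrow> Q (\<lambda>y. H (x(i := y)))"
  shows "(\<integral>\<^sup>+x. H x \<partial>PiM I (\<lambda>_. \<mu>)) = C ^ card I * (\<integral>\<^sup>+x. H (\<lambda>i\<in>I. \<tau> (x i)) \<partial>PiM I (\<lambda>_. \<sigma>))"
  using assms(7-9)
proof (induction I arbitrary: H rule: finite_induct)
  case empty
  show ?case by (simp add: PiM_empty nn_integral_count_space_finite)
next
  case (insert i I H)
  interpret \<mu>: product_sigma_finite "\<lambda>_. \<mu>"
    unfolding product_sigma_finite_def using assms(1) by auto
  interpret \<sigma>: product_sigma_finite "\<lambda>_. \<sigma>"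
    unfolding product_sigma_finite_def using assms(2) by auto
  have space_eq: "space \<mu> = space N" "space \<sigma> = space N"
    using sets_eq_imp_space_eq[OF sets_\<mu>] sets_eq_imp_space_eq[OF sets_\<sigma>] by auto
  have sets_PiM_\<mu>: "sets (PiM J (\<lambda>_. \<mu>)) = sets (PiM J (\<lambda>_. N))" for J :: "nat set"
    by (rule sets_PiM_cong) (auto simp: sets_\<mu>)
  have sets_PiM_\<sigma>: "sets (PiM J (\<lambda>_. \<sigma>)) = sets (PiM J (\<lambda>_. N))" for J :: "nat set"
    by (rule sets_PiM_cong) (auto simp: sets_\<sigma>)
  note [measurable_cong] = sets_PiM_\<mu> sets_PiM_\<sigma>
  note H [measurable] = insert.prems(1)
  have upd: "(\<lambda>p. (fst p)(i := snd p)) \<in> PiM I (\<lambda>_. N) \<Otimes>\<^sub>M N \<rightarrow>\<^sub>M PiM (insert i I) (\<lambda>_. N)"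
    using measurable_add_dim[of i I "\<lambda>_. N"] by (simp add: split_def)
  have "(\<lambda>p. (fst p)(i := \<tau> (snd p))) = (\<lambda>p. (fst p)(i := snd p)) \<circ> (\<lambda>p. (fst p, \<tau> (snd p)))"
    by (simp add: fun_eq_iff)
  also have "\<dots> \<in> PiM I (\<lambda>_. N) \<Otimes>\<^sub>M N \<rightarrow>\<^sub>M PiM (insert i I) (\<lambda>_. N)"
    by (rule measurable_comp[OF _ upd]) measurable
  finally have "(\<lambda>p. H ((fst p)(i := \<tau> (snd p)))) \<in> borel_measurable (PiM I (\<lambda>_. N) \<Otimes>\<^sub>M N)"
    by (rule measurable_compose[OF _ H])
  then have HN: "(\<lambda>(x, y). H (x(i := \<tau> y))) \<in> borel_measurable (PiM I (\<lambda>_. N) \<Otimes>\<^sub>M N)"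
    by (simp only: split_def)
  have sec: "(\<lambda>y. H (x(i := y))) \<in> borel_measurable N" if "x \<in> space (PiM I (\<lambda>_. N))" for x
    using measurable_compose[OF measurable_Pair1'[OF that] measurable_compose[OF upd H]] by (simp only: fst_conv snd_conv)
  have sec2: "(\<lambda>x. H (x(i := y))) \<in> borel_measurable (PiM I (\<lambda>_. N))" if "y \<in> space N" for y
    using measurable_compose[OF measurable_Pair2'[OF that] measurable_compose[OF upd H]] by (simp only: fst_conv snd_conv)
  have \<tau>_space: "\<tau> y \<in> space N" if "y \<in> space N" for y
    using measurable_space[OF \<tau> that] .
  have space_PiM_\<mu>: "space (PiM I (\<lambda>_. \<mu>)) = space (PiM I (\<lambda>_. N))"
    by (rule sets_eq_imp_space_eq[OF sets_PiM_\<mu>])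
  interpret P: sigma_finite_measure "PiM I (\<lambda>_. \<mu>)"
    by (rule \<mu>.sigma_finite) fact
  interpret S: sigma_finite_measure \<sigma> by fact
  interpret PS: pair_sigma_finite "PiM I (\<lambda>_. \<mu>)" \<sigma> ..
  have HPS: "(\<lambda>(x, y). H (x(i := \<tau> y))) \<in> borel_measurable (PiM I (\<lambda>_. \<mu>) \<Otimes>\<^sub>M \<sigma>)"
    using HN by (simp cong: measurable_cong_sets add: sets_pair_measure_cong[OF sets_PiM_\<mu> sets_\<sigma>])
  have "(\<integral>\<^sup>+x. H x \<partial>PiM (insert i I) (\<lambda>_. \<mu>)) = (\<integral>\<^sup>+x. \<integral>\<^sup>+y. H (x(i := y)) \<partial>\<mu> \<partial>PiM I (\<lambda>_. \<mu>))"
    using insert.hyps by (intro \<mu>.product_nn_integral_insert) measurable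
  also have "\<dots> = (\<integral>\<^sup>+x. C * (\<integral>\<^sup>+y. H (x(i := \<tau> y)) \<partial>\<sigma>) \<partial>PiM I (\<lambda>_. \<mu>))"
  proof (rule nn_integral_cong)
    fix x assume x: "x \<in> space (PiM I (\<lambda>_. \<mu>))"
    show "(\<integral>\<^sup>+y. H (x(i := y)) \<partial>\<mu>) = C * (\<integral>\<^sup>+y. H (x(i := \<tau> y)) \<partial>\<sigma>)"
      using x insert.hyps
      by (intro row[of "\<lambda>y. H (x(i := y))"] sec insert.prems(2)) (auto simp: space_PiM_\<mu>)
  qed
  also have "\<dots> = C * (\<integral>\<^sup>+x. \<integral>\<^sup>+y. H (x(i := \<tau> y)) \<partial>\<sigma> \<partial>PiM I (\<lambda>_. \<mu>))"
    using HPS by (intro nn_integral_cmult sigma_finite_measure.borel_measurable_nn_integral[OF assms(2)])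
  also have "(\<integral>\<^sup>+x. \<integral>\<^sup>+y. H (x(i := \<tau> y)) \<partial>\<sigma> \<partial>PiM I (\<lambda>_. \<mu>)) =
      (\<integral>\<^sup>+y. \<integral>\<^sup>+x. H (x(i := \<tau> y)) \<partial>PiM I (\<lambda>_. \<mu>) \<partial>\<sigma>)"
    using HPS by (intro PS.Fubini'[symmetric])
  also have "\<dots> = (\<integral>\<^sup>+y. C ^ card I * (\<integral>\<^sup>+x. H ((\<lambda>j\<in>I. \<tau> (x j))(i := \<tau> y)) \<partial>PiM I (\<lambda>_. \<sigma>)) \<partial>\<sigma>)"
  proof (rule nn_integral_cong)
    fix y assume "y \<in> space \<sigma>"
    then have y: "\<tau> y \<in> space N"
      by (simp add: space_eq \<tau>_space)
    show "(\<integral>\<^sup>+x. H (x(i := \<tau> y)) \<partial>PiM I (\<lambda>_. \<mu>)) =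
        C ^ card I * (\<integral>\<^sup>+x. H ((\<lambda>j\<in>I. \<tau> (x j))(i := \<tau> y)) \<partial>PiM I (\<lambda>_. \<sigma>))"
    \<comment> \<open>With row \<open>i\<close> frozen at \<open>\<tau> y\<close>, sections in the
      remaining rows are still sections of \<open>H\<close>, so \<open>Q\<close> is
      inherited.\<close>
    proof (rule insert.IH[OF sec2[OF y]])
      fix i' x assume i': "i' \<in> I" and x: "x \<in> space (PiM (I - {i'}) (\<lambda>_. N))"
      have "x(i := \<tau> y) \<in> space (PiM (insert i I - {i'}) (\<lambda>_. N))"
        using x y i' insert.hyps by (auto simp: space_PiM PiE_def extensional_def Pi_def)
      then have "Q (\<lambda>y'. H ((x(i := \<tau> y))(i' := y')))"
        by (rule insert.prems(2)[rotated]) (use i' in simp)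
      moreover have "(x(i := \<tau> y))(i' := y') = x(i' := y', i := \<tau> y)" for y'
        using i' insert.hyps by (intro fun_upd_twist) auto
      ultimately show "Q (\<lambda>y'. H (x(i' := y', i := \<tau> y)))"
        by simp
    qed
  qed
  also have "\<dots> = (\<integral>\<^sup>+y. \<integral>\<^sup>+x. C ^ card I * H (\<lambda>j\<in>insert i I. \<tau> ((x(i := y)) j)) \<partial>PiM I (\<lambda>_. \<sigma>) \<partial>\<sigma>)"
  proof (rule nn_integral_cong)
    fix y assume "y \<in> space \<sigma>"
    then have y: "\<tau> y \<in> space N"
      by (simp add: space_eq \<tau>_space)
    have eq: "(\<lambda>j\<in>insert i I. \<tau> ((x(i := y)) j)) = (\<lambda>j\<in>I. \<tau> (x j))(i := \<tau> y)" for x :: "nat \<Rightarrow> 'b"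
      using insert.hyps by (auto simp: fun_eq_iff restrict_def)
    have "(\<lambda>x. \<lambda>j\<in>I. \<tau> (x j)) \<in> PiM I (\<lambda>_. \<sigma>) \<rightarrow>\<^sub>M PiM I (\<lambda>_. N)"
      by (intro measurable_restrict) measurable
    from measurable_compose[OF this sec2[OF y]]
    show "C ^ card I * (\<integral>\<^sup>+x. H ((\<lambda>j\<in>I. \<tau> (x j))(i := \<tau> y)) \<partial>PiM I (\<lambda>_. \<sigma>)) =
      (\<integral>\<^sup>+x. C ^ card I * H (\<lambda>j\<in>insert i I. \<tau> ((x(i := y)) j)) \<partial>PiM I (\<lambda>_. \<sigma>))"
      unfolding eq by (rule nn_integral_cmult[symmetric])
  qed
  also have "\<dots> = (\<integral>\<^sup>+x. C ^ card I * H (\<lambda>j\<in>insert i I. \<tau> (x j)) \<partial>PiM (insert i I) (\<lambda>_. \<sigma>))"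
  proof (rule \<sigma>.product_nn_integral_insert_rev[symmetric])
    have "(\<lambda>x. \<lambda>j\<in>insert i I. \<tau> (x j)) \<in> PiM (insert i I) (\<lambda>_. \<sigma>) \<rightarrow>\<^sub>M PiM (insert i I) (\<lambda>_. N)"
      by (intro measurable_restrict) measurable
    from measurable_compose[OF this H]
    show "(\<lambda>x. C ^ card I * H (\<lambda>j\<in>insert i I. \<tau> (x j))) \<in> borel_measurable (PiM (insert i I) (\<lambda>_. \<sigma>))"
      by (intro borel_measurable_times_ennreal borel_measurable_const)
  qed (use insert.hyps in auto)
  also have "\<dots> = C ^ card I * (\<integral>\<^sup>+x. H (\<lambda>j\<in>insert i I. \<tau> (x j)) \<partial>PiM (insert i I) (\<lambda>_. \<sigma>))"
  proof (rule nn_integral_cmult)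
    have "(\<lambda>x. \<lambda>j\<in>insert i I. \<tau> (x j)) \<in> PiM (insert i I) (\<lambda>_. \<sigma>) \<rightarrow>\<^sub>M PiM (insert i I) (\<lambda>_. N)"
      by (intro measurable_restrict) measurable
    from measurable_compose[OF this H]
    show "(\<lambda>x. H (\<lambda>j\<in>insert i I. \<tau> (x j))) \<in> borel_measurable (PiM (insert i I) (\<lambda>_. \<sigma>))" .
  qed
  finally show ?case
    using insert.hyps(1,2) by (simp only: card_insert_disjoint power_Suc mult.assoc not_False_eq_True)
qed

lemma measurable_rows_upd:
  "(\<lambda>(z, v). \<lambda>i\<in>I. (z i)(n := v i)) \<in>
    PiM I (\<lambda>_. lebesgue_n n) \<Otimes>\<^sub>M PiM I (\<lambda>_. lborel) \<rightarrow>\<^sub>M PiM I (\<lambda>_. lebesgue_n (Suc n))"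
  unfolding split_def
proof (rule measurable_restrict)
  fix i assume i: "i \<in> I"
  have "(\<lambda>p. (fst p i, snd p i)) \<in> PiM I (\<lambda>_. lebesgue_n n) \<Otimes>\<^sub>M PiM I (\<lambda>_. lborel) \<rightarrow>\<^sub>M lebesgue_n n \<Otimes>\<^sub>M lborel"
    using measurable_compose[OF measurable_fst measurable_component_singleton[OF i]]
      measurable_compose[OF measurable_snd measurable_component_singleton[OF i]]
    by (rule measurable_Pair)
  from measurable_compose[OF this upd_lebesgue_n]
  show "(\<lambda>p. (fst p i)(n := snd p i)) \<in>
    PiM I (\<lambda>_. lebesgue_n n) \<Otimes>\<^sub>M PiM I (\<lambda>_. lborel) \<rightarrow>\<^sub>M lebesgue_n (Suc n)"
    by simp
qed

text \<open>Splits the last entry off every row: a matrix becomes its first \<open>n\<close> columns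
  \<open>z\<close> together with a final column \<open>v\<close>.\<close>

lemma nn_integral_rows_Suc:
  assumes "finite I" "H \<in> borel_measurable (PiM I (\<lambda>_. lebesgue_n (Suc n)))"
  shows "(\<integral>\<^sup>+y. H y \<partial>PiM I (\<lambda>_. lebesgue_n (Suc n))) =
    (\<integral>\<^sup>+z. \<integral>\<^sup>+v. H (\<lambda>i\<in>I. (z i)(n := v i)) \<partial>PiM I (\<lambda>_. lborel) \<partial>PiM I (\<lambda>_. lebesgue_n n))"
  using assms
proof (induction I arbitrary: H rule: finite_induct)
  case empty
  show ?case
    by (simp add: PiM_empty nn_integral_count_space_finite)
next
  case (insert i I H)
  interpret Ln: product_sigma_finite "\<lambda>_. lebesgue_n n" by (rule product_sigma_finite_lebesgue_n)
  interpret LS: product_sigma_finite "\<lambda>_. lebesgue_n (Suc n)" by (rule product_sigma_finite_lebesgue_n)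
  interpret Z: sigma_finite_measure "PiM I (\<lambda>_. lebesgue_n n)" by (rule Ln.sigma_finite) fact
  interpret V: sigma_finite_measure "PiM I (\<lambda>_. lborel :: real measure)" by (rule lborel_product.sigma_finite) fact
  interpret Y: sigma_finite_measure "PiM I (\<lambda>_. lebesgue_n (Suc n))" by (rule LS.sigma_finite) fact
  interpret V': sigma_finite_measure "PiM (insert i I) (\<lambda>_. lborel :: real measure)"
    by (rule lborel_product.sigma_finite) (use insert.hyps in simp)
  interpret TZ: pair_sigma_finite "lborel :: real measure" "PiM I (\<lambda>_. lebesgue_n n)" ..
  note H = insert.prems
  define K where "K = (\<lambda>w z v. H ((\<lambda>j\<in>I. (z j)(n := v j))(i := w)))"
  have updH: "(\<lambda>p. H ((fst p)(i := snd p))) \<in> borel_measurable (PiM I (\<lambda>_. lebesgue_n (Suc n)) \<Otimes>\<^sub>M lebesgue_n (Suc n))"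
    using measurable_compose[OF measurable_add_dim[of i I "\<lambda>_. lebesgue_n (Suc n)"] H] by (simp only: split_def)
  have sec: "(\<lambda>y. H (y(i := w))) \<in> borel_measurable (PiM I (\<lambda>_. lebesgue_n (Suc n)))"
    if "w \<in> space (lebesgue_n (Suc n))" for w
    using measurable_compose[OF measurable_Pair2'[OF that] updH] by (simp only: fst_conv snd_conv)
  have Kmeas: "(\<lambda>p. K (fst p) (fst (snd p)) (snd (snd p))) \<in>
      borel_measurable (lebesgue_n (Suc n) \<Otimes>\<^sub>M (PiM I (\<lambda>_. lebesgue_n n) \<Otimes>\<^sub>M PiM I (\<lambda>_. lborel)))"
  proof -
    have "(\<lambda>p. ((\<lambda>(z, v). \<lambda>j\<in>I. (z j)(n := v j)) (snd p), fst p)) \<in>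
      lebesgue_n (Suc n) \<Otimes>\<^sub>M (PiM I (\<lambda>_. lebesgue_n n) \<Otimes>\<^sub>M PiM I (\<lambda>_. lborel)) \<rightarrow>\<^sub>M
      PiM I (\<lambda>_. lebesgue_n (Suc n)) \<Otimes>\<^sub>M lebesgue_n (Suc n)"
      by (rule measurable_Pair[OF measurable_compose[OF measurable_snd measurable_rows_upd] measurable_fst])
    from measurable_compose[OF this updH] show ?thesis
      by (simp add: K_def split_def)
  qed
  have upd3: "(\<lambda>q. ((fst q)(n := fst (snd q)), snd (snd q))) \<in>
      lebesgue_n n \<Otimes>\<^sub>M (lborel \<Otimes>\<^sub>M X) \<rightarrow>\<^sub>M lebesgue_n (Suc n) \<Otimes>\<^sub>M X" for X :: "'x measure"
  proof (rule measurable_Pair)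
    have "(\<lambda>q. (fst q, fst (snd q))) \<in> lebesgue_n n \<Otimes>\<^sub>M (lborel \<Otimes>\<^sub>M X) \<rightarrow>\<^sub>M lebesgue_n n \<Otimes>\<^sub>M lborel"
      by measurable
    from measurable_compose[OF this upd_lebesgue_n]
    show "(\<lambda>q. (fst q)(n := fst (snd q))) \<in> lebesgue_n n \<Otimes>\<^sub>M (lborel \<Otimes>\<^sub>M X) \<rightarrow>\<^sub>M lebesgue_n (Suc n)"
      by simp
  qed measurable
  have "(\<integral>\<^sup>+y. H y \<partial>PiM (insert i I) (\<lambda>_. lebesgue_n (Suc n))) =
      (\<integral>\<^sup>+w. \<integral>\<^sup>+y. H (y(i := w)) \<partial>PiM I (\<lambda>_. lebesgue_n (Suc n)) \<partial>lebesgue_n (Suc n))"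
    using insert.hyps H by (intro LS.product_nn_integral_insert_rev) auto
  also have "\<dots> = (\<integral>\<^sup>+w. \<integral>\<^sup>+z. \<integral>\<^sup>+v. K w z v \<partial>PiM I (\<lambda>_. lborel) \<partial>PiM I (\<lambda>_. lebesgue_n n) \<partial>lebesgue_n (Suc n))"
    unfolding K_def by (rule nn_integral_cong, rule insert.IH, rule sec)
  also have "\<dots> = (\<integral>\<^sup>+zi. \<integral>\<^sup>+t. \<integral>\<^sup>+z. \<integral>\<^sup>+v. K (zi(n := t)) z v \<partial>PiM I (\<lambda>_. lborel)
      \<partial>PiM I (\<lambda>_. lebesgue_n n) \<partial>lborel \<partial>lebesgue_n n)"
  proof (rule nn_integral_lebesgue_n_Suc)
    have "(\<lambda>p. K (fst (fst p)) (snd (fst p)) (snd p)) \<in>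
      borel_measurable ((lebesgue_n (Suc n) \<Otimes>\<^sub>M PiM I (\<lambda>_. lebesgue_n n)) \<Otimes>\<^sub>M PiM I (\<lambda>_. lborel))"
    proof -
      have "(\<lambda>p. (fst (fst p), (snd (fst p), snd p))) \<in>
        (lebesgue_n (Suc n) \<Otimes>\<^sub>M PiM I (\<lambda>_. lebesgue_n n)) \<Otimes>\<^sub>M PiM I (\<lambda>_. lborel) \<rightarrow>\<^sub>M
        lebesgue_n (Suc n) \<Otimes>\<^sub>M (PiM I (\<lambda>_. lebesgue_n n) \<Otimes>\<^sub>M PiM I (\<lambda>_. lborel))"
        by measurable
      from measurable_compose[OF this Kmeas] show ?thesis by simp
    qed
    then have "(\<lambda>p. \<integral>\<^sup>+v. K (fst p) (snd p) v \<partial>PiM I (\<lambda>_. lborel)) \<in>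
      borel_measurable (lebesgue_n (Suc n) \<Otimes>\<^sub>M PiM I (\<lambda>_. lebesgue_n n))"
      by (intro V.borel_measurable_nn_integral) (simp add: split_def)
    then show "(\<lambda>w. \<integral>\<^sup>+z. \<integral>\<^sup>+v. K w z v \<partial>PiM I (\<lambda>_. lborel) \<partial>PiM I (\<lambda>_. lebesgue_n n)) \<in>
      borel_measurable (lebesgue_n (Suc n))"
      by (intro Z.borel_measurable_nn_integral) (simp add: split_def)
  qed
  \<comment> \<open>The last entry \<open>t\<close> of the new row is moved past the other shortened
    rows, so that it joins the column formed by their last entries.\<close>
  also have "\<dots> = (\<integral>\<^sup>+zi. \<integral>\<^sup>+z. \<integral>\<^sup>+t. \<integral>\<^sup>+v. K (zi(n := t)) z v \<partial>PiM I (\<lambda>_. lborel)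
      \<partial>lborel \<partial>PiM I (\<lambda>_. lebesgue_n n) \<partial>lebesgue_n n)"
  proof (rule nn_integral_cong)
    fix zi assume zi: "zi \<in> space (lebesgue_n n)"
    have u: "(\<lambda>t. zi(n := t)) \<in> lborel \<rightarrow>\<^sub>M lebesgue_n (Suc n)"
      using measurable_compose[OF measurable_Pair1'[OF zi] upd_lebesgue_n] by simp
    have "(\<lambda>p. (zi(n := fst (fst p)), (snd (fst p), snd p))) \<in>
      (lborel \<Otimes>\<^sub>M PiM I (\<lambda>_. lebesgue_n n)) \<Otimes>\<^sub>M PiM I (\<lambda>_. lborel) \<rightarrow>\<^sub>M
        lebesgue_n (Suc n) \<Otimes>\<^sub>M (PiM I (\<lambda>_. lebesgue_n n) \<Otimes>\<^sub>M PiM I (\<lambda>_. lborel))"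
      using u by measurable
    from measurable_compose[OF this Kmeas]
    have "(\<lambda>p. \<integral>\<^sup>+v. K (zi(n := fst p)) (snd p) v \<partial>PiM I (\<lambda>_. lborel)) \<in>
      borel_measurable (lborel \<Otimes>\<^sub>M PiM I (\<lambda>_. lebesgue_n n))"
      by (intro V.borel_measurable_nn_integral) (simp add: split_def)
    then have "(\<lambda>(t, z). \<integral>\<^sup>+v. K (zi(n := t)) z v \<partial>PiM I (\<lambda>_. lborel)) \<in>
      borel_measurable (lborel \<Otimes>\<^sub>M PiM I (\<lambda>_. lebesgue_n n))"
      by (simp add: split_def)
    from TZ.Fubini'[OF this]
    show "(\<integral>\<^sup>+t. \<integral>\<^sup>+z. \<integral>\<^sup>+v. K (zi(n := t)) z v \<partial>PiM I (\<lambda>_. lborel) \<partial>PiM I (\<lambda>_. lebesgue_n n) \<partial>lborel) =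
      (\<integral>\<^sup>+z. \<integral>\<^sup>+t. \<integral>\<^sup>+v. K (zi(n := t)) z v \<partial>PiM I (\<lambda>_. lborel) \<partial>lborel \<partial>PiM I (\<lambda>_. lebesgue_n n))"
      by simp
  qed
  also have "\<dots> = (\<integral>\<^sup>+zi. \<integral>\<^sup>+z. \<integral>\<^sup>+v'. H (\<lambda>j\<in>insert i I. ((z(i := zi)) j)(n := v' j))
      \<partial>PiM (insert i I) (\<lambda>_. lborel) \<partial>PiM I (\<lambda>_. lebesgue_n n) \<partial>lebesgue_n n)"
  proof (intro nn_integral_cong)
    fix zi z assume zi: "zi \<in> space (lebesgue_n n)" and z: "z \<in> space (PiM I (\<lambda>_. lebesgue_n n))"
    have zz: "z(i := zi) \<in> space (PiM (insert i I) (\<lambda>_. lebesgue_n n))"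
      using zi z by (auto simp: space_PiM PiE_def extensional_def Pi_def)
    have "(\<lambda>v'. H (\<lambda>j\<in>insert i I. ((z(i := zi)) j)(n := v' j))) \<in> borel_measurable (PiM (insert i I) (\<lambda>_. lborel))"
      using measurable_compose[OF measurable_Pair1'[OF zz] measurable_compose[OF measurable_rows_upd H]] by (simp only: split_conv)
    then have "(\<integral>\<^sup>+v'. H (\<lambda>j\<in>insert i I. ((z(i := zi)) j)(n := v' j)) \<partial>PiM (insert i I) (\<lambda>_. lborel)) =
      (\<integral>\<^sup>+t. \<integral>\<^sup>+v. H (\<lambda>j\<in>insert i I. ((z(i := zi)) j)(n := (v(i := t)) j)) \<partial>PiM I (\<lambda>_. lborel) \<partial>lborel)"
      using insert.hyps by (intro lborel_product.product_nn_integral_insert_rev) auto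
    moreover have "(\<lambda>j\<in>insert i I. ((z(i := zi)) j)(n := (v(i := t)) j)) =
        (\<lambda>j\<in>I. (z j)(n := v j))(i := zi(n := t))" for t v
      using insert.hyps by (auto simp: fun_eq_iff restrict_def)
    ultimately show "(\<integral>\<^sup>+t. \<integral>\<^sup>+v. K (zi(n := t)) z v \<partial>PiM I (\<lambda>_. lborel) \<partial>lborel) =
      (\<integral>\<^sup>+v'. H (\<lambda>j\<in>insert i I. ((z(i := zi)) j)(n := v' j)) \<partial>PiM (insert i I) (\<lambda>_. lborel))"
      by (simp add: K_def)
  qed
  also have "\<dots> = (\<integral>\<^sup>+z'. \<integral>\<^sup>+v'. H (\<lambda>j\<in>insert i I. (z' j)(n := v' j))
      \<partial>PiM (insert i I) (\<lambda>_. lborel) \<partial>PiM (insert i I) (\<lambda>_. lebesgue_n n))"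
  proof (rule Ln.product_nn_integral_insert_rev[symmetric])
    show "(\<lambda>z'. \<integral>\<^sup>+v'. H (\<lambda>j\<in>insert i I. (z' j)(n := v' j)) \<partial>PiM (insert i I) (\<lambda>_. lborel)) \<in>
        borel_measurable (PiM (insert i I) (\<lambda>_. lebesgue_n n))"
      using measurable_compose[OF measurable_rows_upd H]
      by (intro V'.borel_measurable_nn_integral) (simp only: split_def)
  qed (use insert.hyps in auto)
  finally show ?case .
qed

subsection \<open>Polar coordinates\<close>

lemma measurable_norm_n [measurable]: "(\<lambda>x. L2_set x {..<n}) \<in> borel_measurable (lebesgue_n n)"
  unfolding L2_set_def by measurable

lemma L2_set_scale: "L2_set (\<lambda>k\<in>{..<n}. c * x k) {..<n} = \<bar>c\<bar> * L2_set x {..<n}"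
  by (simp add: L2_set_def power_mult_distrib sum_distrib_left[symmetric] real_sqrt_mult)

lemma nn_integral_lebesgue_n_scale:
  assumes "c \<noteq> 0" "f \<in> borel_measurable (lebesgue_n n)"
  shows "(\<integral>\<^sup>+x. f x \<partial>lebesgue_n n) = ennreal (\<bar>c\<bar> ^ n) * (\<integral>\<^sup>+x. f (\<lambda>i\<in>{..<n}. c * x i) \<partial>lebesgue_n n)"
proof -
  define A where "A = (\<lambda>i j :: nat. if i = j then c else 0)"
  have A: "mdet m A = c ^ m" for m
    by (induction m) (simp_all add: mdet_last_row A_def, simp add: mdet_def)
  have "affine_n n A (\<lambda>_. 0) x = (\<lambda>i\<in>{..<n}. c * x i)" for x
  proof -
    have "(\<Sum>j<n. A i j * x j) = c * x i" if "i < n" for i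
    proof -
      have "(\<Sum>j<n. A i j * x j) = (\<Sum>j<n. if i = j then c * x j else 0)"
        by (rule sum.cong) (auto simp: A_def)
      then show ?thesis using that by simp
    qed
    then show ?thesis by (auto simp: affine_n_def fun_eq_iff restrict_def)
  qed
  then show ?thesis
    using nn_integral_affine_n[of n A f "\<lambda>_. 0"] assms by (simp add: A power_abs)
qed

definition unit_ball_n :: "nat \<Rightarrow> (nat \<Rightarrow> real) set" where
  "unit_ball_n n = {x \<in> space (lebesgue_n n). L2_set x {..<n} \<le> 1}"

lemma sets_unit_ball_n [measurable]: "unit_ball_n n \<in> sets (lebesgue_n n)"
  unfolding unit_ball_n_def by measurable

lemma emeasure_unit_ball_n: "emeasure (lebesgue_n n) (unit_ball_n n) = ennreal (unit_ball_vol n)"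
  using emeasure_cball_aux[of "{..<n}" 1]
  by (simp add: unit_ball_n_def L2_set_def Int_def conj_commute)

lemma measurable_normalize [measurable]:
  "(\<lambda>x. \<lambda>k\<in>{..<n}. x k / L2_set x {..<n}) \<in> lebesgue_n n \<rightarrow>\<^sub>M lebesgue_n n"
  by (intro measurable_restrict) measurable

lemma sphere_distribution_altdef:
  "sphere_distribution n = distr (uniform_measure (lebesgue_n n) (unit_ball_n n)) (lebesgue_n n)
    (\<lambda>x. \<lambda>k\<in>{..<n}. x k / L2_set x {..<n})"
  by (simp add: sphere_distribution_def unit_ball_n_def)

lemma sets_sphere_distribution [measurable_cong, simp]: "sets (sphere_distribution n) = sets (lebesgue_n n)"
  by (simp add: sphere_distribution_def)

lemma prob_space_sphere_distribution: "prob_space (sphere_distribution n)"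
  using unit_ball_vol_pos[of "real n", OF of_nat_0_le_iff]
  unfolding sphere_distribution_altdef
  by (intro prob_space.prob_space_distr prob_space_uniform_measure)
     (auto simp: emeasure_unit_ball_n ennreal_eq_0_iff not_le intro!: measurable_compose[OF measurable_ident_sets] measurable_normalize)

lemma nn_integral_sphere_distribution:
  assumes [measurable]: "g \<in> borel_measurable (lebesgue_n n)"
  shows "(\<integral>\<^sup>+u. g u \<partial>sphere_distribution n) =
    (\<integral>\<^sup>+x. g (\<lambda>k\<in>{..<n}. x k / L2_set x {..<n}) * indicator (unit_ball_n n) x \<partial>lebesgue_n n) / ennreal (unit_ball_vol n)"
  unfolding sphere_distribution_altdef
  by (subst nn_integral_distr) (simp_all add: nn_integral_uniform_measure emeasure_unit_ball_n)

text \<open>A point of norm zero has coordinate sum zero, and this hyperplane is already known to be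
  null.\<close>

lemma AE_norm_n_pos:
  assumes "n \<ge> 1"
  shows "AE x in lebesgue_n n. L2_set x {..<n} > 0"
proof (rule AE_I)
  show "{x \<in> space (lebesgue_n n). \<not> L2_set x {..<n} > 0} \<subseteq>
      {x \<in> space (lebesgue_n n). (\<Sum>i<n. 1 * x i) = 0}"
  proof clarsimp
    fix x :: "nat \<Rightarrow> real" assume "\<not> 0 < L2_set x {..<n}"
    then have "L2_set x {..<n} = 0"
      using L2_set_nonneg[of x "{..<n}"] by linarith
    then show "sum x {..<n} = 0"
      by (simp add: L2_set_eq_0_iff)
  qed
  show "emeasure (lebesgue_n n) {x \<in> space (lebesgue_n n). (\<Sum>i<n. 1 * x i) = 0} = 0"
    by (rule emeasure_hyperplane) (use assms in \<open>auto intro!: exI[of _ 0]\<close>)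
qed (rule sets_hyperplane)

lemma AE_sphere_distribution:
  assumes "n \<ge> 1"
  shows "AE u in sphere_distribution n. L2_set u {..<n} = 1"
proof -
  have [measurable]: "{x \<in> space (lebesgue_n n). L2_set x {..<n} = 1} \<in> sets (lebesgue_n n)"
    by measurable
  have "AE x in lebesgue_n n. L2_set (\<lambda>k\<in>{..<n}. x k / L2_set x {..<n}) {..<n} = 1"
    using AE_norm_n_pos[OF assms]
  proof eventually_elim
    case (elim x)
    have "(\<lambda>k\<in>{..<n}. x k / L2_set x {..<n}) = (\<lambda>k\<in>{..<n}. inverse (L2_set x {..<n}) * x k)"
      by (simp add: field_simps)
    then show ?case
      using elim by (simp only: L2_set_scale) simp
  qed
  then have "AE x in uniform_measure (lebesgue_n n) (unit_ball_n n).
      L2_set (\<lambda>k\<in>{..<n}. x k / L2_set x {..<n}) {..<n} = 1"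
    by (intro AE_uniform_measureI) (auto elim: eventually_mono)
  then show ?thesis
    unfolding sphere_distribution_altdef by (subst AE_distr_iff) auto
qed

text \<open>This integral removes the auxiliary scale \<open>v\<close> from the polar coordinate
  formula below.\<close>

lemma nn_integral_inverse_power:
  assumes "a > 0" "n \<ge> 1"
  shows "(\<integral>\<^sup>+v. ennreal (1 / v ^ (n + 1)) * indicator {a..} v \<partial>lborel) = ennreal (1 / (n * a ^ n))"
proof -
  have "(\<integral>\<^sup>+v. ennreal (1 / v ^ (n + 1)) * indicator {a..} v \<partial>lborel) = ennreal (0 - (- 1 / (n * a ^ n)))"
  proof (rule nn_integral_FTC_atLeast)
    show "DERIV (\<lambda>v. - 1 / (real n * v ^ n)) v :> 1 / v ^ (n + 1)" if "a \<le> v" for v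
      using that assms
      by (auto intro!: derivative_eq_intros simp: field_simps power_add[symmetric] power2_eq_square simp flip: power_Suc)
    show "((\<lambda>v. - 1 / (real n * v ^ n)) \<longlongrightarrow> 0) at_top"
      using assms
      by (intro tendsto_divide_0[OF tendsto_const] filterlim_at_top_imp_at_infinity
          filterlim_tendsto_pos_mult_at_top[OF tendsto_const] filterlim_pow_at_top filterlim_ident) auto
  qed (use assms in auto)
  then show ?thesis by simp
qed

lemma measurable_scale_pair: "(\<lambda>p. \<lambda>k\<in>{..<n}. snd p * fst p k) \<in> lebesgue_n n \<Otimes>\<^sub>M lborel \<rightarrow>\<^sub>M lebesgue_n n"
  by (intro measurable_restrict) measurable

text \<open>The sphere law is the image of the uniform law on the ball, so the right side is an
  integral over a ball point \<open>x\<close> and a radius \<open>r\<close>. Put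
  \<open>r = |x| v\<close> and then, for each fixed \<open>v\<close>, \<open>y = v x\<close>. The
  direction disappears, and integrating over the scales \<open>v \<ge> |y|\<close> leaves
  \<open>f y / n\<close>. Neither angles nor their Jacobian occur.\<close>

theorem nn_integral_polar:
  assumes f [measurable]: "f \<in> borel_measurable (lebesgue_n n)" and n: "n \<ge> 1"
  shows "(\<integral>\<^sup>+x. f x \<partial>lebesgue_n n) = ennreal (real n * unit_ball_vol n) *
    (\<integral>\<^sup>+u. \<integral>\<^sup>+r. indicator {0<..} r * ennreal (r ^ (n - 1)) * f (\<lambda>k\<in>{..<n}. r * u k) \<partial>lborel \<partial>sphere_distribution n)"
proof -
  interpret L: sigma_finite_measure "lebesgue_n n" by (rule lborel_product.sigma_finite) simp
  interpret LL: pair_sigma_finite "lebesgue_n n" "lborel :: real measure" ..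
  define N where "N = (\<lambda>x. L2_set x {..<n})"
  have N [measurable]: "N \<in> borel_measurable (lebesgue_n n)"
    unfolding N_def by measurable
  have N0: "N x \<ge> 0" for x by (simp add: N_def)
  define G where "G = (\<lambda>u. \<integral>\<^sup>+r. indicator {0<..} r * ennreal (r ^ (n - 1)) * f (\<lambda>k\<in>{..<n}. r * u k) \<partial>lborel)"
  have f2 [measurable]: "(\<lambda>p. f (\<lambda>k\<in>{..<n}. snd p * fst p k)) \<in> borel_measurable (lebesgue_n n \<Otimes>\<^sub>M lborel)"
    by (rule measurable_compose[OF measurable_scale_pair f])
  have fsec [measurable]: "(\<lambda>r. f (\<lambda>k\<in>{..<n}. r * u k)) \<in> borel_measurable borel" for u
  proof -
    have "(\<lambda>r. \<lambda>k\<in>{..<n}. r * u k) \<in> borel \<rightarrow>\<^sub>M lebesgue_n n"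
      by (intro measurable_restrict) measurable
    from measurable_compose[OF this f] show ?thesis .
  qed
  have G [measurable]: "G \<in> borel_measurable (lebesgue_n n)"
  proof -
    have "(\<lambda>p. indicator {0<..} (snd p) * ennreal (snd p ^ (n - 1)) * f (\<lambda>k\<in>{..<n}. snd p * fst p k))
        \<in> borel_measurable (lebesgue_n n \<Otimes>\<^sub>M lborel)"
      by measurable
    then show ?thesis
      unfolding G_def by (intro lborel.borel_measurable_nn_integral) (simp only: split_def)
  qed
  \<comment> \<open>The integrand after \<open>r = |x| v\<close>, in the variables \<open>x\<close>
    and \<open>v\<close>; the factor \<open>N x ^ n\<close> collects \<open>r ^ (n - 1)\<close> and
    the differential.\<close>
  define K where "K = (\<lambda>x v. indicator (unit_ball_n n) x * ennreal (N x ^ n) * indicator {0<..} v *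
    ennreal (v ^ (n - 1)) * f (\<lambda>k\<in>{..<n}. v * x k))"
  \<comment> \<open>The same integrand in \<open>y = v x\<close>. The ball condition on
    \<open>x\<close> has become \<open>N y \<le> v\<close>, and the power \<open>v ^ (n + 1)\<close>
    in the denominator includes the Jacobian of the scaling.\<close>
  define K' where "K' = (\<lambda>y v. f y * ennreal (N y ^ n) * (ennreal (1 / v ^ (n + 1)) * (if N y \<le> v then 1 else 0)) * (if 0 < v then 1 else 0))"
  have "(\<integral>\<^sup>+u. G u \<partial>sphere_distribution n) =
      (\<integral>\<^sup>+x. G (\<lambda>k\<in>{..<n}. x k / N x) * indicator (unit_ball_n n) x \<partial>lebesgue_n n) / ennreal (unit_ball_vol n)"
    unfolding N_def by (rule nn_integral_sphere_distribution) measurable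
  also have "(\<integral>\<^sup>+x. G (\<lambda>k\<in>{..<n}. x k / N x) * indicator (unit_ball_n n) x \<partial>lebesgue_n n) =
      (\<integral>\<^sup>+x. \<integral>\<^sup>+v. K x v \<partial>lborel \<partial>lebesgue_n n)"
  proof (rule nn_integral_cong_AE)
    show "AE x in lebesgue_n n. G (\<lambda>k\<in>{..<n}. x k / N x) * indicator (unit_ball_n n) x = (\<integral>\<^sup>+v. K x v \<partial>lborel)"
      using AE_norm_n_pos[OF n]
    proof eventually_elim
      case (elim x)
      then have pos: "N x > 0" by (simp add: N_def)
      have "G (\<lambda>k\<in>{..<n}. x k / N x) = ennreal \<bar>N x\<bar> * (\<integral>\<^sup>+v. indicator {0<..} (0 + N x * v) *
          ennreal ((0 + N x * v) ^ (n - 1)) * f (\<lambda>k\<in>{..<n}. (0 + N x * v) * (\<lambda>k\<in>{..<n}. x k / N x) k) \<partial>lborel)"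
        unfolding G_def by (rule nn_integral_real_affine) (use pos in \<open>measurable, simp\<close>)
      also have "\<dots> = ennreal (N x) * (\<integral>\<^sup>+v. ennreal (N x ^ (n - 1)) *
          (indicator {0<..} v * ennreal (v ^ (n - 1)) * f (\<lambda>k\<in>{..<n}. v * x k)) \<partial>lborel)"
      proof -
        have "(\<lambda>k\<in>{..<n}. (0 + N x * v) * (\<lambda>k\<in>{..<n}. x k / N x) k) = (\<lambda>k\<in>{..<n}. v * x k)" for v
          using pos by (auto simp: fun_eq_iff restrict_def)
        moreover have "indicator {0<..} (0 + N x * v) * ennreal ((0 + N x * v) ^ (n - 1)) =
            ennreal (N x ^ (n - 1)) * (indicator {0<..} v * ennreal (v ^ (n - 1)))" for v
          using pos by (cases "v > 0") (auto simp: power_mult_distrib ennreal_mult zero_less_mult_iff)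
        ultimately show ?thesis
          using pos by (simp add: mult.assoc)
      qed
      also have "\<dots> = ennreal (N x) * ennreal (N x ^ (n - 1)) *
          (\<integral>\<^sup>+v. indicator {0<..} v * ennreal (v ^ (n - 1)) * f (\<lambda>k\<in>{..<n}. v * x k) \<partial>lborel)"
        by (subst nn_integral_cmult) (simp_all add: mult.assoc)
      also have "ennreal (N x) * ennreal (N x ^ (n - 1)) = ennreal (N x ^ n)"
        using n N0 by (simp add: ennreal_mult[symmetric] power_Suc[symmetric] del: power_Suc)
      finally have "G (\<lambda>k\<in>{..<n}. x k / N x) * indicator (unit_ball_n n) x =
          ennreal (N x ^ n) * indicator (unit_ball_n n) x *
          (\<integral>\<^sup>+v. indicator {0<..} v * ennreal (v ^ (n - 1)) * f (\<lambda>k\<in>{..<n}. v * x k) \<partial>lborel)"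
        by (simp only: mult_ac)
      also have "\<dots> = (\<integral>\<^sup>+v. ennreal (N x ^ n) * indicator (unit_ball_n n) x *
          (indicator {0<..} v * ennreal (v ^ (n - 1)) * f (\<lambda>k\<in>{..<n}. v * x k)) \<partial>lborel)"
        by (rule nn_integral_cmult[symmetric]) measurable
      also have "\<dots> = (\<integral>\<^sup>+v. K x v \<partial>lborel)"
        by (simp only: K_def mult_ac)
      finally show ?case .
    qed
  qed
  also have "\<dots> = (\<integral>\<^sup>+v. \<integral>\<^sup>+x. K x v \<partial>lebesgue_n n \<partial>lborel)"
  proof (rule LL.Fubini'[symmetric])
    show "(\<lambda>(x, v). K x v) \<in> borel_measurable (lebesgue_n n \<Otimes>\<^sub>M lborel)"
      unfolding K_def split_def by measurable
  qed
  also have "\<dots> = (\<integral>\<^sup>+v. \<integral>\<^sup>+y. K' y v \<partial>lebesgue_n n \<partial>lborel)"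
  proof (rule nn_integral_cong)
    fix v :: real
    show "(\<integral>\<^sup>+x. K x v \<partial>lebesgue_n n) = (\<integral>\<^sup>+y. K' y v \<partial>lebesgue_n n)"
    proof (cases "v > 0")
      case True
      have [measurable]: "(\<lambda>x. f (\<lambda>k\<in>{..<n}. v * x k)) \<in> borel_measurable (lebesgue_n n)"
        using measurable_compose[OF measurable_Pair2'[of v] f2] by (simp only: fst_conv snd_conv) simp
      have "(\<integral>\<^sup>+y. K' y v \<partial>lebesgue_n n) = ennreal (\<bar>v\<bar> ^ n) * (\<integral>\<^sup>+x. K' (\<lambda>k\<in>{..<n}. v * x k) v \<partial>lebesgue_n n)"
      proof (rule nn_integral_lebesgue_n_scale)
        show "(\<lambda>y. K' y v) \<in> borel_measurable (lebesgue_n n)"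
          unfolding K'_def by measurable
      qed (use True in simp)
      also have "\<dots> = (\<integral>\<^sup>+x. ennreal (\<bar>v\<bar> ^ n) * K' (\<lambda>k\<in>{..<n}. v * x k) v \<partial>lebesgue_n n)"
      proof (rule nn_integral_cmult[symmetric])
        have "(\<lambda>x. f (\<lambda>k\<in>{..<n}. v * x k) * ennreal ((\<bar>v\<bar> * N x) ^ n) *
            (ennreal (1 / v ^ (n + 1)) * (if \<bar>v\<bar> * N x \<le> v then 1 else 0)) * (if 0 < v then 1 else 0))
            \<in> borel_measurable (lebesgue_n n)"
          by measurable
        then show "(\<lambda>x. K' (\<lambda>k\<in>{..<n}. v * x k) v) \<in> borel_measurable (lebesgue_n n)"
          unfolding K'_def N_def L2_set_scale .
      qed
      also have "\<dots> = (\<integral>\<^sup>+x. K x v \<partial>lebesgue_n n)"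
      proof (rule nn_integral_cong)
        fix x assume x: "x \<in> space (lebesgue_n n)"
        have "v ^ n * ((v * N x) ^ n * (1 / v ^ (n + 1))) = N x ^ n * v ^ (n - 1)"
          using True n by (cases n) (auto simp: power_mult_distrib field_simps)
        then have "ennreal (v ^ n) * (ennreal ((v * N x) ^ n) * ennreal (1 / v ^ (n + 1))) =
            ennreal (N x ^ n) * ennreal (v ^ (n - 1))"
          using True N0[of x] by (simp add: ennreal_mult[symmetric])
        moreover have "(if v * N x \<le> v then 1 else 0) = (indicator (unit_ball_n n) x :: ennreal)"
          using True x by (auto simp: unit_ball_n_def N_def split: split_indicator)
        moreover have "ennreal (\<bar>v\<bar> ^ n) * K' (\<lambda>k\<in>{..<n}. v * x k) v =
            (ennreal (v ^ n) * (ennreal ((v * N x) ^ n) * ennreal (1 / v ^ (n + 1)))) *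
            ((if v * N x \<le> v then 1 else 0) * f (\<lambda>k\<in>{..<n}. v * x k))"
          using True unfolding K'_def N_def L2_set_scale by (simp only: abs_of_pos if_True mult_ac mult_1)
        ultimately have "ennreal (\<bar>v\<bar> ^ n) * K' (\<lambda>k\<in>{..<n}. v * x k) v =
            (ennreal (N x ^ n) * ennreal (v ^ (n - 1))) * (indicator (unit_ball_n n) x * f (\<lambda>k\<in>{..<n}. v * x k))"
          by (simp only:)
        then show "ennreal (\<bar>v\<bar> ^ n) * K' (\<lambda>k\<in>{..<n}. v * x k) v = K x v"
          using True by (simp add: K_def mult_ac)
      qed
      finally show ?thesis by simp
    qed (simp add: K_def K'_def)
  qed
  also have "\<dots> = (\<integral>\<^sup>+y. \<integral>\<^sup>+v. K' y v \<partial>lborel \<partial>lebesgue_n n)"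
  proof (rule LL.Fubini')
    show "(\<lambda>(y, v). K' y v) \<in> borel_measurable (lebesgue_n n \<Otimes>\<^sub>M lborel)"
      unfolding K'_def split_def by measurable
  qed
  also have "\<dots> = (\<integral>\<^sup>+y. f y * ennreal (1 / n) \<partial>lebesgue_n n)"
  proof (rule nn_integral_cong_AE)
    show "AE y in lebesgue_n n. (\<integral>\<^sup>+v. K' y v \<partial>lborel) = f y * ennreal (1 / n)"
      using AE_norm_n_pos[OF n]
    proof eventually_elim
      case (elim y)
      then have pos: "N y > 0" by (simp add: N_def)
      have "K' y v = f y * ennreal (N y ^ n) * (ennreal (1 / v ^ (n + 1)) * indicator {N y..} v)" for v
        using pos by (auto simp: K'_def split: split_indicator)
      then have "(\<integral>\<^sup>+v. K' y v \<partial>lborel) = f y * ennreal (N y ^ n) * ennreal (1 / (n * N y ^ n))"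
        by (simp only:) (subst nn_integral_cmult, measurable, simp only: nn_integral_inverse_power[OF pos n])
      also have "\<dots> = f y * ennreal (1 / n)"
        using pos by (simp add: mult.assoc ennreal_mult[symmetric])
      finally show ?case .
    qed
  qed
  also have "\<dots> = (\<integral>\<^sup>+y. f y \<partial>lebesgue_n n) * ennreal (1 / n)"
    by (rule nn_integral_multc) measurable
  finally have "ennreal (real n * unit_ball_vol n) * (\<integral>\<^sup>+u. G u \<partial>sphere_distribution n) =
      ennreal (real n * unit_ball_vol n) * ((\<integral>\<^sup>+y. f y \<partial>lebesgue_n n) * ennreal (1 / n) / ennreal (unit_ball_vol n))"
    by simp
  also have "\<dots> = (\<integral>\<^sup>+y. f y \<partial>lebesgue_n n) * (ennreal (real n * unit_ball_vol n) * (ennreal (1 / n) / ennreal (unit_ball_vol n)))"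
    by (simp add: divide_ennreal_def mult_ac)
  also have "ennreal (real n * unit_ball_vol n) * (ennreal (1 / n) / ennreal (unit_ball_vol n)) = 1"
    using n less_imp_neq[OF unit_ball_vol_pos[of "real n", OF of_nat_0_le_iff]]
    by (simp add: divide_ennreal ennreal_mult[symmetric])
  finally show ?thesis
    unfolding G_def by simp
qed

text \<open>The angular integral on the right does not involve \<open>\<phi>\<close>. To compare two
  radial weights on homogeneous functions it therefore suffices to compare their radial
  moments.\<close>

lemma nn_integral_homogeneous:
  assumes h [measurable]: "h \<in> borel_measurable (lebesgue_n n)" and \<phi> [measurable]: "\<phi> \<in> borel_measurable borel"
    and hom: "\<And>r u. r > 0 \<Longrightarrow> h (\<lambda>k\<in>{..<n}. r * u k) = ennreal (r powr s) * h u"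
    and n: "n \<ge> 1"
  shows "(\<integral>\<^sup>+x. h x * \<phi> (L2_set x {..<n}) \<partial>lebesgue_n n) =
    ennreal (real n * unit_ball_vol n) * (\<integral>\<^sup>+r. indicator {0<..} r * ennreal (r powr (real n - 1 + s)) * \<phi> r \<partial>lborel) *
    (\<integral>\<^sup>+u. h u \<partial>sphere_distribution n)"
proof -
  have "(\<integral>\<^sup>+x. h x * \<phi> (L2_set x {..<n}) \<partial>lebesgue_n n) = ennreal (real n * unit_ball_vol n) *
    (\<integral>\<^sup>+u. \<integral>\<^sup>+r. indicator {0<..} r * ennreal (r ^ (n - 1)) *
      (h (\<lambda>k\<in>{..<n}. r * u k) * \<phi> (L2_set (\<lambda>k\<in>{..<n}. r * u k) {..<n})) \<partial>lborel \<partial>sphere_distribution n)"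
    by (rule nn_integral_polar) (use n in measurable)
  also have "(\<integral>\<^sup>+u. \<integral>\<^sup>+r. indicator {0<..} r * ennreal (r ^ (n - 1)) *
      (h (\<lambda>k\<in>{..<n}. r * u k) * \<phi> (L2_set (\<lambda>k\<in>{..<n}. r * u k) {..<n})) \<partial>lborel \<partial>sphere_distribution n) =
    (\<integral>\<^sup>+u. (\<integral>\<^sup>+r. indicator {0<..} r * ennreal (r powr (real n - 1 + s)) * \<phi> r \<partial>lborel) * h u \<partial>sphere_distribution n)"
  proof (rule nn_integral_cong_AE)
    show "AE u in sphere_distribution n. (\<integral>\<^sup>+r. indicator {0<..} r * ennreal (r ^ (n - 1)) *
        (h (\<lambda>k\<in>{..<n}. r * u k) * \<phi> (L2_set (\<lambda>k\<in>{..<n}. r * u k) {..<n})) \<partial>lborel) =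
      (\<integral>\<^sup>+r. indicator {0<..} r * ennreal (r powr (real n - 1 + s)) * \<phi> r \<partial>lborel) * h u"
      using AE_sphere_distribution[OF n]
    proof eventually_elim
      case (elim u)
      have "indicator {0<..} r * ennreal (r ^ (n - 1)) *
          (h (\<lambda>k\<in>{..<n}. r * u k) * \<phi> (L2_set (\<lambda>k\<in>{..<n}. r * u k) {..<n})) =
          indicator {0<..} r * ennreal (r powr (real n - 1 + s)) * \<phi> r * h u" for r
      proof (cases "r > 0")
        case True
        have "ennreal (r ^ (n - 1)) * ennreal (r powr s) = ennreal (r powr (real n - 1 + s))"
          using powr_realpow[OF True, of "n - 1"] n True by (simp add: ennreal_mult[symmetric] powr_add of_nat_diff)
        then show ?thesis
          using True hom[OF True, of u] elim by (simp add: L2_set_scale mult_ac)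
      qed simp
      then show ?case
        by (simp add: nn_integral_multc)
    qed
  qed
  also have "\<dots> = (\<integral>\<^sup>+r. indicator {0<..} r * ennreal (r powr (real n - 1 + s)) * \<phi> r \<partial>lborel) * (\<integral>\<^sup>+u. h u \<partial>sphere_distribution n)"
    by (rule nn_integral_cmult) measurable
  finally show ?thesis
    by (simp add: mult.assoc)
qed

lemma nn_integral_radial:
  assumes [measurable]: "\<phi> \<in> borel_measurable borel" and n: "n \<ge> 1"
  shows "(\<integral>\<^sup>+x. \<phi> (L2_set x {..<n}) \<partial>lebesgue_n n) =
    ennreal (real n * unit_ball_vol n) * (\<integral>\<^sup>+r. indicator {0<..} r * ennreal (r powr (real n - 1)) * \<phi> r \<partial>lborel)"
  using nn_integral_homogeneous[of "\<lambda>_. 1" n \<phi> 0] n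
    prob_space.emeasure_space_1[OF prob_space_sphere_distribution[of n]] 
  by (simp add: sets_eq_imp_space_eq[OF sets_sphere_distribution])

text \<open>Substitution is applied on the compact intervals \<open>[0, m]\<close>, and monotone
  convergence in \<open>m\<close> extends it to the half line.\<close>

lemma nn_integral_square_substitution:
  fixes f :: "real \<Rightarrow> real"
  assumes [measurable]: "f \<in> borel_measurable borel" and nonneg: "\<And>x. x > 0 \<Longrightarrow> f x \<ge> 0"
  shows "(\<integral>\<^sup>+r. indicator {0<..} r * ennreal (2 * r * f (r\<^sup>2)) \<partial>lborel) = (\<integral>\<^sup>+x. indicator {0<..} x * ennreal (f x) \<partial>lborel)"
proof -
  have "(\<integral>\<^sup>+x. indicator {0<..} x * ennreal (f x) \<partial>lborel) =
      (SUP m. \<integral>\<^sup>+x. ennreal (indicator {0<..} x * f x) * indicator {0\<^sup>2..(real m)\<^sup>2} x \<partial>lborel)"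
  proof (subst nn_integral_monotone_convergence_SUP[symmetric])
    show "incseq (\<lambda>m x. ennreal (indicator {0<..} x * f x) * indicator {0\<^sup>2..(real m)\<^sup>2} x)"
      by (auto simp: incseq_def le_fun_def split: split_indicator)
         (meson order_trans power_mono of_nat_0_le_iff of_nat_mono)
    have "(SUP m. ennreal (indicator {0<..} x * f x) * indicator {0\<^sup>2..(real m)\<^sup>2} x) = indicator {0<..} x * ennreal (f x)" for x
    proof (cases "x > 0")
      case True
      obtain m :: nat where m: "x \<le> (real m)\<^sup>2"
        using real_arch_simple[of "sqrt x"] by (meson real_sqrt_le_iff sqrt_le_D)
      show ?thesis
      proof (rule antisym)
        show "(SUP m. ennreal (indicator {0<..} x * f x) * indicator {0\<^sup>2..(real m)\<^sup>2} x) \<le> indicator {0<..} x * ennreal (f x)"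
          by (rule SUP_least) (auto split: split_indicator)
        show "indicator {0<..} x * ennreal (f x) \<le> (SUP m. ennreal (indicator {0<..} x * f x) * indicator {0\<^sup>2..(real m)\<^sup>2} x)"
          by (rule SUP_upper2[of m]) (use True m in auto)
      qed
    qed simp
    then show "(\<integral>\<^sup>+x. indicator {0<..} x * ennreal (f x) \<partial>lborel) =
      (\<integral>\<^sup>+x. (SUP m. ennreal (indicator {0<..} x * f x) * indicator {0\<^sup>2..(real m)\<^sup>2} x) \<partial>lborel)"
      by simp
  qed measurable
  also have "\<dots> = (SUP m. \<integral>\<^sup>+r. ennreal ((indicator {0<..} (r\<^sup>2) * f (r\<^sup>2)) * (2 * r)) * indicator {0..real m} r \<partial>lborel)"
  proof (rule SUP_cong[OF refl])
    fix m :: nat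
    have "(\<integral>\<^sup>+x. ennreal ((indicator {0<..} x * f x) * indicator {0\<^sup>2..(real m)\<^sup>2} x) \<partial>lborel) =
      (\<integral>\<^sup>+r. ennreal ((indicator {0<..} (r\<^sup>2) * f (r\<^sup>2)) * (2 * r) * indicator {0..real m} r) \<partial>lborel)"
      by (rule nn_integral_substitution)
         (auto intro!: derivative_eq_intros continuous_intros simp: set_borel_measurable_def)
    then show "(\<integral>\<^sup>+x. ennreal (indicator {0<..} x * f x) * indicator {0\<^sup>2..(real m)\<^sup>2} x \<partial>lborel) =
      (\<integral>\<^sup>+r. ennreal ((indicator {0<..} (r\<^sup>2) * f (r\<^sup>2)) * (2 * r)) * indicator {0..real m} r \<partial>lborel)"
      by (simp add: ennreal_mult'' ennreal_indicator)
  qed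
  also have "\<dots> = (\<integral>\<^sup>+r. indicator {0<..} r * ennreal (2 * r * f (r\<^sup>2)) \<partial>lborel)"
  proof (subst nn_integral_monotone_convergence_SUP[symmetric])
    show "incseq (\<lambda>m r. ennreal ((indicator {0<..} (r\<^sup>2) * f (r\<^sup>2)) * (2 * r)) * indicator {0..real m} r)"
      by (auto simp: incseq_def le_fun_def split: split_indicator)
    have "(SUP m. ennreal ((indicator {0<..} (r\<^sup>2) * f (r\<^sup>2)) * (2 * r)) * indicator {0..real m} r) =
        indicator {0<..} r * ennreal (2 * r * f (r\<^sup>2))" for r
    proof (cases "r > 0")
      case True
      obtain m :: nat where m: "r \<le> real m"
        using real_arch_simple by blast
      show ?thesis
      proof (rule antisym)
        show "(SUP m. ennreal ((indicator {0<..} (r\<^sup>2) * f (r\<^sup>2)) * (2 * r)) * indicator {0..real m} r)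
            \<le> indicator {0<..} r * ennreal (2 * r * f (r\<^sup>2))"
          using True by (intro SUP_least) (auto simp: mult_ac split: split_indicator)
        show "indicator {0<..} r * ennreal (2 * r * f (r\<^sup>2)) \<le>
            (SUP m. ennreal ((indicator {0<..} (r\<^sup>2) * f (r\<^sup>2)) * (2 * r)) * indicator {0..real m} r)"
          by (rule SUP_upper2[of m]) (use True m in \<open>auto simp: mult_ac\<close>)
      qed
    next
      case False
      then show ?thesis by (cases "r = 0") (auto simp: not_less)
    qed
    then show "(\<integral>\<^sup>+r. (SUP m. ennreal ((indicator {0<..} (r\<^sup>2) * f (r\<^sup>2)) * (2 * r)) * indicator {0..real m} r) \<partial>lborel) =
      (\<integral>\<^sup>+r. indicator {0<..} r * ennreal (2 * r * f (r\<^sup>2)) \<partial>lborel)"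
      by simp
  qed measurable
  finally show ?thesis by simp
qed

lemma square_powr: "r > 0 \<Longrightarrow> (r\<^sup>2) powr c = r powr (2 * c)" for r :: real
  using powr_powr[of r 2 c] by simp

lemma ennreal_half: "x \<ge> 0 \<Longrightarrow> ennreal (1 / 2) * ennreal x = ennreal (x / 2)"
  by (subst ennreal_mult[symmetric]) auto

lemma nn_integral_powr_gauss:
  assumes "p > - 1"
  shows "(\<integral>\<^sup>+r. indicator {0<..} r * ennreal (r powr p) * ennreal (exp (- r\<^sup>2)) \<partial>lborel) = ennreal (Gamma ((p + 1) / 2) / 2)"
proof -
  let ?a = "(p + 1) / 2"
  have "indicator {0<..} r * ennreal (r powr p) * ennreal (exp (- r\<^sup>2)) =
      indicator {0<..} r * ennreal (2 * r * ((r\<^sup>2) powr (?a - 1) / exp (r\<^sup>2) / 2))" for r :: real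
  proof (cases "r > 0")
    case True
    have "2 * r * ((r\<^sup>2) powr (?a - 1) / 2) = r powr 1 * r powr (2 * (?a - 1))"
      using True by (simp add: square_powr)
    also have "\<dots> = r powr p"
      using True by (subst powr_add[symmetric]) (simp add: field_simps)
    finally show ?thesis
      using True by (simp add: ennreal_mult[symmetric] exp_minus field_simps)
  qed simp
  then have "(\<integral>\<^sup>+r. indicator {0<..} r * ennreal (r powr p) * ennreal (exp (- r\<^sup>2)) \<partial>lborel) =
      (\<integral>\<^sup>+r. indicator {0<..} r * ennreal (2 * r * ((r\<^sup>2) powr (?a - 1) / exp (r\<^sup>2) / 2)) \<partial>lborel)"
    by simp
  also have "\<dots> = (\<integral>\<^sup>+x. indicator {0<..} x * ennreal (x powr (?a - 1) / exp x / 2) \<partial>lborel)"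
    by (rule nn_integral_square_substitution) (simp_all, measurable)
  also have "\<dots> = (\<integral>\<^sup>+x. ennreal (1 / 2) * ennreal (indicator {0..} x * x powr (?a - 1) / exp x) \<partial>lborel)"
  proof (rule nn_integral_cong)
    fix x :: real
    show "indicator {0<..} x * ennreal (x powr (?a - 1) / exp x / 2) =
        ennreal (1 / 2) * ennreal (indicator {0..} x * x powr (?a - 1) / exp x)"
      by (subst ennreal_half) (auto split: split_indicator)
  qed
  also have "\<dots> = ennreal (1 / 2) * ennreal (Gamma ?a)"
    using assms by (subst nn_integral_cmult) (simp_all add: Gamma_conv_nn_integral_real)
  also have "\<dots> = ennreal (Gamma ?a / 2)"
    using assms by (intro ennreal_half less_imp_le Gamma_real_pos) simp
  finally show ?thesis .
qed

lemma Beta_real_pos: "a > 0 \<Longrightarrow> b > 0 \<Longrightarrow> Beta a b > 0" for a b :: real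
  unfolding Beta_def by (intro divide_pos_pos mult_pos_pos Gamma_real_pos) auto

lemma nn_integral_powr_beta:
  assumes "p > - 1" "b > - 1"
  shows "(\<integral>\<^sup>+r. indicator {0<..} r * ennreal (r powr p) * ennreal (if r < 1 then (1 - r\<^sup>2) powr b else 0) \<partial>lborel) =
    ennreal (Beta ((p + 1) / 2) (b + 1) / 2)"
proof -
  let ?a = "(p + 1) / 2"
  define f where "f = (\<lambda>x :: real. (if x < 1 then x powr (?a - 1) * (1 - x) powr b else 0) / 2)"
  have [measurable]: "f \<in> borel_measurable borel" unfolding f_def by measurable
  have "indicator {0<..} r * ennreal (r powr p) * ennreal (if r < 1 then (1 - r\<^sup>2) powr b else 0) =
      indicator {0<..} r * ennreal (2 * r * f (r\<^sup>2))" for r :: real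
  proof (cases "r > 0")
    case True
    have "2 * r * ((r\<^sup>2) powr (?a - 1) / 2) = r powr 1 * r powr (2 * (?a - 1))"
      using True by (simp add: square_powr)
    also have "\<dots> = r powr p"
      using True by (subst powr_add[symmetric]) (simp add: field_simps)
    finally have "2 * r * ((r\<^sup>2) powr (?a - 1) / 2) = r powr p" .
    moreover have "r\<^sup>2 < 1 \<longleftrightarrow> r < 1"
      using True by (simp add: power2_less_1_iff)
    ultimately show ?thesis
      using True by (auto simp: f_def ennreal_mult[symmetric] field_simps)
  qed simp
  then have "(\<integral>\<^sup>+r. indicator {0<..} r * ennreal (r powr p) * ennreal (if r < 1 then (1 - r\<^sup>2) powr b else 0) \<partial>lborel) =
      (\<integral>\<^sup>+r. indicator {0<..} r * ennreal (2 * r * f (r\<^sup>2)) \<partial>lborel)"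
    by simp
  also have "\<dots> = (\<integral>\<^sup>+x. indicator {0<..} x * ennreal (f x) \<partial>lborel)"
    by (rule nn_integral_square_substitution) (auto simp: f_def)
  also have "\<dots> = (\<integral>\<^sup>+x. ennreal (1 / 2) * (ennreal (x powr (?a - 1) * (1 - x) powr (b + 1 - 1)) * indicator {0..1} x) \<partial>lborel)"
  proof (rule nn_integral_cong)
    fix x :: real
    show "indicator {0<..} x * ennreal (f x) =
        ennreal (1 / 2) * (ennreal (x powr (?a - 1) * (1 - x) powr (b + 1 - 1)) * indicator {0..1} x)"
      unfolding f_def mult.assoc[symmetric] by (subst ennreal_half) (auto split: split_indicator)
  qed
  also have "\<dots> = ennreal (1 / 2) * (\<integral>\<^sup>+x. ennreal (x powr (?a - 1) * (1 - x) powr (b + 1 - 1)) * indicator {0..1} x \<partial>lborel)"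
    by (rule nn_integral_cmult) measurable
  also have "(\<integral>\<^sup>+x. ennreal (x powr (?a - 1) * (1 - x) powr (b + 1 - 1)) * indicator {0..1} x \<partial>lborel) = ennreal (Beta ?a (b + 1))"
    using nn_integral_has_integral_lebesgue[OF _ has_integral_Beta_real[of ?a "b + 1"]] assms
    by (simp add: ennreal_mult'' ennreal_indicator mult_ac)
  also have "ennreal (1 / 2) * ennreal (Beta ?a (b + 1)) = ennreal (Beta ?a (b + 1) / 2)"
    using assms by (intro ennreal_half less_imp_le Beta_real_pos) auto
  finally show ?thesis .
qed

lemma measurable_entry:
  assumes "i \<in> I" "j < n"
  shows "(\<lambda>y. y i j) \<in> borel_measurable (PiM I (\<lambda>_. lebesgue_n n))"
proof -
  have "(\<lambda>x. x j) \<in> borel_measurable (lebesgue_n n)"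
    using assms measurable_component_singleton[of j "{..<n}" "\<lambda>_. lborel :: real measure"] by simp
  from measurable_compose[OF measurable_component_singleton[OF assms(1)] this] show ?thesis .
qed

lemma measurable_row_norm:
  assumes "i \<in> I"
  shows "(\<lambda>y. L2_set (y i) {..<n}) \<in> borel_measurable (PiM I (\<lambda>_. lebesgue_n n))"
  by (rule measurable_compose[OF measurable_component_singleton[OF assms] measurable_norm_n])

subsection \<open>Moments of random determinants\<close>

text \<open>The reflection that exchanges \<open>p\<close> with its norm times the last unit vector.
  It is symmetric, so its last row is the normalised \<open>p\<close>.\<close>

lemma householder:
  fixes p :: "nat \<Rightarrow> real" and N :: nat
  shows "\<exists>U. (\<forall>i j. U i j = U j i) \<and>
    (\<forall>i<Suc N. \<forall>j<Suc N. (\<Sum>k<Suc N. U i k * U k j) = (if i = j then 1 else 0)) \<and>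
    (\<forall>j<Suc N. p j = L2_set p {..<Suc N} * U N j)"
proof -
  define \<rho> where "\<rho> = L2_set p {..<Suc N}"
  define w where "w = (\<lambda>k. p k - (if k = N then \<rho> else 0))"
  define q where "q = (\<Sum>k<Suc N. (w k)\<^sup>2)"
  \<comment> \<open>If \<open>p\<close> already points along the last axis then \<open>w = 0\<close>
    and \<open>q = 0\<close>; division by zero yields \<open>0\<close>, so \<open>U\<close> is the
    identity and this case fits the same formula.\<close>
  define U where "U = (\<lambda>i j. (if i = j then 1 else 0) - 2 * w i * w j / q)"
  have \<rho>: "\<rho>\<^sup>2 = (\<Sum>k<N. (p k)\<^sup>2) + (p N)\<^sup>2"
    by (simp add: \<rho>_def L2_set_def sum_nonneg)
  have "(\<Sum>k<N. (w k)\<^sup>2) = (\<Sum>k<N. (p k)\<^sup>2)"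
    by (rule sum.cong) (auto simp: w_def)
  \<comment> \<open>With \<open>\<rho> = |p|\<close>, expanding gives
    \<open>|w|^2 = 2 \<rho>^2 - 2 \<rho> p_N\<close>.\<close>
  then have q: "q = - (2 * \<rho> * w N)"
    using \<rho> by (simp add: q_def w_def power2_eq_square algebra_simps)
  have U2: "(\<Sum>k<Suc N. U i k * U k j) = (if i = j then 1 else 0)" if "i < Suc N" "j < Suc N" for i j
  proof -
    have "(\<Sum>k<Suc N. U i k * U k j) = (\<Sum>k<Suc N. (if k = i then (if i = j then 1 else 0) else 0)
        - (if k = i then 2 * w k * w j / q else 0) - (if k = j then 2 * w i * w k / q else 0)
        + 4 * w i * w j / q\<^sup>2 * (w k)\<^sup>2)"
      by (rule sum.cong) (auto simp: U_def algebra_simps power2_eq_square)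
    also have "\<dots> = (if i = j then 1 else 0) - 4 * w i * w j / q + 4 * w i * w j / q\<^sup>2 * q"
      using that unfolding sum.distrib sum_subtractf sum_distrib_left[symmetric] q_def[symmetric] by simp
    also have "\<dots> = (if i = j then 1 else 0)"
      by (simp add: power2_eq_square)
    finally show ?thesis .
  qed
  have p: "p j = \<rho> * U N j" if "j < Suc N" for j
  proof (cases "q = 0")
    case True
    have "w j = 0"
      using True that unfolding q_def by (subst (asm) sum_nonneg_eq_0_iff) auto
    then show ?thesis
      using True by (auto simp: U_def w_def split: if_splits)
  next
    case False
    have "\<rho> * U N j = (if N = j then \<rho> else 0) - 2 * \<rho> * w N * w j / q"
      by (simp add: U_def algebra_simps)
    also have "2 * \<rho> * w N = - q"
      using q by simp
    finally show ?thesis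
      using False by (auto simp: w_def)
  qed
  have "\<forall>i j. U i j = U j i"
    by (simp add: U_def mult_ac)
  with U2 p show ?thesis
    unfolding \<rho>_def by blast
qed

lemma nn_integral_gauss: "(\<integral>\<^sup>+x. ennreal (exp (- x\<^sup>2)) \<partial>lborel) = ennreal (sqrt pi)"
proof -
  have eq: "exp (- x\<^sup>2) = sqrt pi * normal_density 0 (1 / sqrt 2) x" for x
    by (simp add: normal_density_def real_sqrt_mult power_divide)
  have "(\<integral>\<^sup>+x. ennreal (exp (- x\<^sup>2)) \<partial>lborel) = ennreal (sqrt pi) * (\<integral>\<^sup>+x. ennreal (normal_density 0 (1 / sqrt 2) x) \<partial>lborel)"
    unfolding eq by (subst nn_integral_cmult[symmetric]) (auto simp: ennreal_mult'[symmetric])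
  also have "(\<integral>\<^sup>+x. ennreal (normal_density 0 (1 / sqrt 2) x) \<partial>lborel) = 1"
    by (subst nn_integral_eq_integral) auto
  finally show ?thesis by simp
qed

lemma nn_integral_gauss_PiM:
  assumes "finite I"
  shows "(\<integral>\<^sup>+v. (\<Prod>i\<in>I. ennreal (exp (- (v i)\<^sup>2))) \<partial>PiM I (\<lambda>_. lborel)) = ennreal (sqrt pi ^ card I)"
  using assms by (subst lborel_product.product_nn_integral_prod) (simp_all add: nn_integral_gauss ennreal_power)

lemma nn_integral_gauss_moment:
  assumes "n \<ge> 1" "s > - real n"
  shows "(\<integral>\<^sup>+x. ennreal (L2_set x {..<n} powr s) * ennreal (exp (- (L2_set x {..<n})\<^sup>2)) \<partial>lebesgue_n n) =
    ennreal (pi powr (real n / 2) * Gamma ((real n + s) / 2) / Gamma (real n / 2))"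
proof -
  \<comment> \<open>The constant of the polar formula is the surface area of the unit
    sphere.\<close>
  have vol: "real n * unit_ball_vol n = 2 * pi powr (real n / 2) / Gamma (real n / 2)"
  proof -
    have g: "Gamma (real n / 2 + 1) = real n / 2 * Gamma (real n / 2)"
      using assms by (intro Gamma_plus1) (auto elim!: nonpos_Ints_cases)
    show ?thesis
      unfolding unit_ball_vol_def g using assms Gamma_real_pos[of "real n / 2"] by simp
  qed
  have "(\<integral>\<^sup>+x. ennreal (L2_set x {..<n} powr s) * ennreal (exp (- (L2_set x {..<n})\<^sup>2)) \<partial>lebesgue_n n) =
      ennreal (real n * unit_ball_vol n) * (\<integral>\<^sup>+r. indicator {0<..} r * ennreal (r powr (real n - 1)) *
      (ennreal (r powr s) * ennreal (exp (- r\<^sup>2))) \<partial>lborel)"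
    by (rule nn_integral_radial[of "\<lambda>r. ennreal (r powr s) * ennreal (exp (- r\<^sup>2))"]) (use assms in measurable)
  also have "(\<integral>\<^sup>+r. indicator {0<..} r * ennreal (r powr (real n - 1)) * (ennreal (r powr s) * ennreal (exp (- r\<^sup>2))) \<partial>lborel) =
      (\<integral>\<^sup>+r. indicator {0<..} r * ennreal (r powr (real n - 1 + s)) * ennreal (exp (- r\<^sup>2)) \<partial>lborel)"
    by (intro nn_integral_cong) (simp add: powr_add ennreal_mult mult_ac)
  also have "\<dots> = ennreal (Gamma ((real n + s) / 2) / 2)"
    using nn_integral_powr_gauss[of "real n - 1 + s"] assms by simp
  finally have "(\<integral>\<^sup>+x. ennreal (L2_set x {..<n} powr s) * ennreal (exp (- (L2_set x {..<n})\<^sup>2)) \<partial>lebesgue_n n) =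
      ennreal (real n * unit_ball_vol n) * ennreal (Gamma ((real n + s) / 2) / 2)" .
  then show ?thesis
    unfolding vol using assms Gamma_real_pos[of "real n / 2"] Gamma_real_pos[of "(real n + s) / 2"]
    by (subst (asm) ennreal_mult[symmetric]) (auto simp: field_simps)
qed

text \<open>The Gaussian weight is not normalised. Its total mass, a power of
  \<open>sqrt pi\<close>, is cancelled at the end by the constants of the beta densities and the
  hyperplane integral.\<close>

definition gauss_det_integral :: "nat \<Rightarrow> real \<Rightarrow> ennreal" where
  "gauss_det_integral N s = (\<integral>\<^sup>+y. ennreal (\<bar>mdet N y\<bar> powr s) *
     (\<Prod>i<N. ennreal (exp (- (L2_set (y i) {..<N})\<^sup>2))) \<partial>PiM {..<N} (\<lambda>_. lebesgue_n N))"

text \<open>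
  A Householder reflection maps the last row to a multiple of the last unit vector and leaves
  the Gaussian measure of the other rows invariant.
\<close>

lemma gauss_det_integral_row:
  assumes pos: "L2_set p {..<Suc N} > 0"
  shows "(\<integral>\<^sup>+y. ennreal (\<bar>mdet (Suc N) (y(N := p))\<bar> powr s) *
      (\<Prod>i<N. ennreal (exp (- (L2_set (y i) {..<Suc N})\<^sup>2))) \<partial>PiM {..<N} (\<lambda>_. lebesgue_n (Suc N))) =
    ennreal (L2_set p {..<Suc N} powr s) * (ennreal (sqrt pi ^ N) * gauss_det_integral N s)"
proof -
  obtain U where U: "\<And>i j. U i j = U j i"
    "\<And>i j. i < Suc N \<Longrightarrow> j < Suc N \<Longrightarrow> (\<Sum>k<Suc N. U i k * U k j) = (if i = j then 1 else (0::real))"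
    "\<And>j. j < Suc N \<Longrightarrow> p j = L2_set p {..<Suc N} * U N j"
    using householder[of N p] by blast
  define \<rho> where "\<rho> = L2_set p {..<Suc N}"
  \<comment> \<open>\<open>U\<close> is its own inverse, so its determinant squares to one.\<close>
  have detU: "\<bar>mdet (Suc N) U\<bar> = 1"
  proof -
    have "mdet (Suc N) U * mdet (Suc N) U = mdet (Suc N) (\<lambda>i j. if i = j then 1 else 0)"
      unfolding mdet_mult[symmetric] by (rule mdet_cong) (rule U(2))
    then show ?thesis
      by (metis abs_1 abs_mult_self_eq mdet_one abs_square_eq_1 power2_eq_square)
  qed
  define \<tau> where "\<tau> = affine_n (Suc N) U (\<lambda>_. 0)"
  have iso: "L2_set (\<tau> x) {..<Suc N} = L2_set x {..<Suc N}" for x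
  proof -
    have "(\<Sum>i<Suc N. (\<tau> x i)\<^sup>2) = (\<Sum>i<Suc N. \<Sum>j<Suc N. \<Sum>k<Suc N. x j * x k * (U j i * U i k))"
    proof (rule sum.cong[OF refl])
      fix i assume "i \<in> {..<Suc N}"
      then have "(\<tau> x i)\<^sup>2 = (\<Sum>j<Suc N. U i j * x j) * (\<Sum>k<Suc N. U i k * x k)"
        by (simp add: \<tau>_def affine_n_def power2_eq_square del: sum.lessThan_Suc)
      also have "\<dots> = (\<Sum>j<Suc N. \<Sum>k<Suc N. x j * x k * (U j i * U i k))"
        unfolding sum_product by (intro sum.cong refl) (simp add: U(1)[of i] mult_ac)
      finally show "(\<tau> x i)\<^sup>2 = (\<Sum>j<Suc N. \<Sum>k<Suc N. x j * x k * (U j i * U i k))" .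
    qed
    also have "\<dots> = (\<Sum>j<Suc N. \<Sum>i<Suc N. \<Sum>k<Suc N. x j * x k * (U j i * U i k))"
      by (rule sum.swap)
    also have "\<dots> = (\<Sum>j<Suc N. \<Sum>k<Suc N. x j * x k * (\<Sum>i<Suc N. U j i * U i k))"
      unfolding sum_distrib_left by (intro sum.cong refl sum.swap)
    also have "\<dots> = (\<Sum>j<Suc N. \<Sum>k<Suc N. if k = j then (x j)\<^sup>2 else 0)"
      by (intro sum.cong refl) (auto simp: U(2) power2_eq_square simp del: sum.lessThan_Suc)
    also have "\<dots> = (\<Sum>j<Suc N. (x j)\<^sup>2)"
      by (intro sum.cong refl) (simp del: sum.lessThan_Suc)
    finally show ?thesis
      by (simp add: L2_set_def del: sum.lessThan_Suc)
  qed
  define H where "H = (\<lambda>y. ennreal (\<bar>mdet (Suc N) (y(N := p))\<bar> powr s) *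
      (\<Prod>i<N. ennreal (exp (- (L2_set (y i) {..<Suc N})\<^sup>2))))"
  have gauss_meas: "(\<lambda>y. \<Prod>i<N. ennreal (exp (- (L2_set (y i) {..<m})\<^sup>2))) \<in> borel_measurable (PiM {..<N} (\<lambda>_. lebesgue_n m))" for m
    by (intro borel_measurable_prod_ennreal measurable_compose[OF measurable_row_norm[of _ "{..<N}" m]]) auto
  have H [measurable]: "H \<in> borel_measurable (PiM {..<N} (\<lambda>_. lebesgue_n (Suc N)))"
  proof -
    have "(\<lambda>y. mdet (Suc N) (y(N := p))) \<in> borel_measurable (PiM {..<N} (\<lambda>_. lebesgue_n (Suc N)))"
    proof (rule borel_measurable_mdet)
      fix i j assume "i < Suc N" "j < Suc N"
      then show "(\<lambda>y. (y(N := p)) i j) \<in> borel_measurable (PiM {..<N} (\<lambda>_. lebesgue_n (Suc N)))"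
        using measurable_entry[of i "{..<N}" j "Suc N"] by (cases "i = N") auto
    qed
    with gauss_meas[of "Suc N"] show ?thesis
      unfolding H_def by measurable
  qed
  have "(\<integral>\<^sup>+y. H y \<partial>PiM {..<N} (\<lambda>_. lebesgue_n (Suc N))) =
      1 ^ card {..<N} * (\<integral>\<^sup>+y. H (\<lambda>i\<in>{..<N}. \<tau> (y i)) \<partial>PiM {..<N} (\<lambda>_. lebesgue_n (Suc N)))"
  proof (rule nn_integral_PiM_rowwise[where Q = "\<lambda>_. True" and N = "lebesgue_n (Suc N)"])
    show "\<tau> \<in> lebesgue_n (Suc N) \<rightarrow>\<^sub>M lebesgue_n (Suc N)"
      unfolding \<tau>_def by (rule measurable_affine_n)
    show "(\<integral>\<^sup>+y. h y \<partial>lebesgue_n (Suc N)) = 1 * (\<integral>\<^sup>+y. h (\<tau> y) \<partial>lebesgue_n (Suc N))"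
      if "h \<in> borel_measurable (lebesgue_n (Suc N))" for h
      unfolding \<tau>_def using nn_integral_affine_n[OF _ that, of U "\<lambda>_. 0"] detU by auto
  qed (auto intro: lborel_product.sigma_finite)
  also have "\<dots> = (\<integral>\<^sup>+y. ennreal (\<rho> powr s) * (ennreal (\<bar>mdet N y\<bar> powr s) *
      (\<Prod>i<N. ennreal (exp (- (L2_set (y i) {..<Suc N})\<^sup>2)))) \<partial>PiM {..<N} (\<lambda>_. lebesgue_n (Suc N)))"
  proof -
    have "H (\<lambda>i\<in>{..<N}. \<tau> (y i)) = ennreal (\<rho> powr s) * (ennreal (\<bar>mdet N y\<bar> powr s) *
      (\<Prod>i<N. ennreal (exp (- (L2_set (y i) {..<Suc N})\<^sup>2))))" for y
    proof -
      \<comment> \<open>In reflected coordinates the last row is \<open>\<rho>\<close> times the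
        last unit vector; multiplying \<open>y'\<close> by \<open>U\<close> restores
        \<open>p\<close> and reflects the other rows.\<close>
      define y' where "y' = y(N := \<lambda>k. if k = N then \<rho> else 0)"
      have "mdet (Suc N) ((\<lambda>i\<in>{..<N}. \<tau> (y i))(N := p)) = mdet (Suc N) (\<lambda>i j. \<Sum>k<Suc N. y' i k * U k j)"
      proof (rule mdet_cong)
        fix i j assume ij: "i < Suc N" "j < Suc N"
        show "((\<lambda>i\<in>{..<N}. \<tau> (y i))(N := p)) i j = (\<Sum>k<Suc N. y' i k * U k j)"
        proof (cases "i = N")
          case True
          have "(\<Sum>k<N. y' N k * U k j) = 0"
            by (rule sum.neutral) (simp add: y'_def)
          then show ?thesis
            using True U(3)[OF ij(2)] by (simp add: y'_def \<rho>_def)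
        next
          case False
          then show ?thesis
            using ij U(1) by (simp add: y'_def \<tau>_def affine_n_def mult.commute del: sum.lessThan_Suc)
        qed
      qed
      also have "\<dots> = mdet (Suc N) y' * mdet (Suc N) U"
        by (rule mdet_mult)
      also have "mdet (Suc N) y' = \<rho> * mdet N y"
      proof -
        have "mdet (Suc N) y' = y' N N * mdet N y'"
          by (rule mdet_last_row) (simp add: y'_def)
        moreover have "mdet N y' = mdet N y"
          by (rule mdet_cong) (simp add: y'_def)
        ultimately show ?thesis by (simp add: y'_def)
      qed
      finally have det: "mdet (Suc N) ((\<lambda>i\<in>{..<N}. \<tau> (y i))(N := p)) = \<rho> * mdet N y * mdet (Suc N) U" .
      have "\<bar>mdet (Suc N) ((\<lambda>i\<in>{..<N}. \<tau> (y i))(N := p))\<bar> powr s = \<rho> powr s * \<bar>mdet N y\<bar> powr s"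
        unfolding det using pos detU by (simp add: abs_mult powr_mult \<rho>_def)
      moreover have "(\<Prod>i<N. ennreal (exp (- (L2_set ((\<lambda>i\<in>{..<N}. \<tau> (y i)) i) {..<Suc N})\<^sup>2))) =
          (\<Prod>i<N. ennreal (exp (- (L2_set (y i) {..<Suc N})\<^sup>2)))"
        by (rule prod.cong) (simp_all add: iso)
      ultimately show ?thesis
        unfolding H_def by (simp only: ennreal_mult powr_ge_zero mult.assoc)
    qed
    then show ?thesis by simp
  qed
  also have "\<dots> = ennreal (\<rho> powr s) * (\<integral>\<^sup>+y. ennreal (\<bar>mdet N y\<bar> powr s) *
      (\<Prod>i<N. ennreal (exp (- (L2_set (y i) {..<Suc N})\<^sup>2))) \<partial>PiM {..<N} (\<lambda>_. lebesgue_n (Suc N)))"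
    (is "_ = _ * integral\<^sup>N _ ?K")
  proof (rule nn_integral_cmult)
    have "(\<lambda>y. mdet N y) \<in> borel_measurable (PiM {..<N} (\<lambda>_. lebesgue_n (Suc N)))"
      by (rule borel_measurable_mdet) (simp add: measurable_entry)
    with gauss_meas[of "Suc N"] show "?K \<in> borel_measurable (PiM {..<N} (\<lambda>_. lebesgue_n (Suc N)))"
      by measurable
  qed
  \<comment> \<open>The minor of order \<open>N\<close> does not see the last entry of any row, so
    these entries split off and contribute one Gaussian integral each.\<close>
  also have "integral\<^sup>N (PiM {..<N} (\<lambda>_. lebesgue_n (Suc N))) ?K =
      (\<integral>\<^sup>+z. \<integral>\<^sup>+v. ?K (\<lambda>i\<in>{..<N}. (z i)(N := v i)) \<partial>PiM {..<N} (\<lambda>_. lborel) \<partial>PiM {..<N} (\<lambda>_. lebesgue_n N))"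
  proof (rule nn_integral_rows_Suc)
    have "(\<lambda>y. mdet N y) \<in> borel_measurable (PiM {..<N} (\<lambda>_. lebesgue_n (Suc N)))"
      by (rule borel_measurable_mdet) (simp add: measurable_entry)
    with gauss_meas[of "Suc N"] show "?K \<in> borel_measurable (PiM {..<N} (\<lambda>_. lebesgue_n (Suc N)))"
      by measurable
  qed simp
  also have "\<dots> = (\<integral>\<^sup>+z. \<integral>\<^sup>+v. ennreal (\<bar>mdet N z\<bar> powr s) * (\<Prod>i<N. ennreal (exp (- (L2_set (z i) {..<N})\<^sup>2))) *
      (\<Prod>i<N. ennreal (exp (- (v i)\<^sup>2))) \<partial>PiM {..<N} (\<lambda>_. lborel) \<partial>PiM {..<N} (\<lambda>_. lebesgue_n N))"
  proof (intro nn_integral_cong)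
    fix z :: "nat \<Rightarrow> nat \<Rightarrow> real" and v :: "nat \<Rightarrow> real"
    have "mdet N (\<lambda>i\<in>{..<N}. (z i)(N := v i)) = mdet N z"
      by (rule mdet_cong) simp
    moreover have "ennreal (exp (- (L2_set ((\<lambda>i\<in>{..<N}. (z i)(N := v i)) i) {..<Suc N})\<^sup>2)) =
        ennreal (exp (- (L2_set (z i) {..<N})\<^sup>2)) * ennreal (exp (- (v i)\<^sup>2))" if "i < N" for i
    proof -
      have "(L2_set ((\<lambda>i\<in>{..<N}. (z i)(N := v i)) i) {..<Suc N})\<^sup>2 = (L2_set (z i) {..<N})\<^sup>2 + (v i)\<^sup>2"
        using that by (simp add: L2_set_def sum_nonneg)
      then show ?thesis
        by (simp add: ennreal_mult[symmetric] exp_add[symmetric])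
    qed
    ultimately show "?K (\<lambda>i\<in>{..<N}. (z i)(N := v i)) = ennreal (\<bar>mdet N z\<bar> powr s) *
        (\<Prod>i<N. ennreal (exp (- (L2_set (z i) {..<N})\<^sup>2))) * (\<Prod>i<N. ennreal (exp (- (v i)\<^sup>2)))"
      by (simp add: prod.distrib mult.assoc)
  qed
  also have "\<dots> = (\<integral>\<^sup>+z. ennreal (\<bar>mdet N z\<bar> powr s) * (\<Prod>i<N. ennreal (exp (- (L2_set (z i) {..<N})\<^sup>2))) *
      ennreal (sqrt pi ^ N) \<partial>PiM {..<N} (\<lambda>_. lebesgue_n N))"
    by (intro nn_integral_cong, subst nn_integral_cmult)
      (auto simp: nn_integral_gauss_PiM intro!: borel_measurable_prod_ennreal measurable_compose[OF measurable_component_singleton])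
  also have "\<dots> = gauss_det_integral N s * ennreal (sqrt pi ^ N)"
    unfolding gauss_det_integral_def
  proof (rule nn_integral_multc)
    have "(\<lambda>y. mdet N y) \<in> borel_measurable (PiM {..<N} (\<lambda>_. lebesgue_n N))"
      by (rule borel_measurable_mdet) (simp add: measurable_entry)
    with gauss_meas[of N] show "(\<lambda>z. ennreal (\<bar>mdet N z\<bar> powr s) * (\<Prod>i<N. ennreal (exp (- (L2_set (z i) {..<N})\<^sup>2))))
      \<in> borel_measurable (PiM {..<N} (\<lambda>_. lebesgue_n N))"
      by measurable
  qed
  finally show ?thesis
    unfolding H_def \<rho>_def by (simp add: mult_ac)
qed

lemma gauss_det_integral_Suc:
  "gauss_det_integral (Suc N) s = ennreal (sqrt pi ^ N) * gauss_det_integral N s *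
    (\<integral>\<^sup>+p. ennreal (L2_set p {..<Suc N} powr s) * ennreal (exp (- (L2_set p {..<Suc N})\<^sup>2)) \<partial>lebesgue_n (Suc N))"
proof -
  interpret L: product_sigma_finite "\<lambda>_. lebesgue_n (Suc N)" by (rule product_sigma_finite_lebesgue_n)
  define F where "F = (\<lambda>y. ennreal (\<bar>mdet (Suc N) y\<bar> powr s) *
     (\<Prod>i<Suc N. ennreal (exp (- (L2_set (y i) {..<Suc N})\<^sup>2))))"
  have F: "F \<in> borel_measurable (PiM {..<Suc N} (\<lambda>_. lebesgue_n (Suc N)))"
  proof -
    have "(\<lambda>y. \<Prod>i<Suc N. ennreal (exp (- (L2_set (y i) {..<Suc N})\<^sup>2))) \<in> borel_measurable (PiM {..<Suc N} (\<lambda>_. lebesgue_n (Suc N)))"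
      by (intro borel_measurable_prod_ennreal measurable_compose[OF measurable_row_norm[of _ "{..<Suc N}" "Suc N"]]) auto
    moreover have "(\<lambda>y. mdet (Suc N) y) \<in> borel_measurable (PiM {..<Suc N} (\<lambda>_. lebesgue_n (Suc N)))"
      by (rule borel_measurable_mdet) (simp add: measurable_entry)
    ultimately show ?thesis
      unfolding F_def by measurable
  qed
  have "gauss_det_integral (Suc N) s = (\<integral>\<^sup>+y. F y \<partial>PiM (insert N {..<N}) (\<lambda>_. lebesgue_n (Suc N)))"
    by (simp add: gauss_det_integral_def F_def lessThan_Suc)
  also have "\<dots> = (\<integral>\<^sup>+p. \<integral>\<^sup>+y. F (y(N := p)) \<partial>PiM {..<N} (\<lambda>_. lebesgue_n (Suc N)) \<partial>lebesgue_n (Suc N))"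
    by (rule L.product_nn_integral_insert_rev) (use F in \<open>auto simp: lessThan_Suc\<close>)
  also have "\<dots> = (\<integral>\<^sup>+p. (ennreal (sqrt pi ^ N) * gauss_det_integral N s) *
      (ennreal (L2_set p {..<Suc N} powr s) * ennreal (exp (- (L2_set p {..<Suc N})\<^sup>2))) \<partial>lebesgue_n (Suc N))"
  proof (rule nn_integral_cong_AE)
    show "AE p in lebesgue_n (Suc N). (\<integral>\<^sup>+y. F (y(N := p)) \<partial>PiM {..<N} (\<lambda>_. lebesgue_n (Suc N))) =
      (ennreal (sqrt pi ^ N) * gauss_det_integral N s) *
      (ennreal (L2_set p {..<Suc N} powr s) * ennreal (exp (- (L2_set p {..<Suc N})\<^sup>2)))"
      using AE_norm_n_pos[of "Suc N", simplified]
    proof eventually_elim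
      case (elim p)
      have "F (y(N := p)) = ennreal (\<bar>mdet (Suc N) (y(N := p))\<bar> powr s) *
        (\<Prod>i<N. ennreal (exp (- (L2_set (y i) {..<Suc N})\<^sup>2))) * ennreal (exp (- (L2_set p {..<Suc N})\<^sup>2))" for y
        by (simp add: F_def mult.assoc cong: prod.cong_simp)
      moreover have "(\<lambda>y. ennreal (\<bar>mdet (Suc N) (y(N := p))\<bar> powr s) *
        (\<Prod>i<N. ennreal (exp (- (L2_set (y i) {..<Suc N})\<^sup>2)))) \<in> borel_measurable (PiM {..<N} (\<lambda>_. lebesgue_n (Suc N)))"
      proof -
        have "(\<lambda>y. mdet (Suc N) (y(N := p))) \<in> borel_measurable (PiM {..<N} (\<lambda>_. lebesgue_n (Suc N)))"
        proof (rule borel_measurable_mdet)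
          fix i j assume "i < Suc N" "j < Suc N"
          then show "(\<lambda>y. (y(N := p)) i j) \<in> borel_measurable (PiM {..<N} (\<lambda>_. lebesgue_n (Suc N)))"
            using measurable_entry[of i "{..<N}" j "Suc N"] by (cases "i = N") auto
        qed
        moreover have "(\<lambda>y. \<Prod>i<N. ennreal (exp (- (L2_set (y i) {..<Suc N})\<^sup>2))) \<in> borel_measurable (PiM {..<N} (\<lambda>_. lebesgue_n (Suc N)))"
          by (intro borel_measurable_prod_ennreal measurable_compose[OF measurable_row_norm[of _ "{..<N}" "Suc N"]]) auto
        ultimately show ?thesis by measurable
      qed
      ultimately have "(\<integral>\<^sup>+y. F (y(N := p)) \<partial>PiM {..<N} (\<lambda>_. lebesgue_n (Suc N))) =
         ennreal (L2_set p {..<Suc N} powr s) * (ennreal (sqrt pi ^ N) * gauss_det_integral N s) * ennreal (exp (- (L2_set p {..<Suc N})\<^sup>2))"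
        using gauss_det_integral_row[OF elim, of s] by (simp only: nn_integral_multc)
      then show ?case by (simp only: mult_ac)
    qed
  qed
  also have "\<dots> = (ennreal (sqrt pi ^ N) * gauss_det_integral N s) * (\<integral>\<^sup>+p. ennreal (L2_set p {..<Suc N} powr s) *
      ennreal (exp (- (L2_set p {..<Suc N})\<^sup>2)) \<partial>lebesgue_n (Suc N))"
    by (rule nn_integral_cmult) measurable
  finally show ?thesis .
qed

text \<open>The Bartlett decomposition at the level of moments: the factor with index
  \<open>j\<close> is the moment of order \<open>s\<close> of the norm of a Gaussian vector in
  dimension \<open>j\<close>. Convergence for \<open>j = 1\<close> requires
  \<open>s > - 1\<close>.\<close>

lemma gauss_det_integral_eq:
  assumes "s > - 1"
  shows "gauss_det_integral N s = ennreal (sqrt pi ^ (N * N) * (\<Prod>j=1..N. Gamma ((real j + s) / 2) / Gamma (real j / 2)))"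
proof (induction N)
  case 0
  show ?case
    by (simp add: gauss_det_integral_def PiM_empty nn_integral_count_space_finite mdet_def)
next
  case (Suc N)
  have G: "Gamma ((real j + s) / 2) / Gamma (real j / 2) > 0" if "j \<ge> 1" for j
    using that assms by (intro divide_pos_pos Gamma_real_pos) auto
  have P: "(\<Prod>j=1..N. Gamma ((real j + s) / 2) / Gamma (real j / 2)) \<ge> 0"
    using G by (intro prod_nonneg) (auto simp: less_imp_le)
  have "pi powr (real (Suc N) / 2) = sqrt pi ^ Suc N"
    by (simp add: powr_half_sqrt[symmetric] powr_powr powr_realpow[symmetric] del: of_nat_Suc power_Suc)
  then show ?case
    unfolding gauss_det_integral_Suc Suc.IH using P G[of "Suc N"] assms
    by (subst nn_integral_gauss_moment) (auto simp: ennreal_mult[symmetric] power_add algebra_simps simp flip: times_divide_eq_right)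
qed

section \<open>Almost sure nondegeneracy\<close>

lemma ennreal_add_left_cancel_0: "ennreal a = ennreal a + b \<Longrightarrow> b = 0"
  using ennreal_add_left_cancel[of "ennreal a" 0 b] by simp

text \<open>The moment formula at \<open>s = 0\<close> gives the Gaussian mass of the nonsingular
  matrices, and it coincides with the total mass.\<close>

lemma AE_mdet_nonzero: "AE y in PiM {..<N} (\<lambda>_. lebesgue_n N). mdet N y \<noteq> 0"
proof -
  interpret L: product_sigma_finite "\<lambda>_. lebesgue_n N" by (rule product_sigma_finite_lebesgue_n)
  let ?M = "PiM {..<N} (\<lambda>_. lebesgue_n N)"
  define g where "g = (\<lambda>y. \<Prod>i<N. ennreal (exp (- (L2_set (y i) {..<N})\<^sup>2)))"
  have g [measurable]: "g \<in> borel_measurable ?M"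
    unfolding g_def by (intro borel_measurable_prod_ennreal measurable_compose[OF measurable_row_norm[of _ "{..<N}" N]]) auto
  have d [measurable]: "(\<lambda>y. mdet N y) \<in> borel_measurable ?M"
    by (rule borel_measurable_mdet) (simp add: measurable_entry)
  have row: "(\<integral>\<^sup>+x. ennreal (exp (- (L2_set x {..<N})\<^sup>2)) \<partial>lebesgue_n N) = ennreal (sqrt pi ^ N)"
  proof -
    have "ennreal (exp (- (L2_set x {..<N})\<^sup>2)) = (\<Prod>i<N. ennreal (exp (- (x i)\<^sup>2)))" for x
      by (simp add: L2_set_def sum_nonneg exp_sum[symmetric] sum_negf prod_ennreal)
    then show ?thesis
      by (simp add: nn_integral_gauss_PiM)
  qed
  have total: "(\<integral>\<^sup>+y. g y \<partial>?M) = ennreal (sqrt pi ^ (N * N))"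
    unfolding g_def by (subst L.product_nn_integral_prod) (simp_all add: row ennreal_power power_mult)
  have "gauss_det_integral N 0 = ennreal (sqrt pi ^ (N * N) * (\<Prod>j=1..N. Gamma ((real j + 0) / 2) / Gamma (real j / 2)))"
    by (rule gauss_det_integral_eq) simp
  also have "(\<Prod>j=1..N. Gamma ((real j + 0) / 2) / Gamma (real j / 2)) = 1"
  proof (rule prod.neutral, rule ballI)
    fix j assume "j \<in> {1..N}"
    then have "Gamma (real j / 2) > 0" by (intro Gamma_real_pos) simp
    then show "Gamma ((real j + 0) / 2) / Gamma (real j / 2) = 1" by simp
  qed
  finally have "gauss_det_integral N 0 = ennreal (sqrt pi ^ (N * N))"
    by simp
  \<comment> \<open>\<open>0 powr 0 = 0\<close>, whereas \<open>x powr 0 = 1\<close> for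
    \<open>x \<noteq> 0\<close>, so the zeroth moment leaves out exactly the singular
    matrices.\<close>
  moreover have "gauss_det_integral N 0 = (\<integral>\<^sup>+y. (if mdet N y = 0 then 0 else g y) \<partial>?M)"
    unfolding gauss_det_integral_def g_def by (rule nn_integral_cong) simp
  ultimately have nz: "(\<integral>\<^sup>+y. (if mdet N y = 0 then 0 else g y) \<partial>?M) = ennreal (sqrt pi ^ (N * N))"
    by simp
  have "(\<integral>\<^sup>+y. g y \<partial>?M) = (\<integral>\<^sup>+y. (if mdet N y = 0 then 0 else g y) + (if mdet N y = 0 then g y else 0) \<partial>?M)"
    by (intro nn_integral_cong) auto
  also have "\<dots> = (\<integral>\<^sup>+y. (if mdet N y = 0 then 0 else g y) \<partial>?M) + (\<integral>\<^sup>+y. (if mdet N y = 0 then g y else 0) \<partial>?M)"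
    by (rule nn_integral_add) measurable
  finally have "(\<integral>\<^sup>+y. (if mdet N y = 0 then g y else 0) \<partial>?M) = 0"
    unfolding total nz by (rule ennreal_add_left_cancel_0)
  then have "AE y in ?M. (if mdet N y = 0 then g y else 0) = 0"
    by (subst (asm) nn_integral_0_iff_AE) measurable
  then show ?thesis
  proof eventually_elim
    case (elim y)
    have "g y \<noteq> 0" by (simp add: g_def)
    with elim show ?case by auto
  qed
qed

text \<open>For a fixed last vertex, translating the other rows by it reduces the edge matrix to a
  generic square matrix.\<close>

lemma AE_simplex_det_nonzero: "AE x in PiM {..<Suc n} (\<lambda>_. lebesgue_n n). simplex_det n x \<noteq> 0"
proof -
  interpret L: product_sigma_finite "\<lambda>_. lebesgue_n n" by (rule product_sigma_finite_lebesgue_n)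
  let ?M = "PiM {..<Suc n} (\<lambda>_. lebesgue_n n)"
  have [measurable]: "simplex_det n \<in> borel_measurable ?M"
    unfolding simplex_det_eq_edges
    by (intro borel_measurable_mdet borel_measurable_diff measurable_entry) auto
  have "(\<integral>\<^sup>+x. (if simplex_det n x = 0 then 1 else 0) \<partial>PiM (insert n {..<n}) (\<lambda>_. lebesgue_n n)) =
      (\<integral>\<^sup>+q. \<integral>\<^sup>+y. (if simplex_det n (y(n := q)) = 0 then 1 else 0) \<partial>PiM {..<n} (\<lambda>_. lebesgue_n n) \<partial>lebesgue_n n)"
    by (rule L.product_nn_integral_insert_rev) (auto simp: lessThan_Suc[symmetric])
  also have "\<dots> = (\<integral>\<^sup>+q. 0 \<partial>lebesgue_n n)"
  proof (rule nn_integral_cong)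
    fix q
    let ?\<tau> = "affine_n n (\<lambda>i j. if i = j then 1 else 0) q"
    let ?H = "\<lambda>y. if mdet n (\<lambda>i j. y i j - q j) = 0 then 1 else (0::ennreal)"
    have eq: "simplex_det n (y(n := q)) = mdet n (\<lambda>i j. y i j - q j)" for y
      unfolding simplex_det_eq_edges by (rule mdet_cong) auto
    have "(\<integral>\<^sup>+y. ?H y \<partial>PiM {..<n} (\<lambda>_. lebesgue_n n)) =
        1 ^ card {..<n} * (\<integral>\<^sup>+y. ?H (\<lambda>i\<in>{..<n}. ?\<tau> (y i)) \<partial>PiM {..<n} (\<lambda>_. lebesgue_n n))"
    proof (rule nn_integral_PiM_rowwise[where Q = "\<lambda>_. True" and N = "lebesgue_n n"])
      show "(\<integral>\<^sup>+y. h y \<partial>lebesgue_n n) = 1 * (\<integral>\<^sup>+y. h (?\<tau> y) \<partial>lebesgue_n n)"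
        if "h \<in> borel_measurable (lebesgue_n n)" for h
        using nn_integral_affine_n[OF _ that, of "\<lambda>i j. if i = j then 1 else 0" q] mdet_one[of n] by simp
      have [measurable]: "(\<lambda>y. mdet n (\<lambda>i j. y i j - q j)) \<in> borel_measurable (PiM {..<n} (\<lambda>_. lebesgue_n n))"
        by (intro borel_measurable_mdet borel_measurable_diff measurable_entry) auto
      show "?H \<in> borel_measurable (PiM {..<n} (\<lambda>_. lebesgue_n n))"
        by measurable
    qed (auto intro: lborel_product.sigma_finite)
    also have "\<dots> = (\<integral>\<^sup>+y. (if mdet n y = 0 then 1 else 0) \<partial>PiM {..<n} (\<lambda>_. lebesgue_n n))"
    proof -
      have "mdet n (\<lambda>i j. (\<lambda>i\<in>{..<n}. ?\<tau> (y i)) i j - q j) = mdet n y" for y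
        by (rule mdet_cong) (simp add: affine_n_def if_distrib[of "\<lambda>t. t * _"] cong: if_cong)
      then show ?thesis by simp
    qed
    also have "\<dots> = (\<integral>\<^sup>+y. 0 \<partial>PiM {..<n} (\<lambda>_. lebesgue_n n))"
      using AE_mdet_nonzero[of n] by (intro nn_integral_cong_AE) auto
    finally show "(\<integral>\<^sup>+y. (if simplex_det n (y(n := q)) = 0 then 1 else 0) \<partial>PiM {..<n} (\<lambda>_. lebesgue_n n)) = 0"
      unfolding eq by simp
  qed
  finally have "(\<integral>\<^sup>+x. (if simplex_det n x = 0 then 1 else 0) \<partial>?M) = (0::ennreal)"
    by (simp add: lessThan_Suc)
  then have "AE x in ?M. (if simplex_det n x = 0 then 1 else 0) = (0::ennreal)"
    by (subst (asm) nn_integral_0_iff_AE) measurable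
  then show ?thesis
    by eventually_elim (auto split: if_splits)
qed

section \<open>Row densities and the passage from Gaussian to beta rows\<close>

lemma measurable_row_apply:
  assumes "w \<in> M \<rightarrow>\<^sub>M N" "i \<in> I"
  shows "(\<lambda>x. w (x i)) \<in> PiM I (\<lambda>_. M) \<rightarrow>\<^sub>M N"
  using measurable_component_singleton[OF assms(2)] assms(1) by (rule measurable_compose)

lemma PiM_density:
  fixes w :: "'b \<Rightarrow> real" and I :: "'i set"
  assumes M: "sigma_finite_measure M" and I: "finite I" and [measurable]: "w \<in> borel_measurable M"
  shows "PiM I (\<lambda>_. density M w) = density (PiM I (\<lambda>_. M)) (\<lambda>x. \<Prod>i\<in>I. ennreal (w (x i)))"
proof -
  interpret sigma_finite_measure M by fact
  interpret PM: product_sigma_finite "\<lambda>_ :: 'i. M"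
    unfolding product_sigma_finite_def using M by auto
  interpret PD: product_sigma_finite "\<lambda>_ :: 'i. density M w"
    unfolding product_sigma_finite_def by (simp add: sigma_finite_iff_density_finite)
  have [measurable]: "(\<lambda>x. \<Prod>i\<in>I. ennreal (w (x i))) \<in> borel_measurable (PiM I (\<lambda>_. M))"
    by (intro borel_measurable_prod_ennreal) measurable
  show ?thesis
  proof (rule PD.PiM_eqI[OF I, symmetric])
    show "sets (density (PiM I (\<lambda>_. M)) (\<lambda>x. \<Prod>i\<in>I. ennreal (w (x i)))) = sets (PiM I (\<lambda>_. density M w))"
      by (simp cong: sets_PiM_cong)
    fix A assume A: "\<And>i. i \<in> I \<Longrightarrow> A i \<in> sets (density M w)"
    then have [measurable]: "A i \<in> sets M" if "i \<in> I" for i using that by simp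
    have [measurable]: "Pi\<^sub>E I A \<in> sets (PiM I (\<lambda>_. M))"
      using A I by (intro sets_PiM_I_finite) auto
    have "emeasure (density (PiM I (\<lambda>_. M)) (\<lambda>x. \<Prod>i\<in>I. ennreal (w (x i)))) (Pi\<^sub>E I A) =
      (\<integral>\<^sup>+x. (\<Prod>i\<in>I. ennreal (w (x i))) * indicator (Pi\<^sub>E I A) x \<partial>PiM I (\<lambda>_. M))"
      by (rule emeasure_density) measurable
    also have "\<dots> = (\<integral>\<^sup>+x. (\<Prod>i\<in>I. ennreal (w (x i)) * indicator (A i) (x i)) \<partial>PiM I (\<lambda>_. M))"
    proof (rule nn_integral_cong)
      fix x assume "x \<in> space (PiM I (\<lambda>_. M))"
      then have "indicator (Pi\<^sub>E I A) x = (\<Prod>i\<in>I. indicator (A i) (x i) :: ennreal)"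
        using I by (auto simp: space_PiM PiE_def indicator_def Pi_def intro!: prod.neutral[symmetric])
      then show "(\<Prod>i\<in>I. ennreal (w (x i))) * indicator (Pi\<^sub>E I A) x = (\<Prod>i\<in>I. ennreal (w (x i)) * indicator (A i) (x i))"
        by (simp add: prod.distrib)
    qed
    also have "\<dots> = (\<Prod>i\<in>I. \<integral>\<^sup>+x. ennreal (w x) * indicator (A i) x \<partial>M)"
      by (rule PM.product_nn_integral_prod[OF I]) measurable
    also have "\<dots> = (\<Prod>i\<in>I. emeasure (density M w) (A i))"
      by (rule prod.cong) (auto simp: emeasure_density)
    finally show "emeasure (density (PiM I (\<lambda>_. M)) (\<lambda>x. \<Prod>i\<in>I. ennreal (w (x i)))) (Pi\<^sub>E I A) =
      (\<Prod>i\<in>I. emeasure (density M w) (A i))" .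
  qed
qed

lemma nn_integral_PiM_density:
  fixes w :: "'b \<Rightarrow> real"
  assumes "sigma_finite_measure M" "finite I" "w \<in> borel_measurable M" "H \<in> borel_measurable (PiM I (\<lambda>_. M))"
  shows "(\<integral>\<^sup>+x. H x \<partial>PiM I (\<lambda>_. density M w)) = (\<integral>\<^sup>+x. H x * (\<Prod>i\<in>I. ennreal (w (x i))) \<partial>PiM I (\<lambda>_. M))"
proof -
  have "(\<lambda>x. \<Prod>i\<in>I. ennreal (w (x i))) \<in> borel_measurable (PiM I (\<lambda>_. M))"
    by (intro borel_measurable_prod_ennreal measurable_compose[OF measurable_row_apply[OF assms(3)] measurable_ennreal])
  then show ?thesis
    unfolding PiM_density[OF assms(1-3)] using assms(4) by (subst nn_integral_density) (auto simp: mult.commute)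
qed

text \<open>The argument is the squared radius, so that cutting the ball by a hyperplane merely adds
  a constant to it.\<close>

definition beta_weight :: "real \<Rightarrow> real \<Rightarrow> real" where
  "beta_weight b q = (if q < 1 then (1 - q) powr b else 0)"

lemma beta_weight_nonneg: "beta_weight b q \<ge> 0"
  by (simp add: beta_weight_def)

lemma measurable_beta_weight [measurable]: "beta_weight b \<in> borel_measurable borel"
  unfolding beta_weight_def by measurable

lemma mdet_row_scale:
  assumes "k < n"
  shows "mdet n (A(k := \<lambda>j\<in>{..<n}. c * v j)) = c * mdet n (A(k := v))"
proof -
  have "(\<Prod>i = 0..<n. (A(k := w)) i (p i)) = w (p k) * (\<Prod>i\<in>{0..<n} - {k}. A i (p i))" for w p
    using assms by (subst prod.remove[of _ k]) auto
  then show ?thesis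
    using assms unfolding mdet_leibniz sum_distrib_left
    by (intro sum.cong) (auto simp: permutes_in_image)
qed

text \<open>Row weights are unnormalised and values lie in \<open>ennreal\<close>, so that moments
  can be transformed before they are known to be finite.\<close>

definition det_moment :: "nat \<Rightarrow> real \<Rightarrow> ((nat \<Rightarrow> real) \<Rightarrow> real) \<Rightarrow> ennreal" where
  "det_moment N s w = (\<integral>\<^sup>+y. ennreal (\<bar>mdet N y\<bar> powr s) * (\<Prod>i<N. ennreal (w (y i))) \<partial>PiM {..<N} (\<lambda>_. lebesgue_n N))"

definition simplex_moment :: "nat \<Rightarrow> real \<Rightarrow> ((nat \<Rightarrow> real) \<Rightarrow> real) \<Rightarrow> ennreal" where
  "simplex_moment n s w = (\<integral>\<^sup>+z. ennreal (\<bar>simplex_det n z\<bar> powr s) * (\<Prod>i<Suc n. ennreal (w (z i)))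
     \<partial>PiM {..<Suc n} (\<lambda>_. lebesgue_n n))"

lemma measurable_mdet_rows [measurable]: "mdet N \<in> borel_measurable (PiM {..<N} (\<lambda>_. lebesgue_n N))"
  by (rule borel_measurable_mdet) (simp add: measurable_entry)

lemma measurable_simplex_det [measurable]: "simplex_det n \<in> borel_measurable (PiM {..<Suc n} (\<lambda>_. lebesgue_n n))"
  unfolding simplex_det_eq_edges
  by (intro borel_measurable_mdet borel_measurable_diff measurable_entry) auto

lemma measurable_prod_rows:
  fixes w :: "(nat \<Rightarrow> real) \<Rightarrow> real"
  assumes "w \<in> borel_measurable (lebesgue_n n)"
  shows "(\<lambda>z. \<Prod>i\<in>I. ennreal (w (z i))) \<in> borel_measurable (PiM I (\<lambda>_. lebesgue_n n))"
  by (intro borel_measurable_prod_ennreal measurable_compose[OF measurable_row_apply[OF assms] measurable_ennreal])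

text \<open>A power of the determinant is homogeneous of degree \<open>s\<close> in every row, so
  replacing one Gaussian row by a beta row multiplies the integral by a ratio of radial moments;
  this happens \<open>N\<close> times.\<close>

lemma det_moment_beta:
  assumes N: "N \<ge> 1" and s: "s > - 1" and b: "b > - 1"
  shows "det_moment N s (\<lambda>x. beta_weight b ((L2_set x {..<N})\<^sup>2)) =
    ennreal ((Gamma (b + 1) / Gamma ((real N + s) / 2 + b + 1)) ^ N) * gauss_det_integral N s"
proof -
  let ?w = "\<lambda>x. beta_weight b ((L2_set x {..<N})\<^sup>2)"
  let ?g = "\<lambda>x. exp (- (L2_set x {..<N})\<^sup>2)"
  \<comment> \<open>The ratio \<open>Beta(x, b + 1) / Gamma(x)\<close> of the two radial integrals,
    with \<open>x = (N + s) / 2\<close>.\<close>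
  define C where "C = Gamma (b + 1) / Gamma ((real N + s) / 2 + b + 1)"
  have p: "real N - 1 + s > - 1" using N s by simp
  have C: "C \<ge> 0"
    unfolding C_def using s b N by (intro divide_nonneg_nonneg less_imp_le Gamma_real_pos) (auto simp: field_simps)
  have L: "sigma_finite_measure (lebesgue_n N)" by (rule lborel_product.sigma_finite) simp
  have [measurable]: "?w \<in> borel_measurable (lebesgue_n N)" "?g \<in> borel_measurable (lebesgue_n N)"
    by measurable
  have row: "(\<integral>\<^sup>+y. h y \<partial>density (lebesgue_n N) ?w) = ennreal C * (\<integral>\<^sup>+y. h y \<partial>density (lebesgue_n N) ?g)"
    if h [measurable]: "h \<in> borel_measurable (lebesgue_n N)"
      and hom: "\<And>r u. r > 0 \<Longrightarrow> h (\<lambda>k\<in>{..<N}. r * u k) = ennreal (r powr s) * h u" for h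
  proof -
    let ?K = "ennreal (real N * unit_ball_vol N)" and ?S = "\<integral>\<^sup>+u. h u \<partial>sphere_distribution N"
    have "(\<integral>\<^sup>+y. h y \<partial>density (lebesgue_n N) ?w) = (\<integral>\<^sup>+y. h y * ennreal (?w y) \<partial>lebesgue_n N)"
      by (subst nn_integral_density) (auto simp: mult.commute)
    also have "\<dots> = ?K * (\<integral>\<^sup>+r. indicator {0<..} r * ennreal (r powr (real N - 1 + s)) * ennreal (beta_weight b (r\<^sup>2)) \<partial>lborel) * ?S"
      by (rule nn_integral_homogeneous[of h N "\<lambda>r. ennreal (beta_weight b (r\<^sup>2))" s]) (use hom N in auto)
    also have "(\<integral>\<^sup>+r. indicator {0<..} r * ennreal (r powr (real N - 1 + s)) * ennreal (beta_weight b (r\<^sup>2)) \<partial>lborel) =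
        (\<integral>\<^sup>+r. indicator {0<..} r * ennreal (r powr (real N - 1 + s)) * ennreal (if r < 1 then (1 - r\<^sup>2) powr b else 0) \<partial>lborel)"
    proof (rule nn_integral_cong)
      fix r :: real
      have "r\<^sup>2 < 1 \<longleftrightarrow> r < 1" if "r > 0"
        using that by (simp add: power2_less_1_iff)
      then show "indicator {0<..} r * ennreal (r powr (real N - 1 + s)) * ennreal (beta_weight b (r\<^sup>2)) =
          indicator {0<..} r * ennreal (r powr (real N - 1 + s)) * ennreal (if r < 1 then (1 - r\<^sup>2) powr b else 0)"
        by (cases "r > 0") (auto simp: beta_weight_def)
    qed
    also have "\<dots> = ennreal (Beta ((real N + s) / 2) (b + 1) / 2)"
      using nn_integral_powr_beta[OF p b] by simp
    finally have 1: "(\<integral>\<^sup>+y. h y \<partial>density (lebesgue_n N) ?w) = ?K * ennreal (Beta ((real N + s) / 2) (b + 1) / 2) * ?S" .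
    have "(\<integral>\<^sup>+y. h y \<partial>density (lebesgue_n N) ?g) = (\<integral>\<^sup>+y. h y * ennreal (?g y) \<partial>lebesgue_n N)"
      by (subst nn_integral_density) (auto simp: mult.commute)
    also have "\<dots> = ?K * (\<integral>\<^sup>+r. indicator {0<..} r * ennreal (r powr (real N - 1 + s)) * ennreal (exp (- r\<^sup>2)) \<partial>lborel) * ?S"
      by (rule nn_integral_homogeneous[of h N "\<lambda>r. ennreal (exp (- r\<^sup>2))" s]) (use hom N in auto)
    also have "(\<integral>\<^sup>+r. indicator {0<..} r * ennreal (r powr (real N - 1 + s)) * ennreal (exp (- r\<^sup>2)) \<partial>lborel) =
        ennreal (Gamma ((real N + s) / 2) / 2)"
      using nn_integral_powr_gauss[OF p] by simp
    finally have 2: "(\<integral>\<^sup>+y. h y \<partial>density (lebesgue_n N) ?g) = ?K * ennreal (Gamma ((real N + s) / 2) / 2) * ?S" .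
    have G: "Gamma ((real N + s) / 2) > 0"
      using p by (intro Gamma_real_pos) simp
    have "Beta ((real N + s) / 2) (b + 1) / 2 = C * (Gamma ((real N + s) / 2) / 2)"
      by (simp add: Beta_def C_def add.assoc)
    then have "ennreal (Beta ((real N + s) / 2) (b + 1) / 2) = ennreal C * ennreal (Gamma ((real N + s) / 2) / 2)"
      using C G by (simp only: ennreal_mult[symmetric])
    then show ?thesis
      unfolding 1 2 by (simp only: mult_ac)
  qed
  have sf: "sigma_finite_measure (density (lebesgue_n N) (\<lambda>x. ennreal (u x)))" if "u \<in> borel_measurable (lebesgue_n N)" for u
    using that sigma_finite_measure.sigma_finite_iff_density_finite[OF L, of "\<lambda>x. ennreal (u x)"] by simp
  have "det_moment N s ?w = (\<integral>\<^sup>+y. ennreal (\<bar>mdet N y\<bar> powr s) \<partial>PiM {..<N} (\<lambda>_. density (lebesgue_n N) ?w))"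
    unfolding det_moment_def by (rule nn_integral_PiM_density[OF L, symmetric]) measurable
  also have "\<dots> = ennreal C ^ card {..<N} * (\<integral>\<^sup>+y. ennreal (\<bar>mdet N (\<lambda>i\<in>{..<N}. y i)\<bar> powr s)
      \<partial>PiM {..<N} (\<lambda>_. density (lebesgue_n N) ?g))"
  \<comment> \<open>The row map is the identity here; only the measure changes, and \<open>Q\<close>
    is homogeneity of degree \<open>s\<close>.\<close>
  proof (rule nn_integral_PiM_rowwise[where N = "lebesgue_n N" and
        Q = "\<lambda>h. \<forall>r u. r > 0 \<longrightarrow> h (\<lambda>k\<in>{..<N}. r * u k) = ennreal (r powr s) * h u"])
    show "\<forall>r u. r > 0 \<longrightarrow> ennreal (\<bar>mdet N (x(i := \<lambda>k\<in>{..<N}. r * u k))\<bar> powr s) =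
        ennreal (r powr s) * ennreal (\<bar>mdet N (x(i := u))\<bar> powr s)" if "i \<in> {..<N}" for i x
      using that by (auto simp: mdet_row_scale abs_mult powr_mult ennreal_mult)
  qed (use row sf in auto)
  also have "(\<integral>\<^sup>+y. ennreal (\<bar>mdet N (\<lambda>i\<in>{..<N}. y i)\<bar> powr s) \<partial>PiM {..<N} (\<lambda>_. density (lebesgue_n N) ?g)) =
      (\<integral>\<^sup>+y. ennreal (\<bar>mdet N y\<bar> powr s) \<partial>PiM {..<N} (\<lambda>_. density (lebesgue_n N) ?g))"
    by (intro nn_integral_cong arg_cong[where f = "\<lambda>d. ennreal (\<bar>d\<bar> powr s)"] mdet_cong) simp
  also have "\<dots> = gauss_det_integral N s"
    unfolding gauss_det_integral_def by (rule nn_integral_PiM_density[OF L]) measurable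
  finally show ?thesis
    using C by (simp add: C_def ennreal_power)
qed

subsection \<open>Moments of random simplices\<close>

lemma ennreal_mult_left_assoc: "a \<ge> 0 \<Longrightarrow> ennreal a * (ennreal b * c) = ennreal (a * b) * c"
  by (simp add: ennreal_mult' mult.assoc)

lemma L2_set_square: "(L2_set x A)\<^sup>2 = (\<Sum>k\<in>A. (x k)\<^sup>2)"
  by (simp add: L2_set_def sum_nonneg)

lemma measurable_simplex_integrand:
  assumes "w \<in> borel_measurable (lebesgue_n n)"
  shows "(\<lambda>z. ennreal (\<bar>simplex_det n z\<bar> powr s) * (\<Prod>i<Suc n. ennreal (w (z i)))) \<in>
    borel_measurable (PiM {..<Suc n} (\<lambda>_. lebesgue_n n))"
  using measurable_prod_rows[OF assms, of "{..<Suc n}"] by measurable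

text \<open>In homogeneous coordinates an affine map is right multiplication by a bordered
  matrix.\<close>

lemma simplex_det_affine:
  "simplex_det n (\<lambda>i\<in>{..<Suc n}. affine_n n T c (z i)) = mdet n T * simplex_det n z"
proof -
  define Z where "Z = (\<lambda>i j. if j < n then z i j else (1::real))"
  define M where "M = (\<lambda>k j. if j < n then (if k < n then T j k else c j) else (if k = n then 1 else (0::real)))"
  have "simplex_det n (\<lambda>i\<in>{..<Suc n}. affine_n n T c (z i)) = mdet (Suc n) (\<lambda>i j. \<Sum>k<Suc n. Z i k * M k j)"
    unfolding simplex_det_def
    by (rule mdet_cong) (auto simp: affine_n_def Z_def M_def mult.commute cong: sum.cong_simp)
  also have "\<dots> = mdet (Suc n) Z * mdet (Suc n) M"
    by (rule mdet_mult)
  also have "mdet (Suc n) M = M n n * mdet n M"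
    by (rule mdet_last_col) (simp add: M_def)
  also have "mdet n M = mdet n (\<lambda>k j. T j k)"
    by (rule mdet_cong) (simp add: M_def)
  also have "\<dots> = mdet n T"
    by (rule mdet_transpose)
  also have "M n n = 1"
    by (simp add: M_def)
  also have "mdet (Suc n) Z = simplex_det n z"
    by (simp only: Z_def simplex_det_def)
  finally show ?thesis
    by (simp only: mult_1 mult.commute)
qed

text \<open>Each of the \<open>n + 1\<close> vertices contributes one Jacobian
  \<open>|mdet n T|\<close>, and the simplex determinant contributes its power of order
  \<open>s\<close>.\<close>

lemma simplex_moment_affine:
  assumes T: "mdet n T \<noteq> 0" and w [measurable]: "w \<in> borel_measurable (lebesgue_n n)"
  shows "simplex_moment n s w =
    ennreal (\<bar>mdet n T\<bar> ^ Suc n * \<bar>mdet n T\<bar> powr s) * simplex_moment n s (\<lambda>x. w (affine_n n T c x))"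
proof -
  let ?M = "PiM {..<Suc n} (\<lambda>_. lebesgue_n n)"
  let ?H = "\<lambda>z. ennreal (\<bar>simplex_det n z\<bar> powr s) * (\<Prod>i<Suc n. ennreal (w (z i)))"
  have w': "(\<lambda>x. w (affine_n n T c x)) \<in> borel_measurable (lebesgue_n n)"
    by (rule measurable_compose[OF measurable_affine_n w])
  have "(\<integral>\<^sup>+z. ?H z \<partial>?M) =
      ennreal \<bar>mdet n T\<bar> ^ card {..<Suc n} * (\<integral>\<^sup>+z. ?H (\<lambda>i\<in>{..<Suc n}. affine_n n T c (z i)) \<partial>?M)"
  proof (rule nn_integral_PiM_rowwise[where Q = "\<lambda>_. True" and N = "lebesgue_n n"])
    show "?H \<in> borel_measurable ?M"
      by (rule measurable_simplex_integrand[OF w])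
  qed (use nn_integral_affine_n[OF T] in \<open>auto intro: lborel_product.sigma_finite\<close>)
  also have "(\<integral>\<^sup>+z. ?H (\<lambda>i\<in>{..<Suc n}. affine_n n T c (z i)) \<partial>?M) =
      (\<integral>\<^sup>+z. ennreal (\<bar>mdet n T\<bar> powr s) * (ennreal (\<bar>simplex_det n z\<bar> powr s) *
        (\<Prod>i<Suc n. ennreal (w (affine_n n T c (z i))))) \<partial>?M)"
  proof (rule nn_integral_cong)
    fix z :: "nat \<Rightarrow> nat \<Rightarrow> real"
    have "(\<Prod>i<Suc n. ennreal (w ((\<lambda>i\<in>{..<Suc n}. affine_n n T c (z i)) i))) =
        (\<Prod>i<Suc n. ennreal (w (affine_n n T c (z i))))"
      by (rule prod.cong) (auto simp del: prod.lessThan_Suc)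
    then show "?H (\<lambda>i\<in>{..<Suc n}. affine_n n T c (z i)) = ennreal (\<bar>mdet n T\<bar> powr s) *
        (ennreal (\<bar>simplex_det n z\<bar> powr s) * (\<Prod>i<Suc n. ennreal (w (affine_n n T c (z i)))))"
      unfolding simplex_det_affine
      by (simp only: abs_mult powr_mult abs_ge_zero ennreal_mult powr_ge_zero mult.assoc)
  qed
  also have "\<dots> = ennreal (\<bar>mdet n T\<bar> powr s) * simplex_moment n s (\<lambda>x. w (affine_n n T c x))"
    unfolding simplex_moment_def
    by (rule nn_integral_cmult) (rule measurable_simplex_integrand[OF w'])
  finally show ?thesis
    unfolding simplex_moment_def
    by (simp only: card_lessThan ennreal_mult ennreal_power abs_ge_zero powr_ge_zero zero_le_power mult.assoc)
qed

lemma simplex_moment_cmult: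
  assumes c: "c \<ge> 0" and w: "w \<in> borel_measurable (lebesgue_n n)"
  shows "simplex_moment n s (\<lambda>x. c * w x) = ennreal (c ^ Suc n) * simplex_moment n s w"
proof -
  have "(\<Prod>i<Suc n. ennreal (c * w (z i))) = ennreal (c ^ Suc n) * (\<Prod>i<Suc n. ennreal (w (z i)))"
    for z :: "nat \<Rightarrow> nat \<Rightarrow> real"
    using c by (simp only: ennreal_mult' prod.distrib prod_constant card_lessThan ennreal_power)
  then have "simplex_moment n s (\<lambda>x. c * w x) = (\<integral>\<^sup>+z. ennreal (c ^ Suc n) *
      (ennreal (\<bar>simplex_det n z\<bar> powr s) * (\<Prod>i<Suc n. ennreal (w (z i)))) \<partial>PiM {..<Suc n} (\<lambda>_. lebesgue_n n))"
    unfolding simplex_moment_def by (simp only: mult.left_commute)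
  also have "\<dots> = ennreal (c ^ Suc n) * simplex_moment n s w"
    unfolding simplex_moment_def
    by (rule nn_integral_cmult) (rule measurable_simplex_integrand[OF w])
  finally show ?thesis .
qed

text \<open>The left side is a quadratic form with matrix \<open>I + \<alpha> \<alpha>^T\<close>, up
  to linear and constant terms. \<open>T\<close> is the inverse square root of this matrix: it
  multiplies \<open>\<alpha>\<close> by \<open>1 / sqrt (1 + S)\<close> and fixes its orthogonal
  complement, which determines \<open>\<theta>\<close>. The offset \<open>d\<close> is the centre of
  the form, where its value is \<open>c^2 / (1 + S)\<close>.\<close>

lemma complete_square:
  fixes \<alpha> :: "nat \<Rightarrow> real" and c :: real and n :: nat
  defines "S \<equiv> \<Sum>k<n. (\<alpha> k)\<^sup>2"
  defines "\<theta> \<equiv> (1 - 1 / sqrt (1 + S)) / S"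
  defines "T \<equiv> \<lambda>i j. (if i = j then 1 else 0) - \<theta> * \<alpha> i * \<alpha> j"
    and "d \<equiv> \<lambda>i. - \<alpha> i * c / (1 + S)"
  shows "mdet n T = 1 / sqrt (1 + S)"
    and "(\<Sum>k<n. (affine_n n T d w k)\<^sup>2) + ((\<Sum>k<n. \<alpha> k * affine_n n T d w k) + c)\<^sup>2 =
      (\<Sum>k<n. (w k)\<^sup>2) + c\<^sup>2 / (1 + S)"
proof -
  have S: "S \<ge> 0" unfolding S_def by (rule sum_nonneg) simp
  have \<theta>S: "\<theta> * S = 1 - 1 / sqrt (1 + S)"
    by (cases "S = 0") (simp_all add: \<theta>_def)
  show "mdet n T = 1 / sqrt (1 + S)"
    unfolding T_def
  proof (subst mdet_rank_one)
    show "0 \<le> \<theta>" using S by (simp add: \<theta>_def)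
    show "\<theta> * (\<Sum>k<n. (\<alpha> k)\<^sup>2) < 1" unfolding S_def[symmetric] \<theta>S using S by simp
    show "1 - \<theta> * (\<Sum>k<n. (\<alpha> k)\<^sup>2) = 1 / sqrt (1 + S)" unfolding S_def[symmetric] \<theta>S by simp
  qed
  define D where "D = (\<Sum>k<n. \<alpha> k * w k)"
  define W where "W = (\<Sum>k<n. (w k)\<^sup>2)"
  \<comment> \<open>The substitution moves \<open>w\<close> along \<open>\<alpha>\<close> only;
    \<open>\<kappa>\<close> is the amount.\<close>
  define \<kappa> where "\<kappa> = \<theta> * D + c / (1 + S)"
  have \<tau>: "affine_n n T d w i = w i - \<alpha> i * \<kappa>" if "i < n" for i
  proof -
    have "(\<Sum>j<n. T i j * w j) = (\<Sum>j<n. (if i = j then w j else 0) - \<theta> * \<alpha> i * (\<alpha> j * w j))"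
      by (rule sum.cong) (auto simp: T_def algebra_simps)
    also have "\<dots> = w i - \<theta> * \<alpha> i * D"
      using that by (simp add: sum_subtractf sum_distrib_left D_def)
    finally show ?thesis
      using that by (simp add: affine_n_def d_def \<kappa>_def algebra_simps)
  qed
  have "(\<Sum>k<n. (affine_n n T d w k)\<^sup>2) = (\<Sum>k<n. (w k)\<^sup>2 - 2 * \<kappa> * (\<alpha> k * w k) + \<kappa>\<^sup>2 * (\<alpha> k)\<^sup>2)"
    by (rule sum.cong) (auto simp: \<tau> power2_eq_square algebra_simps)
  also have "\<dots> = W - 2 * \<kappa> * D + \<kappa>\<^sup>2 * S"
    by (simp add: sum.distrib sum_subtractf sum_distrib_left W_def D_def S_def)
  finally have 1: "(\<Sum>k<n. (affine_n n T d w k)\<^sup>2) = W - 2 * \<kappa> * D + \<kappa>\<^sup>2 * S" .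
  have "(\<Sum>k<n. \<alpha> k * affine_n n T d w k) = (\<Sum>k<n. \<alpha> k * w k - \<kappa> * (\<alpha> k)\<^sup>2)"
    by (rule sum.cong) (auto simp: \<tau> power2_eq_square algebra_simps)
  also have "\<dots> = D - \<kappa> * S"
    by (simp add: sum_subtractf sum_distrib_left D_def S_def)
  finally have 2: "(\<Sum>k<n. \<alpha> k * affine_n n T d w k) = D - \<kappa> * S" .
  have "- 2 * \<kappa> * D + \<kappa>\<^sup>2 * S + (D - \<kappa> * S + c)\<^sup>2 = c\<^sup>2 / (1 + S)"
  proof (cases "S = 0")
    case True
    then have "\<forall>k\<in>{..<n}. (\<alpha> k)\<^sup>2 = 0"
      unfolding S_def by (subst (asm) sum_nonneg_eq_0_iff) auto
    then have "D = 0" unfolding D_def by (intro sum.neutral) auto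
    then show ?thesis using True by simp
  next
    case False
    define P where "P = 1 + S"
    define A where "A = sqrt P"
    have P: "P > 0" "A > 0" "A\<^sup>2 = P" using S by (auto simp: P_def A_def)
    \<comment> \<open>The square root enters only through \<open>A * D\<close>. Isolating this term
      and squaring leaves a polynomial identity in \<open>S\<close>, \<open>\<kappa>\<close>,
      \<open>D\<close> and \<open>c\<close>.\<close>
    have "S * P * \<kappa> = P * (\<theta> * S) * D + c * S"
      using P by (simp add: \<kappa>_def P_def[symmetric] algebra_simps)
    also have "\<dots> = P * D - P / A * D + c * S"
      unfolding \<theta>S P_def[symmetric] A_def[symmetric] by (simp add: algebra_simps)
    also have "P / A = A"
      using P by (simp add: power2_eq_square field_simps)
    finally have "S * P * \<kappa> - (D * P + c * S) = - (A * D)"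
      by (simp add: algebra_simps)
    then have "(S * P * \<kappa> - (D * P + c * S))\<^sup>2 = P * D\<^sup>2"
      using P(3) by (simp add: power_mult_distrib)
    moreover have "S * P * (P * (- 2 * \<kappa> * D + \<kappa>\<^sup>2 * S + (D - \<kappa> * S + c)\<^sup>2) - c\<^sup>2) =
        P * ((S * P * \<kappa> - (D * P + c * S))\<^sup>2 - P * D\<^sup>2)"
      by (simp add: P_def power2_eq_square algebra_simps)
    ultimately have "P * (- 2 * \<kappa> * D + \<kappa>\<^sup>2 * S + (D - \<kappa> * S + c)\<^sup>2) - c\<^sup>2 = 0"
      using False P by simp
    then show ?thesis
      using P unfolding P_def[symmetric] by (simp add: field_simps)
  qed
  then show "(\<Sum>k<n. (affine_n n T d w k)\<^sup>2) + ((\<Sum>k<n. \<alpha> k * affine_n n T d w k) + c)\<^sup>2 =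
      (\<Sum>k<n. (w k)\<^sup>2) + c\<^sup>2 / (1 + S)"
    unfolding 1 2 W_def[symmetric] by simp
qed

text \<open>The section of the ball by the graph of \<open>x \<mapsto> \<alpha> x + c\<close>
  projects to an ellipsoid. The map from \<open>complete_square\<close> makes it a ball of squared
  radius \<open>1 - q\<close>, and a scaling makes it the unit ball. The scaling contributes the
  power \<open>n (n + 1) / 2\<close> of \<open>1 - q\<close> from the vertices,
  \<open>n s / 2\<close> from the determinant and \<open>b\<close> from each of the
  \<open>n + 1\<close> weights; together they form the exponent of the right-hand weight.\<close>

lemma simplex_moment_hyperplane:
  fixes \<alpha> :: "nat \<Rightarrow> real" and c b s :: real and n :: nat
  defines "S \<equiv> \<Sum>k<n. (\<alpha> k)\<^sup>2"
  shows "simplex_moment n s (\<lambda>x. beta_weight b ((\<Sum>k<n. (x k)\<^sup>2) + ((\<Sum>k<n. \<alpha> k * x k) + c)\<^sup>2)) =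
    ennreal ((1 + S) powr (- (real n + 1 + s) / 2)) *
    (ennreal (beta_weight ((real n + 1) * b + real n * (real n + 1 + s) / 2) (c\<^sup>2 / (1 + S))) *
     simplex_moment n s (\<lambda>x. beta_weight b (\<Sum>k<n. (x k)\<^sup>2)))"
proof -
  define \<theta> where "\<theta> = (1 - 1 / sqrt (1 + S)) / S"
  define T where "T = (\<lambda>i j. (if i = j then 1 else 0) - \<theta> * \<alpha> i * \<alpha> j)"
  define d where "d = (\<lambda>i. - \<alpha> i * c / (1 + S))"
  define q where "q = c\<^sup>2 / (1 + S)"
  have S: "S \<ge> 0" unfolding S_def by (rule sum_nonneg) simp
  have q: "q \<ge> 0" using S by (simp add: q_def)
  have det: "mdet n T = 1 / sqrt (1 + S)"
    unfolding T_def \<theta>_def S_def by (rule complete_square)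
  have sq: "(\<Sum>k<n. (affine_n n T d w k)\<^sup>2) + ((\<Sum>k<n. \<alpha> k * affine_n n T d w k) + c)\<^sup>2 = (\<Sum>k<n. (w k)\<^sup>2) + q" for w
    unfolding T_def \<theta>_def d_def q_def S_def by (rule complete_square)
  have "simplex_moment n s (\<lambda>x. beta_weight b ((\<Sum>k<n. (x k)\<^sup>2) + ((\<Sum>k<n. \<alpha> k * x k) + c)\<^sup>2)) =
      ennreal (\<bar>mdet n T\<bar> ^ Suc n * \<bar>mdet n T\<bar> powr s) *
      simplex_moment n s (\<lambda>x. beta_weight b ((\<Sum>k<n. (affine_n n T d x k)\<^sup>2) + ((\<Sum>k<n. \<alpha> k * affine_n n T d x k) + c)\<^sup>2))"
    by (rule simplex_moment_affine) (use det S in \<open>auto\<close>)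
  also have "\<bar>mdet n T\<bar> ^ Suc n * \<bar>mdet n T\<bar> powr s = (1 + S) powr (- (real n + 1 + s) / 2)"
  proof -
    have m: "\<bar>mdet n T\<bar> = (1 + S) powr (- 1 / 2)"
      using S by (simp add: det powr_minus_divide powr_half_sqrt)
    have pw: "((1 + S) powr (- 1 / 2)) ^ Suc n = (1 + S) powr (- 1 / 2 * real (Suc n))"
      using S by (simp only: powr_powr[symmetric]) (subst powr_realpow; simp)
    have e: "- 1 / 2 * real (Suc n) + - 1 / 2 * s = - (real n + 1 + s) / 2"
      by (simp add: field_simps)
    show ?thesis
      unfolding m pw unfolding powr_powr powr_add[symmetric] e ..
  qed
  also have "simplex_moment n s (\<lambda>x. beta_weight b ((\<Sum>k<n. (affine_n n T d x k)\<^sup>2) + ((\<Sum>k<n. \<alpha> k * affine_n n T d x k) + c)\<^sup>2)) =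
      simplex_moment n s (\<lambda>x. beta_weight b ((\<Sum>k<n. (x k)\<^sup>2) + q))"
    unfolding sq ..
  also have "\<dots> = ennreal (beta_weight ((real n + 1) * b + real n * (real n + 1 + s) / 2) q) *
      simplex_moment n s (\<lambda>x. beta_weight b (\<Sum>k<n. (x k)\<^sup>2))"
  proof (cases "q < 1")
    \<comment> \<open>\<open>q\<close> is the squared distance of the hyperplane from the origin;
      for \<open>q \<ge> 1\<close> the hyperplane misses the open unit ball.\<close>
    case False
    have "(\<Sum>k<n. (x k)\<^sup>2) \<ge> 0" for x :: "nat \<Rightarrow> real" by (rule sum_nonneg) simp
    then have "beta_weight b ((\<Sum>k<n. (x k)\<^sup>2) + q) = 0" for x :: "nat \<Rightarrow> real"
      using False by (simp add: beta_weight_def not_less add_increasing)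
    then have "simplex_moment n s (\<lambda>x. beta_weight b ((\<Sum>k<n. (x k)\<^sup>2) + q)) = 0"
      by (simp add: simplex_moment_def)
    then show ?thesis
      using False by (simp add: beta_weight_def)
  next
    case True
    \<comment> \<open>The radius of the section, used as the scaling factor.\<close>
    define \<rho> where "\<rho> = sqrt (1 - q)"
    have \<rho>: "\<rho> > 0" "\<rho>\<^sup>2 = 1 - q" using True by (auto simp: \<rho>_def)
    define R where "R = (\<lambda>i j :: nat. if i = j then \<rho> else 0)"
    have R: "mdet m R = \<rho> ^ m" for m
      by (induction m) (simp_all add: mdet_last_row R_def, simp add: mdet_def)
    have aff: "affine_n n R (\<lambda>_. 0) x i = \<rho> * x i" if "i < n" for x i
    proof -
      have "(\<Sum>j<n. R i j * x j) = (\<Sum>j<n. if i = j then \<rho> * x j else 0)"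
        by (rule sum.cong) (auto simp: R_def)
      then show ?thesis using that by (simp add: affine_n_def)
    qed
    have bw: "beta_weight b ((\<Sum>k<n. (affine_n n R (\<lambda>_. 0) x k)\<^sup>2) + q) =
        (1 - q) powr b * beta_weight b (\<Sum>k<n. (x k)\<^sup>2)" for x
    proof -
      have "(\<Sum>k<n. (affine_n n R (\<lambda>_. 0) x k)\<^sup>2) = (1 - q) * (\<Sum>k<n. (x k)\<^sup>2)"
        unfolding sum_distrib_left \<rho>(2)[symmetric] by (rule sum.cong) (auto simp: aff power_mult_distrib)
      moreover have "1 - ((1 - q) * W + q) = (1 - q) * (1 - W)" for W
        by (simp add: algebra_simps)
      moreover have "(1 - q) * W + q < 1 \<longleftrightarrow> W < 1" for W
      proof -
        have "(1 - q) * W + q < 1 \<longleftrightarrow> (1 - q) * W < (1 - q) * 1" by (simp add: algebra_simps)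
        then show ?thesis using True by simp
      qed
      ultimately show ?thesis
        using True by (simp add: beta_weight_def powr_mult)
    qed
    have "simplex_moment n s (\<lambda>x. beta_weight b ((\<Sum>k<n. (x k)\<^sup>2) + q)) =
        ennreal (\<bar>mdet n R\<bar> ^ Suc n * \<bar>mdet n R\<bar> powr s) *
        simplex_moment n s (\<lambda>x. beta_weight b ((\<Sum>k<n. (affine_n n R (\<lambda>_. 0) x k)\<^sup>2) + q))"
      by (rule simplex_moment_affine) (use \<rho> R in auto)
    also have "\<dots> = ennreal (\<bar>mdet n R\<bar> ^ Suc n * \<bar>mdet n R\<bar> powr s) *
        (ennreal (((1 - q) powr b) ^ Suc n) * simplex_moment n s (\<lambda>x. beta_weight b (\<Sum>k<n. (x k)\<^sup>2)))"
      unfolding bw by (subst simplex_moment_cmult) auto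
    also have "\<dots> = ennreal (\<bar>mdet n R\<bar> ^ Suc n * \<bar>mdet n R\<bar> powr s * ((1 - q) powr b) ^ Suc n) *
        simplex_moment n s (\<lambda>x. beta_weight b (\<Sum>k<n. (x k)\<^sup>2))"
      by (rule ennreal_mult_left_assoc) (simp del: power_Suc)
    also have "\<bar>mdet n R\<bar> ^ Suc n * \<bar>mdet n R\<bar> powr s * ((1 - q) powr b) ^ Suc n =
        (1 - q) powr ((real n + 1) * b + real n * (real n + 1 + s) / 2)"
    proof -
      have Rp: "\<bar>mdet n R\<bar> = (1 - q) powr (real n / 2)"
      proof -
        have "\<rho> = (1 - q) powr (1 / 2)"
          using True by (simp add: \<rho>_def powr_half_sqrt)
        then have "\<rho> ^ n = (1 - q) powr (1 / 2 * real n)"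
          using True by (simp only: powr_powr[symmetric]) (subst powr_realpow; simp)
        then show ?thesis using \<rho> R by simp
      qed
      have pw: "((1 - q) powr t) ^ Suc n = (1 - q) powr (t * real (Suc n))" for t
        using True by (simp only: powr_powr[symmetric]) (subst powr_realpow; simp)
      show ?thesis
        using True unfolding Rp pw powr_powr powr_add[symmetric]
        by (simp add: algebra_simps add_divide_distrib)
    qed
    finally show ?thesis
      using True by (simp add: beta_weight_def)
  qed
  finally show ?thesis
    by (simp add: q_def)
qed

lemma measurable_simplex_det_fst:
  "(\<lambda>p. simplex_det n (fst p)) \<in> borel_measurable (PiM {..<Suc n} (\<lambda>_. lebesgue_n n) \<Otimes>\<^sub>M M)"
  by (rule measurable_compose[OF measurable_fst measurable_simplex_det])

text \<open>
  An affine Blaschke--Petkantschin formula in graph coordinates: for fixed base points \<open>z\<^sub>i\<close> the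
  heights \<open>v\<^sub>i = \<alpha> \<bullet> z\<^sub>i + c\<close> depend linearly on \<open>(\<alpha>, c)\<close>, with Jacobian the simplex determinant
  of the base points.
\<close>

lemma det_moment_graph_coordinates:
  fixes g :: "real \<Rightarrow> real" and n :: nat
  assumes g [measurable]: "g \<in> borel_measurable borel"
  shows "det_moment (Suc n) s (\<lambda>x. g (\<Sum>k<Suc n. (x k)\<^sup>2)) =
    (\<integral>\<^sup>+a. ennreal (\<bar>a n\<bar> powr s) *
      simplex_moment n (s + 1) (\<lambda>x. g ((\<Sum>k<n. (x k)\<^sup>2) + ((\<Sum>k<n. a k * x k) + a n)\<^sup>2)) \<partial>lebesgue_n (Suc n))"
proof -
  let ?M = "PiM {..<Suc n} (\<lambda>_. lebesgue_n n)"
  interpret Lm: product_sigma_finite "\<lambda>_. lebesgue_n n" by (rule product_sigma_finite_lebesgue_n)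
  interpret sM: sigma_finite_measure ?M by (rule Lm.sigma_finite) simp
  interpret L: sigma_finite_measure "lebesgue_n (Suc n)" by (rule lborel_product.sigma_finite) simp
  interpret sML: pair_sigma_finite ?M "lebesgue_n (Suc n)" ..
  define Zm where "Zm = (\<lambda>z :: nat \<Rightarrow> nat \<Rightarrow> real. \<lambda>i j. if j < n then z i j else 1)"
  define \<Phi> where "\<Phi> = (\<lambda>z v. ennreal (\<bar>mdet (Suc n) (\<lambda>i j. if j < n then z i j else v i)\<bar> powr s) *
    (\<Prod>i<Suc n. ennreal (g ((\<Sum>k<n. (z i k)\<^sup>2) + (v i)\<^sup>2))))"
  \<comment> \<open>Of the exponent \<open>s + 1\<close>, the part \<open>s\<close> comes from the
    determinant of the lifted points and the remaining \<open>1\<close> from the Jacobian.\<close>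
  define \<Omega> where "\<Omega> = (\<lambda>z a. ennreal (\<bar>simplex_det n z\<bar> powr (s + 1)) *
    (\<Prod>i<Suc n. ennreal (g ((\<Sum>k<n. (z i k)\<^sup>2) + ((\<Sum>k<n. a k * z i k) + a n)\<^sup>2))))"
  have \<Phi>_meas: "\<Phi> z \<in> borel_measurable (lebesgue_n (Suc n))" for z
  proof -
    have "(\<lambda>v. mdet (Suc n) (\<lambda>i j. if j < n then z i j else v i)) \<in> borel_measurable (lebesgue_n (Suc n))"
    proof (rule borel_measurable_mdet)
      fix i j assume "i < Suc n"
      then have "(\<lambda>v. v i) \<in> borel_measurable (lebesgue_n (Suc n))"
        using measurable_component_singleton[of i "{..<Suc n}" "\<lambda>_. lborel :: real measure"] by simp
      then show "(\<lambda>v. if j < n then z i j else v i) \<in> borel_measurable (lebesgue_n (Suc n))"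
        by (cases "j < n") auto
    qed
    moreover have "(\<lambda>v. \<Prod>i<Suc n. ennreal (g ((\<Sum>k<n. (z i k)\<^sup>2) + (v i)\<^sup>2))) \<in> borel_measurable (lebesgue_n (Suc n))"
      by (rule borel_measurable_prod_ennreal) measurable
    ultimately show ?thesis
      unfolding \<Phi>_def by measurable
  qed
  have entry: "(\<lambda>p. fst p i j) \<in> borel_measurable (?M \<Otimes>\<^sub>M lebesgue_n (Suc n))" if "i < Suc n" "j < n" for i j
    using that by (intro measurable_compose[OF measurable_fst measurable_entry]) auto
  have entry2: "(\<lambda>p. snd p i) \<in> borel_measurable (?M \<Otimes>\<^sub>M lebesgue_n (Suc n))" if "i < Suc n" for i
    using that measurable_compose[OF measurable_snd measurable_component_singleton[of i "{..<Suc n}" "\<lambda>_. lborel :: real measure"]]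
    by simp
  have weight: "(\<lambda>p. \<Prod>i<Suc n. ennreal (g ((\<Sum>k<n. (fst p i k)\<^sup>2) + ((\<Sum>k<n. snd p k * fst p i k) + snd p n)\<^sup>2)))
      \<in> borel_measurable (?M \<Otimes>\<^sub>M lebesgue_n (Suc n))"
    by (intro borel_measurable_prod_ennreal measurable_compose[OF measurable_compose[OF _ g] measurable_ennreal]
        borel_measurable_add borel_measurable_sum borel_measurable_power borel_measurable_times entry entry2) auto
  have \<Omega>_meas: "(\<lambda>p. \<Omega> (fst p) (snd p)) \<in> borel_measurable (?M \<Otimes>\<^sub>M lebesgue_n (Suc n))"
    using weight measurable_simplex_det_fst[of n "lebesgue_n (Suc n)"] unfolding \<Omega>_def by measurable
  have "det_moment (Suc n) s (\<lambda>x. g (\<Sum>k<Suc n. (x k)\<^sup>2)) = (\<integral>\<^sup>+z. \<integral>\<^sup>+v. \<Phi> z v \<partial>lebesgue_n (Suc n) \<partial>?M)"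
  proof -
    let ?H = "\<lambda>y. ennreal (\<bar>mdet (Suc n) y\<bar> powr s) * (\<Prod>i<Suc n. ennreal (g (\<Sum>k<Suc n. (y i k)\<^sup>2)))"
    have sq: "(\<lambda>x. g (\<Sum>k<Suc n. (x k)\<^sup>2)) \<in> borel_measurable (lebesgue_n (Suc n))"
      by measurable
    have Heq: "?H (\<lambda>i\<in>{..<Suc n}. (z i)(n := v i)) = \<Phi> z v" for z v
    proof -
      have "mdet (Suc n) (\<lambda>i\<in>{..<Suc n}. (z i)(n := v i)) = mdet (Suc n) (\<lambda>i j. if j < n then z i j else v i)"
        by (rule mdet_cong) auto
      moreover have "(\<Prod>i<Suc n. ennreal (g (\<Sum>k<Suc n. ((\<lambda>i\<in>{..<Suc n}. (z i)(n := v i)) i k)\<^sup>2))) =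
          (\<Prod>i<Suc n. ennreal (g ((\<Sum>k<n. (z i k)\<^sup>2) + (v i)\<^sup>2)))"
        by (rule prod.cong) auto
      ultimately show ?thesis
        unfolding \<Phi>_def by (simp only:)
    qed
    have "det_moment (Suc n) s (\<lambda>x. g (\<Sum>k<Suc n. (x k)\<^sup>2)) =
        (\<integral>\<^sup>+z. \<integral>\<^sup>+v. ?H (\<lambda>i\<in>{..<Suc n}. (z i)(n := v i)) \<partial>lebesgue_n (Suc n) \<partial>?M)"
      unfolding det_moment_def
    proof (rule nn_integral_rows_Suc)
      show "?H \<in> borel_measurable (PiM {..<Suc n} (\<lambda>_. lebesgue_n (Suc n)))"
        using measurable_prod_rows[OF sq, of "{..<Suc n}"] measurable_mdet_rows[of "Suc n"] by measurable
    qed simp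
    then show ?thesis
      unfolding Heq .
  qed
  also have "\<dots> = (\<integral>\<^sup>+z. \<integral>\<^sup>+a. ennreal (\<bar>a n\<bar> powr s) * \<Omega> z a \<partial>lebesgue_n (Suc n) \<partial>?M)"
  proof (rule nn_integral_cong_AE)
    show "AE z in ?M. (\<integral>\<^sup>+v. \<Phi> z v \<partial>lebesgue_n (Suc n)) = (\<integral>\<^sup>+a. ennreal (\<bar>a n\<bar> powr s) * \<Omega> z a \<partial>lebesgue_n (Suc n))"
      using AE_simplex_det_nonzero[of n]
    proof eventually_elim
      case (elim z)
      have D: "mdet (Suc n) (Zm z) = simplex_det n z"
        by (simp add: simplex_det_def Zm_def)
      have \<Phi>_aff: "ennreal \<bar>simplex_det n z\<bar> * \<Phi> z (affine_n (Suc n) (Zm z) (\<lambda>_. 0) a) = ennreal (\<bar>a n\<bar> powr s) * \<Omega> z a" for a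
      proof -
        \<comment> \<open>Replacing the border of ones by the heights is right multiplication by
          \<open>E\<close>, whose determinant is the constant term \<open>a n\<close>.\<close>
        define E where "E = (\<lambda>k j. if j = n then a k else if k = j then 1 else (0::real))"
        have v: "affine_n (Suc n) (Zm z) (\<lambda>_. 0) a i = (\<Sum>k<n. a k * z i k) + a n" if "i < Suc n" for i
          using that by (simp add: affine_n_def Zm_def mult.commute cong: sum.cong_simp)
        have "mdet (Suc n) (\<lambda>i j. if j < n then z i j else affine_n (Suc n) (Zm z) (\<lambda>_. 0) a i) =
            mdet (Suc n) (\<lambda>i j. \<Sum>k<Suc n. Zm z i k * E k j)"
        proof (rule mdet_cong)
          fix i j assume ij: "i < Suc n" "j < Suc n"
          show "(if j < n then z i j else affine_n (Suc n) (Zm z) (\<lambda>_. 0) a i) = (\<Sum>k<Suc n. Zm z i k * E k j)"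
          proof (cases "j < n")
            case True
            have "(\<Sum>k<Suc n. Zm z i k * E k j) = (\<Sum>k<Suc n. if k = j then Zm z i k else 0)"
              by (rule sum.cong) (use True in \<open>auto simp: E_def\<close>)
            then show ?thesis using True by (simp add: Zm_def)
          next
            case False
            then have "j = n" using ij by simp
            then show ?thesis using ij v[of i] by (simp add: E_def Zm_def mult.commute cong: sum.cong_simp)
          qed
        qed
        also have "\<dots> = mdet (Suc n) (Zm z) * mdet (Suc n) E"
          by (rule mdet_mult)
        also have "mdet (Suc n) E = E n n * mdet n E"
          by (rule mdet_last_row) (simp add: E_def)
        also have "mdet n E = mdet n (\<lambda>i j. if i = j then 1 else 0)"
          by (rule mdet_cong) (simp add: E_def)
        finally have det: "mdet (Suc n) (\<lambda>i j. if j < n then z i j else affine_n (Suc n) (Zm z) (\<lambda>_. 0) a i) = simplex_det n z * a n"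
          by (simp add: mdet_one D E_def)
        have pr: "(\<Prod>i<Suc n. ennreal (g ((\<Sum>k<n. (z i k)\<^sup>2) + (affine_n (Suc n) (Zm z) (\<lambda>_. 0) a i)\<^sup>2))) =
            (\<Prod>i<Suc n. ennreal (g ((\<Sum>k<n. (z i k)\<^sup>2) + ((\<Sum>k<n. a k * z i k) + a n)\<^sup>2)))"
          by (rule prod.cong) (auto simp: v)
        have "\<bar>simplex_det n z\<bar> * (\<bar>simplex_det n z * a n\<bar> powr s) = \<bar>a n\<bar> powr s * \<bar>simplex_det n z\<bar> powr (s + 1)"
          using elim by (simp add: abs_mult powr_mult powr_add)
        then have "ennreal \<bar>simplex_det n z\<bar> * ennreal (\<bar>simplex_det n z * a n\<bar> powr s) =
            ennreal (\<bar>a n\<bar> powr s) * ennreal (\<bar>simplex_det n z\<bar> powr (s + 1))"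
          by (simp only: ennreal_mult[symmetric] abs_ge_zero powr_ge_zero)
        then show ?thesis
          unfolding \<Phi>_def \<Omega>_def det pr by (simp only: mult.assoc[symmetric])
      qed
      have meas: "(\<lambda>a. \<Phi> z (affine_n (Suc n) (Zm z) (\<lambda>_. 0) a)) \<in> borel_measurable (lebesgue_n (Suc n))"
        by (rule measurable_compose[OF measurable_affine_n \<Phi>_meas])
      have "(\<integral>\<^sup>+v. \<Phi> z v \<partial>lebesgue_n (Suc n)) = ennreal \<bar>mdet (Suc n) (Zm z)\<bar> *
          (\<integral>\<^sup>+a. \<Phi> z (affine_n (Suc n) (Zm z) (\<lambda>_. 0) a) \<partial>lebesgue_n (Suc n))"
        by (rule nn_integral_affine_n[OF _ \<Phi>_meas]) (use elim D in simp)
      also have "\<dots> = (\<integral>\<^sup>+a. ennreal (\<bar>a n\<bar> powr s) * \<Omega> z a \<partial>lebesgue_n (Suc n))"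
        unfolding D \<Phi>_aff[symmetric] by (rule nn_integral_cmult[symmetric]) (rule meas)
      finally show ?case .
    qed
  qed
  also have "\<dots> = (\<integral>\<^sup>+a. \<integral>\<^sup>+z. ennreal (\<bar>a n\<bar> powr s) * \<Omega> z a \<partial>?M \<partial>lebesgue_n (Suc n))"
  proof (rule sML.Fubini'[symmetric])
    show "(\<lambda>(z, a). ennreal (\<bar>a n\<bar> powr s) * \<Omega> z a) \<in> borel_measurable (?M \<Otimes>\<^sub>M lebesgue_n (Suc n))"
      unfolding split_def using \<Omega>_meas entry2[of n] by measurable
  qed
  also have "\<dots> = (\<integral>\<^sup>+a. ennreal (\<bar>a n\<bar> powr s) *
      simplex_moment n (s + 1) (\<lambda>x. g ((\<Sum>k<n. (x k)\<^sup>2) + ((\<Sum>k<n. a k * x k) + a n)\<^sup>2)) \<partial>lebesgue_n (Suc n))"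
  proof (rule nn_integral_cong)
    fix a :: "nat \<Rightarrow> real"
    have "(\<lambda>z. \<Omega> z a) \<in> borel_measurable ?M"
      unfolding \<Omega>_def by (rule measurable_simplex_integrand) measurable
    then show "(\<integral>\<^sup>+z. ennreal (\<bar>a n\<bar> powr s) * \<Omega> z a \<partial>?M) = ennreal (\<bar>a n\<bar> powr s) *
      simplex_moment n (s + 1) (\<lambda>x. g ((\<Sum>k<n. (x k)\<^sup>2) + ((\<Sum>k<n. a k * x k) + a n)\<^sup>2))"
      unfolding simplex_moment_def \<Omega>_def by (rule nn_integral_cmult)
  qed
  finally show ?thesis .
qed

text \<open>Rescaling the intercept to the signed distance \<open>h\<close> of the hyperplane from
  the origin separates the variables: slope, distance and shape of the simplex integrate
  independently. \<open>B\<close> is the exponent of \<open>simplex_moment_hyperplane\<close> at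
  \<open>s + 1\<close>.\<close>

lemma det_moment_eq_simplex_moment:
  fixes n :: nat and b s :: real
  defines "B \<equiv> (real n + 1) * b + real n * (real n + 2 + s) / 2"
  shows "det_moment (Suc n) s (\<lambda>x. beta_weight b (\<Sum>k<Suc n. (x k)\<^sup>2)) =
    (\<integral>\<^sup>+\<alpha>. ennreal ((1 + (\<Sum>k<n. (\<alpha> k)\<^sup>2)) powr (- (real n + 1) / 2)) \<partial>lebesgue_n n) *
    ((\<integral>\<^sup>+h. ennreal (\<bar>h\<bar> powr s * beta_weight B (h\<^sup>2)) \<partial>lborel) *
     simplex_moment n (s + 1) (\<lambda>x. beta_weight b (\<Sum>k<n. (x k)\<^sup>2)))"
proof -
  define S where "S = (\<lambda>a :: nat \<Rightarrow> real. \<Sum>k<n. (a k)\<^sup>2)"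
  define m where "m = simplex_moment n (s + 1) (\<lambda>x. beta_weight b (\<Sum>k<n. (x k)\<^sup>2))"
  define I where "I = (\<integral>\<^sup>+h. ennreal (\<bar>h\<bar> powr s * beta_weight B (h\<^sup>2)) \<partial>lborel)"
  have S: "S a \<ge> 0" for a unfolding S_def by (rule sum_nonneg) simp
  have S_meas [measurable]: "S \<in> borel_measurable (lebesgue_n n)"
    unfolding S_def by measurable
  have S_meas' [measurable]: "S \<in> borel_measurable (lebesgue_n (Suc n))"
    unfolding S_def by (intro borel_measurable_sum borel_measurable_power)
      (use measurable_component_singleton[of _ "{..<Suc n}" "\<lambda>_. lborel :: real measure"] in simp)
  define F where "F = (\<lambda>S c. ennreal (\<bar>c\<bar> powr s) * (ennreal ((1 + S) powr (- (real n + 2 + s) / 2)) *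
    (ennreal (beta_weight B (c\<^sup>2 / (1 + S))) * m)))"
  have F_eq: "(\<integral>\<^sup>+c. F S c \<partial>lborel) = ennreal ((1 + S) powr (- (real n + 1) / 2)) * (I * m)" if S: "S \<ge> 0" for S
  proof -
    \<comment> \<open>The intercept is \<open>c = A * h\<close>. The factor \<open>A\<close> of the
      differential and \<open>A powr s\<close> from the intercept reduce the power of
      \<open>1 + S\<close> to \<open>- (n + 1) / 2\<close>, which is free of
      \<open>s\<close>.\<close>
    define A where "A = sqrt (1 + S)"
    have A: "A > 0" "A\<^sup>2 = 1 + S" using S by (auto simp: A_def)
    have Apow: "A powr t = (1 + S) powr (t / 2)" for t
      using S by (simp add: A_def powr_half_sqrt[symmetric] powr_powr)
    have "(\<integral>\<^sup>+c. F S c \<partial>lborel) = ennreal \<bar>A\<bar> * (\<integral>\<^sup>+h. F S (0 + A * h) \<partial>lborel)"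
      by (rule nn_integral_real_affine) (use A in \<open>auto simp: F_def\<close>)
    also have "\<dots> = (\<integral>\<^sup>+h. ennreal \<bar>A\<bar> * F S (0 + A * h) \<partial>lborel)"
      unfolding F_def by (rule nn_integral_cmult[symmetric]) measurable
    also have "\<dots> = (\<integral>\<^sup>+h. ennreal ((1 + S) powr (- (real n + 1) / 2)) * m * ennreal (\<bar>h\<bar> powr s * beta_weight B (h\<^sup>2)) \<partial>lborel)"
    proof (rule nn_integral_cong)
      fix h :: real
      have "A * (\<bar>A * h\<bar> powr s * ((1 + S) powr (- (real n + 2 + s) / 2) * beta_weight B ((A * h)\<^sup>2 / (1 + S)))) =
          A powr 1 * A powr s * (1 + S) powr (- (real n + 2 + s) / 2) * (\<bar>h\<bar> powr s * beta_weight B (h\<^sup>2))"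
        using A S by (simp add: abs_mult powr_mult power_mult_distrib)
      also have "A powr 1 * A powr s * (1 + S) powr (- (real n + 2 + s) / 2) = (1 + S) powr (- (real n + 1) / 2)"
        unfolding Apow powr_add[symmetric] by (simp add: field_simps)
      finally have "ennreal A * (ennreal (\<bar>A * h\<bar> powr s) * (ennreal ((1 + S) powr (- (real n + 2 + s) / 2)) *
          ennreal (beta_weight B ((A * h)\<^sup>2 / (1 + S))))) =
          ennreal ((1 + S) powr (- (real n + 1) / 2)) * ennreal (\<bar>h\<bar> powr s * beta_weight B (h\<^sup>2))"
        using A by (simp only: ennreal_mult[symmetric] beta_weight_nonneg powr_ge_zero less_imp_le mult_nonneg_nonneg)
      then show "ennreal \<bar>A\<bar> * F S (0 + A * h) =
          ennreal ((1 + S) powr (- (real n + 1) / 2)) * m * ennreal (\<bar>h\<bar> powr s * beta_weight B (h\<^sup>2))"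
        using A unfolding F_def by (simp add: mult_ac)
    qed
    also have "\<dots> = ennreal ((1 + S) powr (- (real n + 1) / 2)) * m * I"
      unfolding I_def by (rule nn_integral_cmult) measurable
    finally show ?thesis by (simp only: mult_ac)
  qed
  have "det_moment (Suc n) s (\<lambda>x. beta_weight b (\<Sum>k<Suc n. (x k)\<^sup>2)) =
      (\<integral>\<^sup>+a. ennreal (\<bar>a n\<bar> powr s) * simplex_moment n (s + 1)
        (\<lambda>x. beta_weight b ((\<Sum>k<n. (x k)\<^sup>2) + ((\<Sum>k<n. a k * x k) + a n)\<^sup>2)) \<partial>lebesgue_n (Suc n))"
    by (rule det_moment_graph_coordinates) measurable
  also have "\<dots> = (\<integral>\<^sup>+a. F (S a) (a n) \<partial>lebesgue_n (Suc n))"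
    unfolding simplex_moment_hyperplane F_def S_def B_def m_def by (simp add: algebra_simps)
  also have "\<dots> = (\<integral>\<^sup>+\<alpha>. \<integral>\<^sup>+c. F (S (\<alpha>(n := c))) ((\<alpha>(n := c)) n) \<partial>lborel \<partial>lebesgue_n n)"
    by (rule nn_integral_lebesgue_n_Suc) (unfold F_def, measurable)
  also have "\<dots> = (\<integral>\<^sup>+\<alpha>. ennreal ((1 + S \<alpha>) powr (- (real n + 1) / 2)) * (I * m) \<partial>lebesgue_n n)"
    by (intro nn_integral_cong) (simp add: S_def F_eq[OF S, unfolded S_def])
  also have "\<dots> = (\<integral>\<^sup>+\<alpha>. ennreal ((1 + S \<alpha>) powr (- (real n + 1) / 2)) \<partial>lebesgue_n n) * (I * m)"
    by (rule nn_integral_multc) measurable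
  finally show ?thesis
    unfolding S_def I_def m_def .
qed

text \<open>The value is half the surface area of the unit sphere in dimension \<open>n + 1\<close>:
  slopes of hyperplanes parametrise a hemisphere. The power of \<open>1 + S\<close> is written as an
  integral of Gaussians, which factors over the coordinates once the order of integration is
  exchanged.\<close>

lemma nn_integral_sphere_constant:
  assumes n: "n \<ge> 1"
  shows "(\<integral>\<^sup>+\<alpha>. ennreal ((1 + (\<Sum>k<n. (\<alpha> k)\<^sup>2)) powr (- (real n + 1) / 2)) \<partial>lebesgue_n n) =
    ennreal (pi powr ((real n + 1) / 2) / Gamma ((real n + 1) / 2))"
proof -
  define p where "p = (real n + 1) / 2"
  define S where "S = (\<lambda>a :: nat \<Rightarrow> real. \<Sum>k<n. (a k)\<^sup>2)"
  have S: "S a \<ge> 0" for a unfolding S_def by (rule sum_nonneg) simp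
  have [measurable]: "S \<in> borel_measurable (lebesgue_n n)"
    unfolding S_def by measurable
  interpret L: sigma_finite_measure "lebesgue_n n" by (rule lborel_product.sigma_finite) simp
  interpret LL: pair_sigma_finite "lebesgue_n n" "lborel :: real measure" ..
  have Gp: "Gamma p > 0" by (intro Gamma_real_pos) (simp add: p_def)
  \<comment> \<open>The Gamma integral in the form
    \<open>2 * u powr (2 * p - 1) * exp (- u^2)\<close>, rescaled by
    \<open>sqrt (1 + S)\<close>.\<close>
  have 1: "ennreal (Gamma p) * ennreal ((1 + S a) powr (- p)) =
      (\<integral>\<^sup>+u. indicator {0<..} u * ennreal (u powr (2 * p - 1)) * ennreal (2 * exp (- u\<^sup>2 * (1 + S a))) \<partial>lborel)" for a
  proof -
    define A where "A = sqrt (1 + S a)"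
    have A: "A > 0" "A\<^sup>2 = 1 + S a" using S[of a] by (auto simp: A_def add_pos_nonneg)
    define H where "H = (\<lambda>u. indicator {0<..} (0 + A * u) * ennreal ((0 + A * u) powr (2 * p - 1)) *
        ennreal (exp (- (0 + A * u)\<^sup>2)))"
    have H_meas: "H \<in> borel_measurable lborel"
      unfolding H_def by measurable
    have "ennreal (Gamma p) = ennreal 2 * ennreal (Gamma ((2 * p - 1 + 1) / 2) / 2)"
      using Gp by (subst ennreal_mult[symmetric]) auto
    also have "\<dots> = ennreal 2 * (\<integral>\<^sup>+r. indicator {0<..} r * ennreal (r powr (2 * p - 1)) * ennreal (exp (- r\<^sup>2)) \<partial>lborel)"
      by (subst nn_integral_powr_gauss) (auto simp: p_def)
    also have "(\<integral>\<^sup>+r. indicator {0<..} r * ennreal (r powr (2 * p - 1)) * ennreal (exp (- r\<^sup>2)) \<partial>lborel) =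
        ennreal \<bar>A\<bar> * (\<integral>\<^sup>+u. indicator {0<..} (0 + A * u) * ennreal ((0 + A * u) powr (2 * p - 1)) * ennreal (exp (- (0 + A * u)\<^sup>2)) \<partial>lborel)"
      by (rule nn_integral_real_affine) (use A in auto)
    finally have G: "ennreal (Gamma p) = ennreal 2 * (ennreal \<bar>A\<bar> * (\<integral>\<^sup>+u. H u \<partial>lborel))"
      by (simp only: H_def)
    have "ennreal (Gamma p) * ennreal ((1 + S a) powr (- p)) =
        (\<integral>\<^sup>+u. ennreal 2 * (ennreal \<bar>A\<bar> * H u) * ennreal ((1 + S a) powr (- p)) \<partial>lborel)"
      unfolding G by (simp only: nn_integral_cmult nn_integral_multc borel_measurable_times_ennreal borel_measurable_const H_meas)
    also have "\<dots> = (\<integral>\<^sup>+u. indicator {0<..} u * ennreal (u powr (2 * p - 1)) * ennreal (2 * exp (- u\<^sup>2 * (1 + S a))) \<partial>lborel)"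
    proof (rule nn_integral_cong)
      fix u :: real
      show "ennreal 2 * (ennreal \<bar>A\<bar> * H u) * ennreal ((1 + S a) powr (- p)) = indicator {0<..} u * ennreal (u powr (2 * p - 1)) * ennreal (2 * exp (- u\<^sup>2 * (1 + S a)))"
      proof (cases "u > 0")
        case True
        have "(1 + S a) powr (- p) = A powr (- 2 * p)"
          using A square_powr[OF A(1), of "- p"] by simp
        then have "A * A powr (2 * p - 1) * (1 + S a) powr (- p) = A powr 1 * A powr (2 * p - 1) * A powr (- 2 * p)"
          using A by simp
        also have "\<dots> = 1"
          using A unfolding powr_add[symmetric] by simp
        finally have e: "A * A powr (2 * p - 1) * (1 + S a) powr (- p) = 1" .
        have "2 * (A * ((A * u) powr (2 * p - 1) * exp (- (A * u)\<^sup>2))) * (1 + S a) powr (- p) =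
            A * A powr (2 * p - 1) * (1 + S a) powr (- p) * (u powr (2 * p - 1) * (2 * exp (- u\<^sup>2 * (1 + S a))))"
          using A True by (simp add: powr_mult power_mult_distrib mult_ac)
        then have "2 * (A * ((A * u) powr (2 * p - 1) * exp (- (A * u)\<^sup>2))) * (1 + S a) powr (- p) =
            u powr (2 * p - 1) * (2 * exp (- u\<^sup>2 * (1 + S a)))"
          unfolding e by simp
        then have "ennreal 2 * (ennreal A * (ennreal ((A * u) powr (2 * p - 1)) * ennreal (exp (- (A * u)\<^sup>2)))) * ennreal ((1 + S a) powr (- p)) =
            ennreal (u powr (2 * p - 1)) * ennreal (2 * exp (- u\<^sup>2 * (1 + S a)))"
          using A by (simp only: ennreal_mult[symmetric] powr_ge_zero exp_ge_zero less_imp_le mult_nonneg_nonneg zero_le_numeral)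
        then show ?thesis
          using True A by (simp only: add_0 abs_of_pos H_def) simp
      next
        case False
        then have "\<not> A * u > 0" using A by (simp add: zero_less_mult_iff)
        with False show ?thesis by (simp add: H_def)
      qed
    qed
    finally show ?thesis .
  qed
  have gauss: "(\<integral>\<^sup>+a. ennreal (exp (- u\<^sup>2 * S a)) \<partial>lebesgue_n n) * ennreal (u ^ n) = ennreal (sqrt pi ^ n)" if "u > 0" for u
  proof -
    have scale: "S (\<lambda>i\<in>{..<n}. u * x i) = u\<^sup>2 * S x" for x
      by (simp add: S_def power_mult_distrib sum_distrib_left)
    have "ennreal (sqrt pi ^ n) = (\<integral>\<^sup>+x. ennreal (exp (- S x)) \<partial>lebesgue_n n)"
    proof -
      have "ennreal (exp (- S x)) = (\<Prod>i<n. ennreal (exp (- (x i)\<^sup>2)))" for x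
        by (simp add: S_def exp_sum[symmetric] sum_negf prod_ennreal)
      then show ?thesis
        by (simp add: nn_integral_gauss_PiM)
    qed
    also have "\<dots> = ennreal (\<bar>u\<bar> ^ n) * (\<integral>\<^sup>+x. ennreal (exp (- S (\<lambda>i\<in>{..<n}. u * x i))) \<partial>lebesgue_n n)"
      by (rule nn_integral_lebesgue_n_scale) (use that in \<open>simp, measurable\<close>)
    finally show ?thesis
      using that unfolding scale by (simp add: mult.commute)
  qed
  have "ennreal (Gamma p) * (\<integral>\<^sup>+a. ennreal ((1 + S a) powr (- p)) \<partial>lebesgue_n n) =
      (\<integral>\<^sup>+a. \<integral>\<^sup>+u. indicator {0<..} u * ennreal (u powr (2 * p - 1)) * ennreal (2 * exp (- u\<^sup>2 * (1 + S a))) \<partial>lborel \<partial>lebesgue_n n)"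
    unfolding 1[symmetric] by (rule nn_integral_cmult[symmetric]) measurable
  also have "\<dots> = (\<integral>\<^sup>+u. \<integral>\<^sup>+a. indicator {0<..} u * ennreal (u powr (2 * p - 1)) * ennreal (2 * exp (- u\<^sup>2 * (1 + S a))) \<partial>lebesgue_n n \<partial>lborel)"
    by (rule LL.Fubini'[symmetric]) measurable
  also have "\<dots> = (\<integral>\<^sup>+u. ennreal (2 * sqrt pi ^ n) * (indicator {0<..} u * ennreal (u powr 0) * ennreal (exp (- u\<^sup>2))) \<partial>lborel)"
  proof (rule nn_integral_cong)
    fix u :: real
    show "(\<integral>\<^sup>+a. indicator {0<..} u * ennreal (u powr (2 * p - 1)) * ennreal (2 * exp (- u\<^sup>2 * (1 + S a))) \<partial>lebesgue_n n) =
      ennreal (2 * sqrt pi ^ n) * (indicator {0<..} u * ennreal (u powr 0) * ennreal (exp (- u\<^sup>2)))"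
    proof (cases "u > 0")
      case True
      \<comment> \<open>The power of \<open>u\<close> is exactly the one that cancels the scaling of
        the \<open>n\<close>-dimensional Gaussian integral.\<close>
      have "2 * p - 1 = real n"
        by (simp add: p_def field_simps)
      then have "u powr (2 * p - 1) = u ^ n"
        using True by (simp only: powr_realpow)
      then have "indicator {0<..} u * ennreal (u powr (2 * p - 1)) * ennreal (2 * exp (- u\<^sup>2 * (1 + S a))) =
          ennreal (2 * exp (- u\<^sup>2)) * (ennreal (exp (- u\<^sup>2 * S a)) * ennreal (u ^ n))" for a
        using True by (simp add: ennreal_mult[symmetric] exp_add[symmetric] algebra_simps)
      then have "(\<integral>\<^sup>+a. indicator {0<..} u * ennreal (u powr (2 * p - 1)) * ennreal (2 * exp (- u\<^sup>2 * (1 + S a))) \<partial>lebesgue_n n) =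
          ennreal (2 * exp (- u\<^sup>2)) * ((\<integral>\<^sup>+a. ennreal (exp (- u\<^sup>2 * S a)) \<partial>lebesgue_n n) * ennreal (u ^ n))"
        by (simp only:) (subst nn_integral_cmult, measurable, subst nn_integral_multc, measurable)
      also have "\<dots> = ennreal (2 * sqrt pi ^ n) * ennreal (exp (- u\<^sup>2))"
        unfolding gauss[OF True] by (simp add: ennreal_mult[symmetric] mult_ac)
      finally show ?thesis using True by simp
    qed simp
  qed
  also have "\<dots> = ennreal (2 * sqrt pi ^ n) * ennreal (Gamma ((0 + 1) / 2) / 2)"
    by (subst nn_integral_cmult) (use nn_integral_powr_gauss[of 0] in auto)
  also have "\<dots> = ennreal (pi powr ((real n + 1) / 2))"
  proof -
    have "pi powr ((real n + 1) / 2) = sqrt pi ^ Suc n"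
      by (simp add: powr_half_sqrt[symmetric] powr_powr powr_realpow[symmetric] algebra_simps del: power_Suc)
    then show ?thesis
      by (subst ennreal_mult[symmetric]) (auto simp: Gamma_one_half_real)
  qed
  finally have "ennreal (1 / Gamma p) * (ennreal (Gamma p) * (\<integral>\<^sup>+a. ennreal ((1 + S a) powr (- p)) \<partial>lebesgue_n n)) =
      ennreal (1 / Gamma p) * ennreal (pi powr ((real n + 1) / 2))"
    by (simp only:)
  then have "(\<integral>\<^sup>+a. ennreal ((1 + S a) powr (- p)) \<partial>lebesgue_n n) = ennreal (pi powr ((real n + 1) / 2) / Gamma p)"
    using Gp by (simp add: mult.assoc[symmetric] ennreal_mult[symmetric])
  then show ?thesis
    by (simp only: S_def p_def minus_divide_left)
qed

lemma nn_integral_abs_powr_beta: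
  assumes "s > - 1" "B > - 1"
  shows "(\<integral>\<^sup>+h. ennreal (\<bar>h\<bar> powr s * beta_weight B (h\<^sup>2)) \<partial>lborel) = ennreal (Beta ((s + 1) / 2) (B + 1))"
proof -
  let ?f = "\<lambda>h. ennreal (\<bar>h\<bar> powr s * beta_weight B (h\<^sup>2))"
  have half: "(\<integral>\<^sup>+h. indicator {0<..} h * ?f h \<partial>lborel) = ennreal (Beta ((s + 1) / 2) (B + 1) / 2)"
  proof -
    have "indicator {0<..} h * ?f h = indicator {0<..} h * ennreal (h powr s) * ennreal (if h < 1 then (1 - h\<^sup>2) powr B else 0)" for h
    proof (cases "h > 0")
      case True
      then have "h\<^sup>2 < 1 \<longleftrightarrow> h < 1" by (simp add: power2_less_1_iff)
      then show ?thesis using True by (auto simp: beta_weight_def ennreal_mult)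
    qed simp
    then show ?thesis
      using nn_integral_powr_beta[OF assms] by simp
  qed
  have "(\<integral>\<^sup>+h. ?f h \<partial>lborel) = (\<integral>\<^sup>+h. indicator {0<..} h * ?f h + indicator {0<..} (0 + (- 1) * h) * ?f (0 + (- 1) * h) \<partial>lborel)"
    by (intro nn_integral_cong_AE AE_I[where N = "{0}"]) (auto split: split_indicator_asm simp: not_less indicator_def)
  also have "\<dots> = (\<integral>\<^sup>+h. indicator {0<..} h * ?f h \<partial>lborel) + (\<integral>\<^sup>+h. indicator {0<..} (0 + (- 1) * h) * ?f (0 + (- 1) * h) \<partial>lborel)"
    by (rule nn_integral_add) measurable
  also have "(\<integral>\<^sup>+h. indicator {0<..} (0 + (- 1) * h) * ?f (0 + (- 1) * h) \<partial>lborel) = (\<integral>\<^sup>+h. indicator {0<..} h * ?f h \<partial>lborel)"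
    using nn_integral_real_affine[of "\<lambda>h. indicator {0<..} h * ?f h" "- 1" 0] by simp
  also have "(\<integral>\<^sup>+h. indicator {0<..} h * ?f h \<partial>lborel) + (\<integral>\<^sup>+h. indicator {0<..} h * ?f h \<partial>lborel) = ennreal (Beta ((s + 1) / 2) (B + 1))"
    unfolding half using Beta_real_pos[of "(s + 1) / 2" "B + 1"] assms by (subst ennreal_plus[symmetric]) auto
  finally show ?thesis .
qed

text \<open>The moment of order \<open>s\<close> of \<open>n!\<close> times the simplex volume,
  known as Miles' formula. The last quotient is what remains of the Beta integral over the distance
  of the hyperplane.\<close>

definition moment_real :: "nat \<Rightarrow> real \<Rightarrow> real \<Rightarrow> real" where
  "moment_real n \<nu> s = (\<Prod>j=1..n. Gamma ((real j + s) / 2) / Gamma (real j / 2)) *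
     (Gamma ((real n + \<nu>) / 2) / Gamma ((real n + \<nu> + s) / 2)) ^ Suc n *
     (Gamma (((real n + 1) * (real n + \<nu> + s) - 2 * real n) / 2) /
      Gamma (((real n + 1) * (real n + \<nu>) + real n * s - 2 * real n) / 2))"

definition beta_const :: "nat \<Rightarrow> real \<Rightarrow> real" where
  "beta_const n \<nu> = pi powr (- real n / 2) * Gamma ((real n + \<nu>) / 2) / Gamma (\<nu> / 2)"

lemma beta_const_pos: "n \<ge> 1 \<Longrightarrow> \<nu> > 0 \<Longrightarrow> beta_const n \<nu> > 0"
  unfolding beta_const_def by (intro divide_pos_pos mult_pos_pos Gamma_real_pos) auto

lemma beta_distribution_eq:
  "beta_distribution n \<nu> = density (lebesgue_n n)
     (\<lambda>x. ennreal (beta_const n \<nu> * beta_weight ((\<nu> - 2) / 2) (\<Sum>k<n. (x k)\<^sup>2)))"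
proof -
  have "(if L2_set x {..<n} < 1
       then pi powr (- real n / 2) * Gamma ((real n + \<nu>) / 2) / Gamma (\<nu> / 2)
            * (1 - (L2_set x {..<n})\<^sup>2) powr ((\<nu> - 2) / 2)
       else 0) = beta_const n \<nu> * beta_weight ((\<nu> - 2) / 2) (\<Sum>k<n. (x k)\<^sup>2)" for x
  proof -
    have "(\<Sum>k<n. (x k)\<^sup>2) < 1 \<longleftrightarrow> L2_set x {..<n} < 1"
      by (simp add: L2_set_def)
    then show ?thesis
      by (simp add: beta_weight_def beta_const_def L2_set_square)
  qed
  then show ?thesis
    unfolding beta_distribution_def by (simp only:)
qed

lemma sets_beta_distribution [measurable_cong, simp]: "sets (beta_distribution n \<nu>) = sets (lebesgue_n n)"
  by (simp add: beta_distribution_eq)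

text \<open>The hyperplane identity in dimension \<open>n + 1\<close> at exponent
  \<open>s - 1\<close> has an explicit determinant moment on the left and explicit slope and
  distance integrals on the right; it is solved for the simplex moment.\<close>

lemma simplex_moment_beta:
  assumes n: "n \<ge> 1" and \<nu>: "\<nu> > 0" and s: "s \<ge> 1"
  shows "(\<integral>\<^sup>+x. ennreal (\<bar>simplex_det n x\<bar> powr s) \<partial>PiM {..<Suc n} (\<lambda>_. beta_distribution n \<nu>)) =
    ennreal (moment_real n \<nu> s)"
proof -
  define b where "b = (\<nu> - 2) / 2"
  define w where "w = (\<lambda>x :: nat \<Rightarrow> real. beta_weight b (\<Sum>k<n. (x k)\<^sup>2))"
  define m where "m = simplex_moment n s w"
  define B where "B = (real n + 1) * b + real n * (real n + 2 + (s - 1)) / 2"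
  define C where "C = Gamma (b + 1) / Gamma ((real (Suc n) + (s - 1)) / 2 + b + 1)"
  define P where "P = (\<Prod>j=1..Suc n. Gamma ((real j + (s - 1)) / 2) / Gamma (real j / 2))"
  define Q where "Q = (\<Prod>j=1..n. Gamma ((real j + s) / 2) / Gamma (real j / 2))"
  define \<kappa> where "\<kappa> = pi powr ((real n + 1) / 2) / Gamma ((real n + 1) / 2)"
  have w [measurable]: "w \<in> borel_measurable (lebesgue_n n)"
    unfolding w_def by measurable
  have b: "b > - 1" using \<nu> by (simp add: b_def)
  have B1: "B + 1 = ((real n + 1) * (real n + \<nu>) + real n * s - 2 * real n) / 2"
    by (simp add: B_def b_def field_simps)
  have "(real n + 1) * \<nu> > 0" "real n * real n \<ge> real n" "real n * s \<ge> 0"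
    using n \<nu> s by (simp_all add: mult_pos_pos)
  then have B: "B > - 1"
    using B1 by (simp add: algebra_simps)
  have \<kappa>: "\<kappa> > 0"
    unfolding \<kappa>_def by (intro divide_pos_pos Gamma_real_pos) auto
  have Beta: "Beta (s / 2) (B + 1) > 0"
    using s B by (intro Beta_real_pos) auto
  have C: "C > 0"
    unfolding C_def using b s n by (intro divide_pos_pos Gamma_real_pos) (auto simp: field_simps)
  have P: "P > 0"
    unfolding P_def using s by (intro prod_pos ballI divide_pos_pos Gamma_real_pos) auto
  have c: "beta_const n \<nu> > 0"
    by (rule beta_const_pos[OF n \<nu>])
  have "ennreal (C ^ Suc n) * ennreal (sqrt pi ^ (Suc n * Suc n) * P) = det_moment (Suc n) (s - 1) (\<lambda>x. beta_weight b (\<Sum>k<Suc n. (x k)\<^sup>2))"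
    using det_moment_beta[of "Suc n" "s - 1" b] gauss_det_integral_eq[of "s - 1" "Suc n"] s b
    by (simp only: L2_set_square C_def P_def)
  also have "\<dots> = ennreal \<kappa> * (ennreal (Beta (s / 2) (B + 1)) * m)"
    using det_moment_eq_simplex_moment[of n "s - 1" b] nn_integral_sphere_constant[OF n]
      nn_integral_abs_powr_beta[of "s - 1" B] s B
    by (simp add: m_def w_def \<kappa>_def B_def)
  also have "\<dots> = ennreal (\<kappa> * Beta (s / 2) (B + 1)) * m"
    using \<kappa> by (intro ennreal_mult_left_assoc) simp
  finally have eq: "ennreal (C ^ Suc n * (sqrt pi ^ (Suc n * Suc n) * P)) = ennreal (\<kappa> * Beta (s / 2) (B + 1)) * m"
    using C P by (simp add: ennreal_mult)
  \<comment> \<open>The factor is positive and finite, so it can be cancelled in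
    \<open>ennreal\<close>; finiteness of \<open>m\<close> is a consequence.\<close>
  have "m = ennreal (1 / (\<kappa> * Beta (s / 2) (B + 1))) * (ennreal (\<kappa> * Beta (s / 2) (B + 1)) * m)"
    using \<kappa> Beta by (simp add: mult.assoc[symmetric] ennreal_mult[symmetric])
  also have "\<dots> = ennreal (C ^ Suc n * (sqrt pi ^ (Suc n * Suc n) * P) / (\<kappa> * Beta (s / 2) (B + 1)))"
    unfolding eq[symmetric] using \<kappa> Beta C P by (subst ennreal_mult[symmetric]) auto
  finally have m: "m = ennreal (C ^ Suc n * (sqrt pi ^ (Suc n * Suc n) * P) / (\<kappa> * Beta (s / 2) (B + 1)))" .
  have "(\<integral>\<^sup>+x. ennreal (\<bar>simplex_det n x\<bar> powr s) \<partial>PiM {..<Suc n} (\<lambda>_. beta_distribution n \<nu>)) =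
      simplex_moment n s (\<lambda>x. beta_const n \<nu> * w x)"
    unfolding beta_distribution_eq simplex_moment_def w_def b_def
    by (rule nn_integral_PiM_density) (auto intro: lborel_product.sigma_finite)
  also have "\<dots> = ennreal (beta_const n \<nu> ^ Suc n) * m"
    unfolding m_def using c by (intro simplex_moment_cmult) auto
  also have "\<dots> = ennreal (beta_const n \<nu> ^ Suc n * (C ^ Suc n * (sqrt pi ^ (Suc n * Suc n) * P) / (\<kappa> * Beta (s / 2) (B + 1))))"
    unfolding m using c C P \<kappa> Beta by (subst ennreal_mult) auto
  also have "beta_const n \<nu> ^ Suc n * (C ^ Suc n * (sqrt pi ^ (Suc n * Suc n) * P) / (\<kappa> * Beta (s / 2) (B + 1))) = moment_real n \<nu> s"
  proof -
    define E where "E = Gamma ((real n + \<nu>) / 2) / Gamma ((real n + \<nu> + s) / 2)"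
    have cC: "beta_const n \<nu> * C = pi powr (- real n / 2) * E"
    proof -
      have e: "b + 1 = \<nu> / 2" "(real (Suc n) + (s - 1)) / 2 + b + 1 = (real n + \<nu> + s) / 2"
        by (simp_all add: b_def field_simps)
      have "Gamma (\<nu> / 2) > 0" using \<nu> by (intro Gamma_real_pos) simp
      then show ?thesis
        unfolding C_def e beta_const_def E_def by simp
    qed
    \<comment> \<open>Shifting the index turns \<open>j = 1..n+1\<close> at \<open>s - 1\<close>
      into \<open>j = 0..n\<close> at \<open>s\<close>. The extra factor
      \<open>Gamma (s / 2)\<close> at \<open>j = 0\<close> cancels against the distance integral,
      the factor \<open>Gamma ((n + 1) / 2)\<close> against the slope integral.\<close>
    have PQ: "P = Q * Gamma (s / 2) / Gamma ((real n + 1) / 2)"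
    proof -
      have "P = (\<Prod>j=1..Suc n. Gamma ((real j + (s - 1)) / 2)) / (\<Prod>j=1..Suc n. Gamma (real j / 2))"
        unfolding P_def by (rule prod_dividef)
      also have "(\<Prod>j=1..Suc n. Gamma (real j / 2)) = (\<Prod>j=1..n. Gamma (real j / 2)) * Gamma ((real n + 1) / 2)"
        by (simp add: add.commute)
      also have "(\<Prod>j=1..Suc n. Gamma ((real j + (s - 1)) / 2)) = (\<Prod>j\<in>{0..n}. Gamma ((real (Suc j) + (s - 1)) / 2))"
        using prod.shift_bounds_cl_Suc_ivl[of "\<lambda>j. Gamma ((real j + (s - 1)) / 2)" 0 n] by simp
      also have "\<dots> = (\<Prod>j\<in>{0..n}. Gamma ((real j + s) / 2))"
        by simp
      also have "\<dots> = Gamma (s / 2) * (\<Prod>j=1..n. Gamma ((real j + s) / 2))"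
        by (subst prod.atLeast_Suc_atMost) auto
      finally show ?thesis
        unfolding Q_def prod_dividef by (simp add: field_simps)
    qed
    have pi_cancel: "(pi powr (- real n / 2)) ^ Suc n * sqrt pi ^ (Suc n * Suc n) = pi powr ((real n + 1) / 2)"
    proof -
      have "sqrt pi ^ (Suc n * Suc n) = pi powr (1 / 2 * real (Suc n * Suc n))"
        by (simp only: powr_half_sqrt[symmetric] powr_powr[symmetric] pi_ge_zero) (subst powr_realpow; simp)
      moreover have "(pi powr (- real n / 2)) ^ Suc n = pi powr (- real n / 2 * real (Suc n))"
        by (simp only: powr_powr[symmetric]) (subst powr_realpow; simp)
      moreover have "- real n / 2 * real (Suc n) + 1 / 2 * real (Suc n * Suc n) = (real n + 1) / 2"
        by (simp add: field_simps)
      ultimately show ?thesis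
        by (simp only: powr_add[symmetric])
    qed
    have G: "Gamma (s / 2) > 0" "Gamma ((real n + 1) / 2) > 0" "Gamma (B + 1) > 0" "Gamma (s / 2 + (B + 1)) > 0"
      using s B by (auto intro!: Gamma_real_pos)
    have SB: "s / 2 + (B + 1) = ((real n + 1) * (real n + \<nu> + s) - 2 * real n) / 2"
      unfolding B1 by (simp add: field_simps)
    have "beta_const n \<nu> ^ Suc n * (C ^ Suc n * (sqrt pi ^ (Suc n * Suc n) * P) / (\<kappa> * Beta (s / 2) (B + 1))) =
        (beta_const n \<nu> * C) ^ Suc n * sqrt pi ^ (Suc n * Suc n) * P / (\<kappa> * Beta (s / 2) (B + 1))"
      by (simp only: power_mult_distrib times_divide_eq_right mult.assoc)
    also have "\<dots> = E ^ Suc n * ((pi powr (- real n / 2)) ^ Suc n * sqrt pi ^ (Suc n * Suc n)) * P / (\<kappa> * Beta (s / 2) (B + 1))"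
      unfolding cC by (simp only: power_mult_distrib mult_ac)
    also have "\<dots> = E ^ Suc n * pi powr ((real n + 1) / 2) * P / (\<kappa> * Beta (s / 2) (B + 1))"
      unfolding pi_cancel ..
    also have "\<dots> = Q * E ^ Suc n * (Gamma (s / 2 + (B + 1)) / Gamma (B + 1))"
      using G unfolding PQ \<kappa>_def Beta_def
      by (simp add: divide_simps mult_ac less_imp_neq[OF G(2), symmetric] del: power_Suc)
    also have "\<dots> = moment_real n \<nu> s"
      unfolding SB unfolding B1 moment_real_def Q_def E_def ..
    finally show ?thesis .
  qed
  finally show ?thesis .
qed

text \<open>Rows are exchanged one at a time, each at a cost \<open>\<epsilon>\<close>. Probability
  measures are used because a constant error then integrates to itself.\<close>

lemma nn_integral_PiM_rowwise_le:
  fixes \<mu> \<sigma> N :: "'b measure" and \<epsilon> :: ennreal and I :: "nat set"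
  assumes \<mu>: "prob_space \<mu>" and \<sigma>: "prob_space \<sigma>"
    and sets_\<mu>: "sets \<mu> = sets N" and sets_\<sigma>: "sets \<sigma> = sets N"
    and row: "\<And>h. h \<in> borel_measurable N \<Longrightarrow> Q h \<Longrightarrow> (\<integral>\<^sup>+y. h y \<partial>\<mu>) \<le> (\<integral>\<^sup>+y. h y \<partial>\<sigma>) + \<epsilon>"
    and "finite I" "H \<in> borel_measurable (PiM I (\<lambda>_. N))"
    and "\<And>i x. i \<in> I \<Longrightarrow> x \<in> space (PiM (I - {i}) (\<lambda>_. N)) \<Longrightarrow> Q (\<lambda>y. H (x(i := y)))"
  shows "(\<integral>\<^sup>+x. H x \<partial>PiM I (\<lambda>_. \<mu>)) \<le> (\<integral>\<^sup>+x. H x \<partial>PiM I (\<lambda>_. \<sigma>)) + of_nat (card I) * \<epsilon>"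
  using assms(6-8)
proof (induction I arbitrary: H rule: finite_induct)
  case empty
  show ?case by (simp add: PiM_empty nn_integral_count_space_finite)
next
  case (insert i I H)
  interpret p\<mu>: prob_space \<mu> by fact
  interpret p\<sigma>: prob_space \<sigma> by fact
  interpret \<mu>: product_prob_space "\<lambda>_. \<mu>" by standard
  interpret \<sigma>: product_prob_space "\<lambda>_. \<sigma>" by standard
  have space_eq: "space \<mu> = space N" "space \<sigma> = space N"
    using sets_eq_imp_space_eq[OF sets_\<mu>] sets_eq_imp_space_eq[OF sets_\<sigma>] by auto
  have sets_PiM_\<mu>: "sets (PiM J (\<lambda>_. \<mu>)) = sets (PiM J (\<lambda>_. N))" for J :: "nat set"
    by (rule sets_PiM_cong) (auto simp: sets_\<mu>)
  have sets_PiM_\<sigma>: "sets (PiM J (\<lambda>_. \<sigma>)) = sets (PiM J (\<lambda>_. N))" for J :: "nat set"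
    by (rule sets_PiM_cong) (auto simp: sets_\<sigma>)
  have space_PiM_\<mu>: "space (PiM I (\<lambda>_. \<mu>)) = space (PiM I (\<lambda>_. N))"
    by (rule sets_eq_imp_space_eq[OF sets_PiM_\<mu>])
  note H = insert.prems(1)
  have upd: "(\<lambda>p. (fst p)(i := snd p)) \<in> PiM I (\<lambda>_. N) \<Otimes>\<^sub>M N \<rightarrow>\<^sub>M PiM (insert i I) (\<lambda>_. N)"
    using measurable_add_dim[of i I "\<lambda>_. N"] by (simp add: split_def)
  have HN: "(\<lambda>(x, y). H (x(i := y))) \<in> borel_measurable (PiM I (\<lambda>_. N) \<Otimes>\<^sub>M N)"
    unfolding split_def by (rule measurable_compose[OF upd H])
  have sec: "(\<lambda>y. H (x(i := y))) \<in> borel_measurable N" if "x \<in> space (PiM I (\<lambda>_. N))" for x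
    using measurable_compose[OF measurable_Pair1'[OF that] measurable_compose[OF upd H]] by (simp only: fst_conv snd_conv)
  have sec2: "(\<lambda>x. H (x(i := y))) \<in> borel_measurable (PiM I (\<lambda>_. N))" if "y \<in> space N" for y
    using measurable_compose[OF measurable_Pair2'[OF that] measurable_compose[OF upd H]] by (simp only: fst_conv snd_conv)
  have PI: "prob_space (PiM I (\<lambda>_. \<mu>))"
    by (rule prob_space_PiM) (rule \<mu>)
  have PIs: "sigma_finite_measure (PiM I (\<lambda>_. \<mu>))"
    using PI by (rule prob_space_imp_sigma_finite)
  have s\<sigma>: "sigma_finite_measure \<sigma>"
    using \<sigma> by (rule prob_space_imp_sigma_finite)
  have HPS: "(\<lambda>(x, y). H (x(i := y))) \<in> borel_measurable (PiM I (\<lambda>_. \<mu>) \<Otimes>\<^sub>M \<sigma>)"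
    using HN by (simp cong: measurable_cong_sets add: sets_pair_measure_cong[OF sets_PiM_\<mu> sets_\<sigma>])
  have H\<mu>: "H \<in> borel_measurable (PiM (insert i I) (\<lambda>_. \<mu>))"
    using H by (simp cong: measurable_cong_sets add: sets_PiM_\<mu>)
  have H\<sigma>: "H \<in> borel_measurable (PiM (insert i I) (\<lambda>_. \<sigma>))"
    using H by (simp cong: measurable_cong_sets add: sets_PiM_\<sigma>)
  have "(\<integral>\<^sup>+x. H x \<partial>PiM (insert i I) (\<lambda>_. \<mu>)) = (\<integral>\<^sup>+x. \<integral>\<^sup>+y. H (x(i := y)) \<partial>\<mu> \<partial>PiM I (\<lambda>_. \<mu>))"
    by (rule \<mu>.product_nn_integral_insert[OF insert.hyps(1,2) H\<mu>])
  also have "\<dots> \<le> (\<integral>\<^sup>+x. (\<integral>\<^sup>+y. H (x(i := y)) \<partial>\<sigma>) + \<epsilon> \<partial>PiM I (\<lambda>_. \<mu>))"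
  proof (rule nn_integral_mono)
    fix x assume x: "x \<in> space (PiM I (\<lambda>_. \<mu>))"
    have "insert i I - {i} = I" using insert.hyps by auto
    then have "Q (\<lambda>y. H (x(i := y)))"
      using x by (intro insert.prems(2)) (simp_all only: insertI1 space_PiM_\<mu>)
    then show "(\<integral>\<^sup>+y. H (x(i := y)) \<partial>\<mu>) \<le> (\<integral>\<^sup>+y. H (x(i := y)) \<partial>\<sigma>) + \<epsilon>"
      using x by (intro row sec) (simp_all only: space_PiM_\<mu>)
  qed
  also have "\<dots> = (\<integral>\<^sup>+x. \<integral>\<^sup>+y. H (x(i := y)) \<partial>\<sigma> \<partial>PiM I (\<lambda>_. \<mu>)) + \<epsilon>"
    using sigma_finite_measure.borel_measurable_nn_integral[OF s\<sigma> HPS] prob_space.emeasure_space_1[OF PI]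
    by (subst nn_integral_add) auto
  also have "(\<integral>\<^sup>+x. \<integral>\<^sup>+y. H (x(i := y)) \<partial>\<sigma> \<partial>PiM I (\<lambda>_. \<mu>)) =
      (\<integral>\<^sup>+y. \<integral>\<^sup>+x. H (x(i := y)) \<partial>PiM I (\<lambda>_. \<mu>) \<partial>\<sigma>)"
    by (rule pair_sigma_finite.Fubini'[symmetric]) (use PIs s\<sigma> HPS in \<open>auto simp: pair_sigma_finite_def\<close>)
  also have "\<dots> \<le> (\<integral>\<^sup>+y. (\<integral>\<^sup>+x. H (x(i := y)) \<partial>PiM I (\<lambda>_. \<sigma>)) + of_nat (card I) * \<epsilon> \<partial>\<sigma>)"
  proof (rule nn_integral_mono)
    fix y assume "y \<in> space \<sigma>"
    then have y: "y \<in> space N"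
      by (simp add: space_eq)
    show "(\<integral>\<^sup>+x. H (x(i := y)) \<partial>PiM I (\<lambda>_. \<mu>)) \<le> (\<integral>\<^sup>+x. H (x(i := y)) \<partial>PiM I (\<lambda>_. \<sigma>)) + of_nat (card I) * \<epsilon>"
    proof (rule insert.IH[OF sec2[OF y]])
      fix i' x assume i': "i' \<in> I" and x: "x \<in> space (PiM (I - {i'}) (\<lambda>_. N))"
      have "x(i := y) \<in> space (PiM (insert i I - {i'}) (\<lambda>_. N))"
        using x y i' insert.hyps by (auto simp: space_PiM PiE_def extensional_def Pi_def)
      then have "Q (\<lambda>y'. H ((x(i := y))(i' := y')))"
        by (rule insert.prems(2)[rotated]) (use i' in simp)
      moreover have "(x(i := y))(i' := y') = x(i' := y', i := y)" for y'
        using i' insert.hyps by (intro fun_upd_twist) auto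
      ultimately show "Q (\<lambda>y'. H (x(i' := y', i := y)))"
        by simp
    qed
  qed
  also have "\<dots> = (\<integral>\<^sup>+y. \<integral>\<^sup>+x. H (x(i := y)) \<partial>PiM I (\<lambda>_. \<sigma>) \<partial>\<sigma>) + of_nat (card I) * \<epsilon>"
  proof (subst nn_integral_add)
    have "sigma_finite_measure (PiM I (\<lambda>_. \<sigma>))"
      by (intro prob_space_imp_sigma_finite prob_space_PiM) (rule \<sigma>)
    moreover have "(\<lambda>(y, x). H (x(i := y))) \<in> borel_measurable (\<sigma> \<Otimes>\<^sub>M PiM I (\<lambda>_. \<sigma>))"
    proof -
      have "(\<lambda>(x, y). H (x(i := y))) \<in> borel_measurable (PiM I (\<lambda>_. \<sigma>) \<Otimes>\<^sub>M \<sigma>)"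
        using HN by (simp cong: measurable_cong_sets add: sets_pair_measure_cong[OF sets_PiM_\<sigma> sets_\<sigma>])
      from measurable_pair_swap[OF this] show ?thesis by (simp only: split_conv)
    qed
    ultimately show "(\<lambda>y. \<integral>\<^sup>+x. H (x(i := y)) \<partial>PiM I (\<lambda>_. \<sigma>)) \<in> borel_measurable \<sigma>"
      by (rule sigma_finite_measure.borel_measurable_nn_integral)
  qed (auto simp: p\<sigma>.emeasure_space_1)
  also have "(\<integral>\<^sup>+y. \<integral>\<^sup>+x. H (x(i := y)) \<partial>PiM I (\<lambda>_. \<sigma>) \<partial>\<sigma>) = (\<integral>\<^sup>+x. H x \<partial>PiM (insert i I) (\<lambda>_. \<sigma>))"
    by (rule \<sigma>.product_nn_integral_insert_rev[OF insert.hyps(1,2) H\<sigma>, symmetric])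
  finally show ?case
    using insert.hyps by (simp add: algebra_simps add_mono)
qed

subsection \<open>The spherical model as a limit of beta models\<close>

lemma beta_radial_mass:
  assumes n: "n \<ge> 1" and \<nu>: "\<nu> > 0"
  shows "ennreal (real n * unit_ball_vol n) * (\<integral>\<^sup>+r. indicator {0<..} r * ennreal (r ^ (n - 1)) *
    ennreal (beta_weight ((\<nu> - 2) / 2) (r\<^sup>2)) \<partial>lborel) = ennreal (1 / beta_const n \<nu>)"
proof -
  have vol: "real n * unit_ball_vol n = 2 * pi powr (real n / 2) / Gamma (real n / 2)"
  proof -
    have g: "Gamma (real n / 2 + 1) = real n / 2 * Gamma (real n / 2)"
      using n by (intro Gamma_plus1) (auto elim!: nonpos_Ints_cases)
    show ?thesis
      unfolding unit_ball_vol_def g using n Gamma_real_pos[of "real n / 2"] by simp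
  qed
  have "indicator {0<..} r * ennreal (r ^ (n - 1)) * ennreal (beta_weight ((\<nu> - 2) / 2) (r\<^sup>2)) =
      indicator {0<..} r * ennreal (r powr (real n - 1)) * ennreal (if r < 1 then (1 - r\<^sup>2) powr ((\<nu> - 2) / 2) else 0)" for r
  proof (cases "r > 0")
    case True
    then have "r\<^sup>2 < 1 \<longleftrightarrow> r < 1" by (simp add: power2_less_1_iff)
    moreover have "r powr (real n - 1) = r ^ (n - 1)"
      using powr_realpow[OF True, of "n - 1"] n by (simp add: of_nat_diff)
    ultimately show ?thesis by (simp add: beta_weight_def)
  qed simp
  then have "(\<integral>\<^sup>+r. indicator {0<..} r * ennreal (r ^ (n - 1)) * ennreal (beta_weight ((\<nu> - 2) / 2) (r\<^sup>2)) \<partial>lborel) =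
      ennreal (Beta ((real n - 1 + 1) / 2) ((\<nu> - 2) / 2 + 1) / 2)"
    using nn_integral_powr_beta[of "real n - 1" "(\<nu> - 2) / 2"] n \<nu> by (simp only:) simp
  also have "Beta ((real n - 1 + 1) / 2) ((\<nu> - 2) / 2 + 1) = Gamma (real n / 2) * Gamma (\<nu> / 2) / Gamma ((real n + \<nu>) / 2)"
    by (simp add: Beta_def diff_divide_distrib add_divide_distrib)
  also have "ennreal (real n * unit_ball_vol n) * ennreal (Gamma (real n / 2) * Gamma (\<nu> / 2) / Gamma ((real n + \<nu>) / 2) / 2) =
      ennreal (1 / beta_const n \<nu>)"
  proof -
    have G: "Gamma (real n / 2) > 0" "Gamma (\<nu> / 2) > 0" "Gamma ((real n + \<nu>) / 2) > 0"
      using n \<nu> by (auto intro!: Gamma_real_pos)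
    have "real n * unit_ball_vol n * (Gamma (real n / 2) * Gamma (\<nu> / 2) / Gamma ((real n + \<nu>) / 2) / 2) = 1 / beta_const n \<nu>"
      unfolding vol beta_const_def using G by (simp add: powr_minus divide_simps less_imp_neq[OF G(1), symmetric])
    then show ?thesis
      using G n by (subst ennreal_mult[symmetric]) auto
  qed
  finally show ?thesis .
qed

text \<open>A beta point is a uniform direction with an independent radius, as the weight depends on
  \<open>r\<close> alone along a unit direction.\<close>

lemma nn_integral_beta_polar:
  assumes h [measurable]: "h \<in> borel_measurable (lebesgue_n n)" and n: "n \<ge> 1" and \<nu>: "\<nu> > 0"
  shows "(\<integral>\<^sup>+x. h x \<partial>beta_distribution n \<nu>) = (\<integral>\<^sup>+u. \<integral>\<^sup>+r. ennreal (beta_const n \<nu>) * ennreal (real n * unit_ball_vol n) *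
    (indicator {0<..} r * ennreal (r ^ (n - 1)) * ennreal (beta_weight ((\<nu> - 2) / 2) (r\<^sup>2))) *
     h (\<lambda>k\<in>{..<n}. r * u k) \<partial>lborel \<partial>sphere_distribution n)"
proof -
  let ?b = "(\<nu> - 2) / 2" and ?K = "ennreal (beta_const n \<nu>) * ennreal (real n * unit_ball_vol n)"
  let ?w = "\<lambda>x. beta_weight ?b (\<Sum>k<n. (x k)\<^sup>2)"
  have c: "beta_const n \<nu> > 0" by (rule beta_const_pos[OF n \<nu>])
  have scal: "(\<lambda>p. h (\<lambda>k\<in>{..<n}. snd p * fst p k)) \<in> borel_measurable (lebesgue_n n \<Otimes>\<^sub>M lborel)"
    by (rule measurable_compose[OF measurable_scale_pair h])
  have scal_u: "(\<lambda>r. h (\<lambda>k\<in>{..<n}. r * u k)) \<in> borel_measurable lborel" for u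
  proof -
    have "(\<lambda>r. \<lambda>k\<in>{..<n}. r * u k) \<in> lborel \<rightarrow>\<^sub>M lebesgue_n n"
      by (intro measurable_restrict) measurable
    from measurable_compose[OF this h] show ?thesis .
  qed
  have "(\<integral>\<^sup>+x. h x \<partial>beta_distribution n \<nu>) = (\<integral>\<^sup>+x. ennreal (beta_const n \<nu>) * (h x * ennreal (?w x)) \<partial>lebesgue_n n)"
    unfolding beta_distribution_eq
    by (subst nn_integral_density) (use c in \<open>auto simp: ennreal_mult beta_weight_nonneg mult_ac\<close>)
  also have "\<dots> = ennreal (beta_const n \<nu>) * (\<integral>\<^sup>+x. h x * ennreal (?w x) \<partial>lebesgue_n n)"
    by (rule nn_integral_cmult) measurable
  also have "(\<integral>\<^sup>+x. h x * ennreal (?w x) \<partial>lebesgue_n n) = ennreal (real n * unit_ball_vol n) *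
    (\<integral>\<^sup>+u. \<integral>\<^sup>+r. indicator {0<..} r * ennreal (r ^ (n - 1)) * (h (\<lambda>k\<in>{..<n}. r * u k) *
      ennreal (?w (\<lambda>k\<in>{..<n}. r * u k))) \<partial>lborel \<partial>sphere_distribution n)"
    by (rule nn_integral_polar) (use n in measurable)
  also have "(\<integral>\<^sup>+u. \<integral>\<^sup>+r. indicator {0<..} r * ennreal (r ^ (n - 1)) * (h (\<lambda>k\<in>{..<n}. r * u k) *
      ennreal (?w (\<lambda>k\<in>{..<n}. r * u k))) \<partial>lborel \<partial>sphere_distribution n) =
    (\<integral>\<^sup>+u. \<integral>\<^sup>+r. (indicator {0<..} r * ennreal (r ^ (n - 1)) * ennreal (beta_weight ?b (r\<^sup>2))) *
      h (\<lambda>k\<in>{..<n}. r * u k) \<partial>lborel \<partial>sphere_distribution n)"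
  proof (rule nn_integral_cong_AE)
    show "AE u in sphere_distribution n. (\<integral>\<^sup>+r. indicator {0<..} r * ennreal (r ^ (n - 1)) * (h (\<lambda>k\<in>{..<n}. r * u k) *
        ennreal (?w (\<lambda>k\<in>{..<n}. r * u k))) \<partial>lborel) =
      (\<integral>\<^sup>+r. (indicator {0<..} r * ennreal (r ^ (n - 1)) * ennreal (beta_weight ?b (r\<^sup>2))) * h (\<lambda>k\<in>{..<n}. r * u k) \<partial>lborel)"
      using AE_sphere_distribution[OF n]
    proof eventually_elim
      case (elim u)
      have "(\<Sum>k<n. (u k)\<^sup>2) = 1"
        using elim by (simp add: L2_set_def)
      then have "(\<Sum>k<n. ((\<lambda>k\<in>{..<n}. r * u k) k)\<^sup>2) = r\<^sup>2" for r
        by (simp add: power_mult_distrib sum_distrib_left[symmetric])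
      then show ?case by (simp only: mult_ac)
    qed
  qed
  also have "ennreal (beta_const n \<nu>) * (ennreal (real n * unit_ball_vol n) *
      (\<integral>\<^sup>+u. \<integral>\<^sup>+r. (indicator {0<..} r * ennreal (r ^ (n - 1)) * ennreal (beta_weight ?b (r\<^sup>2))) *
      h (\<lambda>k\<in>{..<n}. r * u k) \<partial>lborel \<partial>sphere_distribution n)) =
    (\<integral>\<^sup>+u. ?K * (\<integral>\<^sup>+r. (indicator {0<..} r * ennreal (r ^ (n - 1)) * ennreal (beta_weight ?b (r\<^sup>2))) *
      h (\<lambda>k\<in>{..<n}. r * u k) \<partial>lborel) \<partial>sphere_distribution n)"
  proof -
    have "(\<lambda>p. (indicator {0<..} (snd p) * ennreal (snd p ^ (n - 1)) * ennreal (beta_weight ?b ((snd p)\<^sup>2))) *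
      h (\<lambda>k\<in>{..<n}. snd p * fst p k)) \<in> borel_measurable (lebesgue_n n \<Otimes>\<^sub>M lborel)"
      using scal by measurable
    then have "(\<lambda>u. \<integral>\<^sup>+r. (indicator {0<..} r * ennreal (r ^ (n - 1)) * ennreal (beta_weight ?b (r\<^sup>2))) *
      h (\<lambda>k\<in>{..<n}. r * u k) \<partial>lborel) \<in> borel_measurable (lebesgue_n n)"
      by (intro lborel.borel_measurable_nn_integral) (simp only: split_def)
    then have "(\<lambda>u. \<integral>\<^sup>+r. (indicator {0<..} r * ennreal (r ^ (n - 1)) * ennreal (beta_weight ?b (r\<^sup>2))) *
      h (\<lambda>k\<in>{..<n}. r * u k) \<partial>lborel) \<in> borel_measurable (sphere_distribution n)"
      by measurable
    then show ?thesis
      by (simp only: mult.assoc nn_integral_cmult borel_measurable_times_ennreal borel_measurable_const)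
  qed
  also have "\<dots> = (\<integral>\<^sup>+u. \<integral>\<^sup>+r. ?K * (indicator {0<..} r * ennreal (r ^ (n - 1)) * ennreal (beta_weight ?b (r\<^sup>2))) *
     h (\<lambda>k\<in>{..<n}. r * u k) \<partial>lborel \<partial>sphere_distribution n)"
  proof (rule nn_integral_cong)
    fix u
    show "?K * (\<integral>\<^sup>+r. (indicator {0<..} r * ennreal (r ^ (n - 1)) * ennreal (beta_weight ?b (r\<^sup>2))) * h (\<lambda>k\<in>{..<n}. r * u k) \<partial>lborel) =
      (\<integral>\<^sup>+r. ?K * (indicator {0<..} r * ennreal (r ^ (n - 1)) * ennreal (beta_weight ?b (r\<^sup>2))) * h (\<lambda>k\<in>{..<n}. r * u k) \<partial>lborel)"
    proof (subst nn_integral_cmult[symmetric])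
      show "(\<lambda>r. indicator {0<..} r * ennreal (r ^ (n - 1)) * ennreal (beta_weight ?b (r\<^sup>2)) * h (\<lambda>k\<in>{..<n}. r * u k)) \<in> borel_measurable lborel"
        using scal_u[of u] by measurable
    qed (simp only: mult.assoc)
  qed
  finally show ?thesis .
qed

text \<open>The mean value theorem; for \<open>s \<ge> 1\<close> the derivative is increasing and
  hence bounded by its value at \<open>F\<close>, even near \<open>0\<close>.\<close>

lemma powr_diff_le:
  fixes a b F s :: real
  assumes "0 \<le> a" "a \<le> b" "b \<le> F" "1 \<le> s"
  shows "b powr s - a powr s \<le> s * F powr (s - 1) * (b - a)"
proof (cases "a = b")
  case False
  then have ab: "a < b" using assms by simp
  have "\<exists>l z. a < z \<and> z < b \<and> DERIV (\<lambda>x. x powr s) z :> l \<and> b powr s - a powr s = (b - a) * l"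
  proof (rule MVT[OF ab])
    show "continuous_on {a..b} (\<lambda>x. x powr s)"
      using assms by (intro continuous_on_powr' continuous_intros) auto
    show "(\<lambda>x. x powr s) differentiable (at x)" if "a < x" for x
      using that assms real_differentiable_def has_real_derivative_powr[of x s] by fastforce
  qed
  then obtain l z where z: "a < z" "z < b" "DERIV (\<lambda>x. x powr s) z :> l" "b powr s - a powr s = (b - a) * l"
    by blast
  have "l = s * z powr (s - 1)"
    using z(3) has_real_derivative_powr[of z s] z(1) assms(1) by (intro DERIV_unique) auto
  also have "\<dots> \<le> s * F powr (s - 1)"
    using z assms by (intro mult_left_mono powr_mono2) auto
  finally have "(b - a) * l \<le> (b - a) * (s * F powr (s - 1))"
    using ab by (intro mult_left_mono) auto
  then show ?thesis
    using z(4) by (simp add: mult_ac)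
qed simp

lemma abs_powr_diff_le:
  fixes a b F s :: real
  assumes "\<bar>a\<bar> \<le> F" "\<bar>b\<bar> \<le> F" "1 \<le> s"
  shows "\<bar>a\<bar> powr s \<le> \<bar>b\<bar> powr s + s * F powr (s - 1) * \<bar>a - b\<bar>"
proof (cases "\<bar>b\<bar> \<le> \<bar>a\<bar>")
  case True
  have "\<bar>a\<bar> powr s - \<bar>b\<bar> powr s \<le> s * F powr (s - 1) * (\<bar>a\<bar> - \<bar>b\<bar>)"
    using True assms by (intro powr_diff_le) auto
  also have "\<dots> \<le> s * F powr (s - 1) * \<bar>a - b\<bar>"
    using assms by (intro mult_left_mono) auto
  finally show ?thesis by simp
next
  case False
  then have "\<bar>a\<bar> powr s \<le> \<bar>b\<bar> powr s"
    using assms by (intro powr_mono2) auto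
  moreover have "s * F powr (s - 1) * \<bar>a - b\<bar> \<ge> 0"
    using assms by simp
  ultimately show ?thesis by linarith
qed

text \<open>The point \<open>r * u\<close> is the convex combination of \<open>0\<close> and
  \<open>u\<close>, and the bordered determinant is affine in each vertex.\<close>

lemma simplex_det_ray:
  assumes "i < Suc n"
  shows "simplex_det n (x(i := \<lambda>k\<in>{..<n}. r * u k)) =
    (1 - r) * simplex_det n (x(i := \<lambda>_. 0)) + r * simplex_det n (x(i := u))"
proof -
  define Z where "Z = (\<lambda>x :: nat \<Rightarrow> nat \<Rightarrow> real. \<lambda>i j. if j < n then x i j else 1)"
  define u0 u1 where "u0 = (\<lambda>j. if j < n then 0 else (1::real))" and "u1 = (\<lambda>j. if j < n then u j else 1)"
  have "simplex_det n (x(i := \<lambda>k\<in>{..<n}. r * u k)) = mdet (Suc n) ((Z x)(i := \<lambda>j. (1 - r) * u0 j + r * u1 j))"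
    unfolding simplex_det_def by (rule mdet_cong) (auto simp: Z_def u0_def u1_def)
  also have "\<dots> = (1 - r) * mdet (Suc n) ((Z x)(i := u0)) + r * mdet (Suc n) ((Z x)(i := u1))"
    by (rule mdet_row_affine) fact
  also have "mdet (Suc n) ((Z x)(i := u0)) = simplex_det n (x(i := \<lambda>_. 0))"
    unfolding simplex_det_def by (rule mdet_cong) (auto simp: Z_def u0_def)
  also have "mdet (Suc n) ((Z x)(i := u1)) = simplex_det n (x(i := u))"
    unfolding simplex_det_def by (rule mdet_cong) (auto simp: Z_def u1_def)
  finally show ?thesis .
qed

lemma abs_simplex_det_le:
  assumes "\<And>i. i \<le> n \<Longrightarrow> L2_set (x i) {..<n} \<le> 1"
  shows "\<bar>simplex_det n x\<bar> \<le> fact (Suc n)"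
  unfolding simplex_det_def
proof (rule abs_mdet_le)
  fix i j assume "i < Suc n" "j < Suc n"
  have "\<bar>x i j\<bar> \<le> L2_set (\<lambda>j. \<bar>x i j\<bar>) {..<n}" if "j < n"
    using that by (intro member_le_L2_set) auto
  also have "L2_set (\<lambda>j. \<bar>x i j\<bar>) {..<n} \<le> 1"
    using assms[of i] \<open>i < Suc n\<close> by (simp add: L2_set_def)
  finally show "\<bar>if j < n then x i j else 1\<bar> \<le> 1"
    by auto
qed

text \<open>Both models live in the unit ball only almost surely. Clamping bounds the determinant
  everywhere, so that the Lipschitz estimate in one row holds for all values of the other
  rows.\<close>

definition clamp_n :: "nat \<Rightarrow> (nat \<Rightarrow> real) \<Rightarrow> nat \<Rightarrow> real" where
  "clamp_n n x = (if L2_set x {..<n} \<le> 1 then x else (\<lambda>k\<in>{..<n}. 0))"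

lemma measurable_clamp_n [measurable]: "clamp_n n \<in> lebesgue_n n \<rightarrow>\<^sub>M lebesgue_n n"
proof -
  have "(\<lambda>x. if L2_set x {..<n} \<le> 1 then x else (\<lambda>k\<in>{..<n}. 0)) \<in> lebesgue_n n \<rightarrow>\<^sub>M lebesgue_n n"
    by (rule measurable_If) (auto intro!: measurable_const simp: space_PiM)
  then show ?thesis
    by (simp add: clamp_n_def[abs_def])
qed

lemma L2_set_clamp_n: "L2_set (clamp_n n x) {..<n} \<le> 1"
  by (simp add: clamp_n_def L2_set_def)

lemma nn_integral_clamp_rows:
  fixes m n :: nat
  assumes "prob_space \<mu>" "sets \<mu> = sets (lebesgue_n n)" "AE x in \<mu>. L2_set x {..<n} \<le> 1"
    and H: "H \<in> borel_measurable (PiM {..<m} (\<lambda>_. lebesgue_n n))"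
  shows "(\<integral>\<^sup>+x. H x \<partial>PiM {..<m} (\<lambda>_. \<mu>)) = (\<integral>\<^sup>+x. H (\<lambda>i\<in>{..<m}. clamp_n n (x i)) \<partial>PiM {..<m} (\<lambda>_. \<mu>))"
proof -
  have "(\<integral>\<^sup>+x. H x \<partial>PiM {..<m} (\<lambda>_. \<mu>)) =
      1 ^ card {..<m} * (\<integral>\<^sup>+x. H (\<lambda>i\<in>{..<m}. clamp_n n (x i)) \<partial>PiM {..<m} (\<lambda>_. \<mu>))"
  proof (rule nn_integral_PiM_rowwise[where Q = "\<lambda>_. True" and N = "lebesgue_n n"])
    show "(\<integral>\<^sup>+y. h y \<partial>\<mu>) = 1 * (\<integral>\<^sup>+y. h (clamp_n n y) \<partial>\<mu>)" for h
      unfolding mult_1 by (rule nn_integral_cong_AE) (use assms(3) in eventually_elim, simp add: clamp_n_def)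
  qed (use assms prob_space_imp_sigma_finite in auto)
  then show ?thesis by simp
qed

definition beta_radial :: "nat \<Rightarrow> real \<Rightarrow> real \<Rightarrow> ennreal" where
  "beta_radial n \<nu> r = ennreal (beta_const n \<nu>) * ennreal (real n * unit_ball_vol n) *
    (indicator {0<..} r * ennreal (r ^ (n - 1)) * ennreal (beta_weight ((\<nu> - 2) / 2) (r\<^sup>2)))"

lemma measurable_beta_radial [measurable]: "beta_radial n \<nu> \<in> borel_measurable borel"
  unfolding beta_radial_def by measurable

lemma nn_integral_beta_radial:
  assumes "n \<ge> 1" "\<nu> > 0"
  shows "(\<integral>\<^sup>+r. beta_radial n \<nu> r \<partial>lborel) = 1"
proof -
  have "(\<integral>\<^sup>+r. beta_radial n \<nu> r \<partial>lborel) = ennreal (beta_const n \<nu>) * ennreal (1 / beta_const n \<nu>)"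
    unfolding beta_radial_def beta_radial_mass[OF assms, symmetric]
    by (subst nn_integral_cmult) (auto simp: mult.assoc)
  then show ?thesis
    using beta_const_pos[OF assms] by (simp add: ennreal_mult[symmetric])
qed

lemma beta_radial_support: "\<not> (0 < r \<and> r < 1) \<Longrightarrow> beta_radial n \<nu> r = 0"
  by (auto simp: beta_radial_def beta_weight_def not_less power2_less_1_iff abs_if split: split_indicator if_splits)

lemma prob_space_beta_distribution:
  assumes "n \<ge> 1" "\<nu> > 0"
  shows "prob_space (beta_distribution n \<nu>)"
proof (rule prob_spaceI)
  have "emeasure (beta_distribution n \<nu>) (space (beta_distribution n \<nu>)) = (\<integral>\<^sup>+x. 1 \<partial>beta_distribution n \<nu>)"
    by simp
  also have "\<dots> = (\<integral>\<^sup>+u. \<integral>\<^sup>+r. beta_radial n \<nu> r \<partial>lborel \<partial>sphere_distribution n)"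
    using nn_integral_beta_polar[of "\<lambda>_. 1" n \<nu>] assms by (simp add: beta_radial_def)
  also have "\<dots> = 1"
    using prob_space.emeasure_space_1[OF prob_space_sphere_distribution] by (simp add: nn_integral_beta_radial[OF assms])
  finally show "emeasure (beta_distribution n \<nu>) (space (beta_distribution n \<nu>)) = 1" .
qed

lemma AE_beta_distribution: "AE x in beta_distribution n \<nu>. L2_set x {..<n} \<le> 1"
  unfolding beta_distribution_eq
  by (subst AE_density) (auto simp: beta_weight_def L2_set_def ennreal_zero_less_mult_iff split: if_splits intro!: AE_I2)

text \<open>On \<open>(0, 1)\<close> one has \<open>1 - r \<le> 1 - r^2\<close>, and the factor
  \<open>1 - r^2\<close> turns the radial weight for \<open>\<nu>\<close> into the one for
  \<open>\<nu> + 2\<close>. The mean is therefore bounded by the ratio of the normalising constants,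
  which is \<open>\<nu> / (n + \<nu>)\<close>.\<close>

lemma beta_radial_spread:
  assumes n: "n \<ge> 1" and \<nu>: "\<nu> > 0" and K: "K \<ge> 0"
  shows "(\<integral>\<^sup>+r. beta_radial n \<nu> r * ennreal (K * (1 - r)) \<partial>lborel) \<le> ennreal (K * (\<nu> / (real n + \<nu>)))"
proof -
  have c: "beta_const n \<nu> > 0" "beta_const n (\<nu> + 2) > 0"
    using n \<nu> by (auto intro!: beta_const_pos)
  have ratio: "beta_const n \<nu> / beta_const n (\<nu> + 2) = \<nu> / (real n + \<nu>)"
  proof -
    have G: "Gamma (x + 1) = x * Gamma x" if "x > 0" for x :: real
      using that nonpos_Ints_nonpos[of x] by (intro Gamma_plus1) auto
    have "(real n + (\<nu> + 2)) / 2 = (real n + \<nu>) / 2 + 1" "(\<nu> + 2) / 2 = \<nu> / 2 + 1"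
      by (simp_all add: field_simps)
    then have 1: "Gamma ((real n + (\<nu> + 2)) / 2) = (real n + \<nu>) / 2 * Gamma ((real n + \<nu>) / 2)"
      and 2: "Gamma ((\<nu> + 2) / 2) = \<nu> / 2 * Gamma (\<nu> / 2)"
      using G[of "(real n + \<nu>) / 2"] G[of "\<nu> / 2"] n \<nu> by (simp_all only:) auto
    have alg: "p * ga / gb / (p * ((real n + \<nu>) / 2 * ga) / (\<nu> / 2 * gb)) = \<nu> / (real n + \<nu>)"
      if "p > 0" "ga > 0" "gb > 0" for p ga gb :: real
      using that n \<nu> by (simp add: divide_simps)
    show ?thesis
      unfolding beta_const_def 1 2 by (rule alg) (use n \<nu> in \<open>auto intro!: Gamma_real_pos\<close>)
  qed
  have "beta_radial n \<nu> r * ennreal (K * (1 - r)) \<le>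
      ennreal (K * (beta_const n \<nu> / beta_const n (\<nu> + 2))) * beta_radial n (\<nu> + 2) r" for r
  proof (cases "0 < r \<and> r < 1")
    case True
    then have r2: "r\<^sup>2 < 1" by (simp add: power2_less_1_iff)
    have "r\<^sup>2 \<le> r" using True by (simp add: power2_eq_square mult_le_cancel_left1)
    then have "beta_weight ((\<nu> - 2) / 2) (r\<^sup>2) * (1 - r) \<le> beta_weight ((\<nu> - 2) / 2) (r\<^sup>2) * (1 - r\<^sup>2)"
      by (intro mult_left_mono beta_weight_nonneg) simp
    also have "\<dots> = beta_weight ((\<nu> + 2 - 2) / 2) (r\<^sup>2)"
      using r2 powr_add[of "1 - r\<^sup>2" "(\<nu> - 2) / 2" 1] by (simp add: beta_weight_def diff_divide_distrib)
    finally have w: "beta_weight ((\<nu> - 2) / 2) (r\<^sup>2) * (1 - r) \<le> beta_weight ((\<nu> + 2 - 2) / 2) (r\<^sup>2)" .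
    define v where "v = real n * unit_ball_vol n * r ^ (n - 1)"
    have v: "v \<ge> 0" using True by (simp add: v_def)
    have rad: "beta_radial n m r = ennreal (beta_const n m * v * beta_weight ((m - 2) / 2) (r\<^sup>2))" if "beta_const n m > 0" for m
      using that True by (simp add: beta_radial_def v_def ennreal_mult beta_weight_nonneg mult_ac)
    have "beta_const n \<nu> * v * beta_weight ((\<nu> - 2) / 2) (r\<^sup>2) * (K * (1 - r)) =
        K * beta_const n \<nu> * v * (beta_weight ((\<nu> - 2) / 2) (r\<^sup>2) * (1 - r))"
      by (simp only: mult_ac)
    also have "\<dots> \<le> K * beta_const n \<nu> * v * beta_weight ((\<nu> + 2 - 2) / 2) (r\<^sup>2)"
      using K c v w by (intro mult_left_mono) auto
    also have "\<dots> = K * (beta_const n \<nu> / beta_const n (\<nu> + 2)) * (beta_const n (\<nu> + 2) * v * beta_weight ((\<nu> + 2 - 2) / 2) (r\<^sup>2))"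
      using c by simp
    finally show ?thesis
      unfolding rad[OF c(1)] rad[OF c(2)] using K c v True
      by (subst (1 2) ennreal_mult[symmetric]) (auto intro!: ennreal_leI mult_nonneg_nonneg beta_weight_nonneg)
  qed (simp add: beta_radial_support)
  then have "(\<integral>\<^sup>+r. beta_radial n \<nu> r * ennreal (K * (1 - r)) \<partial>lborel) \<le>
      (\<integral>\<^sup>+r. ennreal (K * (beta_const n \<nu> / beta_const n (\<nu> + 2))) * beta_radial n (\<nu> + 2) r \<partial>lborel)"
    by (rule nn_integral_mono)
  also have "\<dots> = ennreal (K * (\<nu> / (real n + \<nu>)))"
    using \<nu> by (subst nn_integral_cmult) (auto simp: ratio nn_integral_beta_radial[OF n])
  finally show ?thesis .
qed

text \<open>
  The beta distribution is a radial perturbation of the sphere distribution that is concentrated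
  near the sphere for small \<open>\<nu>\<close>.
\<close>

lemma beta_sphere_row_le:
  assumes n: "n \<ge> 1" and \<nu>: "\<nu> > 0" and K: "K \<ge> 0"
    and h: "h \<in> borel_measurable (lebesgue_n n)"
    and le: "\<And>u r. L2_set u {..<n} = 1 \<Longrightarrow> 0 < r \<Longrightarrow> r < 1 \<Longrightarrow>
      h (\<lambda>k\<in>{..<n}. r * u k) \<le> h u + ennreal (K * (1 - r))"
    and ge: "\<And>u r. L2_set u {..<n} = 1 \<Longrightarrow> 0 < r \<Longrightarrow> r < 1 \<Longrightarrow>
      h u \<le> h (\<lambda>k\<in>{..<n}. r * u k) + ennreal (K * (1 - r))"
  shows "(\<integral>\<^sup>+x. h x \<partial>beta_distribution n \<nu>) \<le> (\<integral>\<^sup>+x. h x \<partial>sphere_distribution n) + ennreal (K * (\<nu> / (real n + \<nu>)))"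
    and "(\<integral>\<^sup>+x. h x \<partial>sphere_distribution n) \<le> (\<integral>\<^sup>+x. h x \<partial>beta_distribution n \<nu>) + ennreal (K * (\<nu> / (real n + \<nu>)))"
proof -
  let ?D = "beta_radial n \<nu>"
  define \<epsilon> where "\<epsilon> = (\<integral>\<^sup>+r. ?D r * ennreal (K * (1 - r)) \<partial>lborel)"
  have \<epsilon>: "\<epsilon> \<le> ennreal (K * (\<nu> / (real n + \<nu>)))"
    unfolding \<epsilon>_def by (rule beta_radial_spread[OF n \<nu> K])
  have space1: "emeasure (sphere_distribution n) (space (sphere_distribution n)) = 1"
    by (rule prob_space.emeasure_space_1[OF prob_space_sphere_distribution])
  have beta: "(\<integral>\<^sup>+x. h x \<partial>beta_distribution n \<nu>) = (\<integral>\<^sup>+u. \<integral>\<^sup>+r. ?D r * h (\<lambda>k\<in>{..<n}. r * u k) \<partial>lborel \<partial>sphere_distribution n)"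
    using nn_integral_beta_polar[OF h n \<nu>] by (simp only: beta_radial_def)
  have h' [measurable]: "h \<in> borel_measurable (sphere_distribution n)"
    using h by measurable
  have scal_u: "(\<lambda>r. h (\<lambda>k\<in>{..<n}. r * u k)) \<in> borel_measurable lborel" for u
  proof -
    have "(\<lambda>r. \<lambda>k\<in>{..<n}. r * u k) \<in> lborel \<rightarrow>\<^sub>M lebesgue_n n"
      by (intro measurable_restrict) measurable
    from measurable_compose[OF this h] show ?thesis .
  qed
  have const: "(\<integral>\<^sup>+r. ?D r * h u \<partial>lborel) = h u" for u
    by (subst nn_integral_multc) (auto simp: nn_integral_beta_radial[OF n \<nu>])
  have "(\<integral>\<^sup>+u. \<integral>\<^sup>+r. ?D r * h (\<lambda>k\<in>{..<n}. r * u k) \<partial>lborel \<partial>sphere_distribution n) \<le>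
      (\<integral>\<^sup>+u. h u + \<epsilon> \<partial>sphere_distribution n)"
  proof (rule nn_integral_mono_AE)
    show "AE u in sphere_distribution n. (\<integral>\<^sup>+r. ?D r * h (\<lambda>k\<in>{..<n}. r * u k) \<partial>lborel) \<le> h u + \<epsilon>"
      using AE_sphere_distribution[OF n]
    proof eventually_elim
      case (elim u)
      have "(\<integral>\<^sup>+r. ?D r * h (\<lambda>k\<in>{..<n}. r * u k) \<partial>lborel) \<le> (\<integral>\<^sup>+r. ?D r * h u + ?D r * ennreal (K * (1 - r)) \<partial>lborel)"
      proof (rule nn_integral_mono)
        fix r :: real
        show "?D r * h (\<lambda>k\<in>{..<n}. r * u k) \<le> ?D r * h u + ?D r * ennreal (K * (1 - r))"
          using le[OF elim, of r] beta_radial_support[of r n \<nu>]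
          by (cases "0 < r \<and> r < 1") (auto simp: distrib_left[symmetric] intro!: mult_left_mono)
      qed
      also have "\<dots> = h u + \<epsilon>"
        unfolding \<epsilon>_def by (subst nn_integral_add) (auto simp: const)
      finally show ?case .
    qed
  qed
  also have "\<dots> = (\<integral>\<^sup>+u. h u \<partial>sphere_distribution n) + \<epsilon>"
    by (subst nn_integral_add) (auto simp: space1)
  finally show "(\<integral>\<^sup>+x. h x \<partial>beta_distribution n \<nu>) \<le> (\<integral>\<^sup>+x. h x \<partial>sphere_distribution n) + ennreal (K * (\<nu> / (real n + \<nu>)))"
    unfolding beta using \<epsilon> by (meson add_left_mono order_trans)
  have scal: "(\<lambda>p. h (\<lambda>k\<in>{..<n}. snd p * fst p k)) \<in> borel_measurable (lebesgue_n n \<Otimes>\<^sub>M lborel)"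
    by (rule measurable_compose[OF measurable_scale_pair h])
  have "(\<lambda>p. ?D (snd p) * h (\<lambda>k\<in>{..<n}. snd p * fst p k)) \<in> borel_measurable (lebesgue_n n \<Otimes>\<^sub>M lborel)"
    using scal by measurable
  then have "(\<lambda>u. \<integral>\<^sup>+r. ?D r * h (\<lambda>k\<in>{..<n}. r * u k) \<partial>lborel) \<in> borel_measurable (lebesgue_n n)"
    by (intro lborel.borel_measurable_nn_integral) (simp only: split_def)
  then have inner: "(\<lambda>u. \<integral>\<^sup>+r. ?D r * h (\<lambda>k\<in>{..<n}. r * u k) \<partial>lborel) \<in> borel_measurable (sphere_distribution n)"
    by measurable
  have "(\<integral>\<^sup>+u. h u \<partial>sphere_distribution n) \<le>
      (\<integral>\<^sup>+u. (\<integral>\<^sup>+r. ?D r * h (\<lambda>k\<in>{..<n}. r * u k) \<partial>lborel) + \<epsilon> \<partial>sphere_distribution n)"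
  proof (rule nn_integral_mono_AE)
    show "AE u in sphere_distribution n. h u \<le> (\<integral>\<^sup>+r. ?D r * h (\<lambda>k\<in>{..<n}. r * u k) \<partial>lborel) + \<epsilon>"
      using AE_sphere_distribution[OF n]
    proof eventually_elim
      case (elim u)
      have "h u = (\<integral>\<^sup>+r. ?D r * h u \<partial>lborel)"
        by (rule const[symmetric])
      also have "\<dots> \<le> (\<integral>\<^sup>+r. ?D r * h (\<lambda>k\<in>{..<n}. r * u k) + ?D r * ennreal (K * (1 - r)) \<partial>lborel)"
      proof (rule nn_integral_mono)
        fix r :: real
        show "?D r * h u \<le> ?D r * h (\<lambda>k\<in>{..<n}. r * u k) + ?D r * ennreal (K * (1 - r))"
          using ge[OF elim, of r] beta_radial_support[of r n \<nu>]
          by (cases "0 < r \<and> r < 1") (auto simp: distrib_left[symmetric] intro!: mult_left_mono)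
      qed
      also have "\<dots> = (\<integral>\<^sup>+r. ?D r * h (\<lambda>k\<in>{..<n}. r * u k) \<partial>lborel) + \<epsilon>"
        unfolding \<epsilon>_def using scal_u[of u] by (intro nn_integral_add) measurable
      finally show ?case .
    qed
  qed
  also have "\<dots> = (\<integral>\<^sup>+x. h x \<partial>beta_distribution n \<nu>) + \<epsilon>"
    unfolding beta by (subst nn_integral_add[OF inner]) (auto simp: space1)
  finally show "(\<integral>\<^sup>+x. h x \<partial>sphere_distribution n) \<le> (\<integral>\<^sup>+x. h x \<partial>beta_distribution n \<nu>) + ennreal (K * (\<nu> / (real n + \<nu>)))"
    using \<epsilon> by (meson add_left_mono order_trans)
qed

text \<open>Pulling a vertex radially from \<open>u\<close> to \<open>r * u\<close> changes the
  bounded, vertexwise affine determinant by a multiple of \<open>1 - r\<close>, and powers with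
  \<open>s \<ge> 1\<close> are Lipschitz on the range of the determinant. Each vertex thus costs a
  multiple of the mean of \<open>1 - r\<close>.\<close>

lemma simplex_moment_beta_sphere_close:
  assumes n: "n \<ge> 1" and \<nu>: "\<nu> > 0" and s: "s \<ge> 1"
  defines "\<epsilon> \<equiv> \<lambda>\<nu>. s * fact (Suc n) powr (s - 1) * (2 * fact (Suc n)) * (\<nu> / (real n + \<nu>))"
    and "E \<equiv> \<lambda>\<mu>. \<integral>\<^sup>+x. ennreal (\<bar>simplex_det n x\<bar> powr s) \<partial>PiM {..<Suc n} (\<lambda>_. \<mu>)"
  shows "E (beta_distribution n \<nu>) \<le> E (sphere_distribution n) + of_nat (Suc n) * ennreal (\<epsilon> \<nu>)"
    and "E (sphere_distribution n) \<le> E (beta_distribution n \<nu>) + of_nat (Suc n) * ennreal (\<epsilon> \<nu>)"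
proof -
  define F :: real where "F = fact (Suc n)"
  \<comment> \<open>\<open>s * F powr (s - 1)\<close> is the Lipschitz constant of the power on
    \<open>[0, F]\<close>; \<open>2 * F\<close> bounds the variation of the determinant along a
    ray.\<close>
  define K where "K = s * F powr (s - 1) * (2 * F)"
  have F: "F > 0" by (simp add: F_def)
  have K: "K \<ge> 0" using s F by (simp add: K_def)
  have \<epsilon>: "\<epsilon> \<nu> = K * (\<nu> / (real n + \<nu>))"
    by (simp only: \<epsilon>_def K_def F_def)
  define H where "H = (\<lambda>x. ennreal (\<bar>simplex_det n (\<lambda>i\<in>{..<Suc n}. clamp_n n (x i))\<bar> powr s))"
  define Q where "Q = (\<lambda>h :: (nat \<Rightarrow> real) \<Rightarrow> ennreal. \<forall>u r. L2_set u {..<n} = 1 \<longrightarrow> 0 < r \<longrightarrow> r < 1 \<longrightarrow>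
      h (\<lambda>k\<in>{..<n}. r * u k) \<le> h u + ennreal (K * (1 - r)) \<and> h u \<le> h (\<lambda>k\<in>{..<n}. r * u k) + ennreal (K * (1 - r)))"
  have H_meas: "H \<in> borel_measurable (PiM {..<Suc n} (\<lambda>_. lebesgue_n n))"
  proof -
    have "(\<lambda>x. \<lambda>i\<in>{..<Suc n}. clamp_n n (x i)) \<in> PiM {..<Suc n} (\<lambda>_. lebesgue_n n) \<rightarrow>\<^sub>M PiM {..<Suc n} (\<lambda>_. lebesgue_n n)"
      by (intro measurable_restrict measurable_row_apply[OF measurable_clamp_n])
    from measurable_compose[OF this measurable_simplex_det]
    show ?thesis unfolding H_def by measurable
  qed
  have rows: "Q (\<lambda>y. H (x(i := y)))" if i: "i \<in> {..<Suc n}" for i x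
    unfolding Q_def
  proof (intro allI impI)
    fix u :: "nat \<Rightarrow> real" and r :: real
    assume u: "L2_set u {..<n} = 1" and r: "0 < r" "r < 1"
    define x' where "x' = (\<lambda>i\<in>{..<Suc n}. clamp_n n (x i))"
    define d where "d = (\<lambda>y. simplex_det n (x'(i := y)))"
    have H: "H (x(i := y)) = ennreal (\<bar>d y\<bar> powr s)" if "L2_set y {..<n} \<le> 1" for y
    proof -
      have "(\<lambda>j\<in>{..<Suc n}. clamp_n n ((x(i := y)) j)) = x'(i := y)"
        using that i by (auto simp: x'_def fun_eq_iff restrict_def clamp_n_def)
      then show ?thesis by (simp only: H_def d_def)
    qed
    have dF: "\<bar>d y\<bar> \<le> F" if "L2_set y {..<n} \<le> 1" for y
      unfolding d_def F_def
    proof (rule abs_simplex_det_le)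
      show "L2_set ((x'(i := y)) j) {..<n} \<le> 1" if "j \<le> n" for j
        using that \<open>L2_set y {..<n} \<le> 1\<close> L2_set_clamp_n[of n "x j"] by (simp add: x'_def)
    qed
    define ru where "ru = (\<lambda>k\<in>{..<n}. r * u k)"
    have ru: "L2_set ru {..<n} \<le> 1"
      unfolding ru_def L2_set_scale using u r by simp
    have "d ru = (1 - r) * d (\<lambda>_. 0) + r * d u"
      unfolding d_def ru_def by (rule simplex_det_ray) (use i in simp)
    then have "d ru - d u = (1 - r) * (d (\<lambda>_. 0) - d u)"
      by (simp add: algebra_simps)
    then have "\<bar>d ru - d u\<bar> = (1 - r) * \<bar>d (\<lambda>_. 0) - d u\<bar>"
      using r by (simp add: abs_mult)
    also have "\<dots> \<le> (1 - r) * (2 * F)"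
      using r dF[of "\<lambda>_. 0"] dF[of u] u by (intro mult_left_mono) (auto simp: L2_set_def)
    finally have diff: "\<bar>d ru - d u\<bar> \<le> (1 - r) * (2 * F)" .
    have "s * F powr (s - 1) * \<bar>d ru - d u\<bar> \<le> s * F powr (s - 1) * ((1 - r) * (2 * F))"
      using s by (intro mult_left_mono diff) simp
    also have "\<dots> = K * (1 - r)"
      by (simp add: K_def)
    finally have Kr: "s * F powr (s - 1) * \<bar>d ru - d u\<bar> \<le> K * (1 - r)" .
    have "\<bar>d ru\<bar> powr s \<le> \<bar>d u\<bar> powr s + K * (1 - r)" "\<bar>d u\<bar> powr s \<le> \<bar>d ru\<bar> powr s + K * (1 - r)"
      using abs_powr_diff_le[OF dF[OF ru] dF[of u] s] abs_powr_diff_le[OF dF[of u] dF[OF ru] s] u Kr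
      by (auto simp: abs_minus_commute)
    then have "ennreal (\<bar>d ru\<bar> powr s) \<le> ennreal (\<bar>d u\<bar> powr s) + ennreal (K * (1 - r))"
      "ennreal (\<bar>d u\<bar> powr s) \<le> ennreal (\<bar>d ru\<bar> powr s) + ennreal (K * (1 - r))"
      using K r by (simp_all add: ennreal_plus[symmetric] ennreal_leI del: ennreal_plus)
    then show "H (x(i := \<lambda>k\<in>{..<n}. r * u k)) \<le> H (x(i := u)) + ennreal (K * (1 - r)) \<and>
        H (x(i := u)) \<le> H (x(i := \<lambda>k\<in>{..<n}. r * u k)) + ennreal (K * (1 - r))"
      using H[of u] H[OF ru] u unfolding ru_def by simp
  qed
  have det_meas: "(\<lambda>x. ennreal (\<bar>simplex_det n x\<bar> powr s)) \<in> borel_measurable (PiM {..<Suc n} (\<lambda>_. lebesgue_n n))"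
    using measurable_simplex_det[of n] by measurable
  have E_beta: "E (beta_distribution n \<nu>) = (\<integral>\<^sup>+x. H x \<partial>PiM {..<Suc n} (\<lambda>_. beta_distribution n \<nu>))"
    unfolding E_def H_def
    by (rule nn_integral_clamp_rows[OF prob_space_beta_distribution[OF n \<nu>] sets_beta_distribution AE_beta_distribution det_meas])
  have AE_sphere: "AE x in sphere_distribution n. L2_set x {..<n} \<le> 1"
    using AE_sphere_distribution[OF n] by eventually_elim simp
  have E_sphere: "E (sphere_distribution n) = (\<integral>\<^sup>+x. H x \<partial>PiM {..<Suc n} (\<lambda>_. sphere_distribution n))"
    unfolding E_def H_def
    by (rule nn_integral_clamp_rows[OF prob_space_sphere_distribution sets_sphere_distribution AE_sphere det_meas])
  have "E (beta_distribution n \<nu>) \<le> E (sphere_distribution n) + of_nat (card {..<Suc n}) * ennreal (K * (\<nu> / (real n + \<nu>)))"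
    unfolding E_beta E_sphere
  proof (rule nn_integral_PiM_rowwise_le[where N = "lebesgue_n n" and Q = Q])
    show "(\<integral>\<^sup>+y. h y \<partial>beta_distribution n \<nu>) \<le> (\<integral>\<^sup>+y. h y \<partial>sphere_distribution n) + ennreal (K * (\<nu> / (real n + \<nu>)))"
      if "h \<in> borel_measurable (lebesgue_n n)" "Q h" for h
      by (rule beta_sphere_row_le(1)[OF n \<nu> K that(1)]) (use that(2) in \<open>auto simp: Q_def\<close>)
  qed (use rows H_meas prob_space_beta_distribution[OF n \<nu>] prob_space_sphere_distribution in auto)
  then show "E (beta_distribution n \<nu>) \<le> E (sphere_distribution n) + of_nat (Suc n) * ennreal (\<epsilon> \<nu>)"
    unfolding \<epsilon> by (simp only: card_lessThan)
  have "E (sphere_distribution n) \<le> E (beta_distribution n \<nu>) + of_nat (card {..<Suc n}) * ennreal (K * (\<nu> / (real n + \<nu>)))"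
    unfolding E_beta E_sphere
  proof (rule nn_integral_PiM_rowwise_le[where N = "lebesgue_n n" and Q = Q])
    show "(\<integral>\<^sup>+y. h y \<partial>sphere_distribution n) \<le> (\<integral>\<^sup>+y. h y \<partial>beta_distribution n \<nu>) + ennreal (K * (\<nu> / (real n + \<nu>)))"
      if "h \<in> borel_measurable (lebesgue_n n)" "Q h" for h
      by (rule beta_sphere_row_le(2)[OF n \<nu> K that(1)]) (use that(2) in \<open>auto simp: Q_def\<close>)
  qed (use rows H_meas prob_space_beta_distribution[OF n \<nu>] prob_space_sphere_distribution in auto)
  then show "E (sphere_distribution n) \<le> E (beta_distribution n \<nu>) + of_nat (Suc n) * ennreal (\<epsilon> \<nu>)"
    unfolding \<epsilon> by (simp only: card_lessThan)
qed

text \<open>Because \<open>n * n \<ge> n\<close>, these arguments stay positive down to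
  \<open>\<nu> = 0\<close>, which allows the formula to pass to the sphere.\<close>

lemma Gamma_arg_pos:
  assumes "n \<ge> 1" "\<nu> \<ge> 0" "s > 0"
  shows "(real n + 1) * (real n + \<nu> + s) - 2 * real n > 0"
    and "(real n + 1) * (real n + \<nu>) + real n * s - 2 * real n > 0"
proof -
  have *: "real n * real n \<ge> real n" "real n * s > 0" "(real n + 1) * \<nu> \<ge> 0"
    using assms by simp_all
  have "(real n + 1) * (real n + \<nu> + s) - 2 * real n =
      (real n * real n - real n) + (real n + 1) * \<nu> + real n * s + s"
    by (simp add: algebra_simps)
  then show "(real n + 1) * (real n + \<nu> + s) - 2 * real n > 0"
    using * assms by linarith
  have "(real n + 1) * (real n + \<nu>) + real n * s - 2 * real n =
      (real n * real n - real n) + (real n + 1) * \<nu> + real n * s"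
    by (simp add: algebra_simps)
  then show "(real n + 1) * (real n + \<nu>) + real n * s - 2 * real n > 0"
    using * assms by linarith
qed

lemma not_nonpos_Ints_pos: "x > 0 \<Longrightarrow> x \<notin> \<int>\<^sub>\<le>\<^sub>0" for x :: real
  using nonpos_Ints_nonpos[of x] by auto

lemma tendsto_moment_real:
  assumes n: "n \<ge> 1" and s: "s > 0"
  shows "((\<lambda>\<nu>. moment_real n \<nu> s) \<longlongrightarrow> moment_real n 0 s) (at_right 0)"
proof -
  have G: "Gamma x \<noteq> 0" if "x > 0" for x :: real
    using Gamma_real_pos[OF that] by simp
  note pos = Gamma_arg_pos[OF n order_refl s]
  show ?thesis
    unfolding moment_real_def
    by (intro tendsto_intros tendsto_Gamma G not_nonpos_Ints_pos) (use n s pos in auto)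
qed

text \<open>For the sphere, the closed form is continuous at \<open>\<nu> = 0\<close> and the moment
  lies within \<open>\<epsilon> \<nu>\<close> of it, an error that vanishes with
  \<open>\<nu>\<close>.\<close>

lemma nn_integral_model_moment:
  assumes n: "n \<ge> 1" and \<nu>: "\<nu> \<ge> 0" and s: "s \<ge> 1"
  shows "(\<integral>\<^sup>+x. ennreal (\<bar>simplex_det n x\<bar> powr s) \<partial>PiM {..<Suc n} (\<lambda>_. model_distribution n \<nu>)) =
    ennreal (moment_real n \<nu> s)"
proof (cases "\<nu> = 0")
  case False
  then show ?thesis
    using simplex_moment_beta[of n \<nu> s] n \<nu> s by (simp add: model_distribution_def)
next
  case True
  define E where "E = (\<integral>\<^sup>+x. ennreal (\<bar>simplex_det n x\<bar> powr s) \<partial>PiM {..<Suc n} (\<lambda>_. sphere_distribution n))"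
  define \<epsilon> where "\<epsilon> = (\<lambda>\<nu>. real (Suc n) * (s * fact (Suc n) powr (s - 1) * (2 * fact (Suc n)) * (\<nu> / (real n + \<nu>))))"
  have \<epsilon>0: "\<epsilon> \<nu> \<ge> 0" if "\<nu> > 0" for \<nu>
    using that s by (simp add: \<epsilon>_def)
  have close: "ennreal (moment_real n \<nu> s) \<le> E + ennreal (\<epsilon> \<nu>)" "E \<le> ennreal (moment_real n \<nu> s) + ennreal (\<epsilon> \<nu>)" if "\<nu> > 0" for \<nu>
  proof -
    have e: "ennreal (\<epsilon> \<nu>) = of_nat (Suc n) * ennreal (s * fact (Suc n) powr (s - 1) * (2 * fact (Suc n)) * (\<nu> / (real n + \<nu>)))"
      unfolding \<epsilon>_def ennreal_of_nat_eq_real_of_nat by (rule ennreal_mult') simp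
    show "ennreal (moment_real n \<nu> s) \<le> E + ennreal (\<epsilon> \<nu>)" "E \<le> ennreal (moment_real n \<nu> s) + ennreal (\<epsilon> \<nu>)"
      using simplex_moment_beta_sphere_close[OF n that s] unfolding simplex_moment_beta[OF n that s] E_def e by simp_all
  qed
  have mom: "moment_real n \<nu> s \<ge> 0" if "\<nu> \<ge> 0" for \<nu>
    unfolding moment_real_def using Gamma_arg_pos[OF n that, of s] n s that
    by (intro mult_nonneg_nonneg prod_nonneg divide_nonneg_nonneg zero_le_power less_imp_le Gamma_real_pos ballI) auto
  have lim: "((\<lambda>\<nu>. moment_real n \<nu> s) \<longlongrightarrow> moment_real n 0 s) (at_right 0)"
    by (rule tendsto_moment_real[OF n]) (use s in simp)
  have "(\<epsilon> \<longlongrightarrow> real (Suc n) * (s * fact (Suc n) powr (s - 1) * (2 * fact (Suc n)) * (0 / (real n + 0)))) (at_right 0)"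
    unfolding \<epsilon>_def by (intro tendsto_intros) (use n in auto)
  then have \<epsilon>lim: "(\<epsilon> \<longlongrightarrow> 0) (at_right 0)"
    by simp
  \<comment> \<open>Comparison with a single positive parameter shows that the spherical moment is
    finite, so the limit can be taken in the reals.\<close>
  have "E \<le> ennreal (moment_real n 1 s) + ennreal (\<epsilon> 1)"
    by (rule close) simp
  then have "E \<noteq> \<top>"
    by (auto simp: top_unique)
  then obtain e where e: "e \<ge> 0" "E = ennreal e"
    by (cases E) auto
  have pos: "eventually (\<lambda>\<nu>. \<nu> > 0) (at_right (0::real))"
    by (rule eventually_at_right_less)
  have "eventually (\<lambda>\<nu>. moment_real n \<nu> s \<le> e + \<epsilon> \<nu>) (at_right 0)"
    using pos
  proof eventually_elim
    case (elim \<nu>)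
    then show ?case
      using close(1)[OF elim] e \<epsilon>0[OF elim] by (simp add: ennreal_plus[symmetric] ennreal_le_iff del: ennreal_plus)
  qed
  then have 1: "moment_real n 0 s \<le> e + 0"
    by (rule tendsto_le[OF _ tendsto_add[OF tendsto_const \<epsilon>lim] lim, rotated]) simp
  have "eventually (\<lambda>\<nu>. e \<le> moment_real n \<nu> s + \<epsilon> \<nu>) (at_right 0)"
    using pos
  proof eventually_elim
    case (elim \<nu>)
    then show ?case
      using close(2)[OF elim] e \<epsilon>0[OF elim] mom[of \<nu>]
      by (simp add: ennreal_plus[symmetric] ennreal_le_iff del: ennreal_plus)
  qed
  then have 2: "e \<le> moment_real n 0 s + 0"
    by (rule tendsto_le[OF _ tendsto_add[OF lim \<epsilon>lim] tendsto_const, rotated]) simp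
  have "e = moment_real n 0 s"
    using 1 2 by simp
  then show ?thesis
    using True e(2) unfolding E_def model_distribution_def by simp
qed

lemma AE_model_distribution:
  assumes "n \<ge> 1" "\<nu> \<ge> 0"
  shows "AE x in model_distribution n \<nu>. L2_set x {..<n} \<le> 1"
proof (cases "\<nu> = 0")
  case True
  then show ?thesis
    unfolding model_distribution_def using AE_sphere_distribution[OF assms(1)] by (auto elim!: eventually_mono)
next
  case False
  then show ?thesis
    unfolding model_distribution_def using AE_beta_distribution by auto
qed

lemma (in prob_space) simplex_det_moments:
  assumes n: "n \<ge> 1" and \<nu>: "\<nu> \<ge> 0"
    and indep: "indep_vars (\<lambda>_. lebesgue_n n) X {..n}"
    and law: "\<And>i. i \<le> n \<Longrightarrow> distr M (lebesgue_n n) (X i) = model_distribution n \<nu>"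
  shows "(\<lambda>\<omega>. simplex_det n (\<lambda>i. X i \<omega>)) \<in> borel_measurable M"
    and "AE \<omega> in M. \<bar>simplex_det n (\<lambda>i. X i \<omega>)\<bar> \<le> fact (Suc n)"
    and "s \<ge> 1 \<Longrightarrow> (\<integral>\<^sup>+\<omega>. ennreal (\<bar>simplex_det n (\<lambda>i. X i \<omega>)\<bar> powr s) \<partial>M) = ennreal (moment_real n \<nu> s)"
proof -
  have X [measurable]: "X i \<in> M \<rightarrow>\<^sub>M lebesgue_n n" if "i \<le> n" for i
    using indep that by (auto simp: indep_vars_def)
  have T: "(\<lambda>\<omega>. \<lambda>i\<in>{..<Suc n}. X i \<omega>) \<in> M \<rightarrow>\<^sub>M PiM {..<Suc n} (\<lambda>_. lebesgue_n n)"
    by (intro measurable_restrict X) simp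
  have restr: "simplex_det n (\<lambda>i. X i \<omega>) = simplex_det n (\<lambda>i\<in>{..<Suc n}. X i \<omega>)" for \<omega>
    unfolding simplex_det_def by (rule mdet_cong) simp
  show "(\<lambda>\<omega>. simplex_det n (\<lambda>i. X i \<omega>)) \<in> borel_measurable M"
    unfolding restr by (rule measurable_compose[OF T measurable_simplex_det])
  have "AE \<omega> in M. \<forall>i\<in>{..n}. L2_set (X i \<omega>) {..<n} \<le> 1"
  proof (rule AE_finite_allI)
    fix i assume "i \<in> {..n}"
    then have i: "i \<le> n" by simp
    have "AE x in distr M (lebesgue_n n) (X i). L2_set x {..<n} \<le> 1"
      unfolding law[OF i] by (rule AE_model_distribution[OF n \<nu>])
    then show "AE \<omega> in M. L2_set (X i \<omega>) {..<n} \<le> 1"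
      by (subst (asm) AE_distr_iff) (use X[OF i] in auto)
  qed simp
  then show "AE \<omega> in M. \<bar>simplex_det n (\<lambda>i. X i \<omega>)\<bar> \<le> fact (Suc n)"
    by eventually_elim (rule abs_simplex_det_le, simp)
  assume s: "s \<ge> 1"
  have "distr M (PiM {..<Suc n} (\<lambda>_. lebesgue_n n)) (\<lambda>\<omega>. \<lambda>i\<in>{..<Suc n}. X i \<omega>) =
      PiM {..<Suc n} (\<lambda>i. distr M (lebesgue_n n) (X i))"
    using indep_vars_iff_distr_eq_PiM'[of "{..n}" X "\<lambda>_. lebesgue_n n"] indep X by (simp add: lessThan_Suc_atMost)
  also have "\<dots> = PiM {..<Suc n} (\<lambda>_. model_distribution n \<nu>)"
    by (rule PiM_cong) (auto simp: law)
  finally have joint: "distr M (PiM {..<Suc n} (\<lambda>_. lebesgue_n n)) (\<lambda>\<omega>. \<lambda>i\<in>{..<Suc n}. X i \<omega>) =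
      PiM {..<Suc n} (\<lambda>_. model_distribution n \<nu>)" .
  have "(\<integral>\<^sup>+\<omega>. ennreal (\<bar>simplex_det n (\<lambda>i. X i \<omega>)\<bar> powr s) \<partial>M) =
      (\<integral>\<^sup>+x. ennreal (\<bar>simplex_det n x\<bar> powr s) \<partial>distr M (PiM {..<Suc n} (\<lambda>_. lebesgue_n n)) (\<lambda>\<omega>. \<lambda>i\<in>{..<Suc n}. X i \<omega>))"
    unfolding restr using measurable_simplex_det[of n] by (subst nn_integral_distr[OF T]) measurable
  also have "\<dots> = ennreal (moment_real n \<nu> s)"
    unfolding joint by (rule nn_integral_model_moment[OF n \<nu> s])
  finally show "(\<integral>\<^sup>+\<omega>. ennreal (\<bar>simplex_det n (\<lambda>i. X i \<omega>)\<bar> powr s) \<partial>M) = ennreal (moment_real n \<nu> s)" .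
qed

subsection \<open>Moment generating functions\<close>

text \<open>Around \<open>z\<close>, the factor \<open>exp ((w - z) * (U - B))\<close> is expanded
  in powers of the nonnegative \<open>B - U\<close>. The absolute series sums to
  \<open>exp (|w - z| (B - U))\<close>, which is integrable against \<open>exp (Re z * U)\<close> as
  long as \<open>|w - z| < Re z - \<sigma>\<close>.\<close>

lemma mgf_analytic:
  fixes U :: "'a \<Rightarrow> real"
  assumes U [measurable]: "U \<in> borel_measurable M" and B: "\<And>\<omega>. U \<omega> \<le> B"
    and int: "integrable M (\<lambda>\<omega>. exp (\<sigma> * U \<omega>))"
  shows "(\<lambda>t. \<integral>\<omega>. exp (t * of_real (U \<omega>)) \<partial>M) analytic_on {t. Re t > \<sigma>}"
  unfolding analytic_on_def
proof
  fix z assume "z \<in> {t. Re t > \<sigma>}"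
  then have \<rho>: "Re z - \<sigma> > 0" by simp
  let ?f = "\<lambda>t. \<integral>\<omega>. exp (t * of_real (U \<omega>)) \<partial>M"
  \<comment> \<open>Nonnegativity of \<open>V\<close> makes every term of the absolute series
    nonnegative and lets one function dominate all partial sums.\<close>
  define V where "V = (\<lambda>\<omega>. B - U \<omega>)"
  have [measurable]: "V \<in> borel_measurable M" unfolding V_def by measurable
  have V: "V \<omega> \<ge> 0" for \<omega> using B[of \<omega>] by (simp add: V_def)
  define a where "a = (\<lambda>k. \<integral>\<omega>. exp (z * of_real (U \<omega>)) * of_real ((- V \<omega>) ^ k / fact k) \<partial>M)"
  \<comment> \<open>The dominating function: the exponent \<open>Re z * U + |w - z| * V\<close>
    never exceeds \<open>(Re z - \<sigma>) * B + \<sigma> * U\<close>.\<close>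
  define D where "D = (\<lambda>\<omega>. exp ((Re z - \<sigma>) * B) * exp (\<sigma> * U \<omega>))"
  have D: "integrable M D" unfolding D_def using int by simp
  have sums: "(\<lambda>k. a k * (w - z) ^ k) sums (?f w * exp (- ((w - z) * of_real B)))" if w: "w \<in> ball z (Re z - \<sigma>)" for w
  proof -
    define F where "F = (\<lambda>k \<omega>. exp (z * of_real (U \<omega>)) * of_real ((- V \<omega>) ^ k / fact k) * (w - z) ^ k)"
    have [measurable]: "F k \<in> borel_measurable M" for k unfolding F_def by measurable
    have r: "norm (w - z) < Re z - \<sigma>" using w by (simp add: dist_norm norm_minus_commute)
    have normF: "norm (F k \<omega>) = exp (Re z * U \<omega>) * ((norm (w - z) * V \<omega>) ^ k / fact k)" for k \<omega>
      using V[of \<omega>] by (simp add: F_def norm_mult norm_power norm_divide power_mult_distrib)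
    have exp_le: "exp (Re z * U \<omega>) * exp (norm (w - z) * V \<omega>) \<le> D \<omega>" for \<omega>
    proof -
      have "Re z * U \<omega> + norm (w - z) * V \<omega> = (Re z - \<sigma> - norm (w - z)) * U \<omega> + norm (w - z) * B + \<sigma> * U \<omega>"
        by (simp add: V_def algebra_simps)
      also have "\<dots> \<le> (Re z - \<sigma> - norm (w - z)) * B + norm (w - z) * B + \<sigma> * U \<omega>"
        using r B[of \<omega>] by (intro add_right_mono mult_left_mono) auto
      finally show ?thesis
        by (simp add: D_def exp_add[symmetric] algebra_simps)
    qed
    have exp_sums: "(\<lambda>k. (norm (w - z) * V \<omega>) ^ k / fact k) sums exp (norm (w - z) * V \<omega>)" for \<omega>
      using exp_converges[of "norm (w - z) * V \<omega>"] by (simp add: field_simps)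
    have partial: "(\<Sum>k<m. norm (F k \<omega>)) \<le> D \<omega>" for m \<omega>
    proof -
      have "(\<Sum>k<m. (norm (w - z) * V \<omega>) ^ k / fact k) \<le> exp (norm (w - z) * V \<omega>)"
        using sum_le_suminf[OF sums_summable[OF exp_sums[of \<omega>]], of "{..<m}"] sums_unique[OF exp_sums[of \<omega>]] V[of \<omega>] by simp
      then have "(\<Sum>k<m. norm (F k \<omega>)) \<le> exp (Re z * U \<omega>) * exp (norm (w - z) * V \<omega>)"
        unfolding normF sum_distrib_left[symmetric] by (intro mult_left_mono) auto
      with exp_le[of \<omega>] show ?thesis by linarith
    qed
    have intF: "integrable M (F k)" for k
    proof (rule Bochner_Integration.integrable_bound[OF D])
      have "norm (F k \<omega>) \<le> (\<Sum>k<Suc k. norm (F k \<omega>))" for \<omega>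
        by (simp add: sum_nonneg)
      then show "AE \<omega> in M. norm (F k \<omega>) \<le> norm (D \<omega>)"
        using partial by (intro AE_I2) (meson abs_ge_self order_trans real_norm_def norm_ge_zero order_trans[OF _ abs_ge_self[of "D _", folded real_norm_def]])
    qed measurable
    have "(\<lambda>k. integral\<^sup>L M (F k)) sums (\<integral>\<omega>. (\<Sum>k. F k \<omega>) \<partial>M)"
    proof (rule sums_integral[OF intF])
      show "AE \<omega> in M. summable (\<lambda>k. norm (F k \<omega>))"
        unfolding normF by (intro AE_I2 summable_mult sums_summable[OF exp_sums])
      show "summable (\<lambda>k. \<integral>\<omega>. norm (F k \<omega>) \<partial>M)"
      proof (rule summableI_nonneg_bounded)
        fix m
        have "(\<Sum>k<m. \<integral>\<omega>. norm (F k \<omega>) \<partial>M) = (\<integral>\<omega>. (\<Sum>k<m. norm (F k \<omega>)) \<partial>M)"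
          using intF by (subst Bochner_Integration.integral_sum) auto
        also have "\<dots> \<le> integral\<^sup>L M D"
          using intF D partial by (intro integral_mono Bochner_Integration.integrable_sum integrable_norm) auto
        finally show "(\<Sum>k<m. \<integral>\<omega>. norm (F k \<omega>) \<partial>M) \<le> integral\<^sup>L M D" .
      qed simp
    qed
    moreover have "integral\<^sup>L M (F k) = a k * (w - z) ^ k" for k
      unfolding F_def a_def by simp
    moreover have "(\<Sum>k. F k \<omega>) = exp (w * of_real (U \<omega>)) * exp (- ((w - z) * of_real B))" for \<omega>
    proof -
      have "(\<lambda>k. ((w - z) * of_real (- V \<omega>)) ^ k /\<^sub>R fact k) sums exp ((w - z) * of_real (- V \<omega>))"
        by (rule exp_converges)
      then have "(\<lambda>k. exp (z * of_real (U \<omega>)) * (((w - z) * of_real (- V \<omega>)) ^ k /\<^sub>R fact k)) sums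
          (exp (z * of_real (U \<omega>)) * exp ((w - z) * of_real (- V \<omega>)))"
        by (rule sums_mult)
      moreover have "exp (z * of_real (U \<omega>)) * (((w - z) * of_real (- V \<omega>)) ^ k /\<^sub>R fact k) = F k \<omega>" for k
        unfolding F_def power_mult_distrib scaleR_conv_of_real by (simp add: field_simps del: of_real_minus)
      moreover have "exp (z * of_real (U \<omega>)) * exp ((w - z) * of_real (- V \<omega>)) =
          exp (w * of_real (U \<omega>)) * exp (- ((w - z) * of_real B))"
        by (simp add: exp_add[symmetric] V_def algebra_simps)
      ultimately show ?thesis
        by (simp add: sums_iff)
    qed
    ultimately show ?thesis by simp
  qed
  have "(\<lambda>w. ?f w * exp (- ((w - z) * of_real B))) holomorphic_on ball z (Re z - \<sigma>)"
    by (rule power_series_holomorphic[OF sums])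
  moreover have "(\<lambda>w. exp ((w - z) * of_real B)) holomorphic_on ball z (Re z - \<sigma>)"
    by (intro holomorphic_intros)
  ultimately have "(\<lambda>w. (?f w * exp (- ((w - z) * of_real B))) * exp ((w - z) * of_real B)) holomorphic_on ball z (Re z - \<sigma>)"
    by (rule holomorphic_on_mult)
  also have "(\<lambda>w. (?f w * exp (- ((w - z) * of_real B))) * exp ((w - z) * of_real B)) = ?f"
    by (simp add: mult.assoc exp_add[symmetric])
  finally show "\<exists>e>0. ?f holomorphic_on ball z e"
    using \<rho> by blast
qed

lemma mgf_integrable_mono:
  fixes U :: "'a \<Rightarrow> real"
  assumes U [measurable]: "U \<in> borel_measurable M" and B: "\<And>\<omega>. U \<omega> \<le> B"
    and int: "integrable M (\<lambda>\<omega>. exp (\<sigma> * U \<omega>))" and t: "Re t \<ge> \<sigma>"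
  shows "integrable M (\<lambda>\<omega>. exp (t * of_real (U \<omega>)))"
proof (rule Bochner_Integration.integrable_bound)
  show "integrable M (\<lambda>\<omega>. exp ((Re t - \<sigma>) * B) * exp (\<sigma> * U \<omega>))"
    using int by simp
  show "AE \<omega> in M. norm (exp (t * of_real (U \<omega>))) \<le> norm (exp ((Re t - \<sigma>) * B) * exp (\<sigma> * U \<omega>))"
  proof (rule AE_I2)
    fix \<omega>
    have "(Re t - \<sigma>) * U \<omega> \<le> (Re t - \<sigma>) * B"
      using t B[of \<omega>] by (intro mult_left_mono) auto
    then show "norm (exp (t * of_real (U \<omega>))) \<le> norm (exp ((Re t - \<sigma>) * B) * exp (\<sigma> * U \<omega>))"
      by (simp add: exp_add[symmetric] algebra_simps)
  qed
qed measurable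

lemma tendsto_of_real_inverse_Suc: "(\<lambda>k. complex_of_real (1 / real (Suc k))) \<longlonglongrightarrow> 0"
  using tendsto_of_real[OF LIMSEQ_Suc[OF lim_1_over_n]] by (simp only: of_real_0)

text \<open>\<open>U\<close> is bounded above only, so the boundary is approached from the right,
  where the additional factor is at most \<open>exp \<bar>B\<bar>\<close>.\<close>

lemma mgf_tendsto_boundary:
  fixes U :: "'a \<Rightarrow> real"
  assumes U [measurable]: "U \<in> borel_measurable M" and B: "\<And>\<omega>. U \<omega> \<le> B"
    and int: "integrable M (\<lambda>\<omega>. exp (Re t * U \<omega>))"
  shows "(\<lambda>k. \<integral>\<omega>. exp ((t + of_real (1 / real (Suc k))) * of_real (U \<omega>)) \<partial>M) \<longlonglongrightarrow> (\<integral>\<omega>. exp (t * of_real (U \<omega>)) \<partial>M)"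
proof (rule integral_dominated_convergence)
  show "integrable M (\<lambda>\<omega>. exp \<bar>B\<bar> * exp (Re t * U \<omega>))"
    using int by simp
  show "AE \<omega> in M. (\<lambda>k. exp ((t + of_real (1 / real (Suc k))) * of_real (U \<omega>))) \<longlonglongrightarrow> exp (t * of_real (U \<omega>))"
  proof (rule AE_I2)
    fix \<omega>
    have "(\<lambda>k. exp ((t + of_real (1 / real (Suc k))) * of_real (U \<omega>))) \<longlonglongrightarrow> exp ((t + 0) * of_real (U \<omega>))"
      by (intro tendsto_exp tendsto_mult tendsto_add tendsto_const tendsto_of_real_inverse_Suc)
    then show "(\<lambda>k. exp ((t + of_real (1 / real (Suc k))) * of_real (U \<omega>))) \<longlonglongrightarrow> exp (t * of_real (U \<omega>))"
      by simp
  qed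
  show "AE \<omega> in M. norm (exp ((t + of_real (1 / real (Suc k))) * of_real (U \<omega>))) \<le> exp \<bar>B\<bar> * exp (Re t * U \<omega>)" for k
  proof (rule AE_I2)
    fix \<omega>
    have "1 / real (Suc k) * U \<omega> \<le> 1 / real (Suc k) * \<bar>B\<bar>"
      using B[of \<omega>] by (intro mult_left_mono) auto
    also have "\<dots> \<le> 1 * \<bar>B\<bar>"
      by (intro mult_right_mono) auto
    finally have "1 / real (Suc k) * U \<omega> \<le> \<bar>B\<bar>" by simp
    moreover have "Re ((t + of_real (1 / real (Suc k))) * of_real (U \<omega>)) = Re t * U \<omega> + 1 / real (Suc k) * U \<omega>"
      by (simp add: distrib_right)
    ultimately show "norm (exp ((t + of_real (1 / real (Suc k))) * of_real (U \<omega>))) \<le> exp \<bar>B\<bar> * exp (Re t * U \<omega>)"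
      by (simp only: norm_exp_eq_Re exp_add[symmetric] exp_le_cancel_iff)
  qed
qed measurable

lemma connected_Re_gt: "connected {t. Re t > \<sigma>}"
  by (intro convex_connected convex_halfspace_Re_gt)

text \<open>The real points from \<open>1\<close> on accumulate at \<open>2\<close> inside the half
  plane.\<close>

lemma analytic_eq_on_halfplane:
  assumes f: "f analytic_on {t. Re t > 0}" and g: "g analytic_on {t. Re t > 0}"
    and eq: "\<And>s. s \<ge> 1 \<Longrightarrow> f (of_real s) = g (of_real s)" and t: "Re t > 0"
  shows "f t = g t"
proof -
  have "(\<lambda>t. f t - g t) holomorphic_on {t. Re t > 0}"
    using f g by (intro holomorphic_intros analytic_imp_holomorphic)
  moreover have "2 islimpt (of_real ` {1..} :: complex set)"
    unfolding islimpt_sequential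
  proof (intro exI[of _ "\<lambda>k. of_real (2 + 1 / real (Suc k))"] conjI allI)
    show "complex_of_real (2 + 1 / real (Suc k)) \<in> of_real ` {1..} - {2}" for k
    proof -
      have "complex_of_real (2 + 1 / real (Suc k)) \<noteq> of_real 2"
        unfolding of_real_eq_iff by simp
      then show ?thesis by (auto intro!: imageI simp del: of_real_add)
    qed
    have "(\<lambda>k. 2 + 1 / real (Suc k)) \<longlonglongrightarrow> 2 + 0"
      by (intro tendsto_intros LIMSEQ_Suc[OF lim_1_over_n])
    then have "(\<lambda>k. complex_of_real (2 + 1 / real (Suc k))) \<longlonglongrightarrow> of_real (2 + 0)"
      by (rule tendsto_of_real)
    then show "(\<lambda>k. complex_of_real (2 + 1 / real (Suc k))) \<longlonglongrightarrow> 2"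
      by simp
  qed
  ultimately have "f t - g t = 0"
    using t eq
    by (intro analytic_continuation[of "\<lambda>t. f t - g t" "{t. Re t > 0}" "of_real ` {1..}" 2 t])
       (auto simp: open_halfspace_Re_gt connected_Re_gt)
  then show ?thesis by simp
qed

text \<open>
  The moments of order at least one determine the moment generating function of the logarithm on
  the whole domain of absolute convergence: first on the right half plane by the identity theorem,
  then at the origin, where the limit of the moments is the probability of positivity, and finally
  up to the boundary of the domain of convergence by dominated convergence.
\<close>

lemma mgf_continuation_of_moments:
  fixes Z :: "'a \<Rightarrow> real" and \<Phi> :: "complex \<Rightarrow> complex" and \<phi> :: "real \<Rightarrow> real" and c F :: real
  assumes M: "prob_space M" and Z [measurable]: "Z \<in> borel_measurable M"
    and Z0: "\<And>\<omega>. Z \<omega> \<ge> 0" and F: "F > 0" "AE \<omega> in M. Z \<omega> \<le> F"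
    and mero: "\<Phi> meromorphic_on UNIV" and ana: "\<Phi> analytic_on {t. Re t > 0}"
    and cont: "isCont \<Phi> 0" and one: "\<Phi> 0 = 1"
    and mom: "\<And>s. s \<ge> 1 \<Longrightarrow> (\<integral>\<^sup>+\<omega>. ennreal (Z \<omega> powr s) \<partial>M) = ennreal (\<phi> s)"
    and \<phi>: "\<And>s. s \<ge> 1 \<Longrightarrow> \<phi> s \<ge> 0" "\<And>s. s \<ge> 1 \<Longrightarrow> \<Phi> (of_real s) = of_real (\<phi> s)"
  shows "mgf_continuation M (\<lambda>\<omega>. ln (Z \<omega>) - c) UNIV (remove_sings (\<lambda>t. exp (- (t * of_real c)) * \<Phi> t))"
proof -
  interpret prob_space M by fact
  \<comment> \<open>The bound by \<open>F\<close> holds only almost everywhere; truncating at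
    \<open>ln F\<close> makes it hold everywhere.\<close>
  define U where "U = (\<lambda>\<omega>. min (ln (Z \<omega>)) (ln F))"
  have [measurable]: "U \<in> borel_measurable M" unfolding U_def by measurable
  have U: "U \<omega> \<le> ln F" for \<omega> by (simp add: U_def)
  \<comment> \<open>Since \<open>ln 0 = 0\<close>, the exponential equals \<open>1\<close> where
    \<open>Z = 0\<close>, while \<open>0 powr s = 0\<close>. Restricting the measure to
    \<open>Z > 0\<close> makes the transform agree with the moments before positivity is
    known.\<close>
  define N where "N = density M (\<lambda>\<omega>. ennreal (if Z \<omega> > 0 then 1 else 0))"
  have UN [measurable]: "U \<in> borel_measurable N" unfolding N_def by simp
  have N_int: "(\<integral>\<omega>. f \<omega> \<partial>N) = (\<integral>\<omega>. (if Z \<omega> > 0 then 1 else 0) *\<^sub>R f \<omega> \<partial>M)"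
    if "f \<in> borel_measurable M" for f :: "'a \<Rightarrow> complex"
    unfolding N_def using that by (intro integral_density) auto
  have fin: "finite_measure N"
  proof (rule finite_measureI)
    have "emeasure N (space N) = (\<integral>\<^sup>+\<omega>. ennreal (if Z \<omega> > 0 then 1 else 0) \<partial>M)"
      unfolding N_def by (subst emeasure_density) (auto intro!: nn_integral_cong)
    also have "\<dots> \<le> (\<integral>\<^sup>+\<omega>. 1 \<partial>M)"
      by (rule nn_integral_mono) auto
    also have "\<dots> < \<infinity>"
      by (simp add: emeasure_space_1)
    finally show "emeasure N (space N) \<noteq> \<infinity>" by simp
  qed
  have int0: "integrable N (\<lambda>\<omega>. exp (0 * U \<omega>))"
    using finite_measure.integrable_const[OF fin] by simp
  define m where "m = (\<lambda>t :: complex. \<integral>\<omega>. exp (t * of_real (U \<omega>)) \<partial>N)"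
  have m_ana: "m analytic_on {t. Re t > 0}"
    unfolding m_def by (rule mgf_analytic[OF UN U int0])
  have m_real: "m (of_real s) = \<Phi> (of_real s)" if s: "s \<ge> 1" for s
  proof -
    have "m (of_real s) = (\<integral>\<omega>. (if Z \<omega> > 0 then 1 else 0) *\<^sub>R exp (of_real s * of_real (U \<omega>)) \<partial>M)"
      unfolding m_def by (rule N_int) measurable
    also have "\<dots> = (\<integral>\<omega>. of_real (Z \<omega> powr s) \<partial>M)"
    proof (rule integral_cong_AE)
      show "AE \<omega> in M. (if Z \<omega> > 0 then 1 else 0) *\<^sub>R exp (of_real s * of_real (U \<omega>)) = complex_of_real (Z \<omega> powr s)"
        using F(2)
      proof eventually_elim
        case (elim \<omega>)
        show ?case
        proof (cases "Z \<omega> > 0")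
          case True
          then have "U \<omega> = ln (Z \<omega>)" using elim F(1) by (simp add: U_def)
          then show ?thesis
            using True by (simp add: powr_def exp_of_real[symmetric])
        next
          case False
          then have "Z \<omega> = 0" using Z0[of \<omega>] by simp
          then show ?thesis by simp
        qed
      qed
    qed measurable
    also have "\<dots> = of_real (\<integral>\<omega>. Z \<omega> powr s \<partial>M)"
      by (rule integral_complex_of_real)
    also have "(\<integral>\<omega>. Z \<omega> powr s \<partial>M) = \<phi> s"
      using mom[OF s] \<phi>(1)[OF s] by (subst integral_eq_nn_integral) auto
    finally show ?thesis
      using \<phi>(2)[OF s] by simp
  qed
  have m_eq: "m t = \<Phi> t" if "Re t > 0" for t
    by (rule analytic_eq_on_halfplane[OF m_ana ana m_real that])
  \<comment> \<open>At \<open>0\<close> the restricted transform is the probability of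
    \<open>Z > 0\<close>; it is also the limit of \<open>\<Phi>\<close> along positive reals, which
    is \<open>\<Phi> 0 = 1\<close>.\<close>
  have AE_pos: "AE \<omega> in M. Z \<omega> > 0"
  proof -
    have m_lim: "(\<lambda>k. m (0 + of_real (1 / real (Suc k)))) \<longlonglongrightarrow> m 0"
      unfolding m_def by (rule mgf_tendsto_boundary[OF UN U]) (use int0 in simp)
    have m_Phi: "m (0 + of_real (1 / real (Suc k))) = \<Phi> (of_real (1 / real (Suc k)))" for k
      by (subst m_eq) (simp_all add: add_pos_nonneg)
    have "(\<lambda>k. \<Phi> (of_real (1 / real (Suc k)))) \<longlonglongrightarrow> \<Phi> 0"
    proof (rule isCont_tendsto_compose[OF cont])
      show "(\<lambda>k. complex_of_real (1 / real (Suc k))) \<longlonglongrightarrow> 0" by (rule tendsto_of_real_inverse_Suc)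
    qed
    then have "m 0 = 1"
      using m_lim one unfolding m_Phi by (metis LIMSEQ_unique)
    moreover have "m 0 = (\<integral>\<omega>. (if Z \<omega> > 0 then 1 else 0) *\<^sub>R exp (0 * of_real (U \<omega>)) \<partial>M)"
      unfolding m_def by (rule N_int) measurable
    moreover have "\<dots> = (\<integral>\<omega>. of_real (indicator {\<omega> \<in> space M. Z \<omega> > 0} \<omega>) \<partial>M)"
      by (intro Bochner_Integration.integral_cong) (auto simp: scaleR_conv_of_real)
    moreover have "\<dots> = complex_of_real (prob {\<omega> \<in> space M. Z \<omega> > 0})"
      by (subst integral_complex_of_real) (auto simp: Int_def intro!: arg_cong[where f = prob])
    ultimately have "prob {\<omega> \<in> space M. Z \<omega> > 0} = 1"
      by (metis of_real_eq_1_iff)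
    then show ?thesis
      by (subst (asm) prob_Collect_eq_1) auto
  qed
  define Y where "Y = (\<lambda>\<omega>. ln (Z \<omega>) - c)"
  define W where "W = (\<lambda>\<omega>. U \<omega> - c)"
  have [measurable]: "Y \<in> borel_measurable M" "W \<in> borel_measurable M"
    unfolding Y_def W_def by measurable
  have YW: "AE \<omega> in M. Y \<omega> = W \<omega>"
    using AE_pos F(2) by eventually_elim (use F(1) in \<open>simp add: Y_def W_def U_def\<close>)
  have W: "W \<omega> \<le> ln F - c" for \<omega> using U[of \<omega>] by (simp add: W_def)
  define \<mu> where "\<mu> = (\<lambda>t :: complex. \<integral>\<omega>. exp (t * of_real (W \<omega>)) \<partial>M)"
  define \<Psi> where "\<Psi> = (\<lambda>t. exp (- (t * of_real c)) * \<Phi> t)"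
  have domain: "mgf_domain M Y = mgf_domain M W"
  proof -
    have "integrable M (\<lambda>\<omega>. exp (t * of_real (Y \<omega>))) \<longleftrightarrow> integrable M (\<lambda>\<omega>. exp (t * of_real (W \<omega>)))" for t :: complex
      by (rule integrable_cong_AE) (use YW in \<open>measurable, eventually_elim, simp\<close>)
    then show ?thesis by (simp add: mgf_domain_def)
  qed
  have mgf_Y: "(\<integral>\<omega>. exp (t * of_real (Y \<omega>)) \<partial>M) = \<mu> t" for t
    unfolding \<mu>_def by (rule integral_cong_AE) (use YW in \<open>measurable, eventually_elim, simp\<close>)
  have \<mu>_eq: "\<mu> t = \<Psi> t" if "Re t > 0" for t
  proof -
    have "\<mu> t = (\<integral>\<omega>. ((if Z \<omega> > 0 then 1 else 0) *\<^sub>R exp (t * of_real (U \<omega>))) * exp (- (t * of_real c)) \<partial>M)"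
      unfolding \<mu>_def by (rule integral_cong_AE)
        (use AE_pos in \<open>measurable, eventually_elim, simp add: W_def exp_diff exp_minus field_simps\<close>)
    also have "\<dots> = m t * exp (- (t * of_real c))"
      unfolding m_def by (subst N_int) (measurable, rule integral_mult_left_zero)
    finally show ?thesis
      using m_eq[OF that] by (simp add: \<Psi>_def mult.commute)
  qed
  have W_int: "integrable M (\<lambda>\<omega>. exp (0 * W \<omega>))" by simp
  have \<Psi>_mero: "\<Psi> meromorphic_on UNIV"
    unfolding \<Psi>_def by (intro meromorphic_on_mult mero analytic_on_imp_meromorphic_on analytic_intros)
  define G where "G = remove_sings \<Psi>"
  have G: "G nicely_meromorphic_on UNIV"
    unfolding G_def by (rule remove_sings_nicely_meromorphic[OF \<Psi>_mero])
  have G_eq: "G t = \<mu> t" if t: "t \<in> mgf_domain M W" for t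
  proof -
    define \<sigma> where "\<sigma> = Re t"
    have int: "integrable M (\<lambda>\<omega>. exp (\<sigma> * W \<omega>))"
    proof -
      have "integrable M (\<lambda>\<omega>. norm (exp (t * of_real (W \<omega>))))"
        using t by (intro integrable_norm) (simp add: mgf_domain_def)
      then show ?thesis by (simp add: \<sigma>_def)
    qed
    have \<mu>_ana: "\<mu> analytic_on {t. Re t > \<sigma>}"
      unfolding \<mu>_def by (rule mgf_analytic[OF _ W int]) measurable
    \<comment> \<open>The difference of the two functions either vanishes or avoids zero off a
      sparse set, and it vanishes for positive real part. Continuity of \<open>\<mu>\<close> then
      identifies the value left after the removal of singularities.\<close>
    have right: "G w = \<mu> w" if w: "Re w > \<sigma>" for w
    proof -
      let ?A = "{t. Re t > \<sigma>}"
      have openA: "open ?A" by (rule open_halfspace_Re_gt)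
      have "(\<lambda>t. \<Psi> t - \<mu> t) meromorphic_on ?A"
        by (intro meromorphic_intros meromorphic_on_subset[OF \<Psi>_mero] analytic_on_imp_meromorphic_on \<mu>_ana) auto
      then have "(\<forall>\<^sub>\<approx>t\<in>?A. \<Psi> t - \<mu> t = 0) \<or> (\<forall>\<^sub>\<approx>t\<in>?A. \<Psi> t - \<mu> t \<noteq> 0)"
        by (rule meromorphic_imp_constant_or_avoid[OF _ openA connected_Re_gt])
      moreover have "\<not> (\<forall>\<^sub>\<approx>t\<in>?A. \<Psi> t - \<mu> t \<noteq> 0)"
      proof
        assume *: "\<forall>\<^sub>\<approx>t\<in>?A. \<Psi> t - \<mu> t \<noteq> 0"
        \<comment> \<open>Any point to the right of both \<open>\<sigma>\<close> and
          \<open>0\<close> works.\<close>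
        define p where "p = complex_of_real (\<bar>\<sigma>\<bar> + 1)"
        have "p \<in> ?A" by (simp add: p_def)
        then have "eventually (\<lambda>t. \<Psi> t - \<mu> t \<noteq> 0) (at p)"
          using * by (simp add: eventually_cosparse_open_eq[OF openA])
        moreover have "eventually (\<lambda>t. t \<in> {t. Re t > 0}) (at p)"
          by (rule eventually_at_in_open') (auto simp: p_def open_halfspace_Re_gt)
        ultimately have "eventually (\<lambda>t. False) (at p)"
          by eventually_elim (simp add: \<mu>_eq)
        then show False by simp
      qed
      ultimately have ev: "eventually (\<lambda>t. \<Psi> t = \<mu> t) (at w)"
        using w by (auto simp: eventually_cosparse_open_eq[OF openA])
      have "isCont \<mu> w"
        using \<mu>_ana w by (intro analytic_at_imp_isCont) (auto intro: analytic_on_subset)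
      then have "\<mu> \<midarrow>w\<rightarrow> \<mu> w" by (rule isContD)
      then have "\<Psi> \<midarrow>w\<rightarrow> \<mu> w"
        by (rule Lim_transform_eventually) (use ev in \<open>eventually_elim, simp\<close>)
      then show ?thesis
        unfolding G_def by (rule remove_sings_eqI)
    qed
    let ?s = "\<lambda>k. t + of_real (1 / real (Suc k))"
    have lim: "(\<lambda>k. G (?s k)) \<longlonglongrightarrow> \<mu> t"
    proof -
      have "(\<lambda>k. \<mu> (?s k)) \<longlonglongrightarrow> \<mu> t"
        unfolding \<mu>_def by (rule mgf_tendsto_boundary[OF _ W]) (use int in \<open>simp_all add: \<sigma>_def\<close>)
      moreover have "G (?s k) = \<mu> (?s k)" for k
        by (rule right) (simp add: \<sigma>_def)
      ultimately show ?thesis by simp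
    qed
    have s_at: "filterlim ?s (at t) sequentially"
      unfolding filterlim_at
    proof
      have "?s \<longlonglongrightarrow> t + 0"
        by (intro tendsto_add tendsto_const tendsto_of_real_inverse_Suc)
      then show "?s \<longlonglongrightarrow> t" by simp
      have "?s k \<noteq> t" for k
        by (metis add_cancel_left_right of_real_eq_0_iff divide_eq_0_iff of_nat_eq_0_iff old.nat.distinct(2) zero_neq_one)
      then show "\<forall>\<^sub>F k in sequentially. ?s k \<in> UNIV \<and> ?s k \<noteq> t"
        by simp
    qed
    \<comment> \<open>On the boundary line a pole is excluded because the values along a sequence
      from the right converge; otherwise \<open>G\<close> is continuous there.\<close>
    from G have "(is_pole G t \<and> G t = 0) \<or> G \<midarrow>t\<rightarrow> G t"
      by (auto simp: nicely_meromorphic_on_def)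
    then show ?thesis
    proof
      assume "is_pole G t \<and> G t = 0"
      then have "filterlim (\<lambda>k. G (?s k)) at_infinity sequentially"
        using filterlim_compose[OF _ s_at] unfolding is_pole_def by auto
      then show ?thesis
        using lim not_tendsto_and_filterlim_at_infinity[OF _ lim] by simp
    next
      assume "G \<midarrow>t\<rightarrow> G t"
      then have "(\<lambda>k. G (?s k)) \<longlonglongrightarrow> G t"
        using s_at by (rule filterlim_compose)
      then show ?thesis
        using lim by (rule LIMSEQ_unique)
    qed
  qed
  have sub: "{t. Re t > 0} \<subseteq> mgf_domain M W"
  proof
    fix t assume "t \<in> {t. Re t > 0}"
    then show "t \<in> mgf_domain M W"
      using mgf_integrable_mono[OF _ W W_int, of t] by (simp add: mgf_domain_def)
  qed
  have "1 \<in> interior (mgf_domain M W)"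
    by (rule interiorI[OF open_halfspace_Re_gt _ sub]) simp
  then show ?thesis
    using G G_eq unfolding mgf_continuation_def Y_def[symmetric] \<Psi>_def[symmetric] G_def[symmetric] domain mgf_Y
    by auto
qed

subsection \<open>Expansion of Gamma quotients\<close>

text \<open>A comparison series for the sum of inverse cubes: \<open>x^3 - x\<close> factors into
  three consecutive terms, and partial fractions telescope.\<close>

lemma sums_telescope_cubes:
  assumes u: "u \<ge> (2::real)"
  shows "(\<lambda>k. 1 / ((u + real k - 1) * (u + real k) * (u + real k + 1))) sums (1 / (2 * ((u - 1) * u)))"
proof -
  define f where "f = (\<lambda>k. 1 / (2 * ((u + real k - 1) * (u + real k))))"
  have "f \<longlonglongrightarrow> 0"
    unfolding f_def by real_asymp
  then have "(\<lambda>k. f k - f (Suc k)) sums (f 0 - 0)"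
    by (rule telescope_sums')
  moreover have "f k - f (Suc k) = 1 / ((u + real k - 1) * (u + real k) * (u + real k + 1))" for k
  proof -
    have "u + real k > 1" using u by simp
    then show ?thesis
      unfolding f_def by (simp add: divide_simps)
  qed
  ultimately show ?thesis
    by (simp add: f_def)
qed

lemma norm_Polygamma_2_le:
  assumes u: "u \<ge> 2" and y: "Re y \<ge> u"
  shows "norm (Polygamma 2 (y :: complex)) \<le> 2 / u\<^sup>2"
proof -
  have le: "norm (inverse ((y + of_nat k) ^ 3)) \<le> 1 / ((u + real k - 1) * (u + real k) * (u + real k + 1))" for k
  proof -
    have "u + real k \<le> Re (y + of_nat k)" using y by simp
    also have "\<dots> \<le> norm (y + of_nat k)" by (rule complex_Re_le_cmod)
    finally have n: "u + real k \<le> norm (y + of_nat k)" .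
    have p: "u + real k \<ge> 2" using u by simp
    have "(u + real k - 1) * (u + real k) * (u + real k + 1) = (u + real k) ^ 3 - (u + real k)"
      by (simp add: power3_eq_cube algebra_simps)
    also have "\<dots> \<le> norm (y + of_nat k) ^ 3"
      using power_mono[OF n, of 3] p by linarith
    finally have "(u + real k - 1) * (u + real k) * (u + real k + 1) \<le> norm (y + of_nat k) ^ 3" .
    then show ?thesis
      unfolding norm_inverse norm_power inverse_eq_divide[symmetric] using p
      by (intro le_imp_inverse_le mult_pos_pos) auto
  qed
  note S = sums_telescope_cubes[OF u]
  have summable: "summable (\<lambda>k. norm (inverse ((y + of_nat k) ^ 3)))"
    using le by (intro summable_comparison_test'[OF sums_summable[OF S], of 0]) simp
  have "norm (Polygamma 2 y) = 2 * norm (\<Sum>k. inverse ((y + of_nat k) ^ 3))"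
    by (simp add: Polygamma_def norm_mult numeral_3_eq_3 numeral_2_eq_2)
  also have "norm (\<Sum>k. inverse ((y + of_nat k) ^ 3)) \<le> (\<Sum>k. norm (inverse ((y + of_nat k) ^ 3)))"
    by (rule summable_norm[OF summable])
  also have "\<dots> \<le> 1 / (2 * ((u - 1) * u))"
    using suminf_le[OF le summable sums_summable[OF S]] sums_unique[OF S] by simp
  also have "\<dots> \<le> 1 / u\<^sup>2"
  proof -
    have "u\<^sup>2 \<le> 2 * ((u - 1) * u)"
      using mult_mono[of 2 u u u] u by (simp add: power2_eq_square algebra_simps)
    then show ?thesis
      using u by (intro divide_left_mono) (auto intro!: mult_pos_pos)
  qed
  finally show ?thesis by simp
qed

lemma not_nonpos_Ints_Re: "Re z > 0 \<Longrightarrow> z \<notin> \<int>\<^sub>\<le>\<^sub>0"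
proof
  assume "Re z > 0" "z \<in> \<int>\<^sub>\<le>\<^sub>0"
  then obtain n where "n \<le> 0" "z = of_int n" by (auto elim: nonpos_Ints_cases)
  with \<open>Re z > 0\<close> show False by simp
qed

text \<open>On the disc of radius \<open>x / 2\<close> about \<open>x\<close> real parts are at
  least \<open>x / 2\<close>, so the third derivative is at most
  \<open>2 / (x / 2)^2 = 8 / x^2\<close>; the Taylor bound divides this by
  \<open>2!\<close>.\<close>

lemma ln_Gamma_Taylor:
  fixes x :: real and w :: complex
  assumes x: "x \<ge> 4" and w: "norm w \<le> x / 2"
  shows "norm (ln_Gamma (of_real x + w) - (ln_Gamma (of_real x) + Digamma (of_real x) * w + Polygamma 1 (of_real x) * w\<^sup>2 / 2))
    \<le> 4 * norm w ^ 3 / x\<^sup>2"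
proof -
  define f where "f = (\<lambda>i :: nat. if i = 0 then ln_Gamma else Polygamma (i - 1) :: complex \<Rightarrow> complex)"
  let ?S = "cball (complex_of_real x) (x / 2)"
  have Re: "Re y \<ge> x / 2" if "y \<in> ?S" for y
  proof -
    have "\<bar>Re (of_real x - y)\<bar> \<le> x / 2"
      using that abs_Re_le_cmod[of "of_real x - y"] by (simp add: dist_norm)
    then show ?thesis unfolding minus_complex.sel Re_complex_of_real by linarith
  qed
  have "norm (f 0 (of_real x + w) - (\<Sum>i\<le>2. f i (of_real x) * ((of_real x + w) - of_real x) ^ i / fact i))
      \<le> 8 / x\<^sup>2 * norm ((of_real x + w) - of_real x) ^ Suc 2 / fact 2"
  proof (rule complex_Taylor[of ?S])
    fix i :: nat and y assume y: "y \<in> ?S"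
    have pos: "Re y > 0" using Re[OF y] x by simp
    then have n1: "y \<notin> \<real>\<^sub>\<le>\<^sub>0" and n2: "y \<notin> \<int>\<^sub>\<le>\<^sub>0"
      by (auto simp: complex_nonpos_Reals_iff dest: not_nonpos_Ints_Re)
    show "(f i has_field_derivative f (Suc i) y) (at y within ?S)"
    proof (cases "i = 0")
      case True
      have "(ln_Gamma has_field_derivative Digamma y) (at y)"
        by (rule has_field_derivative_ln_Gamma_complex[OF n1])
      with True show ?thesis
        by (auto simp: f_def intro: has_field_derivative_at_within)
    next
      case False
      have "(Polygamma (i - 1) has_field_derivative Polygamma (Suc (i - 1)) y) (at y within ?S)"
        by (rule has_field_derivative_Polygamma[OF n2])
      with False show ?thesis by (simp add: f_def)
    qed
    show "norm (f (Suc 2) y) \<le> 8 / x\<^sup>2"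
      using norm_Polygamma_2_le[of "x / 2" y] Re[OF y] x by (simp add: f_def power_divide)
  qed (use w x in \<open>auto simp: dist_norm\<close>)
  then show ?thesis
    by (simp add: f_def eval_nat_numeral)
qed

lemma ln_Gamma_diff_real:
  assumes "x > 0"
  shows "ln_Gamma (of_real x + 1) = ln_Gamma (of_real x) + complex_of_real (ln x)"
proof -
  have nz: "x \<notin> \<int>\<^sub>\<le>\<^sub>0" using assms nonpos_Ints_nonpos[of x] by auto
  have "ln_Gamma (x + 1) = ln (Gamma (x + 1))"
    using assms by (intro ln_Gamma_real_pos) simp
  also have "\<dots> = ln x + ln_Gamma x"
    using assms nz Gamma_real_pos[OF assms] by (simp add: Gamma_plus1 ln_mult_pos ln_Gamma_real_pos)
  finally have "ln_Gamma (x + 1) = ln x + ln_Gamma x" .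
  then show ?thesis
    using ln_Gamma_complex_of_real[of x] ln_Gamma_complex_of_real[of "x + 1"] assms by simp
qed

text \<open>Taylor's formula with shifts \<open>1\<close> and \<open>2\<close>, together with the
  functional equation of Gamma, gives two linear equations for \<open>\<psi>\<close> and
  \<open>\<psi>'\<close>. The remainders are \<open>4 / x^2\<close> and \<open>32 / x^2\<close> and
  the logarithm costs \<open>1 / x^2\<close>, whence \<open>41 = 1 + 32 + 2 * 4\<close>; and
  \<open>25\<close> bounds \<open>41 / 2 + 4\<close>.\<close>

lemma Polygamma_1_asymp:
  assumes x: "x \<ge> 4"
  shows "norm (Polygamma 1 (of_real x) - of_real (1 / x) :: complex) \<le> 41 / x\<^sup>2"
    and "norm (Digamma (of_real x) - of_real (ln x - 1 / (2 * x)) :: complex) \<le> 25 / x\<^sup>2"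
proof -
  define \<psi> :: complex where "\<psi> = Digamma (of_real x)"
  define \<psi>' :: complex where "\<psi>' = Polygamma 1 (of_real x)"
  define R1 where "R1 = ln_Gamma (of_real x + 1) - (ln_Gamma (of_real x) + \<psi> + \<psi>' / 2)"
  define R2 where "R2 = ln_Gamma (of_real x + 2) - (ln_Gamma (of_real x) + \<psi> * 2 + \<psi>' * 4 / 2)"
  have R1: "norm R1 \<le> 4 / x\<^sup>2"
    using ln_Gamma_Taylor[of x 1] x by (simp add: R1_def \<psi>_def \<psi>'_def)
  have R2: "norm R2 \<le> 32 / x\<^sup>2"
    using ln_Gamma_Taylor[of x 2] x by (simp add: R2_def \<psi>_def \<psi>'_def)
  have e1: "of_real (ln x) = \<psi> + \<psi>' / 2 + R1"
    using ln_Gamma_diff_real[of x] x by (simp add: R1_def)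
  have "ln_Gamma (of_real x + 2) = ln_Gamma (of_real x + 1) + complex_of_real (ln (x + 1))"
    using ln_Gamma_diff_real[of "x + 1"] x by (simp add: add.assoc)
  then have e2: "of_real (ln x) + of_real (ln (x + 1)) = 2 * \<psi> + 2 * \<psi>' + R2"
    using ln_Gamma_diff_real[of x] x by (simp add: R2_def algebra_simps)
  have "ln (x + 1) - ln x = ln (1 + 1 / x)"
    using x by (subst ln_divide_pos[symmetric]) (auto simp: add_divide_distrib)
  then have e3: "of_real (ln (1 + 1 / x)) = \<psi>' + R2 - 2 * R1"
    using e1 e2 by (simp add: of_real_diff[symmetric] algebra_simps)
  have lnb: "\<bar>ln (1 + 1 / x) - 1 / x\<bar> \<le> 1 / x\<^sup>2"
    using abs_ln_one_plus_x_minus_x_bound_nonneg[of "1 / x"] x by (simp add: power_divide)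
  have "\<psi>' - of_real (1 / x) = of_real (ln (1 + 1 / x) - 1 / x) - R2 + 2 * R1"
    using e3 by simp
  then have "norm (\<psi>' - of_real (1 / x)) \<le> norm (complex_of_real (ln (1 + 1 / x) - 1 / x)) + norm R2 + norm (2 * R1)"
    by (simp only:) (intro norm_triangle_mono norm_triangle_le_diff order_refl norm_triangle_ineq4)
  also have "\<dots> \<le> 1 / x\<^sup>2 + 32 / x\<^sup>2 + 2 * (4 / x\<^sup>2)"
    using lnb R1 R2 by (intro add_mono) (simp_all only: norm_of_real norm_mult norm_numeral mult_left_mono zero_le_numeral)
  finally have 1: "norm (\<psi>' - of_real (1 / x)) \<le> 41 / x\<^sup>2" by simp
  then show "norm (Polygamma 1 (of_real x) - of_real (1 / x) :: complex) \<le> 41 / x\<^sup>2"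
    by (simp only: \<psi>'_def)
  have "\<psi> - of_real (ln x - 1 / (2 * x)) = - ((\<psi>' - of_real (1 / x)) / 2) - R1"
    using e1 by (simp add: field_simps)
  then have "norm (\<psi> - of_real (ln x - 1 / (2 * x))) \<le> norm (- ((\<psi>' - of_real (1 / x)) / 2)) + norm R1"
    by (simp only: norm_triangle_ineq4)
  also have "norm (- ((\<psi>' - of_real (1 / x)) / 2)) = norm (\<psi>' - of_real (1 / x)) / 2"
    by (simp only: norm_minus_cancel norm_divide norm_numeral)
  also have "\<dots> + norm R1 \<le> 41 / x\<^sup>2 / 2 + 4 / x\<^sup>2"
    by (intro add_mono divide_right_mono 1 R1) simp
  also have "\<dots> \<le> 25 / x\<^sup>2"
    unfolding divide_divide_eq_left using x by (simp add: divide_simps)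
  finally show "norm (Digamma (of_real x) - of_real (ln x - 1 / (2 * x)) :: complex) \<le> 25 / x\<^sup>2"
    by (simp only: \<psi>_def)
qed

text \<open>The term of order \<open>1 / x\<close> belongs to the main part because the expansion is
  later multiplied by a number of order \<open>x\<close>. The remainder must be of smaller order
  than \<open>1 / x\<close>.\<close>

definition lnGamma_error :: "real \<Rightarrow> complex \<Rightarrow> complex" where
  "lnGamma_error x w = ln_Gamma (of_real x + w) - ln_Gamma (of_real x) -
     (w * of_real (ln x) + w * (w - 1) / of_real (2 * x))"

lemma norm_lnGamma_error_le:
  assumes x: "x \<ge> 4" and w: "norm w \<le> x / 2"
  shows "norm (lnGamma_error x w) \<le> 50 * (1 + norm w) ^ 3 / x\<^sup>2"
proof -
  define \<psi> :: complex where "\<psi> = Digamma (of_real x)"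
  define \<psi>' :: complex where "\<psi>' = Polygamma 1 (of_real x)"
  define R where "R = ln_Gamma (of_real x + w) - (ln_Gamma (of_real x) + \<psi> * w + \<psi>' * w\<^sup>2 / 2)"
  define d1 where "d1 = \<psi> - of_real (ln x - 1 / (2 * x))"
  define d2 where "d2 = \<psi>' - of_real (1 / x)"
  have "lnGamma_error x w = R + d1 * w + d2 * w\<^sup>2 / 2"
    using x by (simp add: lnGamma_error_def R_def d1_def d2_def divide_simps power2_eq_square)
      (simp add: algebra_simps)
  then have "norm (lnGamma_error x w) \<le> norm R + norm (d1 * w) + norm (d2 * w\<^sup>2 / 2)"
    by (simp only:) (intro norm_triangle_mono order_refl)
  also have "\<dots> \<le> 4 * norm w ^ 3 / x\<^sup>2 + 25 / x\<^sup>2 * norm w + 41 / x\<^sup>2 * (norm w)\<^sup>2 / 2"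
    using ln_Gamma_Taylor[OF x w] Polygamma_1_asymp[OF x]
    unfolding norm_mult norm_divide norm_power norm_numeral d1_def d2_def R_def \<psi>_def \<psi>'_def
    by (intro add_mono mult_right_mono divide_right_mono) auto
  also have "\<dots> = (4 * norm w ^ 3 + 25 * norm w + 41 / 2 * (norm w)\<^sup>2) / x\<^sup>2"
    by (simp add: add_divide_distrib)
  also have "\<dots> \<le> 50 * (1 + norm w) ^ 3 / x\<^sup>2"
  proof (intro divide_right_mono)
    have "(1 + norm w) ^ 3 = 1 + 3 * norm w + 3 * (norm w)\<^sup>2 + norm w ^ 3"
      by (simp add: power3_eq_cube power2_eq_square algebra_simps)
    moreover have "norm w ^ 3 \<ge> 0" "(norm w)\<^sup>2 \<ge> 0" "norm w \<ge> 0" by auto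
    ultimately show "4 * norm w ^ 3 + 25 * norm w + 41 / 2 * (norm w)\<^sup>2 \<le> 50 * (1 + norm w) ^ 3"
      by linarith
  qed simp
  finally show ?thesis .
qed

text \<open>\<open>exp\<close> of \<open>ln_Gamma\<close> is \<open>Gamma\<close> off the poles, so
  no branch of the logarithm has to be followed.\<close>

lemma Gamma_ratio_exp:
  assumes x: "x \<ge> 4" and w: "norm w \<le> x / 2"
  shows "Gamma (of_real x + w) / Gamma (of_real x) =
    exp (w * of_real (ln x) + w * (w - 1) / of_real (2 * x) + lnGamma_error x w)"
proof -
  have "Re (of_real x + w) > 0"
    using w x abs_Re_le_cmod[of w] by simp
  then have n1: "of_real x + w \<notin> \<int>\<^sub>\<le>\<^sub>0"
    by (rule not_nonpos_Ints_Re)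
  have n2: "complex_of_real x \<notin> \<int>\<^sub>\<le>\<^sub>0"
    using x by (intro not_nonpos_Ints_Re) simp
  have "Gamma (of_real x + w) / Gamma (of_real x) = exp (ln_Gamma (of_real x + w) - ln_Gamma (of_real x))"
    using n1 n2 by (simp add: Gamma_complex_altdef exp_diff)
  then show ?thesis
    by (simp add: lnGamma_error_def)
qed

lemma prod_Gamma_eq:
  fixes w :: complex
  assumes w: "\<And>k. k \<ge> 1 \<Longrightarrow> w \<noteq> - of_nat k" and m: "m \<ge> 1"
  shows "(\<Prod>i=1..m. Gamma (of_nat i + w) / Gamma (of_nat i)) =
    (Gamma (of_nat m + w) / Gamma (of_nat m)) ^ m / (\<Prod>k=1..<m. (1 + w / of_nat k) ^ k)"
  using m
proof (induction m rule: dec_induct)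
  case base
  show ?case by simp
next
  case (step m)
  have "w + of_nat m \<noteq> 0"
    using w[of m] step.hyps by (metis add_eq_0_iff2)
  then have nz: "1 + w / of_nat m \<noteq> 0"
    using step.hyps by (simp add: field_simps add.commute)
  have "of_nat m + w \<notin> \<int>\<^sub>\<le>\<^sub>0"
  proof
    assume "of_nat m + w \<in> \<int>\<^sub>\<le>\<^sub>0"
    then obtain j where "of_nat m + w = - of_nat j" by (elim nonpos_Ints_cases')
    then have "w = - of_nat (m + j)" by (simp add: algebra_simps eq_neg_iff_add_eq_0)
    then show False using w[of "m + j"] step.hyps by simp
  qed
  then have "Gamma (of_nat m + w + 1) = (of_nat m + w) * Gamma (of_nat m + w)"
    by (rule Gamma_plus1)
  moreover have "Gamma (of_nat m + 1 :: complex) = of_nat m * Gamma (of_nat m)"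
    using step.hyps by (intro Gamma_plus1 not_nonpos_Ints_Re) simp
  \<comment> \<open>One step in \<open>m\<close> multiplies the quotient by
    \<open>1 + w / m\<close>. In the \<open>m\<close>-th power this produces precisely the new
    factor of the denominator.\<close>
  ultimately have G: "Gamma (of_nat (Suc m) + w) / Gamma (of_nat (Suc m)) =
      (1 + w / of_nat m) * (Gamma (of_nat m + w) / Gamma (of_nat m))"
    using step.hyps by (simp add: add_ac field_simps)
  have "(\<Prod>i=1..Suc m. Gamma (of_nat i + w) / Gamma (of_nat i)) =
      (Gamma (of_nat m + w) / Gamma (of_nat m)) ^ m / (\<Prod>k=1..<m. (1 + w / of_nat k) ^ k) *
      (Gamma (of_nat (Suc m) + w) / Gamma (of_nat (Suc m)))"
    using step by simp
  also have "(Gamma (of_nat m + w) / Gamma (of_nat m)) ^ m =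
      (Gamma (of_nat (Suc m) + w) / Gamma (of_nat (Suc m))) ^ m / (1 + w / of_nat m) ^ m"
    unfolding G power_mult_distrib by (rule nonzero_mult_div_cancel_left[symmetric]) (use nz in simp)
  also have "(Gamma (of_nat (Suc m) + w) / Gamma (of_nat (Suc m))) ^ m / (1 + w / of_nat m) ^ m / (\<Prod>k=1..<m. (1 + w / of_nat k) ^ k) *
      (Gamma (of_nat (Suc m) + w) / Gamma (of_nat (Suc m))) =
    (Gamma (of_nat (Suc m) + w) / Gamma (of_nat (Suc m))) ^ Suc m / (\<Prod>k=1..<Suc m. (1 + w / of_nat k) ^ k)"
    using step.hyps by (simp add: mult_ac)
  finally show ?case .
qed

text \<open>On the disc of radius \<open>1 / 2\<close> the third derivative
  \<open>2 / (1 + z)^3\<close> is at most \<open>16\<close>, and the Taylor bound divides by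
  \<open>2!\<close>.\<close>

lemma Ln_quadratic_bound:
  assumes u: "norm u \<le> 1 / 2"
  shows "norm (Ln (1 + u) - (u - u\<^sup>2 / 2)) \<le> 8 * norm u ^ 3"
proof -
  define f where "f = (\<lambda>i :: nat. if i = 0 then (\<lambda>z :: complex. Ln (1 + z)) else if i = 1 then (\<lambda>z. inverse (1 + z))
    else if i = 2 then (\<lambda>z. - inverse ((1 + z) ^ 2)) else (\<lambda>z. 2 * inverse ((1 + z) ^ 3)))"
  let ?S = "cball (0 :: complex) (1 / 2)"
  have n: "1 / 2 \<le> norm (1 + z)" "1 + z \<noteq> 0" "1 + z \<notin> \<real>\<^sub>\<le>\<^sub>0" if "z \<in> ?S" for z
  proof -
    have z: "norm z \<le> 1 / 2" using that by simp
    then show "1 / 2 \<le> norm (1 + z)"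
      using norm_triangle_ineq2[of 1 "- z"] by simp
    then show "1 + z \<noteq> 0" by auto
    have "Re (1 + z) > 0"
      using z abs_Re_le_cmod[of z] by simp
    then show "1 + z \<notin> \<real>\<^sub>\<le>\<^sub>0"
      by (auto simp: complex_nonpos_Reals_iff)
  qed
  have "norm (f 0 u - (\<Sum>i\<le>2. f i 0 * (u - 0) ^ i / fact i)) \<le> 16 * norm (u - 0) ^ Suc 2 / fact 2"
  proof (rule complex_Taylor[of ?S])
    fix i :: nat and z assume z: "z \<in> ?S" and i: "i \<le> 2"
    consider "i = 0" | "i = 1" | "i = 2" using i by linarith
    then show "(f i has_field_derivative f (Suc i) z) (at z within ?S)"
    proof cases
      case 1
      then show ?thesis
        unfolding f_def using n[OF z] by (auto intro!: derivative_eq_intros simp: field_simps)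
    next
      case 2
      then show ?thesis
        unfolding f_def using n[OF z] by (auto intro!: derivative_eq_intros simp: power2_eq_square field_simps)
    next
      case 3
      then show ?thesis
        unfolding f_def using n(2)[OF z]
        by (auto intro!: derivative_eq_intros simp: power2_eq_square power3_eq_cube)
    qed
  next
    fix z assume z: "z \<in> ?S"
    have "(1 / 2) ^ 3 \<le> norm (1 + z) ^ 3"
      using n(1)[OF z] by (intro power_mono) auto
    then have "inverse (norm (1 + z) ^ 3) \<le> inverse ((1 / 2) ^ 3)"
      by (rule le_imp_inverse_le) simp
    then show "norm (f (Suc 2) z) \<le> 16"
      unfolding f_def by (simp add: norm_mult norm_inverse norm_power power_divide)
  qed (use u in auto)
  then show ?thesis
    by (simp add: f_def eval_nat_numeral diff_diff_eq)
qed

subsection \<open>The Weierstrass product of the Barnes function\<close>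

text \<open>The index starts at \<open>0\<close>: factor \<open>k\<close> has its zero, of order
  \<open>k + 1\<close>, at \<open>- (k + 1)\<close>.\<close>

definition barnes_factor :: "nat \<Rightarrow> complex \<Rightarrow> complex" where
  "barnes_factor k z = (1 + z / of_nat (Suc k)) ^ Suc k * exp (z\<^sup>2 / (2 * of_nat (Suc k)) - z)"

text \<open>The exponential in the factor cancels the linear and quadratic terms of
  \<open>(k + 1) * Ln (1 + z / (k + 1))\<close>, so the logarithm \<open>\<delta>\<close> is at most
  \<open>8 * R^3 / (k + 1)^2\<close>. The second size condition gives
  \<open>|\<delta>| \<le> 1 / 2\<close>, where \<open>exp \<delta> - 1\<close> is at most
  \<open>3 / 2\<close> times as large.\<close>

lemma barnes_factor_bound:
  assumes R: "norm z \<le> R" and k: "real (Suc k) \<ge> 2 * R" "real (Suc k) \<ge> 16 * R ^ 3" and R0: "R \<ge> 0"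
  shows "norm (barnes_factor k z - 1) \<le> 12 * R ^ 3 / (real (Suc k))\<^sup>2"
proof -
  let ?n = "real (Suc k)"
  define u where "u = z / of_nat (Suc k)"
  have nu: "norm u = norm z / ?n"
    unfolding u_def norm_divide norm_of_nat ..
  have u: "norm u \<le> R / ?n" "norm u \<le> 1 / 2"
  proof -
    show "norm u \<le> R / ?n"
      unfolding nu using R by (intro divide_right_mono) auto
    also have "\<dots> \<le> 1 / 2"
      using k(1) by (simp add: field_simps)
    finally show "norm u \<le> 1 / 2" .
  qed
  define \<delta> where "\<delta> = of_nat (Suc k) * (Ln (1 + u) - (u - u\<^sup>2 / 2))"
  have nz: "1 + u \<noteq> 0"
    using u(2) norm_triangle_ineq2[of 1 "- u"] by auto
  have ez: "z = of_nat (Suc k) * u"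
    by (simp add: u_def del: of_nat_Suc)
  have "barnes_factor k z = exp (of_nat (Suc k) * Ln (1 + u)) * exp (z\<^sup>2 / (2 * of_nat (Suc k)) - z)"
    using nz by (simp add: barnes_factor_def u_def[symmetric] exp_of_nat_mult del: of_nat_Suc)
  also have "\<dots> = exp \<delta>"
    unfolding exp_add[symmetric] \<delta>_def
    by (rule arg_cong[where f = exp]) (simp add: ez power2_eq_square field_simps del: of_nat_Suc)
  finally have bf: "barnes_factor k z = exp \<delta>" .
  have "norm (Ln (1 + u) - (u - u\<^sup>2 / 2)) \<le> 8 * norm u ^ 3"
    by (rule Ln_quadratic_bound) (rule u(2))
  then have "norm \<delta> \<le> ?n * (8 * norm u ^ 3)"
    unfolding \<delta>_def norm_mult norm_of_nat by (intro mult_left_mono) auto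
  also have "\<dots> \<le> ?n * (8 * (R / ?n) ^ 3)"
    using u(1) by (intro mult_left_mono power_mono) auto
  also have "\<dots> = 8 * R ^ 3 / ?n\<^sup>2"
    by (simp add: power3_eq_cube power2_eq_square field_simps del: of_nat_Suc)
  finally have d: "norm \<delta> \<le> 8 * R ^ 3 / ?n\<^sup>2" .
  also have "\<dots> \<le> 8 * R ^ 3 / ?n"
    using R0 by (intro divide_left_mono) (auto simp: power2_eq_square intro!: mult_pos_pos)
  also have "\<dots> \<le> 1 / 2"
    using k(2) by (simp add: field_simps)
  finally have "norm \<delta> \<le> 1 / 2" .
  then have "norm (exp \<delta> - 1) \<le> 3 / 2 * norm \<delta>"
    by (rule norm_exp_bounds)
  with d show ?thesis
    unfolding bf by simp
qed

definition barnes_prod :: "complex \<Rightarrow> complex" where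
  "barnes_prod z = (\<Prod>k. barnes_factor k z)"

lemma barnes_G_eq:
  "barnes_G (1 + z) = of_real (2 * pi) powr (z / 2) * exp (- (z + (1 + euler_mascheroni) * z\<^sup>2) / 2) * barnes_prod z"
  by (simp add: barnes_G_def barnes_prod_def barnes_factor_def Let_def del: of_nat_Suc)

lemma barnes_factor_bound_eventually:
  assumes R: "R \<ge> 0"
  shows "\<forall>\<^sub>F k in sequentially. \<forall>z\<in>cball 0 R. norm (barnes_factor k z - 1) \<le> 12 * R ^ 3 * inverse ((real (Suc k))\<^sup>2)"
proof -
  have "\<forall>\<^sub>F k in sequentially. real (Suc k) \<ge> c" for c
    by real_asymp
  from this[of "2 * R"] this[of "16 * R ^ 3"] show ?thesis
    by eventually_elim (use barnes_factor_bound R in \<open>auto simp: divide_inverse simp del: of_nat_Suc\<close>)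
qed

lemma summable_inverse_squares: "summable (\<lambda>k. c * inverse ((real (Suc k))\<^sup>2))"
proof -
  have "summable (\<lambda>k. inverse (real k ^ 2))"
    by (rule inverse_power_summable) simp
  then show ?thesis
    by (subst (asm) summable_Suc_iff[symmetric]) (rule summable_mult)
qed

lemma convergent_prod_barnes_factor: "convergent_prod (\<lambda>k. barnes_factor k z)"
proof (rule abs_convergent_prod_imp_convergent_prod)
  have "summable (\<lambda>k. norm (barnes_factor k z - 1))"
  proof (rule summable_comparison_test_ev[OF _ summable_inverse_squares])
    show "\<forall>\<^sub>F k in sequentially. norm (norm (barnes_factor k z - 1)) \<le> 12 * norm z ^ 3 * inverse ((real (Suc k))\<^sup>2)"
      using barnes_factor_bound_eventually[of "norm z"] by (auto elim!: eventually_mono simp del: of_nat_Suc)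
  qed
  then show "abs_convergent_prod (\<lambda>k. barnes_factor k z)"
    by (rule summable_imp_abs_convergent_prod)
qed

lemma continuous_on_barnes_factor: "continuous_on A (barnes_factor k)"
  unfolding barnes_factor_def by (intro continuous_intros) (auto simp del: of_nat_Suc)

text \<open>The M-test for the deviations from \<open>1\<close> gives uniform convergence of the
  products to some limit, which is identified pointwise.\<close>

lemma uniform_limit_barnes_prod:
  assumes R: "R \<ge> 0"
  shows "uniform_limit (cball 0 R) (\<lambda>m z. \<Prod>k<m. barnes_factor k z) barnes_prod sequentially"
proof -
  have "uniform_limit (cball 0 R) (\<lambda>m z. \<Sum>k<m. norm (barnes_factor k z - 1))
      (\<lambda>z. \<Sum>k. norm (barnes_factor k z - 1)) sequentially"
  proof (rule Weierstrass_m_test_ev[OF _ summable_inverse_squares])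
    show "\<forall>\<^sub>F k in sequentially. \<forall>z\<in>cball 0 R. norm (norm (barnes_factor k z - 1)) \<le> 12 * R ^ 3 * inverse ((real (Suc k))\<^sup>2)"
      using barnes_factor_bound_eventually[OF R] by simp
  qed
  then have "uniformly_convergent_on (cball 0 R) (\<lambda>m z. \<Sum>k<m. norm (barnes_factor k z - 1))"
    by (rule uniformly_convergentI)
  then have "uniformly_convergent_on (cball 0 R) (\<lambda>m z. \<Prod>k<m. barnes_factor k z)"
    by (intro uniformly_convergent_on_prod' continuous_on_barnes_factor compact_cball)
  then have "uniform_limit (cball 0 R) (\<lambda>m z. \<Prod>k<m. barnes_factor k z) (\<lambda>z. lim (\<lambda>m. \<Prod>k<m. barnes_factor k z)) sequentially"
    unfolding uniformly_convergent_uniform_limit_iff .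
  moreover have "lim (\<lambda>m. \<Prod>k<m. barnes_factor k z) = barnes_prod z" for z
    using convergent_prod_LIMSEQ[OF convergent_prod_barnes_factor[of z]]
    unfolding LIMSEQ_lessThan_iff_atMost[symmetric] barnes_prod_def by (rule limI)
  ultimately show ?thesis by simp
qed

lemma barnes_prod_nonzero:
  assumes "\<And>k. z \<noteq> - of_nat (Suc k)"
  shows "barnes_prod z \<noteq> 0"
  unfolding barnes_prod_def
proof (rule prodinf_nonzero[OF convergent_prod_barnes_factor])
  fix k
  have "1 + z / of_nat (Suc k) \<noteq> 0"
  proof
    assume "1 + z / of_nat (Suc k) = 0"
    then have "z / of_nat (Suc k) = - 1"
      by (simp only: eq_neg_iff_add_eq_0 add.commute)
    then have "z = - 1 * of_nat (Suc k)"
      by (simp only: nonzero_divide_eq_eq of_nat_eq_0_iff nat.distinct simp_thms)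
    then show False
      using assms[of k] by simp
  qed
  then show "barnes_factor k z \<noteq> 0"
    by (simp add: barnes_factor_def del: of_nat_Suc)
qed

lemma holomorphic_barnes_prod: "barnes_prod holomorphic_on UNIV"
proof (rule holomorphic_uniform_sequence)
  show "(\<lambda>z. \<Prod>k<m. barnes_factor k z) holomorphic_on UNIV" for m
    unfolding barnes_factor_def by (intro holomorphic_intros) (auto simp del: of_nat_Suc)
  fix z :: complex
  have "cball z 1 \<subseteq> cball 0 (norm z + 1)"
    by (rule cball_subset_cball_iff[THEN iffD2]) (simp add: dist_norm)
  then have "uniform_limit (cball z 1) (\<lambda>m z. \<Prod>k<m. barnes_factor k z) barnes_prod sequentially"
    by (rule uniform_limit_on_subset[OF uniform_limit_barnes_prod, rotated]) simp
  then show "\<exists>d>0. cball z d \<subseteq> UNIV \<and> uniform_limit (cball z d) (\<lambda>m z. \<Prod>k<m. barnes_factor k z) barnes_prod sequentially"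
    by (intro exI[of _ 1]) auto
qed simp

text \<open>The convergence factors of \<open>m - 1\<close> Weierstrass factors collect into one
  exponential; its harmonic number is what later yields Euler's constant.\<close>

lemma prod_one_plus_eq_barnes:
  fixes w :: complex
  assumes m: "m \<ge> 1"
  shows "(\<Prod>k=1..<m. (1 + w / of_nat k) ^ k) =
    (\<Prod>k<m - 1. barnes_factor k w) * exp (- (w\<^sup>2 * harm (m - 1) / 2 - of_nat (m - 1) * w))"
proof -
  have *: "(\<Prod>k=1..<Suc j. (1 + w / of_nat k) ^ k) =
      (\<Prod>k<j. barnes_factor k w) * exp (- (w\<^sup>2 * harm j / 2 - of_nat j * w))" for j
  proof (induction j)
    case (Suc j)
    have "barnes_factor j w * exp (- (w\<^sup>2 * harm (Suc j) / 2 - of_nat (Suc j) * w)) =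
        (1 + w / of_nat (Suc j)) ^ Suc j * exp (w\<^sup>2 / (2 * of_nat (Suc j)) - w - (w\<^sup>2 * harm (Suc j) / 2 - of_nat (Suc j) * w))"
      by (simp only: barnes_factor_def mult.assoc exp_add[symmetric] diff_conv_add_uminus)
    also have "w\<^sup>2 / (2 * of_nat (Suc j)) - w - (w\<^sup>2 * harm (Suc j) / 2 - of_nat (Suc j) * w) =
        - (w\<^sup>2 * harm j / 2 - of_nat j * w)"
      unfolding harm_Suc by (simp only: divide_inverse inverse_mult_distrib of_nat_Suc) (simp add: algebra_simps)
    finally have eq: "barnes_factor j w * exp (- (w\<^sup>2 * harm (Suc j) / 2 - of_nat (Suc j) * w)) =
        (1 + w / of_nat (Suc j)) ^ Suc j * exp (- (w\<^sup>2 * harm j / 2 - of_nat j * w))" .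
    have "(\<Prod>k=1..<Suc (Suc j). (1 + w / of_nat k) ^ k) =
        (\<Prod>k=1..<Suc j. (1 + w / of_nat k) ^ k) * (1 + w / of_nat (Suc j)) ^ Suc j"
      by (rule prod.atLeastLessThan_Suc) simp
    then show ?case
      unfolding Suc prod.lessThan_Suc by (simp only: mult.assoc eq) (simp only: mult_ac)
  qed (simp add: harm_def)
  from *[of "m - 1"] m show ?thesis by simp
qed

section \<open>Gamma products in terms of Barnes factors\<close>

definition lnGamma_expansion :: "real \<Rightarrow> complex \<Rightarrow> complex" where
  "lnGamma_expansion x w = w * of_real (ln x) + w * (w - 1) / of_real (2 * x) + lnGamma_error x w"

lemma prod_Gamma_exp:
  fixes w :: complex
  assumes w: "\<And>k. k \<ge> 1 \<Longrightarrow> w \<noteq> - of_nat k" and m: "m \<ge> 4" and wm: "norm w \<le> real m / 2"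
  shows "(\<Prod>i=1..m. Gamma (of_nat i + w) / Gamma (of_nat i)) =
    exp (of_nat m * lnGamma_expansion (real m) w + w\<^sup>2 * harm (m - 1) / 2 - of_nat (m - 1) * w) / (\<Prod>k<m - 1. barnes_factor k w)"
proof -
  have "Gamma (of_nat m + w) / Gamma (of_nat m) = exp (lnGamma_expansion (real m) w)"
    using Gamma_ratio_exp[of "real m" w] m wm by (simp add: lnGamma_expansion_def)
  then have "(Gamma (of_nat m + w) / Gamma (of_nat m)) ^ m = exp (of_nat m * lnGamma_expansion (real m) w)"
    by (simp add: exp_of_nat_mult)
  moreover have "exp (of_nat m * lnGamma_expansion (real m) w + w\<^sup>2 * harm (m - 1) / 2 - of_nat (m - 1) * w) =
      exp (of_nat m * lnGamma_expansion (real m) w) / exp (- (w\<^sup>2 * harm (m - 1) / 2 - of_nat (m - 1) * w))"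
    by (simp add: exp_diff[symmetric] algebra_simps)
  ultimately show ?thesis
    using m by (simp only: prod_Gamma_eq[OF w] prod_one_plus_eq_barnes) (simp add: mult_ac prod_Gamma_eq[OF w] prod_one_plus_eq_barnes)
qed

text \<open>For \<open>j = 2 i\<close> the denominator is \<open>Gamma i\<close>. For
  \<open>j = 2 i - 1\<close> it is \<open>Gamma (i - 1 / 2)\<close>, which is normalised by a third
  product at \<open>w = - 1 / 2\<close>; this one, free of \<open>t\<close>, is the source of
  \<open>G (1 / 2)\<close>.\<close>

lemma prod_Gamma_half:
  fixes t :: complex
  shows "(\<Prod>j=1..n. Gamma ((of_nat j + t) / 2) / Gamma (of_nat j / 2)) =
    (\<Prod>i=1..n div 2. Gamma (of_nat i + t / 2) / Gamma (of_nat i)) *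
    ((\<Prod>i=1..Suc n div 2. Gamma (of_nat i + (t / 2 - 1 / 2)) / Gamma (of_nat i)) /
     (\<Prod>i=1..Suc n div 2. Gamma (of_nat i + (- 1 / 2)) / Gamma (of_nat i)))"
proof (induction n)
  case (Suc n)
  let ?g = "\<lambda>i w. Gamma (of_nat i + w) / Gamma (of_nat i :: complex)"
  have nz: "Gamma (of_nat (Suc i) :: complex) \<noteq> 0" for i
    using not_nonpos_Ints_Re[of "of_nat (Suc i)"] by (simp add: Gamma_eq_zero_iff del: of_nat_Suc)
  show ?case
  proof (cases "even n")
    case True
    then obtain q where n: "n = 2 * q" by (elim evenE)
    have d: "Suc n div 2 = q" "Suc (Suc n) div 2 = Suc q" "n div 2 = q" using n by auto
    have a: "(of_nat (Suc n) + t) / 2 = of_nat (Suc q) + (t / 2 - 1 / 2)"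
      "of_nat (Suc n) / 2 = of_nat (Suc q) + (- 1 / 2 :: complex)"
      by (simp_all add: n field_simps)
    have "Gamma ((of_nat (Suc n) + t) / 2) / Gamma (of_nat (Suc n) / 2) = ?g (Suc q) (t / 2 - 1 / 2) / ?g (Suc q) (- 1 / 2)"
      unfolding a using nz[of q] by (simp del: of_nat_Suc)
    then show ?thesis
      using Suc unfolding d prod.cl_ivl_Suc by (simp del: of_nat_Suc)
  next
    case False
    then obtain q where n: "n = 2 * q + 1" by (elim oddE)
    have d: "Suc n div 2 = Suc q" "Suc (Suc n) div 2 = Suc q" "n div 2 = q" using n by auto
    have a: "(of_nat (Suc n) + t) / 2 = of_nat (Suc q) + t / 2"
      "of_nat (Suc n) / 2 = (of_nat (Suc q) :: complex)"
      by (simp_all add: n field_simps)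
    have e: "(\<Prod>i=1..Suc q. ?g i (t / 2)) = (\<Prod>i=1..q. ?g i (t / 2)) * ?g (Suc q) (t / 2)"
      by simp
    have o: "(\<Prod>j=1..Suc n. f j) = (\<Prod>j=1..n. f j) * f (Suc n)" for f :: "nat \<Rightarrow> complex"
      by simp
    show ?thesis
      unfolding o Suc[unfolded d] d e a by (simp only: mult_ac)
  qed
qed simp

subsection \<open>Asymptotics of the moments\<close>

text \<open>Denominators depending on \<open>t\<close> are written with the entire function
  \<open>rGamma\<close>, so that their poles become zeros of the formula.\<close>

definition moment_complex :: "nat \<Rightarrow> real \<Rightarrow> complex \<Rightarrow> complex" where
  "moment_complex n \<nu> t =
     (\<Prod>j=1..n. Gamma ((of_nat j + t) / 2) / Gamma (of_nat j / 2)) *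
     (Gamma (of_real ((real n + \<nu>) / 2)) * rGamma (of_real ((real n + \<nu>) / 2) + t / 2)) ^ Suc n *
     (Gamma (of_real (((real n + 1) * (real n + \<nu>) - 2 * real n) / 2) + of_nat (Suc n) * (t / 2)) *
      rGamma (of_real (((real n + 1) * (real n + \<nu>) - 2 * real n) / 2) + of_nat n * (t / 2)))"

text \<open>The coefficient of \<open>t / 2\<close> in the logarithm of the centred and normalised
  moment. \<open>q\<close> and \<open>p\<close> count the even and odd indices up to
  \<open>n\<close>; \<open>a\<close> and \<open>A\<close> are the arguments of the remaining Gamma
  factors at \<open>t = 0\<close>.\<close>

definition linear_coeff :: "real \<Rightarrow> nat \<Rightarrow> real" where
  "linear_coeff \<nu> n = (let q = n div 2; p = Suc n div 2; a = (real n + \<nu>) / 2;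
     A = ((real n + 1) * (real n + \<nu>) - 2 * real n) / 2 in
     real q * ln (real q) - 1 / 2 - (real q - 1) + real p * ln (real p) - 1 - harm (p - 1) / 2 - (real p - 1)
     - (real n + 1) * ln a + (real n + 1) * (1 / (2 * a)) + ln A - 1 / (2 * A) - 2 * centering \<nu> n)"

text \<open>The coefficient of \<open>(t / 2)^2\<close> in the same logarithm. One unit of the
  constant \<open>2\<close> comes from the \<open>- 1\<close> in the normalisation
  \<open>ln (n / 2) - 1\<close>.\<close>

definition quadratic_coeff :: "real \<Rightarrow> nat \<Rightarrow> real" where
  "quadratic_coeff \<nu> n = (let q = n div 2; p = Suc n div 2; a = (real n + \<nu>) / 2;
     A = ((real n + 1) * (real n + \<nu>) - 2 * real n) / 2 in
     2 + harm (q - 1) / 2 + harm (p - 1) / 2 - (real n + 1) * (1 / (2 * a))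
     + (2 * real n + 1) * (1 / (2 * A)) - ln (real n / 2))"

definition total_error :: "real \<Rightarrow> nat \<Rightarrow> complex \<Rightarrow> complex" where
  "total_error \<nu> n z = (let q = n div 2; p = Suc n div 2; a = (real n + \<nu>) / 2;
     A = ((real n + 1) * (real n + \<nu>) - 2 * real n) / 2 in
     of_nat q * lnGamma_error (real q) z
     + of_nat p * lnGamma_error (real p) (z - 1 / 2) - of_nat p * lnGamma_error (real p) (- 1 / 2)
     - (of_nat n + 1) * lnGamma_error a z
     + lnGamma_error A (of_nat (Suc n) * z) - lnGamma_error A (of_nat n * z))"

text \<open>Logarithms, harmonic numbers and error terms are abstracted to free variables, which
  makes collecting powers of \<open>z\<close> a polynomial identity. The weight
  \<open>2 * N + 1\<close> is \<open>(N + 1)^2 - N^2\<close>.\<close>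

lemma exponent_identity:
  fixes q p N z :: complex
  shows "(q * (z * lq) + z * (z - 1) / 2 + q * e1) + z\<^sup>2 * hq / 2 - (q - 1) * z
    + ((p * ((z - 1 / 2) * lp) + (z - 1 / 2) * (z - 1 / 2 - 1) / 2 + p * e2) + (z - 1 / 2)\<^sup>2 * hp / 2 - (p - 1) * (z - 1 / 2))
    - ((p * ((- 1 / 2) * lp) + (- 1 / 2) * (- 1 / 2 - 1) / 2 + p * e3) + (- 1 / 2)\<^sup>2 * hp / 2 - (p - 1) * (- 1 / 2))
    - (N + 1) * (z * la + z * (z - 1) * ia + e4)
    + ((N + 1) * z * lA + (N + 1) * z * ((N + 1) * z - 1) * iA + e5)
    - (N * z * lA + N * z * (N * z - 1) * iA + e6)
    - 2 * z * c - z\<^sup>2 * (l - 1)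
    = (q * lq - 1 / 2 - (q - 1) + p * lp - 1 - hp / 2 - (p - 1) - (N + 1) * la + (N + 1) * ia + lA - iA - 2 * c) * z
    + (2 + hq / 2 + hp / 2 - (N + 1) * ia + (2 * N + 1) * iA - l) * z\<^sup>2
    + (q * e1 + p * e2 - p * e3 - (N + 1) * e4 + e5 - e6)"
  by (simp add: field_simps power2_eq_square)

lemma mult_lnGamma_expansion:
  assumes "x \<noteq> 0"
  shows "of_real x * lnGamma_expansion x w = of_real x * (w * of_real (ln x)) + w * (w - 1) / 2 + of_real x * lnGamma_error x w"
  using assms by (simp add: lnGamma_expansion_def distrib_left)

text \<open>An exact identity for large \<open>n\<close>, with no limit taken. The size conditions
  keep every shift within half of its Gamma argument, where the expansion of
  \<open>ln \<Gamma>\<close> applies.\<close>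

lemma moment_quotient_eq:
  fixes t :: complex
  assumes t: "\<And>k. k \<ge> 1 \<Longrightarrow> t \<noteq> - of_nat k"
  assumes R: "norm (t / 2) \<le> R" and \<nu>: "\<nu> \<ge> 0"
  assumes n: "n \<ge> 10" "real n / 2 - 1 \<ge> 2 * (R + 1)"
  assumes A: "((real n + 1) * (real n + \<nu>) - 2 * real n) / 2 \<ge> 4"
    "((real n + 1) * (real n + \<nu>) - 2 * real n) / 2 \<ge> 2 * (real n + 1) * R"
  shows "exp (- (t * of_real (centering \<nu> n))) * moment_complex n \<nu> t / exp (t\<^sup>2 / 4 * of_real (ln (real n / 2) - 1)) =
    exp (of_real (linear_coeff \<nu> n) * (t / 2) + of_real (quadratic_coeff \<nu> n) * (t / 2)\<^sup>2 + total_error \<nu> n (t / 2)) *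
    ((\<Prod>k<Suc n div 2 - 1. barnes_factor k (- 1 / 2)) /
     ((\<Prod>k<n div 2 - 1. barnes_factor k (t / 2)) * (\<Prod>k<Suc n div 2 - 1. barnes_factor k (t / 2 - 1 / 2))))"
proof -
  define z where "z = t / 2"
  define q p a A where "q = n div 2" and "p = Suc n div 2" and "a = (real n + \<nu>) / 2"
    and "A = ((real n + 1) * (real n + \<nu>) - 2 * real n) / 2"
  note defs = q_def p_def a_def A_def
  have R0: "R \<ge> 0" using R norm_ge_zero order_trans by blast
  have q4: "q \<ge> 4" "p \<ge> 4" using n(1) by (auto simp: q_def p_def)
  have "real q \<ge> real n / 2 - 1" "real p \<ge> real n / 2"
    by (auto simp: q_def p_def)
  then have qR: "real q / 2 \<ge> R + 1" "real p / 2 \<ge> R + 1" using n(2) by auto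
  have a4: "a \<ge> 4" "a / 2 \<ge> R" using n \<nu> by (auto simp: a_def)
  have A4: "A \<ge> 4" using A(1) unfolding A_def .
  have A5: "A / 2 \<ge> (real n + 1) * R"
    using A(2)[folded A_def] by (simp only: mult.assoc)
  have nz: "norm z \<le> R" using R by (simp add: z_def)
  have nz': "norm (z - 1 / 2) \<le> R + 1"
    using norm_triangle_ineq4[of z "1 / 2"] nz by simp
  \<comment> \<open>The even negative integers are the singular values of \<open>t\<close> for the
    product over even indices, the odd ones for the product over odd indices.\<close>
  have zq: "z \<noteq> - of_nat k" if "k \<ge> 1" for k
    using t[of "2 * k"] that by (auto simp: z_def)
  have zp: "z - 1 / 2 \<noteq> - of_nat k" if "k \<ge> 1" for k
  proof
    assume "z - 1 / 2 = - of_nat k"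
    then have "t = 1 - 2 * of_nat k" by (simp add: z_def field_simps)
    also have "\<dots> = - of_nat (2 * k - 1)" using that by (simp add: of_nat_diff)
    finally have *: "t = - of_nat (2 * k - 1)" .
    have "2 * k - 1 \<ge> 1" using that by linarith
    from t[OF this] * show False by contradiction
  qed
  have zh: "- 1 / 2 \<noteq> (- of_nat k :: complex)" for k :: nat
  proof
    assume "- 1 / 2 = (- of_nat k :: complex)"
    then have "(1 :: complex) = of_nat (2 * k)" by (simp add: field_simps)
    then have "1 = 2 * k" by (metis of_nat_1 of_nat_eq_iff)
    then show False by presburger
  qed
  have Bq: "(\<Prod>i=1..q. Gamma (of_nat i + z) / Gamma (of_nat i)) =
      exp (of_nat q * lnGamma_expansion (real q) z + z\<^sup>2 * harm (q - 1) / 2 - of_nat (q - 1) * z) / (\<Prod>k<q - 1. barnes_factor k z)"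
    using nz qR by (intro prod_Gamma_exp zq q4) auto
  have Bp: "(\<Prod>i=1..p. Gamma (of_nat i + (z - 1 / 2)) / Gamma (of_nat i)) =
      exp (of_nat p * lnGamma_expansion (real p) (z - 1 / 2) + (z - 1 / 2)\<^sup>2 * harm (p - 1) / 2 - of_nat (p - 1) * (z - 1 / 2)) / (\<Prod>k<p - 1. barnes_factor k (z - 1 / 2))"
    using nz' qR by (intro prod_Gamma_exp zp q4) auto
  have Bh: "(\<Prod>i=1..p. Gamma (of_nat i + (- 1 / 2)) / Gamma (of_nat i :: complex)) =
      exp (of_nat p * lnGamma_expansion (real p) (- 1 / 2) + (- 1 / 2)\<^sup>2 * harm (p - 1) / 2 - of_nat (p - 1) * (- 1 / 2)) / (\<Prod>k<p - 1. barnes_factor k (- 1 / 2))"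
    using R0 qR by (intro prod_Gamma_exp zh q4) auto
  have Ga: "Gamma (of_real a) * rGamma (of_real a + z) = exp (- lnGamma_expansion a z)"
  proof -
    have "exp (- lnGamma_expansion a z) = inverse (Gamma (of_real a + z) / Gamma (of_real a))"
      unfolding exp_minus lnGamma_expansion_def by (subst Gamma_ratio_exp) (use a4 nz in auto)
    then show ?thesis
      by (simp add: rGamma_inverse_Gamma divide_inverse)
  qed
  have AG: "Gamma (of_real A + of_nat (Suc n) * z) * rGamma (of_real A + of_nat n * z) =
      exp (lnGamma_expansion A (of_nat (Suc n) * z) - lnGamma_expansion A (of_nat n * z))"
  proof -
    \<comment> \<open>The shift grows like \<open>n\<close>, but \<open>A\<close> grows like
      \<open>n^2\<close>.\<close>
    have n1: "norm (of_nat (Suc n) * z) \<le> A / 2"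
    proof -
      have "norm (of_nat (Suc n) * z) = (real n + 1) * norm z"
        unfolding norm_mult norm_of_nat by simp
      also have "\<dots> \<le> (real n + 1) * R" using nz by (intro mult_left_mono) auto
      finally show ?thesis using A5 by simp
    qed
    have n2: "norm (of_nat n * z) \<le> A / 2"
    proof -
      have "norm (of_nat n * z) \<le> norm (of_nat (Suc n) * z)"
        unfolding norm_mult norm_of_nat by (intro mult_right_mono) auto
      with n1 show ?thesis by simp
    qed
    have "Gamma (of_real A) \<noteq> (0 :: complex)"
      using A4 by (simp add: Gamma_eq_zero_iff not_nonpos_Ints_Re)
    then have "Gamma (of_real A + of_nat (Suc n) * z) * rGamma (of_real A + of_nat n * z) =
      (Gamma (of_real A + of_nat (Suc n) * z) / Gamma (of_real A)) / (Gamma (of_real A + of_nat n * z) / Gamma (of_real A))"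
      by (simp add: rGamma_inverse_Gamma divide_inverse del: of_nat_Suc)
    also have "\<dots> = exp (lnGamma_expansion A (of_nat (Suc n) * z)) / exp (lnGamma_expansion A (of_nat n * z))"
      unfolding Gamma_ratio_exp[OF A4 n1] Gamma_ratio_exp[OF A4 n2] lnGamma_expansion_def ..
    finally show ?thesis by (simp only: exp_diff)
  qed
  define Eq where "Eq = of_nat q * lnGamma_expansion (real q) z + z\<^sup>2 * harm (q - 1) / 2 - of_nat (q - 1) * z"
  define Ep where "Ep = of_nat p * lnGamma_expansion (real p) (z - 1 / 2) + (z - 1 / 2)\<^sup>2 * harm (p - 1) / 2 - of_nat (p - 1) * (z - 1 / 2)"
  define Eh :: complex where "Eh = of_nat p * lnGamma_expansion (real p) (- 1 / 2) + (- 1 / 2)\<^sup>2 * harm (p - 1) / 2 - of_nat (p - 1) * (- 1 / 2)"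
  define Ea where "Ea = lnGamma_expansion a z"
  define EA where "EA = lnGamma_expansion A (of_nat (Suc n) * z)"
  define EB where "EB = lnGamma_expansion A (of_nat n * z)"
  define Pq Pp Ph where "Pq = (\<Prod>k<q - 1. barnes_factor k z)" and "Pp = (\<Prod>k<p - 1. barnes_factor k (z - 1 / 2))"
    and "Ph = (\<Prod>k<p - 1. barnes_factor k (- 1 / 2))"
  have "moment_complex n \<nu> t = (exp Eq / Pq) * ((exp Ep / Pp) / (exp Eh / Ph)) * exp (- Ea) ^ Suc n * exp (EA - EB)"
    unfolding moment_complex_def prod_Gamma_half z_def[symmetric] defs[symmetric] Bq Bp Bh Ga AG
      Eq_def[symmetric] Ep_def[symmetric] Eh_def[symmetric] Ea_def[symmetric] EA_def[symmetric] EB_def[symmetric]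
      Pq_def[symmetric] Pp_def[symmetric] Ph_def[symmetric] ..
  also have "exp (- Ea) ^ Suc n = exp (- ((of_nat n + 1) * Ea))"
    by (subst exp_of_nat_mult[symmetric]) (simp add: algebra_simps)
  also have "(exp Eq / Pq) * ((exp Ep / Pp) / (exp Eh / Ph)) * exp (- ((of_nat n + 1) * Ea)) * exp (EA - EB) =
      exp (Eq + Ep - Eh - (of_nat n + 1) * Ea + EA - EB) * (Ph / (Pq * Pp))"
    by (simp add: exp_add exp_diff exp_minus divide_inverse mult_ac)
  finally have mc: "moment_complex n \<nu> t = exp (Eq + Ep - Eh - (of_nat n + 1) * Ea + EA - EB) * (Ph / (Pq * Pp))" .
  have "exp (- (t * of_real (centering \<nu> n))) * moment_complex n \<nu> t / exp (t\<^sup>2 / 4 * of_real (ln (real n / 2) - 1)) =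
      exp (Eq + Ep - Eh - (of_nat n + 1) * Ea + EA - EB - 2 * z * of_real (centering \<nu> n) - z\<^sup>2 * (of_real (ln (real n / 2)) - 1)) * (Ph / (Pq * Pp))"
  proof -
    have e: "exp (- u) * (exp v * X) / exp w = exp (v - u - w) * X" for u v w X :: complex
      by (simp add: exp_diff exp_minus divide_inverse mult_ac)
    have "t * of_real (centering \<nu> n) = 2 * z * of_real (centering \<nu> n)"
      "t\<^sup>2 / 4 * of_real (ln (real n / 2) - 1) = z\<^sup>2 * (of_real (ln (real n / 2)) - 1)"
      by (simp_all add: z_def power_divide)
    then show ?thesis unfolding mc by (simp only: e)
  qed
  also have "Eq + Ep - Eh - (of_nat n + 1) * Ea + EA - EB - 2 * z * of_real (centering \<nu> n) - z\<^sup>2 * (of_real (ln (real n / 2)) - 1) =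
      of_real (linear_coeff \<nu> n) * z + of_real (quadratic_coeff \<nu> n) * z\<^sup>2 + total_error \<nu> n z"
  proof -
    have q1: "of_nat (q - 1) = (of_nat q - 1 :: complex)" "of_nat (p - 1) = (of_nat p - 1 :: complex)"
      using q4 by (simp_all add: of_nat_diff)
    have m: "of_nat k * lnGamma_expansion (real k) w = of_nat k * (w * of_real (ln (real k))) + w * (w - 1) / 2 + of_nat k * lnGamma_error (real k) w"
      if "k \<ge> 4" for k :: nat and w
      using mult_lnGamma_expansion[of "real k" w] that by simp
    have l: "complex_of_real (linear_coeff \<nu> n) = of_nat q * of_real (ln (real q)) - 1 / 2 - (of_nat q - 1)
        + of_nat p * of_real (ln (real p)) - 1 - harm (p - 1) / 2 - (of_nat p - 1)
        - (of_nat n + 1) * of_real (ln a) + (of_nat n + 1) * of_real (1 / (2 * a)) + of_real (ln A) - of_real (1 / (2 * A)) - 2 * of_real (centering \<nu> n)"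
      unfolding linear_coeff_def Let_def defs[symmetric]
      by (simp only: of_real_add of_real_diff of_real_mult of_real_harm of_real_of_nat_eq of_real_1 of_real_divide[of 1 2] of_real_divide[of "harm _"] of_real_numeral)
    have qc: "complex_of_real (quadratic_coeff \<nu> n) = 2 + harm (q - 1) / 2 + harm (p - 1) / 2
        - (of_nat n + 1) * of_real (1 / (2 * a)) + (2 * of_nat n + 1) * of_real (1 / (2 * A)) - of_real (ln (real n / 2))"
      unfolding quadratic_coeff_def Let_def defs[symmetric]
      by (simp only: of_real_add of_real_diff of_real_mult of_real_harm of_real_of_nat_eq of_real_1 of_real_divide[of "harm _"] of_real_numeral)
    have e: "lnGamma_expansion x w = w * of_real (ln x) + w * (w - 1) * of_real (1 / (2 * x)) + lnGamma_error x w" for x w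
      by (simp add: lnGamma_expansion_def)
    show ?thesis
      unfolding Eq_def Ep_def Eh_def Ea_def EA_def EB_def m[OF q4(1)] m[OF q4(2)] q1 l qc e[of a] e[of A]
        total_error_def Let_def defs[symmetric]
      using exponent_identity[of "of_nat q" z "of_real (ln (real q))" "lnGamma_error (real q) z" "harm (q - 1)"
          "of_nat p" "of_real (ln (real p))" "lnGamma_error (real p) (z - 1 / 2)" "harm (p - 1)"
          "lnGamma_error (real p) (- 1 / 2)" "of_nat n" "of_real (ln a)" "of_real (1 / (2 * a))" "lnGamma_error a z"
          "of_real (ln A)" "of_real (1 / (2 * A))" "lnGamma_error A (of_nat (Suc n) * z)" "lnGamma_error A (of_nat n * z)"
          "of_real (centering \<nu> n)" "of_real (ln (real n / 2))"]
      by (simp only: of_nat_Suc add_ac)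
  qed
  finally show ?thesis
    unfolding z_def q_def p_def Pq_def Pp_def Ph_def .
qed

section \<open>Limits of the coefficients and of the error\<close>

lemma centering_eq: "2 * centering \<nu> n = ln (real n) / 2 - real n + 1 - \<nu> + 3 / 2 * ln 2 + ln pi"
  by (simp add: centering_def ln_mult_pos ln_powr field_simps)

lemma harm_pred: "m \<ge> 1 \<Longrightarrow> harm (m - 1) = (harm m - 1 / real m :: real)"
  using harm_Suc[of "m - 1", where 'a = real] by (simp add: inverse_eq_divide)

lemma filterlim_half:
  "filterlim (\<lambda>n :: nat. n div 2) sequentially sequentially"
  "filterlim (\<lambda>n :: nat. Suc n div 2) sequentially sequentially"
proof -
  show *: "filterlim (\<lambda>n :: nat. n div 2) sequentially sequentially"
    by (rule filterlim_at_top_div_const_nat) simp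
  show "filterlim (\<lambda>n :: nat. Suc n div 2) sequentially sequentially"
    by (rule filterlim_compose[OF * filterlim_Suc])
qed

lemma tendsto_harm_half:
  "(\<lambda>n. harm (n div 2) - ln (real (n div 2)) :: real) \<longlonglongrightarrow> euler_mascheroni"
  "(\<lambda>n. harm (Suc n div 2) - ln (real (Suc n div 2)) :: real) \<longlonglongrightarrow> euler_mascheroni"
  by (rule filterlim_compose[OF euler_mascheroni_LIMSEQ filterlim_half(1)]
      filterlim_compose[OF euler_mascheroni_LIMSEQ filterlim_half(2)])+

text \<open>The centering cancels the divergent terms and the dependence on \<open>\<nu>\<close>.
  Only the odd indices carry a harmonic number here, since
  \<open>(z - 1 / 2)^2 - 1 / 4 = z^2 - z\<close>, and it contributes
  \<open>- euler_mascheroni / 2\<close>.\<close>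

lemma tendsto_linear_coeff:
  assumes \<nu>: "\<nu> \<ge> 0"
  shows "linear_coeff \<nu> \<longlonglongrightarrow> - ln (2 * pi) + 1 / 2 - euler_mascheroni / 2"
proof -
  \<comment> \<open>The coefficient with the harmonic number replaced by a logarithm, as a function
    of real arguments; for each parity of \<open>n\<close> its limit is elementary.\<close>
  let ?f = "\<lambda>(q :: real) (p :: real) (x :: real).
     q * ln q + p * ln p - q - p + 1 / 2 - ln p / 2 + 1 / (2 * p)
     - (x + 1) * ln ((x + \<nu>) / 2) + (x + 1) * (1 / (2 * ((x + \<nu>) / 2)))
     + ln (((x + 1) * (x + \<nu>) - 2 * x) / 2) - 1 / (2 * (((x + 1) * (x + \<nu>) - 2 * x) / 2))
     - (ln x / 2 - x + 1 - \<nu> + 3 / 2 * ln 2 + ln pi)"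
  have "(\<lambda>n. ?f (real (n div 2)) (real (Suc n div 2)) (real n)) \<longlonglongrightarrow> - ln 2 - ln pi + 1 / 2"
  proof (rule limseq_even_odd)
    have "(\<lambda>n. ?f (real n) (real n) (2 * real n)) \<longlonglongrightarrow> - ln 2 - ln pi + 1 / 2"
      by (real_asymp; simp add: field_simps)
    then show "(\<lambda>n. ?f (real (2 * n div 2)) (real (Suc (2 * n) div 2)) (real (2 * n))) \<longlonglongrightarrow> - ln 2 - ln pi + 1 / 2"
      by simp
    have "(\<lambda>n. ?f (real n) (real n + 1) (2 * real n + 1)) \<longlonglongrightarrow> - ln 2 - ln pi + 1 / 2"
      by (real_asymp; simp add: field_simps)
    then show "(\<lambda>n. ?f (real ((2 * n + 1) div 2)) (real (Suc (2 * n + 1) div 2)) (real (2 * n + 1))) \<longlonglongrightarrow> - ln 2 - ln pi + 1 / 2"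
      by (simp add: add.commute)
  qed
  then have "(\<lambda>n. ?f (real (n div 2)) (real (Suc n div 2)) (real n) - (harm (Suc n div 2) - ln (real (Suc n div 2))) / 2)
      \<longlonglongrightarrow> (- ln 2 - ln pi + 1 / 2) - euler_mascheroni / 2"
    by (intro tendsto_diff tendsto_divide tendsto_harm_half tendsto_const) auto
  moreover have "\<forall>\<^sub>F n in sequentially. ?f (real (n div 2)) (real (Suc n div 2)) (real n)
      - (harm (Suc n div 2) - ln (real (Suc n div 2))) / 2 = linear_coeff \<nu> n"
    using eventually_ge_at_top[of 1]
  proof eventually_elim
    case (elim n)
    define q p where "q = n div 2" and "p = Suc n div 2"
    have p1: "p \<ge> 1" using elim by (auto simp: p_def)
    show ?case
      unfolding linear_coeff_def Let_def q_def[symmetric] p_def[symmetric] centering_eq harm_pred[OF p1]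
      by (simp add: algebra_simps diff_divide_distrib)
  qed
  ultimately have "linear_coeff \<nu> \<longlonglongrightarrow> (- ln 2 - ln pi + 1 / 2) - euler_mascheroni / 2"
    by (rule Lim_transform_eventually)
  then show ?thesis
    by (simp add: ln_mult_pos algebra_simps)
qed

text \<open>The two harmonic numbers contribute half of Euler's constant each, and their logarithms
  cancel \<open>ln (n / 2)\<close>.\<close>

lemma tendsto_quadratic_coeff:
  assumes \<nu>: "\<nu> \<ge> 0"
  shows "quadratic_coeff \<nu> \<longlonglongrightarrow> 1 + euler_mascheroni"
proof -
  let ?f = "\<lambda>(q :: real) (p :: real) (x :: real).
     2 + ln q / 2 - 1 / (2 * q) + ln p / 2 - 1 / (2 * p) - (x + 1) * (1 / (2 * ((x + \<nu>) / 2)))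
     + (2 * x + 1) * (1 / (2 * (((x + 1) * (x + \<nu>) - 2 * x) / 2))) - ln (x / 2)"
  have "(\<lambda>n. ?f (real (n div 2)) (real (Suc n div 2)) (real n)) \<longlonglongrightarrow> 1"
  proof (rule limseq_even_odd)
    have "(\<lambda>n. ?f (real n) (real n) (2 * real n)) \<longlonglongrightarrow> 1"
      by real_asymp
    then show "(\<lambda>n. ?f (real (2 * n div 2)) (real (Suc (2 * n) div 2)) (real (2 * n))) \<longlonglongrightarrow> 1"
      by simp
    have "(\<lambda>n. ?f (real n) (1 + real n) (1 + 2 * real n)) \<longlonglongrightarrow> 1"
      by real_asymp
    then show "(\<lambda>n. ?f (real ((2 * n + 1) div 2)) (real (Suc (2 * n + 1) div 2)) (real (2 * n + 1))) \<longlonglongrightarrow> 1"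
      by (simp add: add.commute)
  qed
  then have "(\<lambda>n. ?f (real (n div 2)) (real (Suc n div 2)) (real n) + (harm (n div 2) - ln (real (n div 2))) / 2
      + (harm (Suc n div 2) - ln (real (Suc n div 2))) / 2) \<longlonglongrightarrow> 1 + euler_mascheroni / 2 + euler_mascheroni / 2"
    by (intro tendsto_add tendsto_divide tendsto_harm_half tendsto_const) auto
  moreover have "\<forall>\<^sub>F n in sequentially. ?f (real (n div 2)) (real (Suc n div 2)) (real n) + (harm (n div 2) - ln (real (n div 2))) / 2
      + (harm (Suc n div 2) - ln (real (Suc n div 2))) / 2 = quadratic_coeff \<nu> n"
    using eventually_ge_at_top[of 2]
  proof eventually_elim
    case (elim n)
    define q p where "q = n div 2" and "p = Suc n div 2"
    have p1: "p \<ge> 1" "q \<ge> 1" using elim by (auto simp: p_def q_def)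
    show ?case
      unfolding quadratic_coeff_def Let_def q_def[symmetric] p_def[symmetric] harm_pred[OF p1(1)] harm_pred[OF p1(2)]
      by (simp add: algebra_simps diff_divide_distrib)
  qed
  ultimately have "quadratic_coeff \<nu> \<longlonglongrightarrow> 1 + euler_mascheroni / 2 + euler_mascheroni / 2"
    by (rule Lim_transform_eventually)
  then show ?thesis by (simp add: add.commute)
qed

lemma eventually_moment_conditions:
  assumes \<nu>: "\<nu> \<ge> 0"
  shows "\<forall>\<^sub>F n in sequentially. n \<ge> 10 \<and> real n / 2 - 1 \<ge> 2 * (R + 1) \<and>
    ((real n + 1) * (real n + \<nu>) - 2 * real n) / 2 \<ge> 4 \<and>
    ((real n + 1) * (real n + \<nu>) - 2 * real n) / 2 \<ge> 2 * (real n + 1) * R"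
proof (intro eventually_conj)
  show "\<forall>\<^sub>F n in sequentially. (10 :: nat) \<le> n" by (rule eventually_ge_at_top)
  show "\<forall>\<^sub>F n in sequentially. 2 * (R + 1) \<le> real n / 2 - 1" by real_asymp
  show "\<forall>\<^sub>F n in sequentially. 4 \<le> ((real n + 1) * (real n + \<nu>) - 2 * real n) / 2" by real_asymp
  show "\<forall>\<^sub>F n in sequentially. 2 * (real n + 1) * R \<le> ((real n + 1) * (real n + \<nu>) - 2 * real n) / 2" by real_asymp
qed

lemma norm_diff_mono:
  fixes a b :: "'a :: real_normed_vector"
  assumes "norm a \<le> r" "norm b \<le> s"
  shows "norm (a - b) \<le> r + s"
  using assms norm_triangle_ineq4[of a b] by linarith

text \<open>Every term is of order \<open>1 / n\<close>: the errors at \<open>q\<close>,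
  \<open>p\<close> and \<open>a\<close> are inverse squares times a factor of order
  \<open>n\<close>, and for \<open>A\<close> the cube of a shift of order \<open>n\<close> is
  divided by \<open>A^2\<close>, of order \<open>n^4\<close>.\<close>

lemma total_error_bound:
  assumes z: "norm z \<le> R" and \<nu>: "\<nu> \<ge> 0"
  assumes n: "n \<ge> 10" "real n / 2 - 1 \<ge> 2 * (R + 1)"
  assumes A: "((real n + 1) * (real n + \<nu>) - 2 * real n) / 2 \<ge> 4"
    "((real n + 1) * (real n + \<nu>) - 2 * real n) / 2 \<ge> 2 * (real n + 1) * R"
  shows "norm (total_error \<nu> n z) \<le> 50 * (R + 2) ^ 3 * (1 / real (n div 2) + 2 / real (Suc n div 2)
    + (real n + 1) / ((real n + \<nu>) / 2)\<^sup>2 + 2 * (real n + 1) ^ 3 / (((real n + 1) * (real n + \<nu>) - 2 * real n) / 2)\<^sup>2)"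
proof -
  define q p a A where "q = n div 2" and "p = Suc n div 2" and "a = (real n + \<nu>) / 2"
    and "A = ((real n + 1) * (real n + \<nu>) - 2 * real n) / 2"
  note defs = q_def p_def a_def A_def
  have R0: "R \<ge> 0" using z norm_ge_zero order_trans by blast
  have q4: "q \<ge> 4" "p \<ge> 4" using n(1) by (auto simp: q_def p_def)
  have "real q \<ge> real n / 2 - 1" "real p \<ge> real n / 2"
    by (auto simp: q_def p_def)
  then have qR: "real q / 2 \<ge> R + 1" "real p / 2 \<ge> R + 1" using n(2) by auto
  have a4: "a \<ge> 4" "a / 2 \<ge> R" using n \<nu> by (auto simp: a_def)
  have A4: "A \<ge> 4" using A(1) unfolding A_def .
  have A5: "A / 2 \<ge> (real n + 1) * R"
    using A(2)[folded A_def] by (simp only: mult.assoc)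
  have nz': "norm (z - 1 / 2) \<le> R + 1"
    using norm_triangle_ineq4[of z "1 / 2"] z by simp
  let ?C = "50 * (R + 2) ^ 3"
  have err: "norm (lnGamma_error x w) \<le> ?C / x\<^sup>2" if "x \<ge> 4" "norm w \<le> x / 2" "norm w \<le> R + 1" for x w
  proof -
    have "norm (lnGamma_error x w) \<le> 50 * (1 + norm w) ^ 3 / x\<^sup>2"
      by (rule norm_lnGamma_error_le[OF that(1,2)])
    also have "\<dots> \<le> ?C / x\<^sup>2"
      using that by (intro divide_right_mono mult_left_mono power_mono) auto
    finally show ?thesis .
  qed
  have nat: "norm (of_nat k * lnGamma_error (real k) w) \<le> ?C * (1 / real k)" if "k \<ge> 4" "norm w \<le> real k / 2" "norm w \<le> R + 1" for k :: nat and w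
  proof -
    have "norm (of_nat k * lnGamma_error (real k) w) \<le> real k * (?C / (real k)\<^sup>2)"
      unfolding norm_mult norm_of_nat using that by (intro mult_left_mono err) auto
    then show ?thesis using that by (simp add: power2_eq_square)
  qed
  have big: "norm (lnGamma_error A w) \<le> ?C * ((real n + 1) ^ 3 / A\<^sup>2)" if w: "norm w \<le> (real n + 1) * R" for w
  proof -
    have "norm (lnGamma_error A w) \<le> 50 * (1 + norm w) ^ 3 / A\<^sup>2"
      using A4 A5 w by (intro norm_lnGamma_error_le) auto
    also have "\<dots> \<le> 50 * ((R + 2) * (real n + 1)) ^ 3 / A\<^sup>2"
    proof (intro divide_right_mono mult_left_mono power_mono)
      show "1 + norm w \<le> (R + 2) * (real n + 1)"
        using w by (simp add: algebra_simps)
    qed auto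
    finally show ?thesis by (simp add: power_mult_distrib)
  qed
  have 1: "norm (of_nat q * lnGamma_error (real q) z) \<le> ?C * (1 / real q)"
    using z qR by (intro nat q4) auto
  have 2: "norm (of_nat p * lnGamma_error (real p) (z - 1 / 2)) \<le> ?C * (1 / real p)"
    using nz' qR by (intro nat q4) auto
  have 3: "norm (of_nat p * lnGamma_error (real p) (- 1 / 2)) \<le> ?C * (1 / real p)"
    using R0 qR by (intro nat q4) auto
  have 4: "norm ((of_nat n + 1) * lnGamma_error a z) \<le> ?C * ((real n + 1) / a\<^sup>2)"
  proof -
    have "norm ((of_nat n + 1) * lnGamma_error a z) = (real n + 1) * norm (lnGamma_error a z)"
      unfolding norm_mult by (metis norm_of_nat of_nat_Suc add.commute)
    also have "\<dots> \<le> (real n + 1) * (?C / a\<^sup>2)"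
      using a4 z by (intro mult_left_mono err) auto
    finally show ?thesis by (simp add: mult_ac)
  qed
  have 5: "norm (lnGamma_error A (of_nat (Suc n) * z)) \<le> ?C * ((real n + 1) ^ 3 / A\<^sup>2)"
    "norm (lnGamma_error A (of_nat n * z)) \<le> ?C * ((real n + 1) ^ 3 / A\<^sup>2)"
  proof -
    show "norm (lnGamma_error A (of_nat (Suc n) * z)) \<le> ?C * ((real n + 1) ^ 3 / A\<^sup>2)"
      by (rule big, unfold norm_mult norm_of_nat, rule mult_mono) (use z in auto)
    show "norm (lnGamma_error A (of_nat n * z)) \<le> ?C * ((real n + 1) ^ 3 / A\<^sup>2)"
      by (rule big, unfold norm_mult norm_of_nat, rule mult_mono) (use z in auto)
  qed
  have "norm (total_error \<nu> n z) \<le> ?C * (1 / real q) + ?C * (1 / real p) + ?C * (1 / real p)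
      + ?C * ((real n + 1) / a\<^sup>2) + ?C * ((real n + 1) ^ 3 / A\<^sup>2) + ?C * ((real n + 1) ^ 3 / A\<^sup>2)"
    unfolding total_error_def Let_def defs[symmetric]
    by (intro norm_diff_mono norm_triangle_mono 1 2 3 4 5)
  also have "\<dots> = ?C * (1 / real q + 2 / real p + (real n + 1) / a\<^sup>2 + 2 * (real n + 1) ^ 3 / A\<^sup>2)"
    by (simp add: algebra_simps)
  finally show ?thesis unfolding defs .
qed

lemma tendsto_total_error_bound:
  assumes "\<nu> \<ge> 0"
  shows "(\<lambda>n. C * (1 / real (n div 2) + 2 / real (Suc n div 2)
    + (real n + 1) / ((real n + \<nu>) / 2)\<^sup>2 + 2 * (real n + 1) ^ 3 / (((real n + 1) * (real n + \<nu>) - 2 * real n) / 2)\<^sup>2)) \<longlonglongrightarrow> 0"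
proof -
  have h: "(\<lambda>n. 1 / real (n div 2)) \<longlonglongrightarrow> 0" "(\<lambda>n. 2 / real (Suc n div 2)) \<longlonglongrightarrow> 0"
    by (rule filterlim_compose[OF lim_const_over_n filterlim_half(1)] filterlim_compose[OF lim_const_over_n filterlim_half(2)])+
  have "(\<lambda>n. (real n + 1) / ((real n + \<nu>) / 2)\<^sup>2) \<longlonglongrightarrow> 0"
    "(\<lambda>n. 2 * (real n + 1) ^ 3 / (((real n + 1) * (real n + \<nu>) - 2 * real n) / 2)\<^sup>2) \<longlonglongrightarrow> 0"
    by real_asymp+
  then have "(\<lambda>n. C * (1 / real (n div 2) + 2 / real (Suc n div 2)
    + (real n + 1) / ((real n + \<nu>) / 2)\<^sup>2 + 2 * (real n + 1) ^ 3 / (((real n + 1) * (real n + \<nu>) - 2 * real n) / 2)\<^sup>2)) \<longlonglongrightarrow> C * (0 + 0 + 0 + 0)"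
    by (intro tendsto_mult tendsto_add h tendsto_const)
  then show ?thesis by simp
qed

section \<open>Uniform convergence on compact sets\<close>

lemma uniform_limit_const_seq:
  "(f \<longlongrightarrow> l) F \<Longrightarrow> uniform_limit S (\<lambda>n _. f n) (\<lambda>_. l) F"
  by (simp add: uniform_limit_iff tendsto_iff)

text \<open>The prefactors of the three Barnes values combine into the exponential of a quadratic
  polynomial in \<open>t / 2\<close> without constant term, whose coefficients are exactly the
  limits of \<open>linear_coeff\<close> and \<open>quadratic_coeff\<close>.\<close>

lemma barnes_G_quotient_eq:
  "barnes_G (1 / 2) / (barnes_G (1 / 2 + t / 2) * barnes_G (1 + t / 2)) =
    exp (of_real (- ln (2 * pi) + 1 / 2 - euler_mascheroni / 2) * (t / 2) + of_real (1 + euler_mascheroni) * (t / 2)\<^sup>2) *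
    (barnes_prod (- 1 / 2) / (barnes_prod (t / 2) * barnes_prod (t / 2 - 1 / 2)))"
proof -
  define z where "z = t / 2"
  define l where "l = complex_of_real (ln (2 * pi))"
  define \<gamma> :: complex where "\<gamma> = euler_mascheroni"
  have G: "barnes_G (1 + w) = exp (w / 2 * l - (w + (1 + \<gamma>) * w\<^sup>2) / 2) * barnes_prod w" for w
  proof -
    have "complex_of_real (2 * pi) powr (w / 2) = exp (w / 2 * l)"
      using Ln_of_real[of "2 * pi"] by (simp add: powr_def l_def)
    then show ?thesis
      unfolding barnes_G_eq \<gamma>_def
      by (simp only: exp_add[symmetric] diff_conv_add_uminus minus_divide_left)
  qed
  have a: "(1 / 2 :: complex) = 1 + (- 1 / 2)" "1 / 2 + z = 1 + (z - 1 / 2)"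
    by (simp_all add: field_simps)
  have "barnes_G (1 / 2) / (barnes_G (1 / 2 + z) * barnes_G (1 + z)) =
      exp ((- 1 / 2) / 2 * l - ((- 1 / 2) + (1 + \<gamma>) * (- 1 / 2)\<^sup>2) / 2
        - ((z - 1 / 2) / 2 * l - ((z - 1 / 2) + (1 + \<gamma>) * (z - 1 / 2)\<^sup>2) / 2)
        - (z / 2 * l - (z + (1 + \<gamma>) * z\<^sup>2) / 2)) *
      (barnes_prod (- 1 / 2) / (barnes_prod z * barnes_prod (z - 1 / 2)))"
  proof -
    have e: "exp u * X / ((exp v * Y) * (exp w * Z)) = exp (u - v - w) * (X / (Z * Y))" for u v w X Y Z :: complex
      by (simp add: exp_diff divide_inverse mult_ac)
    show ?thesis
      unfolding G[of "- 1 / 2", folded a(1)] G[of "z - 1 / 2", folded a(2)] G[of z] e ..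
  qed
  also have "(- 1 / 2) / 2 * l - ((- 1 / 2) + (1 + \<gamma>) * (- 1 / 2)\<^sup>2) / 2
        - ((z - 1 / 2) / 2 * l - ((z - 1 / 2) + (1 + \<gamma>) * (z - 1 / 2)\<^sup>2) / 2)
        - (z / 2 * l - (z + (1 + \<gamma>) * z\<^sup>2) / 2) = (- l + 1 / 2 - \<gamma> / 2) * z + (1 + \<gamma>) * z\<^sup>2"
    by (simp add: field_simps power2_eq_square)
  finally show ?thesis
    by (simp add: z_def l_def \<gamma>_def)
qed

lemma uniform_limit_moment_quotient:
  assumes \<nu>: "\<nu> \<ge> 0" and K: "compact K" "K \<subseteq> UNIV - {- of_nat k | k. k \<ge> 1}"
  shows "uniform_limit K
    (\<lambda>n t. exp (- (t * of_real (centering \<nu> n))) * moment_complex n \<nu> t / exp (t\<^sup>2 / 4 * of_real (ln (real n / 2) - 1)))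
    (\<lambda>t. barnes_G (1 / 2) / (barnes_G (1 / 2 + t / 2) * barnes_G (1 + t / 2))) sequentially"
proof -
  obtain R0 where R0: "\<And>t. t \<in> K \<Longrightarrow> norm t \<le> R0"
    using compact_imp_bounded[OF K(1)] by (auto simp: bounded_iff)
  define R where "R = max R0 0"
  have R: "norm (t / 2) \<le> R" "norm (t / 2 - 1 / 2) \<le> R + 1" if "t \<in> K" for t
  proof -
    show *: "norm (t / 2) \<le> R"
      using R0[OF that] by (simp add: R_def norm_divide)
    then show "norm (t / 2 - 1 / 2) \<le> R + 1"
      using norm_triangle_ineq4[of "t / 2" "1 / 2"] by simp
  qed
  have R_nonneg: "R \<ge> 0" by (simp add: R_def)
  have Kt: "t \<noteq> - of_nat k" if "t \<in> K" "k \<ge> 1" for t and k :: nat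
    using K(2) that by auto
  have conv: "\<forall>\<^sub>F n in sequentially. n \<ge> 10 \<and> real n / 2 - 1 \<ge> 2 * (R + 1) \<and>
    ((real n + 1) * (real n + \<nu>) - 2 * real n) / 2 \<ge> 4 \<and>
    ((real n + 1) * (real n + \<nu>) - 2 * real n) / 2 \<ge> 2 * (real n + 1) * R"
    by (rule eventually_moment_conditions[OF \<nu>])
  let ?e = "\<lambda>n t. of_real (linear_coeff \<nu> n) * (t / 2) + of_real (quadratic_coeff \<nu> n) * (t / 2)\<^sup>2 + total_error \<nu> n (t / 2)"
  let ?e' = "\<lambda>t :: complex. of_real (- ln (2 * pi) + 1 / 2 - euler_mascheroni / 2) * (t / 2) + of_real (1 + euler_mascheroni) * (t / 2)\<^sup>2"
  have bounded: "bounded (f ` K)" if "continuous_on K f" for f :: "complex \<Rightarrow> complex"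
    by (intro compact_imp_bounded compact_continuous_image that K)
  have err: "uniform_limit K (\<lambda>n t. total_error \<nu> n (t / 2)) (\<lambda>_. 0) sequentially"
  proof (rule uniform_limit_null_comparison[OF _ uniform_limit_const_seq[OF tendsto_total_error_bound[OF \<nu>, of "50 * (R + 2) ^ 3"]]])
    show "\<forall>\<^sub>F n in sequentially. \<forall>t\<in>K. norm (total_error \<nu> n (t / 2)) \<le> 50 * (R + 2) ^ 3 * (1 / real (n div 2) + 2 / real (Suc n div 2)
      + (real n + 1) / ((real n + \<nu>) / 2)\<^sup>2 + 2 * (real n + 1) ^ 3 / (((real n + 1) * (real n + \<nu>) - 2 * real n) / 2)\<^sup>2)"
      using conv by eventually_elim (use R total_error_bound[OF _ \<nu>] in blast)
  qed
  have "uniform_limit K ?e (\<lambda>t. ?e' t + 0) sequentially"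
  proof (intro uniform_limit_add uniform_lim_mult uniform_limit_const uniform_limit_const_seq err tendsto_of_real
      tendsto_linear_coeff tendsto_quadratic_coeff \<nu>)
  qed ((intro bounded continuous_intros; simp)+)
  then have e: "uniform_limit K ?e ?e' sequentially" by simp
  obtain B where B: "\<And>t. t \<in> K \<Longrightarrow> norm (?e' t) \<le> B"
  proof -
    have "bounded (?e' ` K)" by (intro bounded continuous_intros) simp_all
    then show ?thesis using that by (auto simp: bounded_iff)
  qed
  have "uniform_limit K (\<lambda>n t. exp (?e n t)) (\<lambda>t. exp (?e' t)) sequentially"
  proof (rule uniform_limit_compose_uniformly_continuous_on[OF e])
    \<comment> \<open>\<open>exp\<close> is uniformly continuous only on bounded sets; the limit
      exponents lie in the ball of radius \<open>B\<close>, and the approximating ones eventually in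
      the ball of radius \<open>B + 1\<close>.\<close>
    show "uniformly_continuous_on (cball 0 (B + 1)) (exp :: complex \<Rightarrow> complex)"
      by (intro compact_uniformly_continuous continuous_intros) auto
    have "\<forall>\<^sub>F n in sequentially. \<forall>t\<in>K. dist (?e n t) (?e' t) < 1"
      using e by (rule uniform_limitD) simp
    then show "\<forall>\<^sub>F n in sequentially. \<forall>t\<in>K. ?e n t \<in> cball 0 (B + 1)"
    proof eventually_elim
      case (elim n)
      show ?case
      proof
        fix t assume t: "t \<in> K"
        have "norm (?e n t) \<le> norm (?e' t) + dist (?e n t) (?e' t)"
          unfolding dist_norm by (rule norm_triangle_sub)
        also have "\<dots> \<le> B + 1"
          using B[OF t] elim t by (intro add_mono less_imp_le) auto
        finally show "?e n t \<in> cball 0 (B + 1)" by simp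
      qed
    qed
  qed simp
  moreover have "uniform_limit K (\<lambda>n t. \<Prod>k<Suc n div 2 - 1. barnes_factor k (- 1 / 2)) (\<lambda>t. barnes_prod (- 1 / 2)) sequentially"
  proof (rule uniform_limit_const_seq)
    have "(\<lambda>m. \<Prod>k<m. barnes_factor k (- 1 / 2)) \<longlonglongrightarrow> barnes_prod (- 1 / 2)"
      by (rule tendsto_uniform_limitI[OF uniform_limit_barnes_prod[of 1]]) auto
    then show "(\<lambda>n. \<Prod>k<Suc n div 2 - 1. barnes_factor k (- 1 / 2)) \<longlonglongrightarrow> barnes_prod (- 1 / 2)"
      by (rule filterlim_compose[OF _ filterlim_compose[OF filterlim_minus_const_nat_at_top filterlim_half(2)]])
  qed
  moreover have "uniform_limit K (\<lambda>n t. \<Prod>k<n div 2 - 1. barnes_factor k (t / 2)) (\<lambda>t. barnes_prod (t / 2)) sequentially"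
  proof -
    have "uniform_limit K (\<lambda>m t. \<Prod>k<m. barnes_factor k (t / 2)) (\<lambda>t. barnes_prod (t / 2)) sequentially"
      by (rule uniform_limit_compose'[OF uniform_limit_barnes_prod[OF R_nonneg]]) (use R in auto)
    then show ?thesis
      by (rule filterlim_compose[OF _ filterlim_compose[OF filterlim_minus_const_nat_at_top filterlim_half(1)]])
  qed
  moreover have "uniform_limit K (\<lambda>n t. \<Prod>k<Suc n div 2 - 1. barnes_factor k (t / 2 - 1 / 2)) (\<lambda>t. barnes_prod (t / 2 - 1 / 2)) sequentially"
  proof -
    have "uniform_limit K (\<lambda>m t. \<Prod>k<m. barnes_factor k (t / 2 - 1 / 2)) (\<lambda>t. barnes_prod (t / 2 - 1 / 2)) sequentially"
      by (rule uniform_limit_compose'[OF uniform_limit_barnes_prod[of "R + 1"]]) (use R R_nonneg in auto)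
    then show ?thesis
      by (rule filterlim_compose[OF _ filterlim_compose[OF filterlim_minus_const_nat_at_top filterlim_half(2)]])
  qed
  moreover have cont: "continuous_on K (\<lambda>t. barnes_prod (t / 2))" "continuous_on K (\<lambda>t. barnes_prod (t / 2 - 1 / 2))"
    by (intro continuous_on_compose2[OF holomorphic_on_imp_continuous_on[OF holomorphic_barnes_prod]] continuous_intros; simp)+
  \<comment> \<open>The zeros of the first factor are the even negative integers and those of the
    second the odd ones. \<open>K\<close> avoids them all, so compactness bounds the product away
    from zero.\<close>
  moreover obtain b where b: "b > 0" "\<And>t. t \<in> K \<Longrightarrow> b \<le> norm (barnes_prod (t / 2) * barnes_prod (t / 2 - 1 / 2))"
  proof -
    have nz: "barnes_prod (t / 2) * barnes_prod (t / 2 - 1 / 2) \<noteq> 0" if t: "t \<in> K" for t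
    proof -
      have "t / 2 \<noteq> - of_nat (Suc k)" for k
        using Kt[OF t, of "2 * Suc k"] by (auto simp: field_simps)
      moreover have "t / 2 - 1 / 2 \<noteq> - of_nat (Suc k)" for k
      proof
        assume "t / 2 - 1 / 2 = - of_nat (Suc k)"
        then have "t = - of_nat (2 * k + 1)" by (simp add: field_simps)
        then show False using Kt[OF t, of "2 * k + 1"] by simp
      qed
      ultimately show ?thesis
        by (simp add: barnes_prod_nonzero del: of_nat_Suc)
    qed
    have "bounded ((\<lambda>t. inverse (barnes_prod (t / 2) * barnes_prod (t / 2 - 1 / 2))) ` K)"
      by (intro bounded continuous_intros cont) (use nz in blast)
    then obtain B where B: "B > 0" "\<And>t. t \<in> K \<Longrightarrow> norm (inverse (barnes_prod (t / 2) * barnes_prod (t / 2 - 1 / 2))) \<le> B"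
      by (auto simp: bounded_pos)
    have "inverse B \<le> norm (barnes_prod (t / 2) * barnes_prod (t / 2 - 1 / 2))" if "t \<in> K" for t
    proof -
      have "norm (inverse (barnes_prod (t / 2) * barnes_prod (t / 2 - 1 / 2))) > 0"
        using nz[OF that] by (simp only: zero_less_norm_iff inverse_nonzero_iff_nonzero not_False_eq_True)
      from le_imp_inverse_le[OF B(2)[OF that] this] show ?thesis
        by (simp only: norm_inverse inverse_inverse_eq)
    qed
    with B(1) show ?thesis by (intro that[of "inverse B"]) simp_all
  qed
  ultimately have "uniform_limit K (\<lambda>n t. exp (?e n t) * ((\<Prod>k<Suc n div 2 - 1. barnes_factor k (- 1 / 2)) /
       ((\<Prod>k<n div 2 - 1. barnes_factor k (t / 2)) * (\<Prod>k<Suc n div 2 - 1. barnes_factor k (t / 2 - 1 / 2)))))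
     (\<lambda>t. exp (?e' t) * (barnes_prod (- 1 / 2) / (barnes_prod (t / 2) * barnes_prod (t / 2 - 1 / 2)))) sequentially"
  proof (intro uniform_lim_mult uniform_lim_divide)
    have nz: "t \<in> K \<Longrightarrow> barnes_prod (t / 2) * barnes_prod (t / 2 - 1 / 2) \<noteq> 0" for t
      using b(2)[of t] b(1) by auto
    show "bounded ((\<lambda>t. barnes_prod (- 1 / 2) / (barnes_prod (t / 2) * barnes_prod (t / 2 - 1 / 2))) ` K)"
      by (intro bounded continuous_intros cont) (use nz in blast)
    show "bounded ((\<lambda>t. exp (?e' t)) ` K)"
      by (intro bounded continuous_intros) simp_all
  qed (auto intro!: bounded cont continuous_intros)
  then show ?thesis
    unfolding barnes_G_quotient_eq
  proof (rule uniform_limit_cong[THEN iffD1, rotated -1])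
    show "\<forall>\<^sub>F n in sequentially. \<forall>t\<in>K. exp (?e n t) * ((\<Prod>k<Suc n div 2 - 1. barnes_factor k (- 1 / 2)) /
       ((\<Prod>k<n div 2 - 1. barnes_factor k (t / 2)) * (\<Prod>k<Suc n div 2 - 1. barnes_factor k (t / 2 - 1 / 2)))) =
       exp (- (t * of_real (centering \<nu> n))) * moment_complex n \<nu> t / exp (t\<^sup>2 / 4 * of_real (ln (real n / 2) - 1))"
      using conv
    proof eventually_elim
      case (elim n)
      then show ?case
        using moment_quotient_eq[OF Kt R(1) \<nu>, symmetric] by blast
    qed
  qed simp
qed

subsection \<open>The normal distribution\<close>

text \<open>The standard normal law is the \<open>k\<close>-fold convolution of the normal law with
  variance \<open>1 / k\<close>; the coordinates of the product measure are the independent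
  summands.\<close>

lemma infinitely_divisible_std_normal: "infinitely_divisible std_normal_distribution"
  unfolding infinitely_divisible_def
proof (intro conjI allI impI)
  show "real_distribution std_normal_distribution" by (rule real_dist_normal_dist)
  fix k :: nat assume k: "k \<ge> 1"
  define \<sigma> where "\<sigma> = 1 / sqrt (real k)"
  have \<sigma>: "\<sigma> > 0" "real k * \<sigma>\<^sup>2 = 1"
    using k by (simp_all add: \<sigma>_def power_divide)
  define \<mu> where "\<mu> = density lborel (normal_density 0 \<sigma>)"
  have p: "prob_space \<mu>" unfolding \<mu>_def by (rule prob_space_normal_density[OF \<sigma>(1)])
  have [measurable_cong, simp]: "sets \<mu> = sets borel" by (simp add: \<mu>_def)
  have rd: "real_distribution \<mu>"
    using p by (simp add: real_distribution_def real_distribution_axioms_def)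
  let ?P = "PiM {..<k} (\<lambda>_. \<mu>)"
  interpret P: prob_space ?P by (rule prob_space_PiM) (rule p)
  have ne: "{..<k} \<noteq> {}" using k by (auto simp: lessThan_empty_iff)
  have comp: "distr ?P N (\<lambda>x. x i) = \<mu>" if "i < k" "sets N = sets borel" for i N
  proof -
    have "distr ?P N (\<lambda>x. x i) = distr ?P \<mu> (\<lambda>x. x i)"
      using that by (intro distr_cong) simp_all
    also have "\<dots> = \<mu>" using that p by (intro distr_PiM_component) auto
    finally show ?thesis .
  qed
  have indep: "P.indep_vars (\<lambda>_. borel) (\<lambda>i x. x i) {..<k}"
  proof (subst P.indep_vars_iff_distr_eq_PiM'[OF ne])
    show "(\<lambda>x. x i) \<in> borel_measurable ?P" if "i \<in> {..<k}" for i
      using that by measurable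
    have "distr ?P (PiM {..<k} (\<lambda>_. borel)) (\<lambda>x. \<lambda>i\<in>{..<k}. x i) = distr ?P ?P (\<lambda>x. x)"
      by (intro distr_cong sets_PiM_cong) (auto simp: space_PiM PiE_def extensional_restrict)
    also have "\<dots> = ?P" by (rule distr_id2) simp
    also have "\<dots> = PiM {..<k} (\<lambda>i. distr ?P borel (\<lambda>x. x i))"
      by (intro PiM_cong) (simp_all add: comp)
    finally show "distr ?P (PiM {..<k} (\<lambda>_. borel)) (\<lambda>x. \<lambda>i\<in>{..<k}. x i) = PiM {..<k} (\<lambda>i. distr ?P borel (\<lambda>x. x i))" .
  qed
  have "distributed ?P lborel (\<lambda>x. \<Sum>i<k. x i) (normal_density (\<Sum>i<k. 0) (sqrt (\<Sum>i<k. \<sigma>\<^sup>2)))"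
  proof (rule P.sum_indep_normal[OF _ ne indep])
    fix i assume i: "i \<in> {..<k}"
    then have [measurable]: "(\<lambda>x. x i) \<in> borel_measurable ?P" by measurable
    show "distributed ?P lborel (\<lambda>x. x i) (normal_density 0 \<sigma>)"
      using i by (auto simp: distributed_def comp \<mu>_def[symmetric])
  qed (use \<sigma> in auto)
  then have "distr ?P lborel (\<lambda>x. \<Sum>i<k. x i) = std_normal_distribution"
    using \<sigma> by (simp add: distributed_def)
  then have "distr ?P borel (\<lambda>x. \<Sum>i<k. x i) = std_normal_distribution"
    by (subst distr_cong[OF refl sets_lborel[symmetric] refl])
  with rd show "\<exists>\<mu>. real_distribution \<mu> \<and> distr (PiM {..<k} (\<lambda>_. \<mu>)) borel (\<lambda>x. \<Sum>i<k. x i) = std_normal_distribution"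
    by blast
qed

text \<open>Completing the square moves the real part of \<open>t\<close> into the density, which reduces the
  claim to the characteristic function.\<close>

lemma std_normal_mgf:
  fixes t :: complex
  shows "t \<in> mgf_domain std_normal_distribution (\<lambda>x. x)"
    and "(\<integral>x. exp (t * of_real x) \<partial>std_normal_distribution) = exp (t\<^sup>2 / 2)"
proof -
  define \<sigma> \<tau> where "\<sigma> = Re t" and "\<tau> = Im t"
  have t: "t = of_real \<sigma> + \<i> * of_real \<tau>" by (simp add: \<sigma>_def \<tau>_def complex_eq)
  define h where "h = (\<lambda>x. std_normal_density x *\<^sub>R exp (t * of_real x))"
  define C where "C = exp (t\<^sup>2 / 2 + of_real (\<tau>\<^sup>2 / 2))"
  interpret N: prob_space std_normal_distribution by (rule prob_space_normal_density) simp
  \<comment> \<open>Only a real translation by \<open>\<sigma> = Re t\<close> is used, so no contour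
    has to be moved; the imaginary part remains as a Fourier factor.\<close>
  have shift: "h (\<sigma> + 1 * x) = C * (std_normal_density x *\<^sub>R iexp (\<tau> * x))" for x
  proof -
    have "h (\<sigma> + 1 * x) = of_real (1 / sqrt (2 * pi)) * exp (of_real (- (\<sigma> + x)\<^sup>2 / 2) + t * of_real (\<sigma> + x))"
      by (simp only: h_def std_normal_density_def scaleR_conv_of_real exp_add exp_of_real of_real_mult mult_1 mult.assoc)
    also have "of_real (- (\<sigma> + x)\<^sup>2 / 2) + t * of_real (\<sigma> + x) =
        (t\<^sup>2 / 2 + of_real (\<tau>\<^sup>2 / 2)) + (of_real (- x\<^sup>2 / 2) + \<i> * of_real (\<tau> * x))"
      unfolding t by (simp add: field_simps power2_eq_square)
    finally show ?thesis
      by (simp only: C_def std_normal_density_def scaleR_conv_of_real exp_add exp_of_real of_real_mult mult_ac)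
  qed
  have iexp: "integrable lborel (\<lambda>x. std_normal_density x *\<^sub>R iexp (\<tau> * x))"
  proof -
    have "integrable std_normal_distribution (\<lambda>x. iexp (\<tau> * x))"
      by (rule N.integrable_const_bound[of _ 1]) auto
    then show ?thesis
      by (subst (asm) integrable_density) auto
  qed
  have "integrable lborel (\<lambda>x. h (\<sigma> + 1 * x))"
    unfolding shift by (rule integrable_mult_right) (rule iexp)
  then have int: "integrable lborel h"
    by (rule lborel_integrable_real_affine_iff[OF one_neq_zero, THEN iffD1])
  then have "integrable std_normal_distribution (\<lambda>x. exp (t * of_real x))"
    by (subst integrable_density) (auto simp: h_def)
  then show "t \<in> mgf_domain std_normal_distribution (\<lambda>x. x)"
    by (simp add: mgf_domain_def)
  have "(\<integral>x. exp (t * of_real x) \<partial>std_normal_distribution) = (\<integral>x. h x \<partial>lborel)"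
    unfolding h_def by (subst integral_density) auto
  also have "\<dots> = (\<integral>x. C * (std_normal_density x *\<^sub>R iexp (\<tau> * x)) \<partial>lborel)"
    by (subst lborel_integral_real_affine[of 1 _ \<sigma>]) (simp_all only: shift, simp_all)
  also have "\<dots> = C * (\<integral>x. std_normal_density x *\<^sub>R iexp (\<tau> * x) \<partial>lborel)"
    by (rule integral_mult_right_zero)
  also have "(\<integral>x. std_normal_density x *\<^sub>R iexp (\<tau> * x) \<partial>lborel) = char std_normal_distribution \<tau>"
    unfolding char_def by (subst integral_density) auto
  also have "\<dots> = exp (- of_real (\<tau>\<^sup>2 / 2))"
    unfolding char_std_normal_distribution by (simp add: exp_of_real[symmetric])
  also have "C * \<dots> = exp (t\<^sup>2 / 2)"
    unfolding C_def exp_add[symmetric] by simp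
  finally show "(\<integral>x. exp (t * of_real x) \<partial>std_normal_distribution) = exp (t\<^sup>2 / 2)" .
qed

subsection \<open>Analytic continuation of the moments\<close>

lemma meromorphic_on_Gamma_compose:
  fixes f :: "complex \<Rightarrow> complex"
  assumes "f analytic_on S"
  shows "(\<lambda>t. Gamma (f t)) meromorphic_on S"
  unfolding Gamma_def
  by (intro meromorphic_on_inverse analytic_on_imp_meromorphic_on analytic_on_rGamma assms)

lemma analytic_on_Gamma_compose:
  fixes f :: "complex \<Rightarrow> complex"
  assumes "f analytic_on S" "\<And>t. t \<in> S \<Longrightarrow> f t \<notin> \<int>\<^sub>\<le>\<^sub>0"
  shows "(\<lambda>t. Gamma (f t)) analytic_on S"
  unfolding Gamma_def using assms
  by (intro analytic_on_inverse analytic_on_rGamma) (auto simp: rGamma_eq_zero_iff)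

lemma moment_complex_meromorphic: "moment_complex n \<nu> meromorphic_on UNIV"
  unfolding moment_complex_def divide_inverse
  by (intro meromorphic_on_mult meromorphic_on_prod meromorphic_on_power meromorphic_on_Gamma_compose
      analytic_on_imp_meromorphic_on analytic_on_rGamma analytic_intros)

lemma moment_complex_analytic:
  assumes "\<And>t j. t \<in> S \<Longrightarrow> j \<ge> 1 \<Longrightarrow> (of_nat j + t) / 2 \<notin> \<int>\<^sub>\<le>\<^sub>0"
    and "\<And>t. t \<in> S \<Longrightarrow> of_real (((real n + 1) * (real n + \<nu>) - 2 * real n) / 2) + of_nat (Suc n) * (t / 2) \<notin> \<int>\<^sub>\<le>\<^sub>0"
  shows "moment_complex n \<nu> analytic_on S"
  unfolding moment_complex_def divide_inverse
  using assms unfolding divide_inverse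
  by (intro analytic_on_mult analytic_on_prod analytic_on_power analytic_on_Gamma_compose
      analytic_on_rGamma analytic_on_const analytic_on_add analytic_on_ident) auto

lemma half_sum_not_nonpos_Int:
  fixes t :: complex
  assumes t: "\<And>k. k \<ge> 1 \<Longrightarrow> t \<noteq> - of_nat k" and j: "j \<ge> 1"
  shows "(of_nat j + t) / 2 \<notin> \<int>\<^sub>\<le>\<^sub>0"
proof
  assume "(of_nat j + t) / 2 \<in> \<int>\<^sub>\<le>\<^sub>0"
  then obtain m where "(of_nat j + t) / 2 = - of_nat m" by (elim nonpos_Ints_cases')
  then have "t = - of_nat (2 * m + j)" by (simp add: field_simps eq_neg_iff_add_eq_0)
  then show False using t[of "2 * m + j"] j by simp
qed

lemma moment_exponent_nonneg:
  assumes "\<nu> \<ge> 0" "n \<ge> 1"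
  shows "((real n + 1) * (real n + \<nu>) - 2 * real n) / 2 \<ge> 0"
    and "n \<ge> 2 \<Longrightarrow> ((real n + 1) * (real n + \<nu>) - 2 * real n) / 2 > 0"
proof -
  have e: "((real n + 1) * (real n + \<nu>) - 2 * real n) = real n * (real n - 1) + (real n + 1) * \<nu>"
    by (simp add: algebra_simps)
  have "(real n + 1) * \<nu> \<ge> 0" "real n * (real n - 1) \<ge> 0" using assms by simp_all
  then show "((real n + 1) * (real n + \<nu>) - 2 * real n) / 2 \<ge> 0" unfolding e by simp
  assume "n \<ge> 2"
  then have "real n * (real n - 1) > 0" by simp
  with \<open>(real n + 1) * \<nu> \<ge> 0\<close> show "((real n + 1) * (real n + \<nu>) - 2 * real n) / 2 > 0" unfolding e by simp
qed

text \<open>The origin is included because the value there decides whether the volume is almost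
  surely positive. For \<open>n = 1\<close> and \<open>\<nu> = 0\<close> the last Gamma argument
  would vanish at \<open>t = 0\<close>; \<open>n \<ge> 2\<close> excludes this.\<close>

lemma moment_complex_analytic_halfplane:
  assumes "\<nu> \<ge> 0" "n \<ge> 2"
  shows "moment_complex n \<nu> analytic_on ({t. Re t > 0} \<union> {0})"
proof (rule moment_complex_analytic)
  fix t :: complex and j :: nat assume t: "t \<in> {t. Re t > 0} \<union> {0}"
  then have Re: "Re t \<ge> 0" by auto
  show "(of_nat j + t) / 2 \<notin> \<int>\<^sub>\<le>\<^sub>0" if "j \<ge> 1"
    using that Re by (intro not_nonpos_Ints_Re) simp
  have "Re (of_nat (Suc n) * (t / 2)) \<ge> 0"
    using Re by simp
  then show "of_real (((real n + 1) * (real n + \<nu>) - 2 * real n) / 2) + of_nat (Suc n) * (t / 2) \<notin> \<int>\<^sub>\<le>\<^sub>0"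
    using moment_exponent_nonneg(2)[OF assms(1) _ assms(2)] assms(2)
    by (intro not_nonpos_Ints_Re) (simp only: plus_complex.sel(1) Re_complex_of_real add_pos_nonneg)
qed

lemma moment_complex_0:
  assumes "\<nu> \<ge> 0" "n \<ge> 2"
  shows "moment_complex n \<nu> 0 = 1"
proof -
  have 1: "Gamma (of_nat j / 2 :: complex) \<noteq> 0" if "j \<ge> 1" for j
    using that by (simp add: Gamma_eq_zero_iff not_nonpos_Ints_Re)
  have 2: "Gamma (complex_of_real x) \<noteq> 0" if "x > 0" for x
    using that by (simp add: Gamma_eq_zero_iff not_nonpos_Ints_Re)
  have "Gamma (complex_of_real ((real n + \<nu>) / 2)) \<noteq> 0"
    "Gamma (complex_of_real (((real n + 1) * (real n + \<nu>) - 2 * real n) / 2)) \<noteq> 0"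
    using assms moment_exponent_nonneg(2)[OF assms(1), of n] by (intro 2; simp)+
  with 1 show ?thesis
    unfolding moment_complex_def
    by (simp add: rGamma_inverse_Gamma del: of_real_divide of_real_add of_real_mult of_real_diff)
qed

text \<open>The fixed poles are negative integers. Those of the factor with argument
  \<open>A + (n + 1) * t / 2\<close> move to infinity with \<open>n\<close>, since \<open>A\<close>
  is of order \<open>n^2\<close>.\<close>

lemma moment_complex_analytic_at:
  fixes t :: complex
  assumes t: "\<And>k. k \<ge> 1 \<Longrightarrow> t \<noteq> - of_nat k" and R: "norm (t / 2) \<le> R"
    and A: "((real n + 1) * (real n + \<nu>) - 2 * real n) / 2 \<ge> 4"
      "((real n + 1) * (real n + \<nu>) - 2 * real n) / 2 \<ge> 2 * (real n + 1) * R"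
  shows "moment_complex n \<nu> analytic_on {t}"
proof (rule moment_complex_analytic)
  show "(of_nat j + s) / 2 \<notin> \<int>\<^sub>\<le>\<^sub>0" if "s \<in> {t}" "j \<ge> 1" for s and j :: nat
    using half_sum_not_nonpos_Int[of t j] t that by blast
  define A' where "A' = ((real n + 1) * (real n + \<nu>) - 2 * real n) / 2"
  have "norm (of_nat (Suc n) * (t / 2)) \<le> (real n + 1) * R"
    unfolding norm_mult norm_of_nat by (rule mult_mono) (use R in auto)
  then have "\<bar>Re (of_nat (Suc n) * (t / 2))\<bar> \<le> (real n + 1) * R"
    using abs_Re_le_cmod order_trans by blast
  moreover have "(real n + 1) * R \<le> A' / 2" "A' > 0"
    using A unfolding A'_def[symmetric] by (simp_all only: mult.assoc)
  ultimately have "Re (of_real A' + of_nat (Suc n) * (t / 2)) > 0"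
    unfolding plus_complex.sel(1) Re_complex_of_real by linarith
  then show "of_real (((real n + 1) * (real n + \<nu>) - 2 * real n) / 2) + of_nat (Suc n) * (s / 2) \<notin> \<int>\<^sub>\<le>\<^sub>0"
    if "s \<in> {t}" for s
    using that not_nonpos_Ints_Re unfolding A'_def by blast
qed

lemma moment_complex_of_real: "moment_complex n \<nu> (of_real s) = of_real (moment_real n \<nu> s)"
proof -
  have 1: "(of_nat j + of_real s) / 2 = complex_of_real ((real j + s) / 2)" "of_nat j / 2 = complex_of_real (real j / 2)" for j
    by simp_all
  have 2: "complex_of_real ((real n + \<nu>) / 2) + of_real s / 2 = of_real ((real n + \<nu> + s) / 2)"
    by (simp add: field_simps)
  have 3: "complex_of_real (((real n + 1) * (real n + \<nu>) - 2 * real n) / 2) + of_nat (Suc n) * (of_real s / 2) =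
      of_real (((real n + 1) * (real n + \<nu> + s) - 2 * real n) / 2)"
    by (simp add: field_simps)
  have 4: "complex_of_real (((real n + 1) * (real n + \<nu>) - 2 * real n) / 2) + of_nat n * (of_real s / 2) =
      of_real (((real n + 1) * (real n + \<nu>) + real n * s - 2 * real n) / 2)"
    by (simp add: field_simps)
  show ?thesis
    unfolding moment_complex_def moment_real_def 1 2 3 4 Gamma_complex_of_real rGamma_complex_of_real
    by (simp only: rGamma_inverse_Gamma divide_inverse of_real_mult of_real_power of_real_prod of_real_inverse)
qed

lemma moment_real_nonneg:
  assumes "n \<ge> 1" "\<nu> \<ge> 0" "s > 0"
  shows "moment_real n \<nu> s \<ge> 0"
proof -
  have G: "Gamma x \<ge> 0" if "x > 0" for x :: real
    using Gamma_real_pos[OF that] by simp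
  show ?thesis
    unfolding moment_real_def using assms Gamma_arg_pos[OF assms]
    by (intro mult_nonneg_nonneg prod_nonneg zero_le_power divide_nonneg_nonneg ballI G) auto
qed

lemma mgf_continuation_log_volume:
  fixes X :: "nat \<Rightarrow> 'a \<Rightarrow> nat \<Rightarrow> real"
  assumes \<nu>: "\<nu> \<ge> 0" and n: "n \<ge> 2" and M: "prob_space M"
    and indep: "prob_space.indep_vars M (\<lambda>_. lebesgue_n n) X {..n}"
    and law: "\<And>i. i \<le> n \<Longrightarrow> distr M (lebesgue_n n) (X i) = model_distribution n \<nu>"
  shows "(\<lambda>\<omega>. log_volume n X \<omega> - c) \<in> borel_measurable M"
    and "mgf_continuation M (\<lambda>\<omega>. log_volume n X \<omega> - c) UNIV
      (remove_sings (\<lambda>t. exp (- (t * of_real c)) * moment_complex n \<nu> t))"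
proof -
  have n1: "n \<ge> 1" using n by simp
  note moments = prob_space.simplex_det_moments[OF M n1 \<nu> indep law]
  have [measurable]: "(\<lambda>\<omega>. simplex_det n (\<lambda>i. X i \<omega>)) \<in> borel_measurable M"
    by (rule moments(1)) auto
  have eq: "log_volume n X \<omega> = ln \<bar>simplex_det n (\<lambda>i. X i \<omega>)\<bar>" for \<omega>
    by (simp add: log_volume_def simplex_volume_eq)
  show "(\<lambda>\<omega>. log_volume n X \<omega> - c) \<in> borel_measurable M"
    unfolding eq by measurable
  show "mgf_continuation M (\<lambda>\<omega>. log_volume n X \<omega> - c) UNIV
      (remove_sings (\<lambda>t. exp (- (t * of_real c)) * moment_complex n \<nu> t))"
    unfolding eq
  proof (rule mgf_continuation_of_moments[OF M])
    show "AE \<omega> in M. \<bar>simplex_det n (\<lambda>i. X i \<omega>)\<bar> \<le> fact (Suc n)"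
      by (rule moments(2)) auto
    show "(\<integral>\<^sup>+\<omega>. ennreal (\<bar>simplex_det n (\<lambda>i. X i \<omega>)\<bar> powr s) \<partial>M) = ennreal (moment_real n \<nu> s)" if "s \<ge> 1" for s
      by (rule moments(3)) (use that in auto)
    show "moment_complex n \<nu> analytic_on {t. Re t > 0}"
      by (rule analytic_on_subset[OF moment_complex_analytic_halfplane[OF \<nu> n]]) auto
    have "moment_complex n \<nu> analytic_on {0}"
      by (rule analytic_on_subset[OF moment_complex_analytic_halfplane[OF \<nu> n]]) auto
    then show "isCont (moment_complex n \<nu>) 0"
      by (rule analytic_at_imp_isCont)
  qed (use \<nu> n n1 in \<open>auto intro: moment_complex_meromorphic moment_complex_0 moment_real_nonneg moment_complex_of_real\<close>)
qed

lemma vertical_strip_eq: "vertical_strip (- 1) \<infinity> = {t. Re t > - 1}"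
proof -
  have "(- 1 :: ereal) < ereal x \<longleftrightarrow> - 1 < x" for x
    using less_ereal.simps(1)[of "- 1" x] by (simp add: one_ereal_def)
  then show ?thesis by (simp add: vertical_strip_def)
qed

text \<open>The Barnes factors in the denominator vanish only at \<open>t = - 1, - 2, ...\<close>,
  outside the open half plane.\<close>

lemma analytic_limit_function:
  "(\<lambda>t. barnes_G (1 / 2) / (barnes_G (1 / 2 + t / 2) * barnes_G (1 + t / 2))) analytic_on {t. Re t > - 1}"
proof -
  have bp: "(\<lambda>t. barnes_prod (f t)) analytic_on S" if "f analytic_on S" for f S
  proof -
    have "barnes_prod analytic_on f ` S"
      by (rule analytic_on_subset[of _ UNIV]) (simp_all add: analytic_on_open holomorphic_barnes_prod)
    then show ?thesis
      using analytic_on_compose[OF that, of barnes_prod] by (simp add: o_def)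
  qed
  have nz: "barnes_prod w \<noteq> 0" if "Re w > - 1" for w
  proof (rule barnes_prod_nonzero)
    fix k
    have "Re (- of_nat (Suc k)) \<le> - 1" by simp
    with that show "w \<noteq> - of_nat (Suc k)" by auto
  qed
  show ?thesis
    unfolding barnes_G_quotient_eq
    by (intro analytic_intros bp) (auto simp: intro!: nz)
qed

theorem proposition4p9:
  fixes \<nu> :: real
    and M :: "nat \<Rightarrow> 'a measure"
    and X :: "nat \<Rightarrow> nat \<Rightarrow> 'a \<Rightarrow> nat \<Rightarrow> real"
    and Y :: "nat \<Rightarrow> 'a \<Rightarrow> real"
    and \<Psi> :: "complex \<Rightarrow> complex"
  assumes nu: "\<nu> \<ge> 0"
    and prob: "\<And>n. n \<ge> 2 \<Longrightarrow> prob_space (M n)"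
    and indep: "\<And>n. n \<ge> 2 \<Longrightarrow> prob_space.indep_vars (M n) (\<lambda>_. lebesgue_n n) (X n) {..n}"
    and law: "\<And>n i. n \<ge> 2 \<Longrightarrow> i \<le> n \<Longrightarrow>
                distr (M n) (lebesgue_n n) (X n i) = model_distribution n \<nu>"
  defines "Y \<equiv> \<lambda>n \<omega>. log_volume n (X n) \<omega> - centering \<nu> n"
    and "\<Psi> \<equiv> \<lambda>t. barnes_G (1 / 2) / (barnes_G (1 / 2 + t / 2) * barnes_G (1 + t / 2))"
  shows "mod_phi_convergence M Y std_normal_distribution (\<lambda>t. t\<^sup>2 / 2)
           (\<lambda>n. 1 / 2 * ln (real n / 2) - 1 / 2) (- 1) \<infinity> \<Psi>
       \<and> (\<exists>F. (\<forall>n\<ge>2. mgf_continuation (M n) (Y n) UNIV (F n))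
            \<and> (\<forall>K. compact K \<and> K \<subseteq> UNIV - {- of_nat k | k. k \<ge> 1} \<longrightarrow>
                 uniform_limit K
                   (\<lambda>n t. F n t / exp (t\<^sup>2 / 4 * of_real (ln (real n / 2) - 1)))
                   \<Psi> sequentially))"
proof -
  \<comment> \<open>\<open>Gamma\<close> is \<open>0\<close> at its poles, so the product formula
    may take arbitrary values at singular points; \<open>remove_sings\<close> replaces them by those
    of the continuation.\<close>
  define F where "F = (\<lambda>n. remove_sings (\<lambda>t. exp (- (t * of_real (centering \<nu> n))) * moment_complex n \<nu> t))"
  have Y: "Y n \<in> borel_measurable (M n)" "mgf_continuation (M n) (Y n) UNIV (F n)" if "n \<ge> 2" for n
    using mgf_continuation_log_volume[OF nu that prob indep law] that unfolding Y_def F_def by blast+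
  have lim: "uniform_limit K (\<lambda>n t. F n t / exp (t\<^sup>2 / 4 * of_real (ln (real n / 2) - 1))) \<Psi> sequentially"
    if K: "compact K" "K \<subseteq> UNIV - {- of_nat k | k. k \<ge> 1}" for K
  proof -
    obtain R where R: "\<And>t. t \<in> K \<Longrightarrow> norm t \<le> R"
      using compact_imp_bounded[OF K(1)] by (auto simp: bounded_iff)
    have "\<forall>\<^sub>F n in sequentially. \<forall>t\<in>K. exp (- (t * of_real (centering \<nu> n))) * moment_complex n \<nu> t / exp (t\<^sup>2 / 4 * of_real (ln (real n / 2) - 1)) =
        F n t / exp (t\<^sup>2 / 4 * of_real (ln (real n / 2) - 1))"
      using eventually_moment_conditions[OF nu, of R]
    proof eventually_elim
      case (elim n)
      show ?case
      proof
        fix t assume t: "t \<in> K"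
        have "norm (t / 2) \<le> norm t" by (simp add: norm_divide)
        then have "norm (t / 2) \<le> R" using R[OF t] by linarith
        moreover have "t \<noteq> - of_nat k" if "k \<ge> 1" for k
          using K(2) t that by auto
        \<comment> \<open>At a point of analyticity the removal of singularities changes nothing, so
          for large \<open>n\<close> the explicit formula holds on all of \<open>K\<close>.\<close>
        ultimately have "moment_complex n \<nu> analytic_on {t}"
          using elim by (intro moment_complex_analytic_at) auto
        then have "(\<lambda>t. exp (- (t * of_real (centering \<nu> n))) * moment_complex n \<nu> t) analytic_on {t}"
          by (intro analytic_intros)
        from remove_sings_at_analytic[OF this]
        show "exp (- (t * of_real (centering \<nu> n))) * moment_complex n \<nu> t / exp (t\<^sup>2 / 4 * of_real (ln (real n / 2) - 1)) =
          F n t / exp (t\<^sup>2 / 4 * of_real (ln (real n / 2) - 1))"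
          unfolding F_def by simp
      qed
    qed
    from uniform_limit_cong[OF this, of \<Psi> \<Psi>] show ?thesis
      using uniform_limit_moment_quotient[OF nu K] unfolding \<Psi>_def by simp
  qed
  have "mod_phi_convergence M Y std_normal_distribution (\<lambda>t. t\<^sup>2 / 2)
           (\<lambda>n. 1 / 2 * ln (real n / 2) - 1 / 2) (- 1) \<infinity> \<Psi>"
    unfolding mod_phi_convergence_def
  proof (intro conjI ballI exI[of _ F])
    show "filterlim (\<lambda>n. 1 / 2 * ln (real n / 2) - 1 / 2) at_top sequentially"
      by real_asymp
    show "(- 1 :: ereal) < \<infinity>" by (simp add: one_ereal_def)
    show "\<Psi> analytic_on vertical_strip (- 1) \<infinity>"
      unfolding vertical_strip_eq \<Psi>_def by (rule analytic_limit_function)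
    show "\<forall>\<^sub>F n in sequentially. prob_space (M n) \<and> Y n \<in> borel_measurable (M n) \<and>
        (\<exists>D. vertical_strip (- 1) \<infinity> \<subseteq> D \<and> mgf_continuation (M n) (Y n) D (F n))"
      using eventually_ge_at_top[of 2]
      by eventually_elim (use prob Y in \<open>auto intro!: exI[of _ UNIV]\<close>)
  next
    fix z assume "z \<in> vertical_strip (- 1) \<infinity>"
    then have z: "z \<in> {t. Re t > - 1}" unfolding vertical_strip_eq .
    then obtain r where r: "r > 0" "cball z r \<subseteq> {t. Re t > - 1}"
      using open_halfspace_Re_gt[of "- 1"] unfolding open_contains_cball by blast
    have "{t. Re t > - 1} \<subseteq> UNIV - {- of_nat k | k. k \<ge> 1}" by auto
    then have "uniform_limit (cball z r) (\<lambda>n t. F n t / exp (t\<^sup>2 / 4 * of_real (ln (real n / 2) - 1))) \<Psi> sequentially"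
      using r(2) by (intro lim compact_cball) blast
    also have "(\<lambda>n t. F n t / exp (t\<^sup>2 / 4 * of_real (ln (real n / 2) - 1))) =
        (\<lambda>n t. F n t / exp (of_real (1 / 2 * ln (real n / 2) - 1 / 2) * (t\<^sup>2 / 2)))"
      by (intro ext arg_cong2[where f = "(/)"] arg_cong[where f = exp] refl) (simp add: field_simps)
    finally show "\<exists>r>0. cball z r \<subseteq> vertical_strip (- 1) \<infinity> \<and>
        uniform_limit (cball z r) (\<lambda>n t. F n t / exp (of_real (1 / 2 * ln (real n / 2) - 1 / 2) * (t\<^sup>2 / 2))) \<Psi> sequentially"
      unfolding vertical_strip_eq using r by blast
  qed (auto intro: infinitely_divisible_std_normal std_normal_mgf)
  with Y(2) lim show ?thesis by blast
qed

end
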